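(* Let $G$ be a finite abelian group, $\chi:G\times G\to k^\times$ a bicharacter, $\mathcal{B}=(\mathrm{Vec}_G,\chi)$ the resulting braided category, and assume that $\omega:G\to\hat G$, $\omega(x,y)=\chi(x,y)\chi(y,x)$, is an isomorphism. Let $H\in\mathcal{B}$ be a Hopf algebra and $\mathcal{C}=H_{\mathcal{B}}\text{-mod}$. Let $\theta(x)=\chi(x,x)$, $\varsigma=\theta^{-1}$, $I=\theta(G)\subset k^\times$ and $n_i=\#\{x\in G\mid\theta(x)=i\}$ for $i\in I$. Let $X=HH_{\mathcal{B}_\varsigma}(\mathcal{C})$. Then $$HC(\mathcal{C})=\bigoplus_{i\in I}X^{i\varsigma^H}\boxtimes\mathrm{Vec}^{n_i}$$ (an equivalence of categories), where $X^{i\varsigma^H}$ is the full subcategory of $X$ consisting of those $M$ with $i\,\varsigma^H_M=Id_M$.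
   Context: $k$ is an algebraically closed field of characteristic $0$; $\mathrm{Vec}$ is finite dimensional $k$-vector spaces; Hopf algebras have invertible antipode; identity factors are suppressed. **$\mathcal{B}$.** $\mathrm{Vec}_G$ is the category of $G$-graded finite dimensional vector spaces, with braiding $\tau(v\otimes w)=\chi(x,y)\,w\otimes v$ for $v\in V_x,w\in W_y$. $\hat G=\mathrm{Hom}(G,k^\times)$. $\tau^{-1}_{X,Y}:=(\tau_{Y,X})^{-1}$. **$\mathcal{B}_\varsigma$.** This is $\mathcal{B}$ as a left module category over itself, with automorphism $\varsigma_V$ of the identity functor acting on $V_x$ by $\varsigma(x)=\chi(x,x)^{-1}$, and $E_{X,M}=\varsigma_{X\otimes M}(Id_X\otimes\varsigma_M)^{-1}:X\otimes M\to X\otimes M$. **$HC(\mathcal{C})$.** For a rigid category $\mathcal{C}$ let $X^*$ be the left dual ($X^*\otimes X\to1$), ${}^*X$ the right dual ($X\otimes{}^*X\to 1$), $X^\#=X^{**}$, ${}^\#X={}^*({}^*X)$. $HH(\mathcal{C})$ has objects $M\in\mathcal{C}$ with natural isomorphisms $\tau^\bullet_{M,X}:M\otimes X\to{}^\#X\otimes M$ with $\tau^\bullet_{M,1}=Id$, $\tau^\bullet_{M,X\otimes Y}=(Id\otimes\tau^\bullet_{M,Y})(\tau^\bullet_{M,X}\otimes Id)$. With $\tau^\bullet_{X,M}:=(\tau^\bullet_{M,X^\#})^{-1}:X\otimes M\to M\otimes X^\#$, put $\varsigma_M=(Id_M\otimes ev)(\tau^\bullet_{M,M}\otimes Id_{M^*})(Id_M\otimes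 coev)$: $M\to M\otimes M\otimes M^*\to M\otimes M^\#\otimes M^*\to M$. $HC(\mathcal{C})$ is the full subcategory of $HH(\mathcal{C})$ of those $M$ with $\varsigma_M=Id_M$. **$X=HH_{\mathcal{B}_\varsigma}(\mathcal{C})$**, identified with $aYD^H_{\mathcal{M}}$ for $\mathcal{M}=\mathcal{B}_\varsigma$: ${}^*H$ is an algebra with unit ${}^*\epsilon$ and multiplication the map whose adjoint $H\otimes{}^*H\otimes{}^*H\to1$ is $ev(Id_H\otimes ev\otimes Id_{{}^*H})(\tau^{-1}_{H,H}\Delta\otimes Id)$ (where $ev:H\otimes{}^*H\to1$). For an $H$-module $M$ in $\mathcal{M}$ let $r_0,r_1:H\otimes{}^*H\otimes M\to{}^*H\otimes M$ be the maps whose adjoints $H\otimes H\otimes{}^*H\otimes M\to M$ are: for $r_1$, $ev\circ(m_H\otimes Id)$; for $r_0$, $\rho_{H,M}(Id_H\otimes ev)(Id_H\otimes m_H\otimes Id)(Id_H\otimes S\otimes Id_H\otimes Id)(\Delta\otimes Id_H\otimes Id)(\tau_{H,H}\otimes Id)$. Put $act_M=r_1\circ E_{H,{}^*H\otimes M}\circ(Id_H\otimes r_0)\circ(\Delta\otimes Id)$. Objects of $aYD^H_{\mathcal{M}}$ are $M\in\mathcal{M}$ which are both $H$- and ${}^*H$-modules in $\mathcal M$ with $\rho_{H,M}(Id_H\otimes\rho_{{}^*H,M})=\rho_{{}^*H,M}\circ act_M$; morphisms respect both actions. $\varsigma^H_M=\rho_{{}^*H,M}(Id_{{}^*H}\otimes\rho_{H,M})(coev\otimes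 Id_M)\varsigma_M$, with $coev:1\to{}^*H\otimes H$. *)

theory Defs
  imports "HOL-Library.FuncSet" "HOL-Computational_Algebra.Polynomial" "Jordan_Normal_Form.Matrix"
begin

section \<open>Linear categories\<close>

text \<open>Hom sets need not be disjoint (an arrow is often a bare matrix), so the arrow part of a
  functor takes the source and the target as arguments.\<close>

record ('o, 'm, 'k) lincat =
  Obj :: "'o set"
  Hom :: "'o \<Rightarrow> 'o \<Rightarrow> 'm set"
  Idn :: "'o \<Rightarrow> 'm"
  Cmp :: "'m \<Rightarrow> 'm \<Rightarrow> 'm"  (infixl "\<cdot>\<index>" 70)
  Add :: "'m \<Rightarrow> 'm \<Rightarrow> 'm"
  Scl :: "'k \<Rightarrow> 'm \<Rightarrow> 'm"

definition full_sub :: "('o, 'm, 'k) lincat \<Rightarrow> ('o \<Rightarrow> bool) \<Rightarrow> ('o, 'm, 'k) lincat" where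
  "full_sub C P = C\<lparr>Obj := {X \<in> Obj C. P X}\<rparr>"

definition inverse_arrows ::
    "('o, 'm, 'k, 'z) lincat_scheme \<Rightarrow> 'o \<Rightarrow> 'o \<Rightarrow> 'm \<Rightarrow> 'm \<Rightarrow> bool" where
  "inverse_arrows C X Y f g \<longleftrightarrow>
     f \<in> Hom C X Y \<and> g \<in> Hom C Y X \<and> g \<cdot>\<^bsub>C\<^esub> f = Idn C X \<and> f \<cdot>\<^bsub>C\<^esub> g = Idn C Y"

definition is_iso :: "('o, 'm, 'k, 'z) lincat_scheme \<Rightarrow> 'o \<Rightarrow> 'o \<Rightarrow> 'm \<Rightarrow> bool" where
  "is_iso C X Y f \<longleftrightarrow> (\<exists>g. inverse_arrows C X Y f g)"

definition inv_arrow :: "('o, 'm, 'k, 'z) lincat_scheme \<Rightarrow> 'o \<Rightarrow> 'o \<Rightarrow> 'm \<Rightarrow> 'm" where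
  "inv_arrow C X Y f = (THE g. inverse_arrows C X Y f g)"

definition linear_functor ::
    "('o, 'm, 'k) lincat \<Rightarrow> ('p, 'n, 'k) lincat \<Rightarrow> ('o \<Rightarrow> 'p) \<Rightarrow> ('o \<Rightarrow> 'o \<Rightarrow> 'm \<Rightarrow> 'n) \<Rightarrow> bool" where
  "linear_functor C D Fo Fm \<longleftrightarrow>
     (\<forall>X \<in> Obj C. Fo X \<in> Obj D) \<and>
     (\<forall>X \<in> Obj C. \<forall>Y \<in> Obj C. \<forall>f \<in> Hom C X Y. Fm X Y f \<in> Hom D (Fo X) (Fo Y)) \<and>
     (\<forall>X \<in> Obj C. Fm X X (Idn C X) = Idn D (Fo X)) \<and>
     (\<forall>X \<in> Obj C. \<forall>Y \<in> Obj C. \<forall>Z \<in> Obj C. \<forall>f \<in> Hom C X Y. \<forall>g \<in> Hom C Y Z.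
        Fm X Z (g \<cdot>\<^bsub>C\<^esub> f) = Fm Y Z g \<cdot>\<^bsub>D\<^esub> Fm X Y f) \<and>
     (\<forall>X \<in> Obj C. \<forall>Y \<in> Obj C. \<forall>f \<in> Hom C X Y. \<forall>g \<in> Hom C X Y.
        Fm X Y (Add C f g) = Add D (Fm X Y f) (Fm X Y g)) \<and>
     (\<forall>X \<in> Obj C. \<forall>Y \<in> Obj C. \<forall>f \<in> Hom C X Y. \<forall>c.
        Fm X Y (Scl C c f) = Scl D c (Fm X Y f))"

definition natural_iso ::
    "('o, 'm, 'k) lincat \<Rightarrow> ('p, 'n, 'k) lincat \<Rightarrow> ('o \<Rightarrow> 'p) \<Rightarrow> ('o \<Rightarrow> 'o \<Rightarrow> 'm \<Rightarrow> 'n) \<Rightarrow>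
     ('o \<Rightarrow> 'p) \<Rightarrow> ('o \<Rightarrow> 'o \<Rightarrow> 'm \<Rightarrow> 'n) \<Rightarrow> ('o \<Rightarrow> 'n) \<Rightarrow> bool" where
  "natural_iso C D Fo Fm Go Gm \<eta> \<longleftrightarrow>
     (\<forall>X \<in> Obj C. is_iso D (Fo X) (Go X) (\<eta> X)) \<and>
     (\<forall>X \<in> Obj C. \<forall>Y \<in> Obj C. \<forall>f \<in> Hom C X Y. \<eta> Y \<cdot>\<^bsub>D\<^esub> Fm X Y f = Gm X Y f \<cdot>\<^bsub>D\<^esub> \<eta> X)"

definition linearly_equivalent :: "('o, 'm, 'k) lincat \<Rightarrow> ('p, 'n, 'k) lincat \<Rightarrow> bool" where
  "linearly_equivalent C D \<longleftrightarrow>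
     (\<exists>Fo Fm Go Gm \<eta> \<epsilon>. linear_functor C D Fo Fm \<and> linear_functor D C Go Gm \<and>
        natural_iso C C id (\<lambda>X Y f. f) (Go \<circ> Fo) (\<lambda>X Y f. Gm (Fo X) (Fo Y) (Fm X Y f)) \<eta> \<and>
        natural_iso D D (Fo \<circ> Go) (\<lambda>X Y f. Fm (Go X) (Go Y) (Gm X Y f)) id (\<lambda>X Y f. f) \<epsilon>)"

text \<open>The direct sum of a family of linear categories; it is used for finite \<open>I\<close> only, where it is
  the product category.\<close>

definition direct_sum :: "'i set \<Rightarrow> ('i \<Rightarrow> ('o, 'm, 'k) lincat) \<Rightarrow> ('i \<Rightarrow> 'o, 'i \<Rightarrow> 'm, 'k) lincat" where
  "direct_sum I D =
     \<lparr> Obj = (\<Pi>\<^sub>E i\<in>I. Obj (D i)),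
       Hom = (\<lambda>X Y. \<Pi>\<^sub>E i\<in>I. Hom (D i) (X i) (Y i)),
       Idn = (\<lambda>X. \<lambda>i\<in>I. Idn (D i) (X i)),
       Cmp = (\<lambda>g f. \<lambda>i\<in>I. g i \<cdot>\<^bsub>D i\<^esub> f i),
       Add = (\<lambda>f g. \<lambda>i\<in>I. Add (D i) (f i) (g i)),
       Scl = (\<lambda>c f. \<lambda>i\<in>I. Scl (D i) c (f i)) \<rparr>"

subsection \<open>The product \<open>\<boxtimes>\<close>\<close>

text \<open>For vector spaces \<open>V\<close>, \<open>W\<close> over a field, \<open>V \<otimes> W\<close> embeds into the dual of the space of bilinear
  forms on \<open>V \<times> W\<close> by sending \<open>v \<otimes> w\<close> to evaluation at \<open>(v, w)\<close>. We use this as the definition of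
  \<open>Hom(a, a') \<otimes> Hom(b, b')\<close>; the tensor \<open>\<Sum> f\<^sub>j \<otimes> g\<^sub>j\<close> is entered as the list of the pairs \<open>(f\<^sub>j, g\<^sub>j)\<close>.\<close>

definition bilinear_forms ::
    "('a, 'm, 'k::field) lincat \<Rightarrow> ('b, 'n, 'k) lincat \<Rightarrow> 'a \<times> 'b \<Rightarrow> 'a \<times> 'b \<Rightarrow>
     ('m \<Rightarrow> 'n \<Rightarrow> 'k) set" where
  "bilinear_forms A B p q = {\<beta>.
     (\<forall>f \<in> Hom A (fst p) (fst q). \<forall>f' \<in> Hom A (fst p) (fst q). \<forall>g \<in> Hom B (snd p) (snd q).
        \<beta> (Add A f f') g = \<beta> f g + \<beta> f' g) \<and>
     (\<forall>f \<in> Hom A (fst p) (fst q). \<forall>g \<in> Hom B (snd p) (snd q). \<forall>g' \<in> Hom B (snd p) (snd q).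
        \<beta> f (Add B g g') = \<beta> f g + \<beta> f g') \<and>
     (\<forall>f \<in> Hom A (fst p) (fst q). \<forall>g \<in> Hom B (snd p) (snd q). \<forall>c.
        \<beta> (Scl A c f) g = c * \<beta> f g \<and> \<beta> f (Scl B c g) = c * \<beta> f g)}"

definition tensor ::
    "('a, 'm, 'k::field) lincat \<Rightarrow> ('b, 'n, 'k) lincat \<Rightarrow> 'a \<times> 'b \<Rightarrow> 'a \<times> 'b \<Rightarrow>
     ('m \<times> 'n) list \<Rightarrow> ('m \<Rightarrow> 'n \<Rightarrow> 'k) \<Rightarrow> 'k" where
  "tensor A B p q fgs = (\<lambda>\<beta> \<in> bilinear_forms A B p q. \<Sum>(f, g)\<leftarrow>fgs. \<beta> f g)"

definition tensor_hom ::
    "('a, 'm, 'k::field) lincat \<Rightarrow> ('b, 'n, 'k) lincat \<Rightarrow> 'a \<times> 'b \<Rightarrow> 'a \<times> 'b \<Rightarrow>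
     (('m \<Rightarrow> 'n \<Rightarrow> 'k) \<Rightarrow> 'k) set" where
  "tensor_hom A B p q =
     {tensor A B p q fgs |fgs. set fgs \<subseteq> Hom A (fst p) (fst q) \<times> Hom B (snd p) (snd q)}"

text \<open>The bilinear extension of \<open>(f \<otimes> g) (f' \<otimes> g') = f f' \<otimes> g g'\<close>.\<close>

definition tensor_comp ::
    "('a, 'm, 'k::field) lincat \<Rightarrow> ('b, 'n, 'k) lincat \<Rightarrow> 'a \<times> 'b \<Rightarrow> 'a \<times> 'b \<Rightarrow>
     (('m \<Rightarrow> 'n \<Rightarrow> 'k) \<Rightarrow> 'k) \<Rightarrow> (('m \<Rightarrow> 'n \<Rightarrow> 'k) \<Rightarrow> 'k) \<Rightarrow> ('m \<Rightarrow> 'n \<Rightarrow> 'k) \<Rightarrow> 'k" where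
  "tensor_comp A B p r t t' =
     (\<lambda>\<beta> \<in> bilinear_forms A B p r. t (\<lambda>f g. t' (\<lambda>f' g'. \<beta> (f \<cdot>\<^bsub>A\<^esub> f') (g \<cdot>\<^bsub>B\<^esub> g'))))"

text \<open>The tensor product of linear categories (pairs of objects, tensor products of Hom spaces),
  completed under finite direct sums: an object is a finite formal direct sum of pairs \<open>a \<boxtimes> b\<close>, an
  arrow is a matrix \<open>F\<close> of arrows, recorded together with its source and its target. When \<open>B\<close> is
  semisimple with finitely many simple objects, each with endomorphism ring \<open>k\<close> (such as \<open>Vec\<^sup>n\<close>),
  and \<open>A\<close> is abelian, this is Deligne's product.\<close>

type_synonym ('a, 'b, 'm, 'n, 'k) box_arrow =
  "('a \<times> 'b) list \<times> (nat \<times> nat \<Rightarrow> ('m \<Rightarrow> 'n \<Rightarrow> 'k) \<Rightarrow> 'k) \<times> ('a \<times> 'b) list"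

definition box ::
    "('a, 'm, 'k::field) lincat \<Rightarrow> ('b, 'n, 'k) lincat \<Rightarrow>
     (('a \<times> 'b) list, ('a, 'b, 'm, 'n, 'k) box_arrow, 'k) lincat"  (infixl "\<boxtimes>" 75) where
  "A \<boxtimes> B =
     \<lparr> Obj = {xs. set xs \<subseteq> Obj A \<times> Obj B},
       Hom = (\<lambda>xs ys. {(xs, F, ys) |F.
         F \<in> (\<Pi>\<^sub>E (i, j) \<in> {..<length ys} \<times> {..<length xs}. tensor_hom A B (xs ! j) (ys ! i))}),
       Idn = (\<lambda>xs. (xs, (\<lambda>(i, j) \<in> {..<length xs} \<times> {..<length xs}.
         tensor A B (xs ! j) (xs ! i)
           (if i = j then [(Idn A (fst (xs ! i)), Idn B (snd (xs ! i)))] else [])), xs)),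
       Cmp = (\<lambda>(_, G, zs) (xs, F, ys).
         (xs, (\<lambda>(i, l) \<in> {..<length zs} \<times> {..<length xs}.
           \<lambda>\<beta> \<in> bilinear_forms A B (xs ! l) (zs ! i).
             \<Sum>j<length ys. tensor_comp A B (xs ! l) (zs ! i) (G (i, j)) (F (j, l)) \<beta>), zs)),
       Add = (\<lambda>(xs, F, ys) (_, G, _).
         (xs, (\<lambda>(i, j) \<in> {..<length ys} \<times> {..<length xs}.
           \<lambda>\<beta> \<in> bilinear_forms A B (xs ! j) (ys ! i). F (i, j) \<beta> + G (i, j) \<beta>), ys)),
       Scl = (\<lambda>c (xs, F, ys).
         (xs, (\<lambda>(i, j) \<in> {..<length ys} \<times> {..<length xs}.
           \<lambda>\<beta> \<in> bilinear_forms A B (xs ! j) (ys ! i). c * F (i, j) \<beta>), ys)) \<rparr>"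

text \<open>Finite dimensional vector spaces; the object \<open>n\<close> stands for \<open>k\<^sup>n\<close>.\<close>

definition Vec :: "(nat, 'k::field mat, 'k) lincat" where
  "Vec = \<lparr> Obj = UNIV, Hom = (\<lambda>m n. carrier_mat n m), Idn = (\<lambda>n. 1\<^sub>m n),
           Cmp = (*), Add = (+), Scl = (\<cdot>\<^sub>m) \<rparr>"

definition Vec_power :: "nat \<Rightarrow> (nat \<Rightarrow> nat, nat \<Rightarrow> 'k::field mat, 'k) lincat" where
  "Vec_power n = direct_sum {..<n} (\<lambda>_. Vec)"

section \<open>Rigid categories, \<open>HH\<close> and \<open>HC\<close>\<close>

text \<open>A rigid category, strictly associative and strictly unital, with chosen left and right duals.
  In the definitions below the canonical isomorphisms between \<open>##\<close>-images (of \<open>1\<close>, of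
  \<open>X \<otimes> Y\<close> and of the left double dual) are suppressed: they have to be identities, as is the case
  for the category \<open>H_mod\<close> defined below.\<close>

record ('o, 'm, 'k) rigid_cat = "('o, 'm, 'k) lincat" +
  tenO :: "'o \<Rightarrow> 'o \<Rightarrow> 'o"  (infixl "\<oslash>\<index>" 75)
  tenM :: "'m \<Rightarrow> 'm \<Rightarrow> 'm"  (infixl "\<star>\<index>" 75)
  unitO :: 'o
  ldual :: "'o \<Rightarrow> 'o"
  ev_l :: "'o \<Rightarrow> 'm"    \<comment> \<open>\<open>X\<^sup>* \<otimes> X \<rightarrow> 1\<close>\<close>
  coev_l :: "'o \<Rightarrow> 'm"  \<comment> \<open>\<open>1 \<rightarrow> X \<otimes> X\<^sup>*\<close>\<close>
  rdual :: "'o \<Rightarrow> 'o"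
  ev_r :: "'o \<Rightarrow> 'm"    \<comment> \<open>\<open>X \<otimes> \<^sup>*X \<rightarrow> 1\<close>\<close>
  coev_r :: "'o \<Rightarrow> 'm"  \<comment> \<open>\<open>1 \<rightarrow> \<^sup>*X \<otimes> X\<close>\<close>

definition lsharp :: "('o, 'm, 'k) rigid_cat \<Rightarrow> 'o \<Rightarrow> 'o" where
  "lsharp C X = ldual C (ldual C X)"

definition rsharp :: "('o, 'm, 'k) rigid_cat \<Rightarrow> 'o \<Rightarrow> 'o" where
  "rsharp C X = rdual C (rdual C X)"

definition rdual_arrow :: "('o, 'm, 'k) rigid_cat \<Rightarrow> 'o \<Rightarrow> 'o \<Rightarrow> 'm \<Rightarrow> 'm" where
  "rdual_arrow C X Y f =
     (Idn C (rdual C X) \<star>\<^bsub>C\<^esub> ev_r C Y)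
     \<cdot>\<^bsub>C\<^esub> (Idn C (rdual C X) \<star>\<^bsub>C\<^esub> f \<star>\<^bsub>C\<^esub> Idn C (rdual C Y))
     \<cdot>\<^bsub>C\<^esub> (coev_r C X \<star>\<^bsub>C\<^esub> Idn C (rdual C Y))"

definition rsharp_arrow :: "('o, 'm, 'k) rigid_cat \<Rightarrow> 'o \<Rightarrow> 'o \<Rightarrow> 'm \<Rightarrow> 'm" where
  "rsharp_arrow C X Y f = rdual_arrow C (rdual C Y) (rdual C X) (rdual_arrow C X Y f)"

definition HH :: "('o, 'm, 'k) rigid_cat \<Rightarrow> ('o \<times> ('o \<Rightarrow> 'm), 'm, 'k) lincat" where
  "HH C =
     \<lparr> Obj = {(M, t). M \<in> Obj C \<and> t \<in> extensional (Obj C) \<and>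
         (\<forall>X \<in> Obj C. is_iso C (M \<oslash>\<^bsub>C\<^esub> X) (rsharp C X \<oslash>\<^bsub>C\<^esub> M) (t X)) \<and>
         (\<forall>X \<in> Obj C. \<forall>Y \<in> Obj C. \<forall>f \<in> Hom C X Y.
            t Y \<cdot>\<^bsub>C\<^esub> (Idn C M \<star>\<^bsub>C\<^esub> f) = (rsharp_arrow C X Y f \<star>\<^bsub>C\<^esub> Idn C M) \<cdot>\<^bsub>C\<^esub> t X) \<and>
         t (unitO C) = Idn C M \<and>
         (\<forall>X \<in> Obj C. \<forall>Y \<in> Obj C.
            t (X \<oslash>\<^bsub>C\<^esub> Y) = (Idn C (rsharp C X) \<star>\<^bsub>C\<^esub> t Y) \<cdot>\<^bsub>C\<^esub> (t X \<star>\<^bsub>C\<^esub> Idn C Y))},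
       Hom = (\<lambda>(M, t) (N, u). {f \<in> Hom C M N. \<forall>X \<in> Obj C.
         u X \<cdot>\<^bsub>C\<^esub> (f \<star>\<^bsub>C\<^esub> Idn C X) = (Idn C (rsharp C X) \<star>\<^bsub>C\<^esub> f) \<cdot>\<^bsub>C\<^esub> t X}),
       Idn = (\<lambda>(M, t). Idn C M), Cmp = Cmp C, Add = Add C, Scl = Scl C \<rparr>"

text \<open>\<open>swapped C M t X\<close> is the map \<open>X \<otimes> M \<rightarrow> M \<otimes> X\<^sup>#\<close>, the inverse of
  \<open>t (X\<^sup>#) : M \<otimes> X\<^sup># \<rightarrow> X \<otimes> M\<close>.\<close>

definition swapped :: "('o, 'm, 'k) rigid_cat \<Rightarrow> 'o \<Rightarrow> ('o \<Rightarrow> 'm) \<Rightarrow> 'o \<Rightarrow> 'm" where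
  "swapped C M t X = inv_arrow C (M \<oslash>\<^bsub>C\<^esub> lsharp C X) (X \<oslash>\<^bsub>C\<^esub> M) (t (lsharp C X))"

definition sigma_HH :: "('o, 'm, 'k) rigid_cat \<Rightarrow> 'o \<times> ('o \<Rightarrow> 'm) \<Rightarrow> 'm" where
  "sigma_HH C = (\<lambda>(M, t).
     (Idn C M \<star>\<^bsub>C\<^esub> ev_l C (ldual C M))
     \<cdot>\<^bsub>C\<^esub> (swapped C M t M \<star>\<^bsub>C\<^esub> Idn C (ldual C M))
     \<cdot>\<^bsub>C\<^esub> (Idn C M \<star>\<^bsub>C\<^esub> coev_l C M))"

definition HC :: "('o, 'm, 'k) rigid_cat \<Rightarrow> ('o \<times> ('o \<Rightarrow> 'm), 'm, 'k) lincat" where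
  "HC C = full_sub (HH C) (\<lambda>(M, t). sigma_HH C (M, t) = Idn C M)"

section \<open>Graded vector spaces\<close>

definition bicharacter :: "('g::ab_group_add \<Rightarrow> 'g \<Rightarrow> 'k::field) \<Rightarrow> bool" where
  "bicharacter \<chi> \<longleftrightarrow>
     (\<forall>x y. \<chi> x y \<noteq> 0) \<and>
     (\<forall>x y z. \<chi> (x + y) z = \<chi> x z * \<chi> y z) \<and>
     (\<forall>x y z. \<chi> x (y + z) = \<chi> x y * \<chi> x z)"

definition characters :: "('g::ab_group_add \<Rightarrow> 'k::field) set" where
  "characters = {\<phi>. (\<forall>x. \<phi> x \<noteq> 0) \<and> (\<forall>x y. \<phi> (x + y) = \<phi> x * \<phi> y)}"

definition iso_to_characters :: "('g::ab_group_add \<Rightarrow> 'g \<Rightarrow> 'k::field) \<Rightarrow> bool" where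
  "iso_to_characters \<omega> \<longleftrightarrow>
     bij_betw \<omega> UNIV characters \<and> (\<forall>x y. \<omega> (x + y) = (\<lambda>z. \<omega> x z * \<omega> y z))"

text \<open>A graded space is given by the list of the degrees of a homogeneous basis: \<open>V\<close> stands for
  \<open>k\<^sup>d\<close>, \<open>d = length V\<close>, whose \<open>i\<close>-th basis vector has degree \<open>V ! i\<close>. The basis of a tensor product
  is ordered lexicographically, which makes the tensor product strictly associative and unital.
  Duals carry the dual basis, in the same order.\<close>

abbreviation grunit :: "'g::ab_group_add list" where
  "grunit \<equiv> [0]"

definition grtensor :: "'g::ab_group_add list \<Rightarrow> 'g list \<Rightarrow> 'g list"  (infixl "\<otimes>\<^sub>g" 75) where
  "V \<otimes>\<^sub>g W = map (\<lambda>(x, y). x + y) (List.product V W)"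

definition grdual :: "'g::ab_group_add list \<Rightarrow> 'g list" where
  "grdual V = map uminus V"

definition grhom :: "'g list \<Rightarrow> 'g list \<Rightarrow> 'k::field mat set" where
  "grhom V W = {A \<in> carrier_mat (length W) (length V).
     \<forall>i<length W. \<forall>j<length V. A $$ (i, j) \<noteq> 0 \<longrightarrow> W ! i = V ! j}"

definition kron :: "'k::field mat \<Rightarrow> 'k mat \<Rightarrow> 'k mat"  (infixl "\<otimes>\<^sub>m" 75) where
  "A \<otimes>\<^sub>m B = mat (dim_row A * dim_row B) (dim_col A * dim_col B)
     (\<lambda>(i, j). A $$ (i div dim_row B, j div dim_col B) * B $$ (i mod dim_row B, j mod dim_col B))"

abbreviation idm :: "'g list \<Rightarrow> 'k::field mat" where
  "idm V \<equiv> 1\<^sub>m (length V)"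

definition minv :: "'k::field mat \<Rightarrow> 'k mat" where
  "minv A = (THE B. B \<in> carrier_mat (dim_col A) (dim_row A) \<and>
     B * A = 1\<^sub>m (dim_col A) \<and> A * B = 1\<^sub>m (dim_row A))"

text \<open>\<open>braid \<chi> V W : V \<otimes> W \<rightarrow> W \<otimes> V\<close> sends \<open>v\<^sub>i \<otimes> w\<^sub>j\<close> to \<open>\<chi>(deg v\<^sub>i, deg w\<^sub>j) w\<^sub>j \<otimes> v\<^sub>i\<close>.\<close>

definition braid :: "('g \<Rightarrow> 'g \<Rightarrow> 'k::field) \<Rightarrow> 'g list \<Rightarrow> 'g list \<Rightarrow> 'k mat" where
  "braid \<chi> V W = mat (length W * length V) (length V * length W)
     (\<lambda>(r, c). let i = c div length W; j = c mod length W
               in if r = j * length V + i then \<chi> (V ! i) (W ! j) else 0)"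

definition braid_inv :: "('g \<Rightarrow> 'g \<Rightarrow> 'k::field) \<Rightarrow> 'g list \<Rightarrow> 'g list \<Rightarrow> 'k mat" where
  "braid_inv \<chi> V W = minv (braid \<chi> W V)"

text \<open>In bases, the evaluations \<open>V\<^sup>* \<otimes> V \<rightarrow> 1\<close> and \<open>V \<otimes> \<^sup>*V \<rightarrow> 1\<close> have the same matrix; likewise the
  coevaluations \<open>1 \<rightarrow> V \<otimes> V\<^sup>*\<close> and \<open>1 \<rightarrow> \<^sup>*V \<otimes> V\<close>.\<close>

definition evm :: "'g list \<Rightarrow> 'k::field mat" where
  "evm V = mat 1 (length V * length V)
     (\<lambda>(_, c). if c div length V = c mod length V then 1 else 0)"

definition coevm :: "'g list \<Rightarrow> 'k::field mat" where
  "coevm V = mat (length V * length V) 1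
     (\<lambda>(r, _). if r div length V = r mod length V then 1 else 0)"

section \<open>Hopf algebras and their modules\<close>

record ('g, 'k) hopf =
  hobj :: "'g list"
  hmult :: "'k mat"
  hunit :: "'k mat"
  hcomult :: "'k mat"
  hcounit :: "'k mat"
  hantipode :: "'k mat"

definition hopf_algebra :: "('g::ab_group_add \<Rightarrow> 'g \<Rightarrow> 'k::field) \<Rightarrow> ('g, 'k) hopf \<Rightarrow> bool" where
  "hopf_algebra \<chi> H \<longleftrightarrow>
    (let A = hobj H; m = hmult H; u = hunit H; \<Delta> = hcomult H; \<epsilon> = hcounit H; S = hantipode H in
      m \<in> grhom (A \<otimes>\<^sub>g A) A \<and> u \<in> grhom grunit A \<and>
      \<Delta> \<in> grhom A (A \<otimes>\<^sub>g A) \<and> \<epsilon> \<in> grhom A grunit \<and> S \<in> grhom A A \<and>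
      m * (m \<otimes>\<^sub>m idm A) = m * (idm A \<otimes>\<^sub>m m) \<and>
      m * (u \<otimes>\<^sub>m idm A) = idm A \<and> m * (idm A \<otimes>\<^sub>m u) = idm A \<and>
      (\<Delta> \<otimes>\<^sub>m idm A) * \<Delta> = (idm A \<otimes>\<^sub>m \<Delta>) * \<Delta> \<and>
      (\<epsilon> \<otimes>\<^sub>m idm A) * \<Delta> = idm A \<and> (idm A \<otimes>\<^sub>m \<epsilon>) * \<Delta> = idm A \<and>
      \<Delta> * m = (m \<otimes>\<^sub>m m) * (idm A \<otimes>\<^sub>m braid \<chi> A A \<otimes>\<^sub>m idm A) * (\<Delta> \<otimes>\<^sub>m \<Delta>) \<and>
      \<Delta> * u = u \<otimes>\<^sub>m u \<and> \<epsilon> * m = \<epsilon> \<otimes>\<^sub>m \<epsilon> \<and> \<epsilon> * u = idm (grunit :: 'g list) \<and>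
      m * (S \<otimes>\<^sub>m idm A) * \<Delta> = u * \<epsilon> \<and> m * (idm A \<otimes>\<^sub>m S) * \<Delta> = u * \<epsilon> \<and>
      invertible_mat S)"

text \<open>\<open>\<rho> : A \<otimes> V \<rightarrow> V\<close> is an action on \<open>V\<close> of the algebra \<open>A\<close> with multiplication \<open>m\<close> and unit \<open>u\<close>.\<close>

definition is_action ::
    "'g::ab_group_add list \<Rightarrow> 'k::field mat \<Rightarrow> 'k mat \<Rightarrow> 'g list \<Rightarrow> 'k mat \<Rightarrow> bool" where
  "is_action A m u V \<rho> \<longleftrightarrow> \<rho> \<in> grhom (A \<otimes>\<^sub>g V) V \<and>
     \<rho> * (m \<otimes>\<^sub>m idm V) = \<rho> * (idm A \<otimes>\<^sub>m \<rho>) \<and> \<rho> * (u \<otimes>\<^sub>m idm V) = idm V"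

text \<open>The actions of \<open>H\<close> on \<open>V \<otimes> W\<close>, on the left dual \<open>V\<^sup>*\<close> and on the right dual \<open>\<^sup>*V\<close>. The last two
  are the unique ones for which evaluation and coevaluation are \<open>H\<close>-linear.\<close>

definition tensor_action ::
    "('g::ab_group_add \<Rightarrow> 'g \<Rightarrow> 'k::field) \<Rightarrow> ('g, 'k) hopf \<Rightarrow>
     'g list \<Rightarrow> 'k mat \<Rightarrow> 'g list \<Rightarrow> 'k mat \<Rightarrow> 'k mat" where
  "tensor_action \<chi> H V \<rho> W \<sigma> =
     (\<rho> \<otimes>\<^sub>m \<sigma>) * (idm (hobj H) \<otimes>\<^sub>m braid \<chi> (hobj H) V \<otimes>\<^sub>m idm W) * (hcomult H \<otimes>\<^sub>m idm V \<otimes>\<^sub>m idm W)"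

definition ldual_action ::
    "('g::ab_group_add \<Rightarrow> 'g \<Rightarrow> 'k::field) \<Rightarrow> ('g, 'k) hopf \<Rightarrow> 'g list \<Rightarrow> 'k mat \<Rightarrow> 'k mat" where
  "ldual_action \<chi> H V \<rho> =
     (evm V \<otimes>\<^sub>m idm (grdual V))
     * (idm (grdual V) \<otimes>\<^sub>m \<rho> \<otimes>\<^sub>m idm (grdual V))
     * (idm (grdual V) \<otimes>\<^sub>m hantipode H \<otimes>\<^sub>m idm V \<otimes>\<^sub>m idm (grdual V))
     * (idm (grdual V) \<otimes>\<^sub>m idm (hobj H) \<otimes>\<^sub>m coevm V)
     * braid \<chi> (hobj H) (grdual V)"

definition rdual_action ::
    "('g::ab_group_add \<Rightarrow> 'g \<Rightarrow> 'k::field) \<Rightarrow> ('g, 'k) hopf \<Rightarrow> 'g list \<Rightarrow> 'k mat \<Rightarrow> 'k mat" where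
  "rdual_action \<chi> H V \<rho> =
     (idm (grdual V) \<otimes>\<^sub>m evm V)
     * (idm (grdual V) \<otimes>\<^sub>m \<rho> \<otimes>\<^sub>m idm (grdual V))
     * (idm (grdual V) \<otimes>\<^sub>m minv (hantipode H) \<otimes>\<^sub>m idm V \<otimes>\<^sub>m idm (grdual V))
     * (idm (grdual V) \<otimes>\<^sub>m braid_inv \<chi> V (hobj H) \<otimes>\<^sub>m idm (grdual V))
     * (coevm V \<otimes>\<^sub>m idm (hobj H) \<otimes>\<^sub>m idm (grdual V))"

definition H_mod ::
    "('g::ab_group_add \<Rightarrow> 'g \<Rightarrow> 'k::field) \<Rightarrow> ('g, 'k) hopf \<Rightarrow>
     ('g list \<times> 'k mat, 'k mat, 'k) rigid_cat" where
  "H_mod \<chi> H =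
     \<lparr> Obj = {(V, \<rho>). is_action (hobj H) (hmult H) (hunit H) V \<rho>},
       Hom = (\<lambda>(V, \<rho>) (W, \<sigma>). {f \<in> grhom V W. f * \<rho> = \<sigma> * (idm (hobj H) \<otimes>\<^sub>m f)}),
       Idn = (\<lambda>(V, \<rho>). idm V),
       Cmp = (*), Add = (+), Scl = (\<cdot>\<^sub>m),
       tenO = (\<lambda>(V, \<rho>) (W, \<sigma>). (V \<otimes>\<^sub>g W, tensor_action \<chi> H V \<rho> W \<sigma>)),
       tenM = (\<otimes>\<^sub>m),
       unitO = (grunit, hcounit H),
       ldual = (\<lambda>(V, \<rho>). (grdual V, ldual_action \<chi> H V \<rho>)),
       ev_l = (\<lambda>(V, \<rho>). evm V),
       coev_l = (\<lambda>(V, \<rho>). coevm V),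
       rdual = (\<lambda>(V, \<rho>). (grdual V, rdual_action \<chi> H V \<rho>)),
       ev_r = (\<lambda>(V, \<rho>). evm V),
       coev_r = (\<lambda>(V, \<rho>). coevm V) \<rparr>"

section \<open>Anti-Yetter-Drinfeld modules\<close>

text \<open>\<open>adjunct A U g : U \<rightarrow> \<^sup>*A \<otimes> M\<close> is the map with adjoint \<open>g : A \<otimes> U \<rightarrow> M\<close>, i.e. the unique \<open>r\<close> with
  \<open>(ev \<otimes> Id) (Id \<otimes> r) = g\<close>.\<close>

definition adjunct :: "'g::ab_group_add list \<Rightarrow> 'g list \<Rightarrow> 'k::field mat \<Rightarrow> 'k mat" where
  "adjunct A U g = (idm (grdual A) \<otimes>\<^sub>m g) * (coevm A \<otimes>\<^sub>m idm U)"

definition dual_mult :: "('g::ab_group_add \<Rightarrow> 'g \<Rightarrow> 'k::field) \<Rightarrow> ('g, 'k) hopf \<Rightarrow> 'k mat" where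
  "dual_mult \<chi> H = (let A = hobj H; A' = grdual A in
     adjunct A (A' \<otimes>\<^sub>g A')
       (evm A * (idm A \<otimes>\<^sub>m evm A \<otimes>\<^sub>m idm A')
        * ((braid_inv \<chi> A A * hcomult H) \<otimes>\<^sub>m idm A' \<otimes>\<^sub>m idm A')))"

definition dual_unit :: "('g::ab_group_add, 'k::field) hopf \<Rightarrow> 'k mat" where
  "dual_unit H = adjunct (hobj H) grunit (hcounit H)"

text \<open>The action of \<open>\<varsigma>\<close>, with \<open>\<varsigma>(x) = \<chi>(x, x)\<^sup>-\<^sup>1\<close>.\<close>

definition twist :: "('g \<Rightarrow> 'g \<Rightarrow> 'k::field) \<Rightarrow> 'g list \<Rightarrow> 'k mat" where
  "twist \<chi> V = mat (length V) (length V)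
     (\<lambda>(i, j). if i = j then inverse (\<chi> (V ! i) (V ! i)) else 0)"

definition twist_E ::
    "('g::ab_group_add \<Rightarrow> 'g \<Rightarrow> 'k::field) \<Rightarrow> 'g list \<Rightarrow> 'g list \<Rightarrow> 'k mat" where
  "twist_E \<chi> V M = twist \<chi> (V \<otimes>\<^sub>g M) * minv (idm V \<otimes>\<^sub>m twist \<chi> M)"

definition r_one :: "('g::ab_group_add, 'k::field) hopf \<Rightarrow> 'g list \<Rightarrow> 'k mat" where
  "r_one H M = (let A = hobj H; A' = grdual A in
     adjunct A (A \<otimes>\<^sub>g A' \<otimes>\<^sub>g M) ((evm A \<otimes>\<^sub>m idm M) * (hmult H \<otimes>\<^sub>m idm A' \<otimes>\<^sub>m idm M)))"

definition r_zero ::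
    "('g::ab_group_add \<Rightarrow> 'g \<Rightarrow> 'k::field) \<Rightarrow> ('g, 'k) hopf \<Rightarrow> 'g list \<Rightarrow> 'k mat \<Rightarrow> 'k mat" where
  "r_zero \<chi> H M \<rho> = (let A = hobj H; A' = grdual A in
     adjunct A (A \<otimes>\<^sub>g A' \<otimes>\<^sub>g M)
       (\<rho> * (idm A \<otimes>\<^sub>m evm A \<otimes>\<^sub>m idm M)
        * (idm A \<otimes>\<^sub>m hmult H \<otimes>\<^sub>m idm A' \<otimes>\<^sub>m idm M)
        * (idm A \<otimes>\<^sub>m hantipode H \<otimes>\<^sub>m idm A \<otimes>\<^sub>m idm A' \<otimes>\<^sub>m idm M)
        * (hcomult H \<otimes>\<^sub>m idm A \<otimes>\<^sub>m idm A' \<otimes>\<^sub>m idm M)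
        * (braid \<chi> A A \<otimes>\<^sub>m idm A' \<otimes>\<^sub>m idm M)))"

definition act ::
    "('g::ab_group_add \<Rightarrow> 'g \<Rightarrow> 'k::field) \<Rightarrow> ('g, 'k) hopf \<Rightarrow> 'g list \<Rightarrow> 'k mat \<Rightarrow> 'k mat" where
  "act \<chi> H M \<rho> = (let A = hobj H; A' = grdual A in
     r_one H M * twist_E \<chi> A (A' \<otimes>\<^sub>g M) * (idm A \<otimes>\<^sub>m r_zero \<chi> H M \<rho>)
     * (hcomult H \<otimes>\<^sub>m idm A' \<otimes>\<^sub>m idm M))"

text \<open>\<open>HH\<close> of \<open>H_mod\<close> with coefficients in \<open>\<B>\<^sub>\<varsigma>\<close>, in the form of anti-Yetter-Drinfeld modules
  \<open>(M, \<rho>, \<rho>')\<close>, where \<open>\<rho>\<close> is the action of \<open>H\<close> and \<open>\<rho>'\<close> that of \<open>\<^sup>*H\<close>.\<close>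

definition aYD ::
    "('g::ab_group_add \<Rightarrow> 'g \<Rightarrow> 'k::field) \<Rightarrow> ('g, 'k) hopf \<Rightarrow>
     ('g list \<times> 'k mat \<times> 'k mat, 'k mat, 'k) lincat" where
  "aYD \<chi> H = (let A = hobj H; A' = grdual A in
     \<lparr> Obj = {(M, \<rho>, \<rho>').
         is_action A (hmult H) (hunit H) M \<rho> \<and>
         is_action A' (dual_mult \<chi> H) (dual_unit H) M \<rho>' \<and>
         \<rho> * (idm A \<otimes>\<^sub>m \<rho>') = \<rho>' * act \<chi> H M \<rho>},
       Hom = (\<lambda>(M, \<rho>, \<rho>') (N, \<sigma>, \<sigma>').
         {f \<in> grhom M N. f * \<rho> = \<sigma> * (idm A \<otimes>\<^sub>m f) \<and> f * \<rho>' = \<sigma>' * (idm A' \<otimes>\<^sub>m f)}),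
       Idn = (\<lambda>(M, \<rho>, \<rho>'). idm M),
       Cmp = (*), Add = (+), Scl = (\<cdot>\<^sub>m) \<rparr>)"

definition sigma_aYD ::
    "('g::ab_group_add \<Rightarrow> 'g \<Rightarrow> 'k::field) \<Rightarrow> ('g, 'k) hopf \<Rightarrow> 'g list \<times> 'k mat \<times> 'k mat \<Rightarrow> 'k mat" where
  "sigma_aYD \<chi> H = (\<lambda>(M, \<rho>, \<rho>').
     \<rho>' * (idm (grdual (hobj H)) \<otimes>\<^sub>m \<rho>) * (coevm (hobj H) \<otimes>\<^sub>m idm M) * twist \<chi> M)"

text \<open>The full subcategory of those \<open>M\<close> on which \<open>i\<close> times \<open>sigma_aYD\<close> is the identity.\<close>

definition aYD_stable ::
    "('g::ab_group_add \<Rightarrow> 'g \<Rightarrow> 'k::field) \<Rightarrow> ('g, 'k) hopf \<Rightarrow> 'k \<Rightarrow>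
     ('g list \<times> 'k mat \<times> 'k mat, 'k mat, 'k) lincat" where
  "aYD_stable \<chi> H i = full_sub (aYD \<chi> H) (\<lambda>M. i \<cdot>\<^sub>m sigma_aYD \<chi> H M = Idn (aYD \<chi> H) M)"

end

(*
 An object M of HC(C) carries, for every one-dimensional trivial module k_y of degree y, an
 automorphism: the half braiding M (x) k_y -> k_y (x) M, corrected by the character of y on the
 degrees. These automorphisms are arrows of HH(C) and form a representation of G, so M splits into
 isotypic summands, one for each character of G, i.e. (omega being an isomorphism) for each x in G.
 On the summand of type x the half braiding is determined by a coaction of H, and after shifting
 the degrees by x this is the same as an anti-Yetter-Drinfeld module. The shift changes the
 stability condition by the factor theta(x), hence the summands of type x form X^(theta(x) sigma).
*)
theory Submission
 imports Defs "Jordan_Normal_Form.Determinant"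
begin

text \<open>Two facts make half-braidings computable. The action A \<otimes> W_0 -> W, where W_0 is
  the space W with trivial action, is a module map. Naturality along it and the tensor axiom express
  the half-braiding with W through those with A and with W_0: the first gives the coaction, the
  second is fixed by the type x. Moreover the double dual of a module is its restriction along a
  Hopf automorphism of H, S^2 corrected by \<theta>^-1, so the underlying space never changes. The
  shift by x works because E and the stability map are quadratic in degrees: passing from v to v + x
  in E produces the factor \<omega>(x, h)^-1, which is the scalar of type x, and \<theta>(v + x) =
  \<theta>(v) \<theta>(x) \<omega>(x, v) leaves \<theta>(x) over in the stability map. An object of
  HH(C) is a family indexed by all modules, so the image of an idempotent and a direct sum must be
  given an action and a half-braiding; one gluing construction serves for both. Splitting into types
  averages over G, hence divides by its order, and uses orthogonality of the characters \<omega>(x,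
  -).\<close>

notation kron (infixl "<*>" 75)
notation grtensor (infixl "<&>" 75)
abbreviation (input) "len \<equiv> length"
abbreviation (input) "drow \<equiv> dim_row"
abbreviation (input) "dcol \<equiv> dim_col"

section \<open>Kronecker products\<close>

lemma mat_assoc:
 fixes A B C :: "'a::semiring_0 mat"
 assumes "dcol A = drow B" "dcol B = drow C"
 shows "A * B * C = A * (B * C)"
 by (rule assoc_mult_mat[of A "drow A" "dcol A" B "dcol B" C "dcol C"])
 (rule carrier_matI; simp only: assms)+

lemma minv_eqI:
 fixes A B :: "'k::field mat"
 assumes d: "drow B = dcol A" "dcol B = drow A"
 and BA: "B * A = 1\<^sub>m (dcol A)" and AB: "A * B = 1\<^sub>m (drow A)"
 shows "minv A = B"
 unfolding minv_def
proof (rule the_equality)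
 have "B \<in> carrier_mat (dcol A) (drow A)" using d by (rule carrier_matI)
 then show "B \<in> carrier_mat (dcol A) (drow A) & B * A = 1\<^sub>m (dcol A) & A * B = 1\<^sub>m (drow A)"
 using BA AB by blast
next
 fix C assume C: "C \<in> carrier_mat (dcol A) (drow A) & C * A = 1\<^sub>m (dcol A) & A * C = 1\<^sub>m (drow A)"
 then have dC: "drow C = dcol A" "dcol C = drow A" by (blast dest: carrier_matD)+
 have "C = C * (A * B)" unfolding AB using dC by simp
 also have "... = (C * A) * B" using dC d(1) by (intro mat_assoc[symmetric]) simp_all
 also have "... = 1\<^sub>m (dcol A) * B" using C by simp
 also have "... = B" using d(1) by simp
 finally show "C = B" .
qed

lemma minv_inverse:
 fixes A :: "'k::field mat"
 assumes "invertible_mat A"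
 shows "drow (minv A) = dcol A" "dcol (minv A) = drow A"
 "minv A * A = 1\<^sub>m (dcol A)" "A * minv A = 1\<^sub>m (drow A)"
proof -
 from assms obtain B where B: "A * B = 1\<^sub>m (drow A)" "B * A = 1\<^sub>m (drow B)" and sq: "drow A = dcol A"
 unfolding invertible_mat_def inverts_mat_def square_mat.simps by metis
 have "dcol (A * B) = drow A" "dcol (B * A) = drow B" by (simp_all only: B index_one_mat)
 then have d: "dcol B = drow A" "drow B = dcol A" by simp_all
 have "minv A = B" using B by (intro minv_eqI) (simp_all add: d sq)
 then show "drow (minv A) = dcol A" "dcol (minv A) = drow A"
 "minv A * A = 1\<^sub>m (dcol A)" "A * minv A = 1\<^sub>m (drow A)"
 using B d by simp_all
qed

text \<open>The position of the basis vector (i, j) of a tensor product in the lexicographic order;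
  q is the dimension of the second factor.\<close>

definition ix :: "nat \<Rightarrow> nat \<Rightarrow> nat \<Rightarrow> nat" where "ix q i j = i * q + j"

lemma ix_div[simp]: "j < q ==> ix q i j div q = i"
 and ix_mod[simp]: "j < q ==> ix q i j mod q = j"
 by (simp_all add: ix_def)

lemma ix_less[simp]: "i < p ==> j < q ==> ix q i j < p * q"
proof -
 assume "i < p" "j < q"
 then have "ix q i j < Suc i * q" "Suc i * q \<le> p * q" using mult_le_mono1[of "Suc i" p q] by (simp_all add: ix_def)
 then show ?thesis by linarith
qed

lemma ix_inject[simp]: "j < q ==> j' < q ==> ix q i j = ix q i' j' \<longleftrightarrow> i = i' & j = j'"
 by (metis ix_div ix_mod)

lemma ix_decompose:
 assumes "k < p * q"
 obtains i j where "i < p" "j < q" "k = ix q i j"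
proof
 have "q > 0" using assms by (cases q) auto
 then show "k div q < p" "k mod q < q" using assms by (simp_all add: less_mult_imp_div_less)
 show "k = ix q (k div q) (k mod q)" by (simp add: ix_def)
qed

lemma ix_0[simp]: "ix q 0 j = j" by (simp add: ix_def)
lemma ix_1[simp]: "ix (Suc 0) i 0 = i" by (simp add: ix_def)
text \<open>As a simp rule this brings every index of an iterated tensor product into left nested
  form, the form in which \<open>ap_kron2\<close> and \<open>ap_kron3\<close> expect it.\<close>

lemma ix_assoc[simp]: "ix (q * p) i (ix p j k) = ix p (ix q i j) k"
 by (simp add: ix_def algebra_simps)

lemma sum_ix: "(\<Sum>k<p * q. F k) = (\<Sum>i<p. \<Sum>j<q. F (ix q i j))" for F :: "nat \<Rightarrow> 'a::comm_monoid_add"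
proof -
 have "(\<Sum>k<p * q. F k) = (\<Sum>(i, j)\<in>{..<p} \<times> {..<q}. F (ix q i j))"
 by (rule sum.reindex_bij_witness[where i = "%(i, j). ix q i j" and j = "%k. (k div q, k mod q)"])
 (auto simp: less_mult_imp_div_less ix_less[unfolded ix_def], auto simp: ix_def intro!: mod_less_divisor gr0I)
 then show ?thesis by (simp add: sum.cartesian_product)
qed

lemma kron_dims[simp]:
 "drow (A <*> B) = drow A * drow B" "dcol (A <*> B) = dcol A * dcol B"
 by (simp_all add: kron_def)

lemma kron_index:
 assumes "i < drow A" "j < drow B" "k < dcol A" "l < dcol B"
 shows "(A <*> B) $$ (ix (drow B) i j, ix (dcol B) k l) = A $$ (i, k) * B $$ (j, l)"
 using assms by (simp add: kron_def)

lemma kron_eqI: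
 assumes "drow C = p * q" "dcol C = p' * q'" "drow D = p * q" "dcol D = p' * q'"
 and "!!i j k l. i < p ==> j < q ==> k < p' ==> l < q' ==>
 C $$ (ix q i j, ix q' k l) = D $$ (ix q i j, ix q' k l)"
 shows "C = D"
proof (rule eq_matI)
 fix r c assume "r < drow D" "c < dcol D"
 then have "r < p * q" "c < p' * q'" using assms by auto
 then show "C $$ (r, c) = D $$ (r, c)" by (elim ix_decompose) (auto intro: assms(5))
qed (use assms in auto)

text \<open>F is a functional on the target, given by its values on the basis, and
  \<open>ap A c F\<close> is F(A e_c). Matrix products become nested applications
  (\<open>ap_mult\<close>), so identities of maps between tensor products can be rewritten leg by
  leg, as in Sweedler notation, instead of through Kronecker products.\<close>

definition ap :: "'k::field mat \<Rightarrow> nat \<Rightarrow> (nat \<Rightarrow> 'k) \<Rightarrow> 'k" where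
 "ap A c F = (\<Sum>r<drow A. A $$ (r, c) * F r)"

lemma ap_cong:
 assumes "!!r. r < drow A ==> A $$ (r, c) ~= 0 ==> F r = G r"
 shows "ap A c F = ap A c G"
 unfolding ap_def by (rule sum.cong) (use assms in fastforce)+

text \<open>As a congruence rule it makes the bound r < N available while F is rewritten. N is a
  separate variable so that simp evaluates the row dimension first.\<close>

lemma ap_weak_cong[cong]:
 assumes "A = B" "c = d" "drow B = N" "!!r. r < N ==> F r = G r"
 shows "ap A c F = ap B d G"
 using assms by (auto intro: ap_cong)

lemma ap_entry: "r < drow A ==> ap A c (%k. if k = r then 1 else 0) = A $$ (r, c)"
 unfolding ap_def by (simp add: if_distrib[of "%x. _ * x"] sum.delta cong: if_cong)

text \<open>Indicator functionals recover the entries of a matrix.\<close>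

lemma ap_eqI:
 assumes "drow A = drow B" "dcol A = dcol B"
 and "!!c F. c < dcol B ==> ap A c F = ap B c F"
 shows "A = B"
proof (rule eq_matI)
 fix r c assume "r < drow B" "c < dcol B"
 then show "A $$ (r, c) = B $$ (r, c)" using assms by (metis ap_entry)
qed (use assms in auto)

lemma ap_mult[simp]:
 assumes "dcol A = drow B" "c < dcol B"
 shows "ap (A * B) c F = ap B c (%k. ap A k F)"
proof -
 have "ap (A * B) c F = (\<Sum>r<drow A. \<Sum>k<drow B. A $$ (r, k) * B $$ (k, c) * F r)"
 unfolding ap_def by (rule sum.cong) (use assms in \<open>auto simp: scalar_prod_def lessThan_atLeast0 sum_distrib_right\<close>)
 also have "... = ap B c (%k. ap A k F)"
 unfolding ap_def by (subst sum.swap) (simp add: sum_distrib_left mult_ac)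
 finally show ?thesis .
qed

lemma ap_one[simp]: "c < n ==> ap (1\<^sub>m n) c F = F c"
 unfolding ap_def by (simp add: if_distrib[of "%x. x * _"] sum.delta cong: if_cong)

lemma ap_add[simp]:
 "drow A = drow B ==> dcol A = dcol B ==> c < dcol B ==> ap (A + B) c F = ap A c F + ap B c F"
 unfolding ap_def by (simp add: sum.distrib algebra_simps)

lemma ap_smult[simp]: "c < dcol B ==> ap (a \<cdot>\<^sub>m B) c F = a * ap B c F"
 unfolding ap_def by (simp add: sum_distrib_left mult_ac)

lemma ap_kron:
 assumes "dcol B = q" "i < dcol A" "j < q"
 shows "ap (A <*> B) (ix q i j) F = ap A i (%r. ap B j (%s. F (ix (drow B) r s)))"
 unfolding ap_def kron_dims sum_ix sum_distrib_left
 by (intro sum.cong refl) (use assms kron_index[of _ A _ B i j] in \<open>auto simp: mult_ac\<close>)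

text \<open>A second factor whose source is itself a tensor product sees the last two legs of a left
  nested index.\<close>

lemma ap_kron2:
 assumes "dcol B = q * p" "i < dcol A" "j < q" "k < p"
 shows "ap (A <*> B) (ix p (ix q i j) k) F = ap A i (%r. ap B (ix p j k) (%s. F (ix (drow B) r s)))"
 using ap_kron[of B "q * p" i A "ix p j k" F] assms by simp

lemma ap_kron3:
 assumes "dcol B = q * p * o'" "i < dcol A" "j < q" "k < p" "l < o'"
 shows "ap (A <*> B) (ix o' (ix p (ix q i j) k) l) F =
 ap A i (%r. ap B (ix o' (ix p j k) l) (%s. F (ix (drow B) r s)))"
 using ap_kron[of B "q * p * o'" i A "ix o' (ix p j k) l" F] assms by simp

lemma ap_kron_scalar_left:
 assumes "dcol A = 1" "j < dcol B"
 shows "ap (A <*> B) j F = ap A 0 (%r. ap B j (%s. F (ix (drow B) r s)))"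
 using ap_kron[of B "dcol B" 0 A j F] assms by simp

lemma ap_kron_scalar_right:
 assumes "dcol B = 1" "i < dcol A"
 shows "ap (A <*> B) i F = ap A i (%r. ap B 0 (%s. F (ix (drow B) r s)))"
 using ap_kron[of B 1 i A 0 F] assms by simp

lemma kron_assoc: "(A <*> B) <*> C = A <*> (B <*> C)" for A :: "'k::field mat"
proof (rule ap_eqI)
 fix c :: nat and F :: "nat \<Rightarrow> 'k" assume "c < dcol (A <*> (B <*> C))"
 then have "c < (dcol A * dcol B) * dcol C" by (simp add: mult.assoc)
 then obtain d k where c: "c = ix (dcol C) d k" and d: "d < dcol A * dcol B" and k: "k < dcol C"
 by (rule ix_decompose)
 from d obtain i j where "d = ix (dcol B) i j" "i < dcol A" "j < dcol B"
 by (rule ix_decompose)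
 with c k show "ap ((A <*> B) <*> C) c F = ap (A <*> (B <*> C)) c F"
 by (simp add: ap_kron ap_kron2)
qed (auto simp: mult_ac)

lemma kron_ap_eqI:
 assumes "drow C = drow D" "dcol C = p * q" "dcol D = p * q"
 and "!!i j F. i < p ==> j < q ==> ap C (ix q i j) F = ap D (ix q i j) F"
 shows "C = D"
proof (rule ap_eqI)
 fix c F assume "c < dcol D"
 then obtain i j where "i < p" "j < q" "c = ix q i j" using assms(3) by (metis ix_decompose)
 then show "ap C c F = ap D c F" using assms(4) by simp
qed (use assms in auto)

text \<open>Maps on different tensor legs do not interact; in this notation that is the exchange of
  two finite sums.\<close>

lemma ap_swap: "ap A i (%r. ap B j (%s. F r s)) = ap B j (%s. ap A i (%r. F r s))"
 unfolding ap_def sum_distrib_left by (subst sum.swap) (simp add: mult_ac)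

lemma kron_mult:
 fixes A B C D :: "'k::field mat"
 assumes "dcol A = drow C" "dcol B = drow D"
 shows "(A <*> B) * (C <*> D) = (A * C) <*> (B * D)"
proof (rule kron_ap_eqI)
 fix i j F assume ij: "i < dcol C" "j < dcol D"
 have "ap ((A <*> B) * (C <*> D)) (ix (dcol D) i j) F =
 ap C i (%r. ap D j (%s. ap A r (%x. ap B s (%y. F (ix (drow B) x y)))))"
 using ij assms by (simp add: ap_kron)
 also have "... = ap C i (%r. ap A r (%x. ap D j (%s. ap B s (%y. F (ix (drow B) x y)))))"
 by (intro ap_cong ap_swap)
 also have "... = ap ((A * C) <*> (B * D)) (ix (dcol D) i j) F"
 using ij assms by (simp add: ap_kron)
 finally show "ap ((A <*> B) * (C <*> D)) (ix (dcol D) i j) F =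
 ap ((A * C) <*> (B * D)) (ix (dcol D) i j) F" .
qed (use assms in auto)

lemma kron_one[simp]: "1\<^sub>m a <*> 1\<^sub>m b = (1\<^sub>m (a * b) :: 'k::field mat)"
 by (rule kron_ap_eqI[of _ _ a b]) (simp_all add: ap_kron)

lemma kron_one1[simp]: "1\<^sub>m (Suc 0) <*> A = A" "A <*> 1\<^sub>m (Suc 0) = A" for A :: "'k::field mat"
proof -
 show "1\<^sub>m (Suc 0) <*> A = A" by (rule ap_eqI) (simp_all add: ap_kron_scalar_left)
 show "A <*> 1\<^sub>m (Suc 0) = A" by (rule ap_eqI) (simp_all add: ap_kron_scalar_right)
qed

lemma ap_plus: "ap A c (%r. F r + G r) = ap A c F + ap A c G"
 unfolding ap_def by (simp add: distrib_left sum.distrib)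

lemma ap_scale: "ap A c (%r. x * F r) = x * ap A c F"
 unfolding ap_def by (simp add: sum_distrib_left mult_ac)

lemma kron_add_left:
 fixes A B C :: "'k::field mat"
 assumes "drow A = drow B" "dcol A = dcol B"
 shows "(A + B) <*> C = A <*> C + B <*> C"
proof (rule kron_ap_eqI)
 fix i j F assume "i < dcol B" "j < dcol C"
 then show "ap ((A + B) <*> C) (ix (dcol C) i j) F = ap (A <*> C + B <*> C) (ix (dcol C) i j) F"
 using assms by (simp add: ap_kron)
qed (use assms in simp_all)

lemma kron_add_right:
 fixes A B C :: "'k::field mat"
 assumes "drow A = drow B" "dcol A = dcol B"
 shows "C <*> (A + B) = C <*> A + C <*> B"
proof (rule kron_ap_eqI)
 fix i j F assume "i < dcol C" "j < dcol B"
 then show "ap (C <*> (A + B)) (ix (dcol B) i j) F = ap (C <*> A + C <*> B) (ix (dcol B) i j) F"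
 using assms by (simp add: ap_kron ap_plus)
qed (use assms in simp_all)

lemma kron_smult_left: "(a \<cdot>\<^sub>m A) <*> C = a \<cdot>\<^sub>m (A <*> C)"
proof (rule kron_ap_eqI)
 fix i j F assume "i < dcol A" "j < dcol C"
 then show "ap ((a \<cdot>\<^sub>m A) <*> C) (ix (dcol C) i j) F = ap (a \<cdot>\<^sub>m (A <*> C)) (ix (dcol C) i j) F"
 by (simp add: ap_kron)
qed simp_all

lemma kron_smult_right: "C <*> (a \<cdot>\<^sub>m A) = a \<cdot>\<^sub>m (C <*> A)"
proof (rule kron_ap_eqI)
 fix i j F assume "i < dcol C" "j < dcol A"
 then show "ap (C <*> (a \<cdot>\<^sub>m A)) (ix (dcol A) i j) F = ap (a \<cdot>\<^sub>m (C <*> A)) (ix (dcol A) i j) F"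
 by (simp add: ap_kron ap_scale[of _ _ a])
qed simp_all

lemma kron_transpose: "(A <*> B)\<^sup>T = A\<^sup>T <*> B\<^sup>T"
proof (rule kron_eqI)
 fix i j k l assume "i < dcol A" "j < dcol B" "k < drow A" "l < drow B"
 then show "(A <*> B)\<^sup>T $$ (ix (dcol B) i j, ix (drow B) k l) =
 (A\<^sup>T <*> B\<^sup>T) $$ (ix (dcol B) i j, ix (drow B) k l)"
 using kron_index[of i "A\<^sup>T" j "B\<^sup>T" k l] by (simp add: kron_index)
qed auto

section \<open>Graded spaces\<close>

lemma length_grtensor[simp]: "len (V <&> W) = len V * len W"
 by (simp add: grtensor_def)

lemma nth_grtensor[simp]:
 assumes "i < len V" "j < len W"
 shows "(V <&> W) ! ix (len W) i j = V ! i + W ! j"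
 using assms by (simp add: grtensor_def product_nth)

lemma length_grdual[simp]: "len (grdual V) = len V"
 by (simp add: grdual_def)

lemma nth_grdual[simp]: "i < len V ==> grdual V ! i = - (V ! i)"
 by (simp add: grdual_def)

lemma grtensor_unit[simp]: "V <&> [0] = V" "[0] <&> V = V"
proof -
 show "V <&> [0] = V"
 proof (rule nth_equalityI)
 fix i assume "i < len (V <&> [0])"
 then show "(V <&> [0]) ! i = V ! i" using nth_grtensor[of i V 0 "[0]"] by simp
 qed simp
 show "[0] <&> V = V"
 proof (rule nth_equalityI)
 fix i assume "i < len ([0] <&> V)"
 then show "([0] <&> V) ! i = V ! i" using nth_grtensor[of 0 "[0]" i V] by simp
 qed simp
qed

lemma grtensor_assoc: "(U <&> V) <&> W = U <&> (V <&> W)"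
proof (rule nth_equalityI)
 fix r assume "r < len ((U <&> V) <&> W)"
 then obtain d k where r: "r = ix (len W) d k" "d < len U * len V" "k < len W"
 by (auto elim: ix_decompose)
 then obtain i j where d: "d = ix (len V) i j" "i < len U" "j < len V"
 by (auto elim: ix_decompose)
 show "((U <&> V) <&> W) ! r = (U <&> (V <&> W)) ! r"
 using r d nth_grtensor[of i U "ix (len W) j k" "V <&> W"] by (simp add: add.assoc)
qed (simp add: mult.assoc)

lemma grhom_dims: "f \<in> grhom V W ==> drow f = len W" "f \<in> grhom V W ==> dcol f = len V"
 by (auto simp: grhom_def)

lemma grhom_degree:
 "f \<in> grhom V W ==> f $$ (i, j) ~= 0 ==> i < len W ==> j < len V ==> W ! i = V ! j"
 by (auto simp: grhom_def)

lemma grhomI: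
 "drow f = len W ==> dcol f = len V ==>
 (!!i j. i < len W ==> j < len V ==> f $$ (i, j) ~= 0 ==> W ! i = V ! j) ==> f \<in> grhom V W"
 by (auto simp: grhom_def)

lemma ap_grhom_cong:
 assumes "f \<in> grhom V W" "c < len V"
 and "!!r. r < len W ==> W ! r = V ! c ==> F r = G r"
 shows "ap f c F = ap f c G"
 by (rule ap_cong) (use assms grhom_degree[OF assms(1)] grhom_dims[OF assms(1)] in auto)

lemma grhom_one[simp]: "1\<^sub>m (len V) \<in> grhom V V"
 by (rule grhomI) (auto split: if_splits)

lemma grhom_mult:
 assumes "f \<in> grhom V W" "g \<in> grhom U V"
 shows "f * g \<in> grhom U W"
proof (rule grhomI)
 fix i j assume ij: "i < len W" "j < len U" and nz: "(f * g) $$ (i, j) ~= 0"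
 have "(f * g) $$ (i, j) = (\<Sum>l<len V. f $$ (i, l) * g $$ (l, j))"
 using ij grhom_dims[OF assms(1)] grhom_dims[OF assms(2)] by (simp add: scalar_prod_def lessThan_atLeast0)
 with nz obtain l where "l < len V" "f $$ (i, l) * g $$ (l, j) ~= 0"
 by (metis (mono_tags, lifting) lessThan_iff sum.not_neutral_contains_not_neutral)
 then show "W ! i = U ! j"
 using grhom_degree[OF assms(1), of i l] grhom_degree[OF assms(2), of l j] ij by simp
qed (use grhom_dims[OF assms(1)] grhom_dims[OF assms(2)] in auto)

lemma grhom_kron:
 assumes "f \<in> grhom V W" "g \<in> grhom V' W'"
 shows "f <*> g \<in> grhom (V <&> V') (W <&> W')"
proof (rule grhomI)
 note d = grhom_dims[OF assms(1)] grhom_dims[OF assms(2)]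
 fix r c assume "r < len (W <&> W')" "c < len (V <&> V')" and nz: "(f <*> g) $$ (r, c) ~= 0"
 then obtain i j k l where r: "r = ix (len W') i j" "i < len W" "j < len W'"
 and c: "c = ix (len V') k l" "k < len V" "l < len V'"
 by (metis ix_decompose length_grtensor)
 show "(W <&> W') ! r = (V <&> V') ! c"
 using nz r c d kron_index[of i f j g k l] grhom_degree[OF assms(1), of i k] grhom_degree[OF assms(2), of j l]
 by simp
qed (use grhom_dims[OF assms(1)] grhom_dims[OF assms(2)] in auto)

lemma grhom_add: "f \<in> grhom V W ==> g \<in> grhom V W ==> f + g \<in> grhom V W"
 unfolding grhom_def by (auto) (metis add.right_neutral)

lemma grhom_smult: "f \<in> grhom V W ==> a \<cdot>\<^sub>m f \<in> grhom V W"
 unfolding grhom_def by auto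

lemma grhom_zero: "0\<^sub>m (len W) (len V) \<in> grhom V W"
 unfolding grhom_def by auto

lemma grhom_transpose: "f \<in> grhom V W ==> f\<^sup>T \<in> grhom W V"
 unfolding grhom_def by auto

text \<open>The analogue of \<open>ap\<close> for a map into a tensor product with factors of
  dimensions p and q. The bound variables of F play the role of the two Sweedler components.\<close>

definition sc :: "nat \<Rightarrow> nat \<Rightarrow> 'k::field mat \<Rightarrow> nat \<Rightarrow> (nat \<Rightarrow> nat \<Rightarrow> 'k) \<Rightarrow> 'k" where
 "sc p q A c F = (\<Sum>a<p. \<Sum>b<q. A $$ (ix q a b, c) * F a b)"

lemma ap_sc: "drow A = p * q ==> ap A c F = sc p q A c (%a b. F (ix q a b))"
 by (simp add: ap_def sc_def sum_ix)

lemma sc_weak_cong[cong]: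
 assumes "p = p'" "q = q'" "A = B" "c = d" "!!a b. a < p' ==> b < q' ==> F a b = G a b"
 shows "sc p q A c F = sc p' q' B d G"
 using assms by (auto simp: sc_def intro!: sum.cong)

lemma sc_swap: "sc p q A c (%a b. ap B d (%r. F a b r)) = ap B d (%r. sc p q A c (%a b. F a b r))"
 unfolding sc_def ap_def sum_distrib_left
 by (subst sum.swap[where A = "{..<drow B}"])
 (rule sum.cong[OF refl], subst sum.swap[where A = "{..<drow B}"], simp add: mult_ac)

lemma sc_flat: "sc p q A c F = (\<Sum>k<p * q. A $$ (k, c) * F (k div q) (k mod q))"
 unfolding sc_def sum_ix by (intro sum.cong) auto

lemma sc_swap2: "sc p q A c (%a b. sc p' q' B d (%r s. F a b r s)) = sc p' q' B d (%r s. sc p q A c (%a b. F a b r s))"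
 unfolding sc_flat sum_distrib_left by (subst sum.swap) (simp add: mult_ac)

lemma sc_scale: "sc p q A c (%a b. x * F a b) = x * sc p q A c F"
 by (simp add: sc_def sum_distrib_left mult_ac)

lemma ap_zero[simp]: "ap A c (%r. 0) = 0" by (simp add: ap_def)
lemma sc_zero[simp]: "sc p q A c (%a b. 0) = 0" by (simp add: sc_def)

lemma sc_grhom_cong:
 assumes "f \<in> grhom U (V <&> W)" "c < len U"
 and "!!a b. a < len V ==> b < len W ==> U ! c = V ! a + W ! b ==> F a b = G a b"
 shows "sc (len V) (len W) f c F = sc (len V) (len W) f c G"
 unfolding sc_def
proof (intro sum.cong refl)
 fix a b assume ab: "a \<in> {..<len V}" "b \<in> {..<len W}"
 show "f $$ (ix (len W) a b, c) * F a b = f $$ (ix (len W) a b, c) * G a b"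
 using ab grhom_degree[OF assms(1), of "ix (len W) a b" c] assms(2,3) by (cases "f $$ (ix (len W) a b, c) = 0") auto
qed

lemma braid_dims[simp]: "drow (braid ch V W) = len W * len V" "dcol (braid ch V W) = len V * len W"
 by (simp_all add: braid_def)

lemma ap_braid[simp]:
 assumes "i < len V" "j < len W"
 shows "ap (braid ch V W) (ix (len W) i j) F = ch (V ! i) (W ! j) * F (ix (len V) j i)"
proof -
 have "ap (braid ch V W) (ix (len W) i j) F =
 (\<Sum>r<len W * len V. if r = ix (len V) j i then ch (V ! i) (W ! j) * F (ix (len V) j i) else 0)"
 unfolding ap_def braid_dims using assms by (intro sum.cong) (auto simp: braid_def Let_def, auto simp: ix_def)
 then show ?thesis using assms by simp
qed

lemma braid_inv_eq:
 assumes "!!x y. ch x y ~= 0"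
 shows "braid_inv ch V W = braid (%x y. inverse (ch y x)) V W"
 unfolding braid_inv_def
proof (rule minv_eqI)
 show "braid (%x y. inverse (ch y x)) V W * braid ch W V = 1\<^sub>m (dcol (braid ch W V))"
 by (rule kron_ap_eqI[where p = "len W" and q = "len V"]) (simp_all add: assms)
 show "braid ch W V * braid (%x y. inverse (ch y x)) V W = 1\<^sub>m (drow (braid ch W V))"
 by (rule kron_ap_eqI[where p = "len V" and q = "len W"]) (simp_all add: assms)
qed simp_all

lemma evm_dims[simp]: "drow (evm V) = 1" "dcol (evm V) = len V * len V"
 and coevm_dims[simp]: "drow (coevm V) = len V * len V" "dcol (coevm V) = 1"
 by (simp_all add: evm_def coevm_def)

lemma ap_evm[simp]: "i < len V ==> j < len V ==> ap (evm V) (ix (len V) i j) F = (if i = j then F 0 else 0)"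
 unfolding ap_def by (simp add: evm_def)

lemma ap_coevm[simp]: "ap (coevm V) 0 F = (\<Sum>i<len V. F (ix (len V) i i))"
proof -
 have "ap (coevm V) 0 F = (\<Sum>i<len V. \<Sum>j<len V. if i = j then F (ix (len V) i i) else 0)"
 unfolding ap_def coevm_dims sum_ix by (intro sum.cong) (auto simp: coevm_def)
 then show ?thesis by (simp add: sum.delta)
qed

lemma twist_dims[simp]: "drow (twist ch V) = len V" "dcol (twist ch V) = len V"
 by (simp_all add: twist_def)

lemma ap_mat_diag:
 "i < n ==> ap (mat n n (%(i, j). if i = j then d i else 0)) i F = d i * F i"
proof -
 assume "i < n"
 then have "ap (mat n n (%(i, j). if i = j then d i else 0)) i F = (\<Sum>r<n. if r = i then d i * F i else 0)"
 unfolding ap_def by (intro sum.cong) auto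
 then show ?thesis using \<open>i < n\<close> by simp
qed

lemma ap_twist[simp]: "i < len V ==> ap (twist ch V) i F = inverse (ch (V ! i) (V ! i)) * F i"
 unfolding twist_def by (rule ap_mat_diag)

lemma minv_one_kron_twist:
 assumes "!!x y. ch x y ~= 0"
 shows "minv (idm V <*> twist ch M) =
 idm V <*> mat (len M) (len M) (%(i, j). if i = j then ch (M ! i) (M ! i) else 0)" (is "_ = idm V <*> ?D")
proof (rule minv_eqI)
 show "(idm V <*> ?D) * (idm V <*> twist ch M) = 1\<^sub>m (dcol (idm V <*> twist ch M))"
 by (rule kron_ap_eqI[where p = "len V" and q = "len M"]) (simp_all add: ap_kron ap_mat_diag assms)
 show "(idm V <*> twist ch M) * (idm V <*> ?D) = 1\<^sub>m (drow (idm V <*> twist ch M))"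
 by (rule kron_ap_eqI[where p = "len V" and q = "len M"]) (simp_all add: ap_kron ap_mat_diag assms)
qed simp_all

lemma bicharacter_simps:
 assumes "bicharacter ch"
 shows "ch x y ~= 0" "ch (x + y) z = ch x z * ch y z" "ch x (y + z) = ch x y * ch x z"
 "ch 0 x = 1" "ch x 0 = 1" "ch (- x) y = inverse (ch x y)" "ch x (- y) = inverse (ch x y)"
 "ch (x - y) z = ch x z * inverse (ch y z)" "ch x (y - z) = ch x y * inverse (ch x z)"
proof -
 have nz: "ch x y ~= 0" and l: "ch (x + y) z = ch x z * ch y z" and r: "ch x (y + z) = ch x y * ch x z" for x y z
 using assms unfolding bicharacter_def by auto
 have zl: "ch 0 x = 1" for x using l[of 0 0 x] nz[of 0 x] by simp
 have zr: "ch x 0 = 1" for x using r[of x 0 0] nz[of x 0] by simp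
 have ml: "ch (- x) y = inverse (ch x y)" for x y
 using l[of x "- x" y] zl[of y] inverse_unique[of "ch x y" "ch (- x) y"] by (metis add.right_inverse)
 have mr: "ch x (- y) = inverse (ch x y)" for x y using r[of x y "-y"] zr[of x] inverse_unique[of "ch x y" "ch x (- y)"] by simp
 show "ch x y ~= 0" "ch (x + y) z = ch x z * ch y z" "ch x (y + z) = ch x y * ch x z"
 "ch 0 x = 1" "ch x 0 = 1" "ch (- x) y = inverse (ch x y)" "ch x (- y) = inverse (ch x y)"
 by (fact nz l r zl zr ml mr)+
 show "ch (x - y) z = ch x z * inverse (ch y z)" using l[of x "-y" z] ml by simp
 show "ch x (y - z) = ch x y * inverse (ch x z)" using r[of x y "-z"] mr by simp
qed

section \<open>Hopf algebras in coordinates\<close>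

locale braided_hopf =
 fixes ch :: "'g::ab_group_add \<Rightarrow> 'g \<Rightarrow> 'k::field" and H :: "('g, 'k) hopf"
 assumes bichar: "bicharacter ch" and hopf: "hopf_algebra ch H"
begin

abbreviation "A \<equiv> hobj H"
abbreviation "n \<equiv> len (hobj H)"
abbreviation "g a \<equiv> hobj H ! a"
abbreviation "un \<equiv> ap (hunit H) 0"
abbreviation "ep a \<equiv> hcounit H $$ (0, a)"
abbreviation "an \<equiv> ap (hantipode H)"
abbreviation "dl \<equiv> sc n n (hcomult H)"

definition ml :: "nat \<Rightarrow> nat \<Rightarrow> (nat \<Rightarrow> 'k) \<Rightarrow> 'k" where "ml a b = ap (hmult H) (ix n a b)"

lemmas chi = bicharacter_simps[OF bichar]

lemma hopf_grhom:
 "hmult H \<in> grhom (A <&> A) A" "hunit H \<in> grhom [0] A"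
 "hcomult H \<in> grhom A (A <&> A)" "hcounit H \<in> grhom A [0]" "hantipode H \<in> grhom A A"
 using hopf unfolding hopf_algebra_def Let_def by blast+

lemma hopf_dims[simp]:
 "drow (hmult H) = n" "dcol (hmult H) = n * n"
 "drow (hunit H) = n" "dcol (hunit H) = 1"
 "drow (hcomult H) = n * n" "dcol (hcomult H) = n"
 "drow (hcounit H) = 1" "dcol (hcounit H) = n"
 "drow (hantipode H) = n" "dcol (hantipode H) = n"
 using grhom_dims[OF hopf_grhom(1)] grhom_dims[OF hopf_grhom(2)] grhom_dims[OF hopf_grhom(3)]
 grhom_dims[OF hopf_grhom(4)] grhom_dims[OF hopf_grhom(5)] by auto

lemma ml_cong[cong]:
 assumes "a = a'" "b = b'" "!!r. r < n ==> F r = G r"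
 shows "ml a b F = ml a' b' G"
 using assms unfolding ml_def by (auto intro: ap_cong)

lemma ap_mult_H[simp]: "ap (hmult H) (ix n a b) F = ml a b F"
 by (simp add: ml_def)

lemma ap_comult[simp]: "ap (hcomult H) c F = dl c (%a b. F (ix n a b))"
 by (simp add: ap_sc)

lemma ap_counit[simp]: "ap (hcounit H) a F = ep a * F 0"
 by (simp add: ap_def)

lemmas ml_swap = ap_swap[of "hmult H" "ix n _ _", folded ml_def]

lemma ml_scale: "ml a b (%r. x * F r) = x * ml a b F"
 unfolding ml_def by (rule ap_scale)

lemma ml_zero[simp]: "ml a b (%r. 0) = 0"
 unfolding ml_def by simp

lemma ml_degree:
 assumes "a < n" "b < n" "!!r. r < n ==> g r = g a + g b ==> F r = G r"
 shows "ml a b F = ml a b G"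
 unfolding ml_def by (rule ap_grhom_cong[OF hopf_grhom(1)]) (use assms in auto)

lemma un_degree:
 assumes "!!r. r < n ==> g r = 0 ==> F r = G r"
 shows "un F = un G"
 by (rule ap_grhom_cong[OF hopf_grhom(2)]) (use assms in auto)

lemma an_degree:
 assumes "a < n" "!!r. r < n ==> g r = g a ==> F r = G r"
 shows "an a F = an a G"
 by (rule ap_grhom_cong[OF hopf_grhom(5)]) (use assms in auto)

lemma dl_degree:
 assumes "c < n" "!!a b. a < n ==> b < n ==> g c = g a + g b ==> F a b = G a b"
 shows "dl c F = dl c G"
 by (rule sc_grhom_cong[OF hopf_grhom(3)]) (use assms in auto)

lemma ep_degree: "a < n ==> ep a ~= 0 ==> g a = 0"
 using grhom_degree[OF hopf_grhom(4), of 0 a] by simp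

text \<open>The counit is supported in degree 0, where all braiding scalars are 1; this is how
  scalars next to a counit disappear.\<close>

lemma ep_cong: "a < n ==> (g a = 0 ==> x = y) ==> ep a * x = ep a * y"
 using ep_degree by fastforce

lemma hopf_eqs:
 "hmult H * (hmult H <*> idm A) = hmult H * (idm A <*> hmult H)"
 "hmult H * (hunit H <*> idm A) = idm A" "hmult H * (idm A <*> hunit H) = idm A"
 "(hcomult H <*> idm A) * hcomult H = (idm A <*> hcomult H) * hcomult H"
 "(hcounit H <*> idm A) * hcomult H = idm A" "(idm A <*> hcounit H) * hcomult H = idm A"
 "hcomult H * hmult H = (hmult H <*> hmult H) * (idm A <*> braid ch A A <*> idm A) * (hcomult H <*> hcomult H)"
 "hcomult H * hunit H = hunit H <*> hunit H" "hcounit H * hmult H = hcounit H <*> hcounit H"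
 "hcounit H * hunit H = 1\<^sub>m 1"
 "hmult H * (hantipode H <*> idm A) * hcomult H = hunit H * hcounit H"
 "hmult H * (idm A <*> hantipode H) * hcomult H = hunit H * hcounit H"
 "invertible_mat (hantipode H)"
 using hopf unfolding hopf_algebra_def Let_def by simp_all

lemma ml_assoc:
 assumes "a < n" "b < n" "c < n"
 shows "ml a b (%p. ml p c F) = ml b c (%p. ml a p F)"
proof -
 have "ap (hmult H * (hmult H <*> idm A)) (ix n (ix n a b) c) F = ap (hmult H * (idm A <*> hmult H)) (ix n (ix n a b) c) F"
 by (simp only: hopf_eqs)
 then show ?thesis using assms by (simp add: ap_kron ap_kron2 mult.assoc[symmetric])
qed

lemma un_ml: "b < n ==> un (%a. ml a b F) = F b"
 using arg_cong[OF hopf_eqs(2), of "%M. ap M b F"] by (simp add: ap_kron_scalar_left)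

lemma ml_un: "a < n ==> un (%b. ml a b F) = F a"
 using arg_cong[OF hopf_eqs(3), of "%M. ap M a F"] by (simp add: ap_kron_scalar_right)

lemma dl_coassoc: "c < n ==> dl c (%a b. dl a (%a1 a2. F a1 a2 b)) = dl c (%a b. dl b (%b1 b2. F a b1 b2))"
 \<comment> \<open>The functional decodes a flat index of the triple tensor product, so that F can
   have three separate arguments.\<close>
 using arg_cong[OF hopf_eqs(4), of "%M. ap M c (%r. F (r div n div n) (r div n mod n) (r mod n))"]
 by (simp add: ap_kron ap_kron2)

lemma ep_dl: "c < n ==> dl c (%a b. ep a * F b) = F c"
 using arg_cong[OF hopf_eqs(5), of "%M. ap M c F"] by (simp add: ap_kron ap_kron2)

lemma dl_ep: "c < n ==> dl c (%a b. ep b * F a) = F c"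
 using arg_cong[OF hopf_eqs(6), of "%M. ap M c F"] by (simp add: ap_kron ap_kron2)

lemma ml_dl:
 assumes "a < n" "b < n"
 shows "ml a b (%c. dl c F) = dl a (%a1 a2. dl b (%b1 b2. ch (g a2) (g b1) * ml a1 b1 (%p. ml a2 b2 (%q. F p q))))"
 using assms arg_cong[OF hopf_eqs(7), of "%M. ap M (ix n a b) (%r. F (r div n) (r mod n))"]
 by (simp add: ap_kron ap_kron2 mult.assoc[symmetric])

lemma un_dl: "un (%a. dl a F) = un (%a. un (%b. F a b))"
proof -
 have "un (%a. dl a F) = ap (hcomult H * hunit H) 0 (%r. F (r div n) (r mod n))"
 by simp
 also have "... = un (%r. un (%s. F (ix n r s div n) (ix n r s mod n)))"
 unfolding hopf_eqs by (simp add: ap_kron_scalar_left)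
 also have "... = un (%a. un (%b. F a b))"
 by (intro ap_cong) simp
 finally show ?thesis .
qed

lemma ml_ep: "a < n ==> b < n ==> ml a b ep = ep a * ep b"
 using arg_cong[OF hopf_eqs(9), of "%M. ap M (ix n a b) (%r. 1)"] by (simp add: ap_kron)

lemma un_ep: "un ep = 1"
 using arg_cong[OF hopf_eqs(10), of "%M. ap M 0 (%r. 1)"] by simp

lemma an_left: "c < n ==> dl c (%a b. an a (%s. ml s b F)) = ep c * un F"
 using arg_cong[OF hopf_eqs(11), of "%M. ap M c F"] by (simp add: ap_kron)

lemma an_right: "c < n ==> dl c (%a b. an b (%s. ml a s F)) = ep c * un F"
 using arg_cong[OF hopf_eqs(12), of "%M. ap M c F"] by (simp add: ap_kron)

end

text \<open>The antipode is anti-multiplicative since both sides are convolution inverses of the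
 multiplication.\<close>

lemma convolution_inverse_unique:
 fixes f g h m u E :: "'k::field mat" and e :: "nat \<Rightarrow> 'k"
 assumes coassoc: "!!c F. c < q ==> sc q q E c (%a b. sc q q E a (%a1 a2. F a1 a2 b)) = sc q q E c (%a b. sc q q E b (%b1 b2. F a b1 b2))"
 and counit: "!!c F. c < q ==> sc q q E c (%a b. e a * F b) = F c" "!!c F. c < q ==> sc q q E c (%a b. e b * F a) = F c"
 and assoc: "!!a b c F. a < p ==> b < p ==> c < p ==>
 ap m (ix p a b) (%r. ap m (ix p r c) F) = ap m (ix p b c) (%r. ap m (ix p a r) F)"
 and unit: "!!a F. a < p ==> ap u 0 (%r. ap m (ix p r a) F) = F a" "!!a F. a < p ==> ap u 0 (%r. ap m (ix p a r) F) = F a"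
 and dims: "drow f = p" "dcol f = q" "drow g = p" "dcol g = q" "drow h = p" "dcol h = q"
 and fg: "!!c F. c < q ==> sc q q E c (%a b. ap f a (%r. ap g b (%s. ap m (ix p r s) F))) = e c * ap u 0 F"
 and gh: "!!c F. c < q ==> sc q q E c (%a b. ap g a (%r. ap h b (%s. ap m (ix p r s) F))) = e c * ap u 0 F"
 shows "f = h"
proof (rule ap_eqI)
 fix c F assume "c < dcol h"
 then have c: "c < q" using dims by simp
 \<comment> \<open>The computation f = f * (g * h) = (f * g) * h = h in the convolution algebra,
   evaluated at c against F.\<close>
 have "ap f c F = sc q q E c (%a b. e b * ap f a F)"
 using counit(2)[OF c] by simp
 also have "... = sc q q E c (%a b. ap f a (%r. e b * ap u 0 (%s. ap m (ix p r s) F)))"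
 by (rule sc_weak_cong) (simp_all add: ap_scale dims unit)
 also have "... = sc q q E c (%a b. ap f a (%r. sc q q E b (%b1 b2. ap g b1 (%s. ap h b2 (%t. ap m (ix p s t) (%v. ap m (ix p r v) F))))))"
 by (simp add: gh)
 also have "... = sc q q E c (%a b. sc q q E b (%b1 b2. ap f a (%r. ap g b1 (%s. ap h b2 (%t. ap m (ix p s t) (%v. ap m (ix p r v) F))))))"
 by (simp only: sc_swap)
 also have "... = sc q q E c (%a b. sc q q E a (%a1 a2. ap f a1 (%r. ap g a2 (%s. ap h b (%t. ap m (ix p s t) (%v. ap m (ix p r v) F))))))"
 by (rule coassoc[OF c, symmetric])
 also have "... = sc q q E c (%a b. sc q q E a (%a1 a2. ap h b (%t. ap f a1 (%r. ap g a2 (%s. ap m (ix p r s) (%v. ap m (ix p v t) F))))))"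
 (is "_ = sc q q E c (%a b. ?R a b)")
 proof (intro sc_weak_cong refl)
 fix a b a1 a2 assume "a1 < q" "a2 < q" "b < q"
 have "ap f a1 (%r. ap g a2 (%s. ap h b (%t. ap m (ix p s t) (%v. ap m (ix p r v) F)))) =
 ap f a1 (%r. ap g a2 (%s. ap h b (%t. ap m (ix p r s) (%v. ap m (ix p v t) F))))"
 by (intro ap_cong) (simp add: dims assoc)
 also have "... = ap f a1 (%r. ap h b (%t. ap g a2 (%s. ap m (ix p r s) (%v. ap m (ix p v t) F))))"
 by (subst ap_swap[of g]) (rule refl)
 also have "... = ap h b (%t. ap f a1 (%r. ap g a2 (%s. ap m (ix p r s) (%v. ap m (ix p v t) F))))"
 by (rule ap_swap)
 finally show "ap f a1 (%r. ap g a2 (%s. ap h b (%t. ap m (ix p s t) (%v. ap m (ix p r v) F)))) =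
 ap h b (%t. ap f a1 (%r. ap g a2 (%s. ap m (ix p r s) (%v. ap m (ix p v t) F))))" .
 qed
 also have "... = sc q q E c (%a b. e a * ap h b F)"
 by (intro sc_weak_cong refl) (simp add: sc_swap fg ap_scale unit dims)
 also have "... = ap h c F" by (rule counit(1)[OF c])
 finally show "ap f c F = ap h c F" .
qed (simp_all add: dims)

context braided_hopf
begin

text \<open>The comultiplication of the tensor product coalgebra A \<otimes> A, with the braiding
  exchanging the two middle legs.\<close>

definition pair_comult :: "'k mat" where
 "pair_comult = (idm A <*> braid ch A A <*> idm A) * (hcomult H <*> hcomult H)"

lemma sc_pair_comult:
 assumes "a < n" "b < n"
 shows "sc (n * n) (n * n) pair_comult (ix n a b) F =
 dl a (%a1 a2. dl b (%b1 b2. ch (g a2) (g b1) * F (ix n a1 b1) (ix n a2 b2)))"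
proof -
 have "sc (n * n) (n * n) pair_comult (ix n a b) F =
 sc (n * n) (n * n) pair_comult (ix n a b) (%r s. F (ix (n * n) r s div (n * n)) (ix (n * n) r s mod (n * n)))"
 by (intro sc_weak_cong refl) (simp only: ix_div ix_mod)
 also have "... = ap pair_comult (ix n a b) (%r. F (r div (n * n)) (r mod (n * n)))"
 by (rule ap_sc[symmetric]) (simp add: pair_comult_def mult.assoc)
 also have "... = dl a (%a1 a2. dl b (%b1 b2. ch (g a2) (g b1) *
 F (ix n (ix n (ix n a1 b1) a2) b2 div (n * n)) (ix n (ix n (ix n a1 b1) a2) b2 mod (n * n))))"
 unfolding pair_comult_def using assms by (simp add: ap_kron ap_kron2 mult.assoc[symmetric])
 also have "... = dl a (%a1 a2. dl b (%b1 b2. ch (g a2) (g b1) * F (ix n a1 b1) (ix n a2 b2)))"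
 proof (intro sc_weak_cong refl)
 fix a1 a2 b1 b2 assume "a1 < n" "a2 < n" "b1 < n" "b2 < n"
 then have "ix n (ix n (ix n a1 b1) a2) b2 = ix (n * n) (ix n a1 b1) (ix n a2 b2)" "ix n a2 b2 < n * n"
 by simp_all
 then show "ch (g a2) (g b1) * F (ix n (ix n (ix n a1 b1) a2) b2 div (n * n)) (ix n (ix n (ix n a1 b1) a2) b2 mod (n * n)) =
 ch (g a2) (g b1) * F (ix n a1 b1) (ix n a2 b2)"
 by (simp only: ix_div ix_mod)
 qed
 finally show ?thesis .
qed

text \<open>Uniqueness of convolution inverses for the coalgebra A \<otimes> A and the algebra A.
  The left side is a left inverse of m since m is a coalgebra map; the right side is a right inverse
  by cancelling the inner pair of legs before the outer one.\<close>

lemma antipode_mult_matrix: "hantipode H * hmult H = hmult H * (hantipode H <*> hantipode H) * braid ch A A"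
proof (rule convolution_inverse_unique[where q = "n * n" and p = n and E = pair_comult and m = "hmult H" and
 u = "hunit H" and g = "hmult H" and e = "%c. ep (c div n) * ep (c mod n)"])
 fix c F assume "c < n * n"
 then obtain a b where ab: "a < n" "b < n" "c = ix n a b" by (rule ix_decompose)
 \<comment> \<open>Coassociativity of \<open>pair_comult\<close>. The scalars of the two iterated
   coproducts agree once the degree of a leg that is split again is written as the sum of the
   degrees of its own legs.\<close>
 have "dl a (%a' a3. dl b (%b' b3. ch (g a3) (g b') * dl a' (%a1 a2. dl b' (%b1 b2. ch (g a2) (g b1) * F (ix n a1 b1) (ix n a2 b2) (ix n a3 b3))))) =
 dl a (%a' a3. dl a' (%a1 a2. dl b (%b' b3. dl b' (%b1 b2. ch (g a3) (g b') * (ch (g a2) (g b1) * F (ix n a1 b1) (ix n a2 b2) (ix n a3 b3))))))"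
 by (simp only: sc_scale[symmetric] sc_swap2[of n n _ b])
 also have "... = dl a (%a1 a'. dl a' (%a2 a3. dl b (%b' b3. dl b' (%b1 b2. ch (g a3) (g b') * (ch (g a2) (g b1) * F (ix n a1 b1) (ix n a2 b2) (ix n a3 b3))))))"
 by (rule dl_coassoc[OF ab(1)])
 also have "... = dl a (%a1 a'. dl a' (%a2 a3. dl b (%b' b3. dl b' (%b1 b2. ch (g a3) (g b1 + g b2) * (ch (g a2) (g b1) * F (ix n a1 b1) (ix n a2 b2) (ix n a3 b3))))))"
 by (intro dl_degree ab) (simp_all)
 also have "... = dl a (%a1 a'. dl a' (%a2 a3. dl b (%b1 b'. dl b' (%b2 b3. ch (g a3) (g b1 + g b2) * (ch (g a2) (g b1) * F (ix n a1 b1) (ix n a2 b2) (ix n a3 b3))))))"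
 by (intro sc_weak_cong refl dl_coassoc ab)
 also have "... = dl a (%a1 a'. dl a' (%a2 a3. dl b (%b1 b'. dl b' (%b2 b3. ch (g a') (g b1) * (ch (g a3) (g b2) * F (ix n a1 b1) (ix n a2 b2) (ix n a3 b3))))))"
 by (intro dl_degree ab) (simp_all add: chi mult_ac)
 also have "... = dl a (%a1 a'. dl b (%b1 b'. ch (g a') (g b1) * dl a' (%a2 a3. dl b' (%b2 b3. ch (g a3) (g b2) * F (ix n a1 b1) (ix n a2 b2) (ix n a3 b3)))))"
 by (simp only: sc_scale[symmetric] sc_swap2[of n n _ b])
 finally show "sc (n * n) (n * n) pair_comult c (%a b. sc (n * n) (n * n) pair_comult a (%a1 a2. F a1 a2 b)) =
 sc (n * n) (n * n) pair_comult c (%a b. sc (n * n) (n * n) pair_comult b (%b1 b2. F a b1 b2))"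
 using ab by (simp add: sc_pair_comult)
next
 fix c and F :: "nat \<Rightarrow> 'k" assume "c < n * n"
 then obtain a b where ab: "a < n" "b < n" "c = ix n a b" by (rule ix_decompose)
 have "dl a (%a1 a2. dl b (%b1 b2. ch (g a2) (g b1) * (ep a1 * ep b1 * F (ix n a2 b2)))) =
 dl a (%a1 a2. ep a1 * dl b (%b1 b2. ep b1 * F (ix n a2 b2)))"
 unfolding sc_scale[symmetric] by (intro dl_degree ab) (use ep_degree in \<open>auto simp: chi mult_ac\<close>)
 then show "sc (n * n) (n * n) pair_comult c (%a b. ep (a div n) * ep (a mod n) * F b) = F c"
 using ab by (simp add: sc_pair_comult ep_dl)
 have "dl a (%a1 a2. dl b (%b1 b2. ch (g a2) (g b1) * (ep a2 * ep b2 * F (ix n a1 b1)))) =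
 dl a (%a1 a2. ep a2 * dl b (%b1 b2. ep b2 * F (ix n a1 b1)))"
 unfolding sc_scale[symmetric] by (intro dl_degree ab) (use ep_degree in \<open>auto simp: chi mult_ac\<close>)
 then show "sc (n * n) (n * n) pair_comult c (%a b. ep (b div n) * ep (b mod n) * F a) = F c"
 using ab by (simp add: sc_pair_comult dl_ep)
next
 fix c and F :: "nat \<Rightarrow> 'k" assume "c < n * n"
 then obtain a b where ab: "a < n" "b < n" "c = ix n a b" by (rule ix_decompose)
 have "dl a (%a1 a2. dl b (%b1 b2. ch (g a2) (g b1) * ml a1 b1 (%r. an r (%r. ml a2 b2 (%s. ml r s F))))) =
 dl a (%a1 a2. dl b (%b1 b2. ch (g a2) (g b1) * ml a1 b1 (%r. ml a2 b2 (%s. an r (%r. ml r s F)))))"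
 by (intro sc_weak_cong refl arg_cong2[where f = "(*)"] ml_cong) (unfold ml_def, rule ap_swap)
 also have "... = ml a b (%c. dl c (%r s. an r (%r. ml r s F)))"
 by (rule ml_dl[symmetric]) (fact ab)+
 also have "... = ml a b (%c. ep c * un F)" by (intro ml_cong refl an_left)
 also have "... = ep a * ep b * un F" using ml_scale[of a b "un F" ep] ab by (simp add: ml_ep mult.commute)
 finally show "sc (n * n) (n * n) pair_comult c (%a b. ap (hantipode H * hmult H) a (%r. ap (hmult H) b (%s. ap (hmult H) (ix n r s) F))) =
 ep (c div n) * ep (c mod n) * un F"
 using ab by (simp add: sc_pair_comult)
 \<comment> \<open>Right inverse: a1 b1 (S(b2) S(a2)) is regrouped as a1 (b1 S(b2)) S(a2), so that
   the legs of b cancel first and then those of a.\<close>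
 have "dl a (%a1 a2. dl b (%b1 b2. ch (g a2) (g b1) * ml a1 b1 (%r. ch (g a2) (g b2) * an b2 (%s. an a2 (%t. ml s t (%v. ml r v F)))))) =
 dl a (%a1 a2. dl b (%b1 b2. ch (g a2) (g b) * an a2 (%t. an b2 (%s. ml b1 s (%v. ml a1 v (%w. ml w t F))))))"
 proof (intro dl_degree ab)
 fix a1 a2 b1 b2 assume i: "a1 < n" "a2 < n" "b1 < n" "b2 < n" and d: "g b = g b1 + g b2"
 have "ml a1 b1 (%r. an b2 (%s. an a2 (%t. ml s t (%v. ml r v F)))) =
 an b2 (%s. ml a1 b1 (%r. an a2 (%t. ml s t (%v. ml r v F))))"
 unfolding ml_def by (rule ap_swap)
 also have "... = an b2 (%s. an a2 (%t. ml a1 b1 (%r. ml s t (%v. ml r v F))))"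
 unfolding ml_def by (rule ap_cong, rule ap_swap)
 also have "... = an a2 (%t. an b2 (%s. ml a1 b1 (%r. ml s t (%v. ml r v F))))"
 by (rule ap_swap)
 also have "... = an a2 (%t. an b2 (%s. ml b1 s (%v. ml a1 v (%w. ml w t F))))"
 using i by (intro ap_cong) (simp add: ml_assoc[symmetric])
 finally show "ch (g a2) (g b1) * ml a1 b1 (%r. ch (g a2) (g b2) * an b2 (%s. an a2 (%t. ml s t (%v. ml r v F)))) =
 ch (g a2) (g b) * an a2 (%t. an b2 (%s. ml b1 s (%v. ml a1 v (%w. ml w t F))))"
 by (simp add: ml_scale d chi)
 qed
 also have "... = dl a (%a1 a2. ch (g a2) (g b) * an a2 (%t. dl b (%b1 b2. an b2 (%s. ml b1 s (%v. ml a1 v (%w. ml w t F))))))"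
 by (intro sc_weak_cong refl) (subst sc_scale, subst sc_swap, rule refl)
 also have "... = dl a (%a1 a2. ch (g a2) (g b) * an a2 (%t. ep b * ml a1 t F))"
 by (intro sc_weak_cong refl arg_cong2[where f = "(*)"] ap_cong, subst an_right[OF ab(2)]) (simp add: ml_un)
 also have "... = ep b * dl a (%a1 a2. an a2 (%t. ml a1 t F))"
 unfolding sc_scale[symmetric] using ab ep_degree[of b] by (intro sc_weak_cong refl) (auto simp: ap_scale chi)
 also have "... = ep a * ep b * un F" using ab by (simp add: an_right)
 finally show "sc (n * n) (n * n) pair_comult c (%a b. ap (hmult H) a (%r. ap (hmult H * (hantipode H <*> hantipode H) * braid ch A A) b
 (%s. ap (hmult H) (ix n r s) F))) = ep (c div n) * ep (c mod n) * un F"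
 using ab by (simp add: sc_pair_comult ap_kron)
qed (simp_all add: ml_assoc un_ml ml_un)

lemma antipode_mult:
 assumes "a < n" "b < n"
 shows "ml a b (%c. an c F) = ch (g a) (g b) * an b (%s. an a (%t. ml s t F))"
 using arg_cong[OF antipode_mult_matrix, of "%M. ap M (ix n a b) F"] assms by (simp add: ap_kron)

end

lemma transpose_mult_dims: "dcol A = drow B ==> (A * B)\<^sup>T = B\<^sup>T * A\<^sup>T" for A B :: "'k::field mat"
 by (rule transpose_mult[of A "drow A" "dcol A" B "dcol B"]) (rule carrier_matI; simp)+

lemma braid_index:
 assumes "i < len V" "j < len W" "k < len V" "l < len W"
 shows "braid ch V W $$ (ix (len V) l k, ix (len W) i j) = (if i = k & j = l then ch (V ! i) (W ! j) else 0)"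
proof -
 have "braid ch V W $$ (ix (len V) l k, ix (len W) i j) =
 ap (braid ch V W) (ix (len W) i j) (%r. if r = ix (len V) l k then 1 else 0)"
 using assms by (intro ap_entry[symmetric]) simp
 then show ?thesis using assms by auto
qed

lemma braid_transpose: "(braid ch V W)\<^sup>T = braid (%x y. ch y x) W V"
 by (rule kron_eqI[where p = "len V" and q = "len W" and p' = "len W" and q' = "len V"])
 (auto simp: braid_index)

lemma transpose_one: "(1\<^sub>m m)\<^sup>T = (1\<^sub>m m :: 'k::field mat)"
 by (rule eq_matI) auto

section \<open>Anti-comultiplicativity of the antipode by duality, and the square of the
  antipode\<close>

context braided_hopf
begin

text \<open>Duality: transposition exchanges multiplication with comultiplication and replaces the
  braiding by the one of the opposite bicharacter, while the grading is kept. It turns each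
  multiplicative fact about the antipode into a comultiplicative one.\<close>

lemma transpose_braided_hopf:
 "braided_hopf (%x y. ch y x) \<lparr>hobj = A, hmult = (hcomult H)\<^sup>T, hunit = (hcounit H)\<^sup>T, hcomult = (hmult H)\<^sup>T,
 hcounit = (hunit H)\<^sup>T, hantipode = (hantipode H)\<^sup>T\<rparr>"
proof
 show "bicharacter (%x y. ch y x)" using bichar unfolding bicharacter_def by simp
 note t = arg_cong[where f = transpose_mat]
 note e = t[OF hopf_eqs(1)] t[OF hopf_eqs(2)] t[OF hopf_eqs(3)] t[OF hopf_eqs(4)] t[OF hopf_eqs(5)]
 t[OF hopf_eqs(6)] t[OF hopf_eqs(7)] t[OF hopf_eqs(8)] t[OF hopf_eqs(9)] t[OF hopf_eqs(10)]
 t[OF hopf_eqs(11)] t[OF hopf_eqs(12)]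
 note e' = e[simplified transpose_mult_dims kron_transpose transpose_one hopf_dims kron_dims index_one_mat
 braid_dims braid_transpose mult.assoc refl index_mult_mat simp_thms]
 have inv: "invertible_mat ((hantipode H)\<^sup>T)"
 proof -
 let ?S = "hantipode H"
 have "?S\<^sup>T * (minv ?S)\<^sup>T = (minv ?S * ?S)\<^sup>T" "(minv ?S)\<^sup>T * ?S\<^sup>T = (?S * minv ?S)\<^sup>T"
 using minv_inverse(1,2)[OF hopf_eqs(13)] by (simp_all only: transpose_mult_dims hopf_dims)
 then have "inverts_mat (?S\<^sup>T) ((minv ?S)\<^sup>T)" "inverts_mat ((minv ?S)\<^sup>T) (?S\<^sup>T)"
 using minv_inverse[OF hopf_eqs(13)] unfolding inverts_mat_def by (simp_all add: transpose_one)
 then show ?thesis unfolding invertible_mat_def square_mat.simps by (metis hopf_dims(9,10) index_transpose_mat(2,3))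
 qed
 show "hopf_algebra (%x y. ch y x) \<lparr>hobj = A, hmult = (hcomult H)\<^sup>T, hunit = (hcounit H)\<^sup>T, hcomult = (hmult H)\<^sup>T,
 hcounit = (hunit H)\<^sup>T, hantipode = (hantipode H)\<^sup>T\<rparr>"
 unfolding hopf_algebra_def Let_def hopf.simps
 using e' hopf_grhom[THEN grhom_transpose] inv by (simp add: mat_assoc mult.assoc)
qed

lemma antipode_comult_matrix: "hcomult H * hantipode H = braid ch A A * (hantipode H <*> hantipode H) * hcomult H"
 using arg_cong[OF braided_hopf.antipode_mult_matrix[OF transpose_braided_hopf], of transpose_mat]
 by (simp add: transpose_mult_dims kron_transpose braid_transpose mat_assoc)

lemma an_dl:
 assumes "a < n"
 shows "an a (%c. dl c F) = dl a (%a1 a2. ch (g a1) (g a2) * an a1 (%s. an a2 (%t. F t s)))"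
proof -
 have "an a (%c. dl c F) = dl a (%a1 a2. an a1 (%s. an a2 (%t. ch (g s) (g t) * F t s)))"
 using arg_cong[OF antipode_comult_matrix, of "%M. ap M a (%r. F (r div n) (r mod n))"] assms by (simp add: ap_kron)
 also have "... = dl a (%a1 a2. an a1 (%s. an a2 (%t. ch (g a1) (g a2) * F t s)))"
 by (intro sc_weak_cong refl an_degree) simp_all
 finally show ?thesis by (simp add: ap_scale)
qed

lemma un_an: "un (%a. an a F) = un F"
proof -
 have "un (%c. dl c (%a b. an a (%s. ml s b F))) = un (%c. ep c * un F)"
 by (intro ap_cong an_left) simp
 moreover have "un (%c. dl c (%a b. an a (%s. ml s b F))) = un (%a. an a F)"
 by (subst un_dl, subst ap_swap[of "hunit H" _ "hantipode H"]) (simp add: ml_un)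
 moreover have "un (%c. ep c * un F) = un F"
 using ap_scale[of "hunit H" 0 "un F" ep] by (simp add: un_ep mult.commute)
 ultimately show ?thesis by simp
qed

lemma an_ep: "a < n ==> an a ep = ep a"
proof -
 assume a: "a < n"
 have "dl a (%b c. ep c * an b ep) = dl a (%b c. an b (%s. ml s c ep))"
 by (intro sc_weak_cong refl) (simp add: ml_ep ap_scale mult.commute[of "ep _" "ep c" for c])
 then show ?thesis using an_left[OF a, of ep] dl_ep[OF a, of "%b. an b ep"] by (simp add: un_ep)
qed

text \<open>S^2 alone is multiplicative only up to the scalar \<chi>(a, b) \<chi>(b, a), and
  \<theta>^-1 alone only up to its inverse; the product of both is a Hopf algebra endomorphism.
  Restriction along it is the left double dual (\<open>ldual_ldual\<close>).\<close>

definition Q :: "'k mat" where "Q = hantipode H * hantipode H * twist ch A"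

lemma Q_dims[simp]: "drow Q = n" "dcol Q = n"
 by (simp_all add: Q_def)

lemma ap_Q: "a < n ==> ap Q a F = inverse (ch (g a) (g a)) * an a (%s. an s F)"
 by (simp add: Q_def)

lemma twist_grhom: "twist ch V \<in> grhom V V"
 by (rule grhomI) (auto simp: twist_def split: if_splits)

lemma Q_grhom: "Q \<in> grhom A A"
 unfolding Q_def by (rule grhom_mult[OF grhom_mult[OF hopf_grhom(5) hopf_grhom(5)] twist_grhom])

lemma Q_degree:
 assumes "a < n" "!!r. r < n ==> g r = g a ==> F r = G r"
 shows "ap Q a F = ap Q a G"
 by (rule ap_grhom_cong[OF Q_grhom]) (use assms in auto)

lemma Q_mult:
 assumes "a < n" "b < n"
 shows "ml a b (%c. ap Q c F) = ap Q a (%s. ap Q b (%t. ml s t F))"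
proof -
 have "ml a b (%c. ap Q c F) = ml a b (%c. inverse (ch (g a + g b) (g a + g b)) * an c (%s. an s F))"
 by (rule ml_degree) (use assms in \<open>simp_all add: ap_Q\<close>)
 also have "... = inverse (ch (g a + g b) (g a + g b)) * (ch (g a) (g b) * an b (%s. an a (%t. ml s t (%v. an v F))))"
 using assms by (simp add: ml_scale antipode_mult)
 also have "an b (%s. an a (%t. ml s t (%v. an v F))) =
 an b (%s. an a (%t. ch (g b) (g a) * an t (%v. an s (%w. ml v w F))))"
 by (intro an_degree assms) (simp_all add: antipode_mult)
 also have "... = ch (g b) (g a) * an a (%t. an b (%s. an t (%v. an s (%w. ml v w F))))"
 by (subst ap_swap) (simp add: ap_scale)
 also have "an a (%t. an b (%s. an t (%v. an s (%w. ml v w F)))) = an a (%t. an t (%v. an b (%s. an s (%w. ml v w F))))"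
 by (intro ap_cong ap_swap)
 \<comment> \<open>The expansion of \<theta>^-1 at a sum of two degrees contains exactly the
   inverses of the two braiding scalars produced by S^2.\<close>
 also have "inverse (ch (g a + g b) (g a + g b)) * (ch (g a) (g b) * (ch (g b) (g a) * X)) =
 inverse (ch (g a) (g a)) * (inverse (ch (g b) (g b)) * X)" for X
 by (simp add: chi field_simps)
 finally show ?thesis using assms by (simp add: ap_Q ap_scale)
qed

lemma Q_comult:
 assumes "a < n"
 shows "ap Q a (%c. dl c F) = dl a (%a1 a2. ap Q a1 (%s. ap Q a2 (%t. F s t)))"
proof -
 have "an a (%s. an s (%c. dl c F)) = an a (%s. dl s (%s1 s2. ch (g s1) (g s2) * an s1 (%v. an s2 (%w. F w v))))"
 by (intro ap_cong an_dl) simp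
 also have "... = dl a (%a1 a2. ch (g a1) (g a2) * an a1 (%s. an a2 (%t. ch (g t) (g s) * an t (%v. an s (%w. F w v)))))"
 by (rule an_dl[OF assms])
 also have "... = dl a (%a1 a2. ch (g a1) (g a2) * an a1 (%s. an a2 (%t. ch (g a2) (g a1) * an s (%w. an t (%v. F w v)))))"
 by (intro sc_weak_cong refl arg_cong2[where f = "(*)"] an_degree ap_swap) auto
 also have "... = dl a (%a1 a2. ch (g a1) (g a2) * ch (g a2) (g a1) * an a1 (%s. an s (%w. an a2 (%t. an t (%v. F w v)))))"
 proof (intro sc_weak_cong refl)
 fix a1 a2
 have "an a1 (%s. an a2 (%t. an s (%w. an t (%v. F w v)))) = an a1 (%s. an s (%w. an a2 (%t. an t (%v. F w v))))"
 by (intro ap_cong ap_swap)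
 then show "ch (g a1) (g a2) * an a1 (%s. an a2 (%t. ch (g a2) (g a1) * an s (%w. an t (%v. F w v)))) =
 ch (g a1) (g a2) * ch (g a2) (g a1) * an a1 (%s. an s (%w. an a2 (%t. an t (%v. F w v))))"
 by (simp add: ap_scale)
 qed
 finally have "ap Q a (%c. dl c F) = dl a (%a1 a2. inverse (ch (g a) (g a)) *
 (ch (g a1) (g a2) * ch (g a2) (g a1) * an a1 (%s. an s (%w. an a2 (%t. an t (%v. F w v))))))"
 using assms by (simp add: ap_Q sc_scale)
 also have "... = dl a (%a1 a2. inverse (ch (g a1) (g a1)) * (inverse (ch (g a2) (g a2)) * an a1 (%s. an s (%w. an a2 (%t. an t (%v. F w v))))))"
 by (rule dl_degree[OF assms]) (simp add: chi field_simps)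
 finally show ?thesis by (simp add: ap_Q ap_scale mult.left_commute)
qed

lemma un_Q: "un (%a. ap Q a F) = un F"
proof -
 have "un (%a. ap Q a F) = un (%a. an a (%s. an s F))"
 by (rule un_degree) (simp add: ap_Q chi)
 then show ?thesis by (simp add: un_an)
qed

lemma Q_ep: "a < n ==> ap Q a ep = ep a"
proof -
 assume a: "a < n"
 have "ap Q a ep = inverse (ch (g a) (g a)) * an a (%s. ep s)" using a by (simp add: ap_Q an_ep)
 also have "... = ep a * inverse (ch (g a) (g a))" using a by (simp add: an_ep)
 also have "... = ep a * 1" by (rule ep_cong[OF a]) (simp add: chi)
 finally show ?thesis by simp
qed

end

section \<open>Modules\<close>

text \<open>A map that commutes with the projections onto homogeneous components is graded, and this
  commutation passes from f to its inverse.\<close>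

lemma grhom_inverse:
 fixes f h :: "'k::field mat"
 assumes f: "f \<in> grhom V W" and d: "drow h = len V" "dcol h = len W"
 and fh: "f * h = 1\<^sub>m (len W)" and hf: "h * f = 1\<^sub>m (len V)"
 shows "h \<in> grhom W V"
proof (rule grhomI)
 fix i j assume i: "i < len V" and j: "j < len W" and nz: "h $$ (i, j) ~= 0"
 \<comment> \<open>The projection onto the homogeneous component of degree \<open>W ! j\<close>, the
   degree of the column under consideration.\<close>
 define D :: "'a list \<Rightarrow> 'k mat" where
 "D = (%U. mat (len U) (len U) (%(r, s). if r = s then (if U ! r = W ! j then 1 else 0) else 0))"
 have D: "drow (D U) = len U" "dcol (D U) = len U"
 "r < len U ==> ap (D U) r F = (if U ! r = W ! j then 1 else 0) * F r" for U r F
 by (simp_all add: D_def ap_mat_diag)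
 note df = grhom_dims[OF f]
 have "D W * f = f * D V"
 proof (rule ap_eqI)
 fix c F assume "c < dcol (f * D V)"
 then have c: "c < len V" by (simp add: D)
 have "ap f c (%r. (if W ! r = W ! j then 1 else 0) * F r) = ap f c (%r. (if V ! c = W ! j then 1 else 0) * F r)"
 by (rule ap_grhom_cong[OF f c]) simp
 then show "ap (D W * f) c F = ap (f * D V) c F"
 using c by (simp add: D df ap_scale)
 qed (simp_all add: D df)
 then have "h * (D W * f) * h = h * (f * D V) * h" by simp
 then have "(h * D W) * (f * h) = (h * f) * (D V * h)"
 using d df by (simp add: mat_assoc D)
 then have eq: "h * D W = D V * h" using d by (simp add: fh hf D)
 have "(h * D W) $$ (i, j) = h $$ (i, j)"
 using ap_entry[of i "h * D W" j] ap_entry[of i h j] i j d by (simp add: D)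
 moreover have "(D V * h) $$ (i, j) = (if V ! i = W ! j then 1 else 0) * h $$ (i, j)"
 proof -
 have "(D V * h) $$ (i, j) = ap h j (%r. (if V ! r = W ! j then 1 else 0) * (if r = i then 1 else 0))"
 using ap_entry[of i "D V * h" j] i j d by (simp add: D)
 also have "... = ap h j (%r. (if V ! i = W ! j then 1 else 0) * (if r = i then 1 else 0))"
 by (intro ap_cong) auto
 also have "... = (if V ! i = W ! j then 1 else 0) * h $$ (i, j)"
 using ap_entry[of i h j] i d by (simp only: ap_scale)
 finally show ?thesis .
 qed
 ultimately show "V ! i = W ! j" using eq nz by (auto split: if_splits)
qed (use d in auto)

context braided_hopf
begin

abbreviation "act_on V rh \<equiv> is_action A (hmult H) (hunit H) V rh"

lemma act_grhom: "act_on V rh ==> rh \<in> grhom (A <&> V) V"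
 by (simp add: is_action_def)

lemma act_dims: "act_on V rh ==> drow rh = len V" "act_on V rh ==> dcol rh = n * len V"
 using grhom_dims[OF act_grhom] by auto

lemma act_mult:
 assumes "act_on V rh" "a < n" "b < n" "i < len V"
 shows "ml a b (%c. ap rh (ix (len V) c i) F) = ap rh (ix (len V) b i) (%j. ap rh (ix (len V) a j) F)"
proof -
 have e: "rh * (hmult H <*> idm V) = rh * (idm A <*> rh)" using assms(1) by (simp add: is_action_def)
 show ?thesis
 using arg_cong[OF e, of "%M. ap M (ix (len V) (ix n a b) i) F"] assms(2-) act_dims[OF assms(1)]
 by (simp add: ap_kron ap_kron2 mult.assoc[symmetric])
qed

lemma act_unit:
 assumes "act_on V rh" "i < len V"
 shows "un (%a. ap rh (ix (len V) a i) F) = F i"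
proof -
 have e: "rh * (hunit H <*> idm V) = idm V" using assms(1) by (simp add: is_action_def)
 show ?thesis
 using arg_cong[OF e, of "%M. ap M i F"] assms(2) act_dims[OF assms(1)]
 by (simp add: ap_kron_scalar_left)
qed

lemma act_degree:
 assumes "act_on V rh" "a < n" "i < len V" "!!j. j < len V ==> V ! j = g a + V ! i ==> F j = G j"
 shows "ap rh (ix (len V) a i) F = ap rh (ix (len V) a i) G"
 by (rule ap_grhom_cong[OF act_grhom[OF assms(1)]]) (use assms in auto)

lemma act_onI:
 assumes gr: "rh \<in> grhom (A <&> V) V"
 and m: "!!a b i F. a < n ==> b < n ==> i < len V ==>
 ml a b (%c. ap rh (ix (len V) c i) F) = ap rh (ix (len V) b i) (%j. ap rh (ix (len V) a j) F)"
 and u: "!!i F. i < len V ==> un (%a. ap rh (ix (len V) a i) F) = F i"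
 shows "act_on V rh"
proof -
 have d: "drow rh = len V" "dcol rh = n * len V" using grhom_dims[OF gr] by simp_all
 have "rh * (hmult H <*> idm V) = rh * (idm A <*> rh)"
 proof (rule kron_ap_eqI[where p = "n * n" and q = "len V"])
 fix c i F assume "c < n * n" and i: "i < len V"
 then obtain a b where "a < n" "b < n" "c = ix n a b" by (elim ix_decompose)
 then show "ap (rh * (hmult H <*> idm V)) (ix (len V) c i) F = ap (rh * (idm A <*> rh)) (ix (len V) c i) F"
 using i by (simp add: d m ap_kron ap_kron2 mult.assoc[symmetric])
 qed (simp_all add: d)
 moreover have "rh * (hunit H <*> idm V) = idm V"
 by (rule ap_eqI) (simp_all add: d ap_kron_scalar_left u)
 ultimately show ?thesis using gr by (simp add: is_action_def)
qed

lemma act_trivial: "act_on V (hcounit H <*> idm V)"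
proof (rule act_onI)
 show "hcounit H <*> idm V \<in> grhom (A <&> V) V"
 using grhom_kron[OF hopf_grhom(4) grhom_one[of V]] by simp
 fix a b i F assume "a < n" "b < n" "i < len V"
 then show "ml a b (%c. ap (hcounit H <*> idm V) (ix (len V) c i) F) =
 ap (hcounit H <*> idm V) (ix (len V) b i) (%j. ap (hcounit H <*> idm V) (ix (len V) a j) F)"
 using ml_scale[of a b "F i" ep] by (simp add: ap_kron ml_ep mult_ac)
next
 fix i F assume "i < len V"
 then show "un (%a. ap (hcounit H <*> idm V) (ix (len V) a i) F) = F i"
 using ap_scale[of "hunit H" 0 "F i" ep] by (simp add: ap_kron un_ep mult.commute)
qed

lemma act_unit_object: "act_on [0] (hcounit H)"
 using act_trivial[of "[0]"] by simp

lemma act_regular: "act_on A (hmult H)"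
 by (rule act_onI) (simp_all add: hopf_grhom ml_assoc un_ml)

text \<open>Restriction of scalars along an algebra endomorphism of A; it is applied to
  \<open>P\<close> and \<open>Q\<close>.\<close>

lemma act_twist:
 assumes V: "act_on V rh" and f: "f \<in> grhom A A"
 and m: "f * hmult H = hmult H * (f <*> f)" and u: "f * hunit H = hunit H"
 shows "act_on V (rh * (f <*> idm V))"
proof (rule act_onI)
 note d = act_dims[OF V] grhom_dims[OF f]
 show "rh * (f <*> idm V) \<in> grhom (A <&> V) V"
 by (rule grhom_mult[OF act_grhom[OF V] grhom_kron[OF f grhom_one]])
 have f1: "ml a b (%c. ap f c G) = ap f a (%s. ap f b (%t. ml s t G))" if "a < n" "b < n" for a b G
 using arg_cong[OF m, of "%M. ap M (ix n a b) G"] that d by (simp add: ap_kron)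
 have f2: "un (%c. ap f c G) = un G" for G
 using arg_cong[OF u, of "%M. ap M 0 G"] d by simp
 fix i F assume i: "i < len V"
 show "un (%a. ap (rh * (f <*> idm V)) (ix (len V) a i) F) = F i"
 using i d by (simp add: ap_kron f2 act_unit[OF V])
 fix a b assume ab: "a < n" "b < n"
 have "ap f a (%s. ap f b (%t. ap rh (ix (len V) t i) (%j. ap rh (ix (len V) s j) F))) =
 ap f b (%t. ap rh (ix (len V) t i) (%j. ap f a (%s. ap rh (ix (len V) s j) F)))"
 by (subst ap_swap) (rule ap_cong, rule ap_swap)
 then show "ml a b (%c. ap (rh * (f <*> idm V)) (ix (len V) c i) F) =
 ap (rh * (f <*> idm V)) (ix (len V) b i) (%j. ap (rh * (f <*> idm V)) (ix (len V) a j) F)"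
 using i ab d by (simp add: ap_kron f1 act_mult[OF V])
qed

lemma tensor_dims:
 assumes "drow rh = len V" "dcol rh = n * len V" "drow sg = len W" "dcol sg = n * len W"
 shows "drow (tensor_action ch H V rh W sg) = len V * len W"
 "dcol (tensor_action ch H V rh W sg) = n * len V * len W"
 using assms by (simp_all add: tensor_action_def)

lemma ap_tensor_action:
 assumes "drow rh = len V" "dcol rh = n * len V" "drow sg = len W" "dcol sg = n * len W"
 and "h < n" "i < len V" "p < len W"
 shows "ap (tensor_action ch H V rh W sg) (ix (len W) (ix (len V) h i) p) F =
 dl h (%h1 h2. ch (g h2) (V ! i) * ap rh (ix (len V) h1 i) (%j. ap sg (ix (len W) h2 p) (%q. F (ix (len W) j q))))"
 unfolding tensor_action_def using assms by (simp add: ap_kron ap_kron2 mult.assoc[symmetric])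

lemma tensor_action_grhom:
 assumes "rh \<in> grhom (A <&> V) V" "sg \<in> grhom (A <&> W) W"
 shows "tensor_action ch H V rh W sg \<in> grhom (A <&> (V <&> W)) (V <&> W)"
proof -
 have b: "braid ch A V \<in> grhom (A <&> V) (V <&> A)"
 proof (rule grhomI)
 fix r c assume "r < len (V <&> A)" "c < len (A <&> V)" and nz: "braid ch A V $$ (r, c) ~= 0"
 then obtain i j k l where "r = ix n l k" "l < len V" "k < n" "c = ix (len V) i j" "i < n" "j < len V"
 by (metis ix_decompose length_grtensor)
 then show "(V <&> A) ! r = (A <&> V) ! c" using nz by (auto simp: braid_index add.commute split: if_splits)
 qed simp_all
 have "(rh <*> sg) * (idm A <*> braid ch A V <*> idm W) * (hcomult H <*> idm V <*> idm W) \<in>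
 grhom (A <&> V <&> W) (V <&> W)"
 proof (intro grhom_mult)
 show "rh <*> sg \<in> grhom ((A <&> V) <&> (A <&> W)) (V <&> W)" by (intro grhom_kron assms)
 show "idm A <*> braid ch A V <*> idm W \<in> grhom (A <&> (A <&> V) <&> W) ((A <&> V) <&> (A <&> W))"
 using grhom_kron[OF grhom_kron[OF grhom_one b] grhom_one, of A W] by (simp add: grtensor_assoc)
 show "hcomult H <*> idm V <*> idm W \<in> grhom (A <&> V <&> W) (A <&> (A <&> V) <&> W)"
 using grhom_kron[OF grhom_kron[OF hopf_grhom(3) grhom_one] grhom_one, of V W] by (simp add: grtensor_assoc)
 qed
 then show ?thesis by (simp add: tensor_action_def grtensor_assoc)
qed

text \<open>The unit acts trivially since \<Delta>(1) = 1 \<otimes> 1. For products, the braiding in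
  \<Delta>(a b) and the two braidings of the iterated action give the same scalar once the degree of
  the intermediate vector b1 v_i is expanded.\<close>

lemma act_tensor:
 assumes V: "act_on V rh" and W: "act_on W sg"
 shows "act_on (V <&> W) (tensor_action ch H V rh W sg)"
proof (rule act_onI)
 note d = act_dims[OF V] act_dims[OF W]
 let ?v = "len V" and ?w = "len W" and ?T = "tensor_action ch H V rh W sg"
 show "?T \<in> grhom (A <&> (V <&> W)) (V <&> W)"
 by (intro tensor_action_grhom act_grhom V W)
 fix r F assume "r < len (V <&> W)"
 then obtain i p where r: "r = ix ?w i p" and i: "i < ?v" and p: "p < ?w" by (auto elim: ix_decompose)
 have T: "ap ?T (ix (len (V <&> W)) h (ix ?w i p)) F = dl h (%h1 h2. ch (g h2) (V ! i) * ap rh (ix ?v h1 i) (%j. ap sg (ix ?w h2 p) (%q. F (ix ?w j q))))"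
 if "h < n" "i < ?v" "p < ?w" for h i p F
 using ap_tensor_action[of rh V sg W h i p F] d that by simp
 show "un (%a. ap ?T (ix (len (V <&> W)) a r) F) = F r"
 proof -
 have "un (%a. ap ?T (ix (len (V <&> W)) a r) F) =
 un (%h1. un (%h2. ch (g h2) (V ! i) * ap rh (ix ?v h1 i) (%j. ap sg (ix ?w h2 p) (%q. F (ix ?w j q)))))"
 unfolding r by (simp only: un_dl[symmetric]) (intro ap_cong T i p, simp)
 also have "... = un (%h1. un (%h2. ap rh (ix ?v h1 i) (%j. ap sg (ix ?w h2 p) (%q. F (ix ?w j q)))))"
 by (rule ap_cong, rule un_degree) (simp add: chi)
 also have "... = un (%h1. ap rh (ix ?v h1 i) (%j. un (%h2. ap sg (ix ?w h2 p) (%q. F (ix ?w j q)))))"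
 by (rule ap_cong, rule ap_swap)
 also have "... = F r" by (simp add: act_unit[OF W p] act_unit[OF V i] r)
 finally show ?thesis .
 qed
 fix a b assume a: "a < n" and b: "b < n"
 let ?R = "%h i. ap rh (ix ?v h i)" and ?S = "%h i. ap sg (ix ?w h i)"
 have "ml a b (%c. ap ?T (ix (len (V <&> W)) c r) F) =
 ml a b (%c. dl c (%h1 h2. ch (g h2) (V ! i) * ?R h1 i (%j. ?S h2 p (%q. F (ix ?w j q)))))"
 unfolding r by (intro ml_cong refl T i p)
 also have "... = dl a (%a1 a2. dl b (%b1 b2. ch (g a2) (g b1) * ml a1 b1 (%c1. ml a2 b2 (%c2. ch (g c2) (V ! i) * ?R c1 i (%j. ?S c2 p (%q. F (ix ?w j q)))))))"
 by (rule ml_dl[OF a b])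
 also have "... = dl a (%a1 a2. dl b (%b1 b2. ch (g b2) (V ! i) * ?R b1 i (%j. ch (g a2) (V ! j) * ?S b2 p (%q. ?R a1 j (%j'. ?S a2 q (%q'. F (ix ?w j' q')))))))"
 proof (intro sc_weak_cong refl)
 fix a1 a2 b1 b2 assume l: "a1 < n" "a2 < n" "b1 < n" "b2 < n"
 have "ml a1 b1 (%c1. ml a2 b2 (%c2. ch (g c2) (V ! i) * ?R c1 i (%j. ?S c2 p (%q. F (ix ?w j q))))) =
 ml a1 b1 (%c1. ml a2 b2 (%c2. ch (g a2) (V ! i) * ch (g b2) (V ! i) * ?R c1 i (%j. ?S c2 p (%q. F (ix ?w j q)))))"
 by (rule ml_cong[OF refl refl], rule ml_degree[OF l(2,4)]) (simp add: chi)
 also have "... = ch (g a2) (V ! i) * ch (g b2) (V ! i) * ml a1 b1 (%c1. ?R c1 i (%j. ml a2 b2 (%c2. ?S c2 p (%q. F (ix ?w j q)))))"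
 unfolding ml_scale by (intro arg_cong2[where f = "(*)"] refl ml_cong) (unfold ml_def, rule ap_swap)
 also have "... = ch (g a2) (V ! i) * ch (g b2) (V ! i) * ?R b1 i (%j. ?R a1 j (%j'. ?S b2 p (%q. ?S a2 q (%q'. F (ix ?w j' q')))))"
 using l i p by (simp add: act_mult[OF V] act_mult[OF W])
 also have "... = ch (g a2) (V ! i) * ch (g b2) (V ! i) * ?R b1 i (%j. ?S b2 p (%q. ?R a1 j (%j'. ?S a2 q (%q'. F (ix ?w j' q')))))"
 by (rule arg_cong2[where f = "(*)", OF refl], rule ap_cong, rule ap_swap)
 finally have 1: "ch (g a2) (g b1) * ml a1 b1 (%c1. ml a2 b2 (%c2. ch (g c2) (V ! i) * ?R c1 i (%j. ?S c2 p (%q. F (ix ?w j q))))) =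
 ch (g a2) (g b1) * (ch (g a2) (V ! i) * ch (g b2) (V ! i) * ?R b1 i (%j. ?S b2 p (%q. ?R a1 j (%j'. ?S a2 q (%q'. F (ix ?w j' q'))))))"
 by (simp only:)
 have "ch (g b2) (V ! i) * ?R b1 i (%j. ch (g a2) (V ! j) * ?S b2 p (%q. ?R a1 j (%j'. ?S a2 q (%q'. F (ix ?w j' q'))))) =
 ch (g b2) (V ! i) * ?R b1 i (%j. ch (g a2) (g b1 + V ! i) * ?S b2 p (%q. ?R a1 j (%j'. ?S a2 q (%q'. F (ix ?w j' q')))))"
 by (intro arg_cong2[where f = "(*)"] refl act_degree[OF V] l i) simp
 with 1 show "ch (g a2) (g b1) * ml a1 b1 (%c1. ml a2 b2 (%c2. ch (g c2) (V ! i) * ?R c1 i (%j. ?S c2 p (%q. F (ix ?w j q))))) =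
 ch (g b2) (V ! i) * ?R b1 i (%j. ch (g a2) (V ! j) * ?S b2 p (%q. ?R a1 j (%j'. ?S a2 q (%q'. F (ix ?w j' q')))))"
 by (simp add: ap_scale chi)
 qed
 also have "... = dl b (%b1 b2. dl a (%a1 a2. ch (g b2) (V ! i) * ?R b1 i (%j. ch (g a2) (V ! j) * ?S b2 p (%q. ?R a1 j (%j'. ?S a2 q (%q'. F (ix ?w j' q')))))))"
 by (rule sc_swap2)
 also have "... = dl b (%b1 b2. ch (g b2) (V ! i) * ?R b1 i (%j. ?S b2 p (%q. dl a (%a1 a2. ch (g a2) (V ! j) * ?R a1 j (%j'. ?S a2 q (%q'. F (ix ?w j' q')))))))"
 by (intro sc_weak_cong refl trans[OF sc_scale] arg_cong2[where f = "(*)"] trans[OF sc_swap] ap_cong)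
 (simp only: ap_scale[symmetric] sc_swap)
 also have "... = ap ?T (ix (len (V <&> W)) b r) (%j. ap ?T (ix (len (V <&> W)) a j) F)"
 unfolding r T[OF b i p]
 by (intro sc_weak_cong refl arg_cong2[where f = "(*)"] ap_cong) (rule T[OF a, symmetric]; simp add: d)
 finally show "ml a b (%c. ap ?T (ix (len (V <&> W)) c r) F) =
 ap ?T (ix (len (V <&> W)) b r) (%j. ap ?T (ix (len (V <&> W)) a j) F)" .
qed

lemma tensor_action_twist:
 assumes V: "drow rh = len V" "dcol rh = n * len V" "drow sg = len W" "dcol sg = n * len W"
 and f: "f \<in> grhom A A" and c: "hcomult H * f = (f <*> f) * hcomult H"
 shows "tensor_action ch H V (rh * (f <*> idm V)) W (sg * (f <*> idm W)) =
 tensor_action ch H V rh W sg * (f <*> idm (V <&> W))"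
proof (rule kron_ap_eqI[where p = "n * len V" and q = "len W"])
 note d = V grhom_dims[OF f]
 have f1: "ap f a (%c. dl c G) = dl a (%a1 a2. ap f a1 (%s. ap f a2 (%t. G s t)))" if "a < n" for a G
 using arg_cong[OF c, of "%M. ap M a (%r. G (r div n) (r mod n))"] that d by (simp add: ap_kron)
 fix hi p F assume "hi < n * len V" and p: "p < len W"
 then obtain h i where hi: "hi = ix (len V) h i" "h < n" "i < len V" by (elim ix_decompose)
 have "ap (tensor_action ch H V (rh * (f <*> idm V)) W (sg * (f <*> idm W))) (ix (len W) hi p) F =
 dl h (%h1 h2. ch (g h2) (V ! i) * ap f h1 (%a. ap rh (ix (len V) a i) (%j. ap f h2 (%b. ap sg (ix (len W) b p) (%q. F (ix (len W) j q))))))"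
 unfolding hi(1) using hi p d by (subst ap_tensor_action) (simp_all add: ap_kron)
 also have "... = dl h (%h1 h2. ap f h1 (%a. ap f h2 (%b. ch (g h2) (V ! i) * ap rh (ix (len V) a i) (%j. ap sg (ix (len W) b p) (%q. F (ix (len W) j q))))))"
 unfolding ap_scale by (intro sc_weak_cong refl arg_cong2[where f = "(*)"] ap_cong, rule ap_swap)
 also have "... = dl h (%h1 h2. ap f h1 (%a. ap f h2 (%b. ch (g b) (V ! i) * ap rh (ix (len V) a i) (%j. ap sg (ix (len W) b p) (%q. F (ix (len W) j q))))))"
 by (rule sc_weak_cong[OF refl refl refl refl], rule ap_cong, rule ap_grhom_cong[OF f]) simp_all
 also have "... = ap (tensor_action ch H V rh W sg * (f <*> idm (V <&> W))) (ix (len W) hi p) F"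
 unfolding hi(1) using hi p d
 by (simp add: ap_kron2 f1[symmetric] tensor_dims mult.assoc[symmetric] ap_tensor_action)
 finally show "ap (tensor_action ch H V (rh * (f <*> idm V)) W (sg * (f <*> idm W))) (ix (len W) hi p) F =
 ap (tensor_action ch H V rh W sg * (f <*> idm (V <&> W))) (ix (len W) hi p) F" .
qed (simp_all add: tensor_dims V grhom_dims[OF f] mult.assoc)

end

lemma grdual_grdual[simp]: "grdual (grdual V) = V"
 by (simp add: grdual_def comp_def)

lemma braid_grhom: "braid ch V W \<in> grhom (V <&> W) (W <&> V)"
proof (rule grhomI)
 fix r c assume "r < len (W <&> V)" "c < len (V <&> W)" and nz: "braid ch V W $$ (r, c) ~= 0"
 then obtain i j k l where "r = ix (len V) l k" "l < len W" "k < len V" "c = ix (len W) i j" "i < len V" "j < len W"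
 by (metis ix_decompose length_grtensor)
 then show "(W <&> V) ! r = (V <&> W) ! c" using nz by (auto simp: braid_index add.commute split: if_splits)
qed simp_all

section \<open>Double duals as restriction along Hopf automorphisms\<close>

context braided_hopf
begin

abbreviation "Si \<equiv> minv (hantipode H)"

lemma Si_dims[simp]: "drow Si = n" "dcol Si = n"
 and Si_inverse: "Si * hantipode H = idm A" "hantipode H * Si = idm A"
 using minv_inverse[OF hopf_eqs(13)] by simp_all

lemma Si_grhom: "Si \<in> grhom A A"
 by (rule grhom_inverse[OF hopf_grhom(5)]) (simp_all add: Si_inverse)

lemma an_Si: "a < n ==> an a (%s. ap Si s F) = F a" "a < n ==> ap Si a (%s. an s F) = F a"
 using arg_cong[OF Si_inverse(1), of "%M. ap M a F"] arg_cong[OF Si_inverse(2), of "%M. ap M a F"] by simp_all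

text \<open>The inverse of \<open>Q\<close>, as shown by \<open>PQ\<close> and \<open>QP\<close>;
  restriction along it is the right double dual.\<close>

definition P :: "'k mat" where
 "P = Si * Si * mat n n (%(i, j). if i = j then ch (g i) (g i) else 0)"

lemma P_dims[simp]: "drow P = n" "dcol P = n"
 by (simp_all add: P_def)

lemma ap_P: "a < n ==> ap P a F = ch (g a) (g a) * ap Si a (%s. ap Si s F)"
 by (simp add: P_def ap_mat_diag)

lemma Si_degree:
 assumes "a < n" "!!r. r < n ==> g r = g a ==> F r = G r"
 shows "ap Si a F = ap Si a G"
 by (rule ap_grhom_cong[OF Si_grhom]) (use assms in auto)

lemma PQ: "P * Q = idm A" and QP: "Q * P = idm A"
proof -
 show "Q * P = idm A"
 proof (rule ap_eqI)
 fix a and F :: "nat \<Rightarrow> 'k" assume "a < dcol (idm A :: 'k mat)"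
 then have a: "a < n" by simp
 have "ap Si a (%s. ap Si s (%r. ap Q r F)) =
 ap Si a (%s. ap Si s (%r. inverse (ch (g a) (g a)) * an r (%s. an s F)))"
 by (rule Si_degree[OF a], rule Si_degree) (simp_all add: ap_Q)
 then show "ap (Q * P) a F = ap (idm A) a F"
 using a by (simp add: ap_P ap_scale an_Si chi)
 qed simp_all
 show "P * Q = idm A"
 proof (rule ap_eqI)
 fix a and F :: "nat \<Rightarrow> 'k" assume "a < dcol (idm A :: 'k mat)"
 then have a: "a < n" by simp
 have "an a (%s. an s (%r. ap P r F)) =
 an a (%s. an s (%r. ch (g a) (g a) * ap Si r (%s. ap Si s F)))"
 by (rule an_degree[OF a], rule an_degree) (simp_all add: ap_P)
 then show "ap (P * Q) a F = ap (idm A) a F"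
 using a by (simp add: ap_Q ap_scale an_Si chi)
 qed simp_all
qed

lemma P_grhom: "P \<in> grhom A A"
 by (rule grhom_inverse[OF Q_grhom]) (simp_all add: PQ QP)

lemma Q_mult_matrix: "Q * hmult H = hmult H * (Q <*> Q)"
 by (rule kron_ap_eqI[where p = n and q = n]) (simp_all add: ap_kron Q_mult)

lemma Q_unit_matrix: "Q * hunit H = hunit H"
 by (rule ap_eqI) (simp_all add: un_Q)

lemma Q_comult_matrix: "hcomult H * Q = (Q <*> Q) * hcomult H"
 by (rule ap_eqI) (simp_all add: ap_kron Q_comult)

lemma P_mult_matrix: "P * hmult H = hmult H * (P <*> P)"
proof -
 have "P * hmult H = P * (hmult H * ((Q <*> Q) * (P <*> P)))"
 by (simp add: kron_mult QP)
 also have "... = P * ((Q * hmult H) * (P <*> P))" by (simp add: Q_mult_matrix mat_assoc)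
 also have "... = (P * Q) * (hmult H * (P <*> P))" by (simp add: mat_assoc)
 finally show ?thesis by (simp add: PQ)
qed

lemma P_unit_matrix: "P * hunit H = hunit H"
proof -
 have "P * hunit H = P * (Q * hunit H)" by (simp add: Q_unit_matrix)
 also have "... = hunit H" by (subst mat_assoc[symmetric]) (simp_all add: PQ)
 finally show ?thesis .
qed

lemma rdual_dims:
 assumes "drow rh = len V" "dcol rh = n * len V"
 shows "drow (rdual_action ch H V rh) = len V" "dcol (rdual_action ch H V rh) = n * len V"
 "drow (ldual_action ch H V rh) = len V" "dcol (ldual_action ch H V rh) = n * len V"
 using assms by (simp_all add: rdual_action_def ldual_action_def braid_inv_eq[OF chi(1)])

text \<open>Evaluation and coevaluation collapse the composite: what remains is a transposed action
  matrix with S^-1 inserted and one braiding scalar.\<close>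

lemma rdual_index:
 assumes d: "drow rh = len V" "dcol rh = n * len V" and a: "a < n" "i < len V" "j < len V"
 shows "rdual_action ch H V rh $$ (j, ix (len V) a i) =
 inverse (ch (g a) (V ! j)) * ap Si a (%b. rh $$ (i, ix (len V) b j))"
proof -
 let ?v = "len V"
 have "rdual_action ch H V rh $$ (j, ix ?v a i) = ap (rdual_action ch H V rh) (ix ?v a i) (%k. if k = j then 1 else 0)"
 using assms by (intro ap_entry[symmetric]) (simp add: rdual_dims)
 also have "... = (\<Sum>k<?v. inverse (ch (g a) (V ! k)) * ap Si a (%b. ap rh (ix ?v b k) (%r. if r = i then if k = j then 1 else 0 else 0)))"
 unfolding rdual_action_def using assms
 by (simp add: ap_kron ap_kron2 ap_kron_scalar_left ap_kron_scalar_right braid_inv_eq[OF chi(1)] mult.assoc[symmetric] cong: if_cong)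
 also have "... = (\<Sum>k<?v. if k = j then inverse (ch (g a) (V ! k)) * ap Si a (%b. rh $$ (i, ix ?v b k)) else 0)"
 using assms by (intro sum.cong refl) (simp add: ap_entry)
 finally show ?thesis using assms by simp
qed

lemma ldual_index:
 assumes d: "drow rh = len V" "dcol rh = n * len V" and a: "a < n" "i < len V" "j < len V"
 shows "ldual_action ch H V rh $$ (j, ix (len V) a i) =
 inverse (ch (g a) (V ! i)) * an a (%b. rh $$ (i, ix (len V) b j))"
proof -
 let ?v = "len V"
 have "ldual_action ch H V rh $$ (j, ix ?v a i) = ap (ldual_action ch H V rh) (ix ?v a i) (%k. if k = j then 1 else 0)"
 using assms by (intro ap_entry[symmetric]) (simp add: rdual_dims)
 also have "... = inverse (ch (g a) (V ! i)) * (\<Sum>k<?v. an a (%b. ap rh (ix ?v b k) (%r. if i = r then if k = j then 1 else 0 else 0)))"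
 unfolding ldual_action_def using assms ap_braid[of a A i "grdual V" ch]
 by (simp add: ap_kron ap_kron2 ap_kron_scalar_left ap_kron_scalar_right chi mult.assoc[symmetric] cong: if_cong)
 also have "(\<Sum>k<?v. an a (%b. ap rh (ix ?v b k) (%r. if i = r then if k = j then 1 else 0 else 0))) =
 (\<Sum>k<?v. if k = j then an a (%b. rh $$ (i, ix ?v b k)) else 0)"
 using assms by (intro sum.cong refl) (simp add: ap_entry eq_commute[of i])
 finally show ?thesis using assms by simp
qed

lemma twisted_index:
 assumes "drow rh = len V" "dcol rh = n * len V" "drow f = n" "dcol f = n"
 and "a < n" "i < len V" "j < len V"
 shows "(rh * (f <*> idm V)) $$ (j, ix (len V) a i) = ap f a (%b. rh $$ (j, ix (len V) b i))"
proof -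
 have "(rh * (f <*> idm V)) $$ (j, ix (len V) a i) =
 ap (rh * (f <*> idm V)) (ix (len V) a i) (%k. if k = j then 1 else 0)"
 using assms by (intro ap_entry[symmetric]) simp
 also have "... = ap f a (%b. ap rh (ix (len V) b i) (%k. if k = j then 1 else 0))"
 using assms by (simp add: ap_kron)
 also have "... = ap f a (%b. rh $$ (j, ix (len V) b i))"
 using assms by (simp add: ap_entry)
 finally show ?thesis .
qed

lemma act_index_degree:
 "act_on V rh ==> a < n ==> i < len V ==> j < len V ==> rh $$ (j, ix (len V) a i) ~= 0 ==> V ! j = g a + V ! i"
 using grhom_degree[OF act_grhom, of V rh j "ix (len V) a i"] by simp

text \<open>Two transpositions cancel and S^-1 is applied twice. A nonzero entry of the action has
  \<open>V ! i\<close> = a + \<open>V ! j\<close>, so the two braiding scalars combine to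
  \<theta>(a). For left duals the same computation gives S^2 and \<theta>(a)^-1.\<close>

lemma rdual_rdual:
 assumes V: "act_on V rh"
 shows "rdual_action ch H (grdual V) (rdual_action ch H V rh) = rh * (P <*> idm V)"
proof (rule kron_eqI[where p = 1 and q = "len V" and p' = n and q' = "len V"])
 note d = act_dims[OF V] and rd = rdual_dims[OF act_dims[OF V]]
 let ?v = "len V"
 fix z i a j assume z: "z < (1::nat)" and ij: "i < ?v" "a < n" "j < ?v"
 have "rdual_action ch H (grdual V) (rdual_action ch H V rh) $$ (i, ix ?v a j) =
 ch (g a) (V ! i) * ap Si a (%b. rdual_action ch H V rh $$ (j, ix ?v b i))"
 using rdual_index[of "rdual_action ch H V rh" "grdual V" a j i] ij rd by (simp add: chi)
 also have "... = ch (g a) (V ! i) * ap Si a (%b. inverse (ch (g b) (V ! j)) * ap Si b (%c. rh $$ (i, ix ?v c j)))"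
 using ij d by (simp add: rdual_index)
 also have "... = ch (g a) (V ! i) * ap Si a (%b. inverse (ch (g a) (V ! j)) * ap Si b (%c. rh $$ (i, ix ?v c j)))"
 by (intro arg_cong2[where f = "(*)"] refl Si_degree ij) simp
 also have "... = ap Si a (%b. ap Si b (%c. ch (g a) (V ! i) * inverse (ch (g a) (V ! j)) * rh $$ (i, ix ?v c j)))"
 by (simp add: ap_scale)
 also have "... = ap Si a (%b. ap Si b (%c. ch (g a) (g a) * rh $$ (i, ix ?v c j)))"
 proof (rule Si_degree[OF ij(2)], rule Si_degree)
 fix b c assume "g b = g a" "c < n" "g c = g b"
 then show "ch (g a) (V ! i) * inverse (ch (g a) (V ! j)) * rh $$ (i, ix ?v c j) = ch (g a) (g a) * rh $$ (i, ix ?v c j)"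
 using act_index_degree[OF V, of c j i] ij by (cases "rh $$ (i, ix ?v c j) = 0") (simp_all add: chi)
 qed assumption
 also have "... = (rh * (P <*> idm V)) $$ (i, ix ?v a j)"
 using ij d by (simp add: twisted_index ap_P ap_scale del: index_mult_mat(1))
 finally show "rdual_action ch H (grdual V) (rdual_action ch H V rh) $$ (ix ?v z i, ix ?v a j) =
 (rh * (P <*> idm V)) $$ (ix ?v z i, ix ?v a j)" using z by simp
qed (simp_all add: act_dims[OF V] rdual_dims)

lemma ldual_ldual:
 assumes V: "act_on V rh"
 shows "ldual_action ch H (grdual V) (ldual_action ch H V rh) = rh * (Q <*> idm V)"
proof (rule kron_eqI[where p = 1 and q = "len V" and p' = n and q' = "len V"])
 note d = act_dims[OF V] and rd = rdual_dims[OF act_dims[OF V]]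
 let ?v = "len V"
 fix z i a j assume z: "z < (1::nat)" and ij: "i < ?v" "a < n" "j < ?v"
 have "ldual_action ch H (grdual V) (ldual_action ch H V rh) $$ (i, ix ?v a j) =
 ch (g a) (V ! j) * an a (%b. ldual_action ch H V rh $$ (j, ix ?v b i))"
 using ldual_index[of "ldual_action ch H V rh" "grdual V" a j i] ij rd by (simp add: chi)
 also have "... = ch (g a) (V ! j) * an a (%b. inverse (ch (g b) (V ! i)) * an b (%c. rh $$ (i, ix ?v c j)))"
 using ij d by (simp add: ldual_index)
 also have "... = ch (g a) (V ! j) * an a (%b. inverse (ch (g a) (V ! i)) * an b (%c. rh $$ (i, ix ?v c j)))"
 by (intro arg_cong2[where f = "(*)"] refl an_degree ij) simp
 also have "... = an a (%b. an b (%c. ch (g a) (V ! j) * inverse (ch (g a) (V ! i)) * rh $$ (i, ix ?v c j)))"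
 by (simp add: ap_scale)
 also have "... = an a (%b. an b (%c. inverse (ch (g a) (g a)) * rh $$ (i, ix ?v c j)))"
 proof (rule an_degree[OF ij(2)], rule an_degree)
 fix b c assume "g b = g a" "c < n" "g c = g b"
 then show "ch (g a) (V ! j) * inverse (ch (g a) (V ! i)) * rh $$ (i, ix ?v c j) = inverse (ch (g a) (g a)) * rh $$ (i, ix ?v c j)"
 using act_index_degree[OF V, of c j i] ij by (cases "rh $$ (i, ix ?v c j) = 0") (simp_all add: chi)
 qed assumption
 also have "... = (rh * (Q <*> idm V)) $$ (i, ix ?v a j)"
 using ij d by (simp add: twisted_index ap_Q ap_scale del: index_mult_mat(1))
 finally show "ldual_action ch H (grdual V) (ldual_action ch H V rh) $$ (ix ?v z i, ix ?v a j) =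
 (rh * (Q <*> idm V)) $$ (ix ?v z i, ix ?v a j)" using z by simp
qed (simp_all add: act_dims[OF V] rdual_dims)

abbreviation "C \<equiv> H_mod ch H"

lemma H_mod_simps[simp]:
 "(V, rh) \<in> Obj C \<longleftrightarrow> act_on V rh"
 "Hom C (V, rh) (W, sg) = {f \<in> grhom V W. f * rh = sg * (idm A <*> f)}"
 "Idn C (V, rh) = idm V" "Cmp C = (*)" "Add C = (+)" "Scl C = (\<cdot>\<^sub>m)"
 "tenO C (V, rh) (W, sg) = (V <&> W, tensor_action ch H V rh W sg)" "tenM C = (<*>)"
 "unitO C = ([0], hcounit H)" "ldual C (V, rh) = (grdual V, ldual_action ch H V rh)"
 "rdual C (V, rh) = (grdual V, rdual_action ch H V rh)" "ev_l C (V, rh) = evm V" "coev_l C (V, rh) = coevm V"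
 "ev_r C (V, rh) = evm V" "coev_r C (V, rh) = coevm V"
 by (simp_all add: H_mod_def)

text \<open>Restriction of scalars along f. With f = \<open>P\<close> and f = \<open>Q\<close> these
  are the two double duals: mutually inverse, strictly compatible with tensor products and without
  effect on underlying spaces.\<close>

definition tw :: "'k mat \<Rightarrow> 'g list \<times> 'k mat \<Rightarrow> 'g list \<times> 'k mat" where
 "tw f = (%(V, rh). (V, rh * (f <*> idm V)))"

lemma sharp_eq: "X \<in> Obj C ==> rsharp C X = tw P X" "X \<in> Obj C ==> lsharp C X = tw Q X"
 by (cases X; simp add: rsharp_def lsharp_def tw_def rdual_rdual ldual_ldual)+

lemma tw_Obj: "X \<in> Obj C ==> tw P X \<in> Obj C" "X \<in> Obj C ==> tw Q X \<in> Obj C"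
 by (cases X; simp add: tw_def act_twist P_grhom Q_grhom P_mult_matrix Q_mult_matrix P_unit_matrix Q_unit_matrix)+

lemma tw_tw: "X \<in> Obj C ==> tw P (tw Q X) = X" "X \<in> Obj C ==> tw Q (tw P X) = X"
 by (cases X; simp add: tw_def act_dims mat_assoc kron_mult PQ QP)+

lemma tw_tensor:
 assumes "X \<in> Obj C" "Y \<in> Obj C"
 shows "tw Q (tenO C X Y) = tenO C (tw Q X) (tw Q Y)" "tw P (tenO C X Y) = tenO C (tw P X) (tw P Y)"
proof -
 have Q: "tw Q (tenO C X Y) = tenO C (tw Q X) (tw Q Y)" if "X \<in> Obj C" "Y \<in> Obj C" for X Y
 using that by (cases X; cases Y) (simp add: tw_def tensor_action_twist act_dims Q_grhom Q_comult_matrix)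
 show "tw Q (tenO C X Y) = tenO C (tw Q X) (tw Q Y)" by (rule Q[OF assms])
 have t: "tenO C U W \<in> Obj C" if "U \<in> Obj C" "W \<in> Obj C" for U W
 using that by (cases U; cases W) (simp add: act_tensor)
 \<comment> \<open>Compatibility for \<open>P\<close> is transported from \<open>Q\<close>, of which
   it is the inverse.\<close>
 have "tw P (tenO C X Y) = tw P (tenO C (tw Q (tw P X)) (tw Q (tw P Y)))"
 by (simp add: tw_tw assms)
 also have "... = tw P (tw Q (tenO C (tw P X) (tw P Y)))"
 by (simp add: Q tw_Obj assms)
 also have "... = tenO C (tw P X) (tw P Y)"
 by (simp add: tw_tw t tw_Obj assms)
 finally show "tw P (tenO C X Y) = tenO C (tw P X) (tw P Y)" .
qed

text \<open>The zig-zag of coevaluation and evaluation moves the input index of f to the output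
  side. Consequently double dualisation is the identity on arrows
  (\<open>rsharp_arrow_eq\<close>).\<close>

lemma rdual_arrow_eq:
 assumes "f \<in> grhom V W"
 shows "(idm V <*> evm W) * (idm V <*> f <*> idm W) * (coevm V <*> idm W) = f\<^sup>T"
proof (rule eq_matI)
 note d = grhom_dims[OF assms]
 fix i j assume "i < drow f\<^sup>T" "j < dcol f\<^sup>T"
 then have ij: "i < len V" "j < len W" using d by simp_all
 have "((idm V <*> evm W) * (idm V <*> f <*> idm W) * (coevm V <*> idm W)) $$ (i, j) =
 ap ((idm V <*> evm W) * (idm V <*> f <*> idm W) * (coevm V <*> idm W)) j (%k. if k = i then 1 else 0)"
 using ij by (intro ap_entry[symmetric]) simp
 also have "... = (\<Sum>k<len V. ap f k (%r. if r = j then if k = i then 1 else 0 else 0))"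
 using ij d by (simp add: ap_kron ap_kron2 ap_kron_scalar_left ap_kron_scalar_right mult.assoc[symmetric] cong: if_cong)
 also have "... = (\<Sum>k<len V. if k = i then f $$ (j, k) else 0)"
 using ij d by (intro sum.cong refl) (simp add: ap_entry)
 finally show "((idm V <*> evm W) * (idm V <*> f <*> idm W) * (coevm V <*> idm W)) $$ (i, j) = f\<^sup>T $$ (i, j)"
 using ij d by simp
qed (use grhom_dims[OF assms] in simp_all)

lemma rsharp_arrow_eq:
 assumes "f \<in> Hom C X Y"
 shows "rsharp_arrow C X Y f = f"
proof -
 obtain V rh W sg where XY: "X = (V, rh)" "Y = (W, sg)" by (cases X; cases Y)
 have f: "f \<in> grhom V W" using assms XY by simp
 then have "f\<^sup>T \<in> grhom (grdual W) (grdual V)" by (auto simp: grhom_def)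
 from rdual_arrow_eq[OF f] rdual_arrow_eq[OF this] show ?thesis
 unfolding rsharp_arrow_def rdual_arrow_def XY by simp
qed

end

section \<open>Half-braidings and coactions\<close>

context braided_hopf
begin

lemma Hom_inverse:
 assumes f: "f \<in> Hom C (V, rh) (W, sg)" and rh: "drow rh = len V" "dcol rh = n * len V"
 and sg: "drow sg = len W" "dcol sg = n * len W"
 and d: "drow h = len V" "dcol h = len W" and i: "h * f = idm V" "f * h = idm W"
 shows "h \<in> Hom C (W, sg) (V, rh)"
proof -
 have fg: "f \<in> grhom V W" and fl: "f * rh = sg * (idm A <*> f)" using f by simp_all
 note df = grhom_dims[OF fg]
 have "h * sg = h * (sg * ((idm A <*> f) * (idm A <*> h)))"
 using d df sg by (simp add: kron_mult i)
 also have "... = h * ((f * rh) * (idm A <*> h))"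
 using d df sg by (simp add: mat_assoc fl)
 also have "... = (h * f) * (rh * (idm A <*> h))"
 using d df rh by (simp add: mat_assoc)
 finally have "h * sg = rh * (idm A <*> h)" using rh by (simp add: i)
 then show ?thesis using grhom_inverse[OF fg d i(2,1)] by simp
qed

definition om :: "'g \<Rightarrow> 'g \<Rightarrow> 'k" where "om x y = ch x y * ch y x"

lemma om_simps: "om x y ~= 0" "om x (y + z) = om x y * om x z" "om x 0 = 1" "om (x + x') y = om x y * om x' y"
 "om (- x) y = inverse (om x y)" "om x (- y) = inverse (om x y)" "om 0 y = 1"
 by (simp_all add: om_def chi)

text \<open>The inverse of the braiding V \<otimes> W -> W \<otimes> V, divided by
  \<open>om x\<close> of the degree in W: the inverse half-braiding of type x with a module W on
  which H acts trivially.\<close>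

definition ubr :: "'g \<Rightarrow> 'g list \<Rightarrow> 'g list \<Rightarrow> 'k mat" where
 "ubr x W V = braid (%y m. inverse (om x y * ch m y)) W V"

lemma ubr_dims[simp]: "drow (ubr x W V) = len V * len W" "dcol (ubr x W V) = len W * len V"
 by (simp_all add: ubr_def)

lemma ap_ubr: "p < len W ==> i < len V ==>
 ap (ubr x W V) (ix (len V) p i) F = inverse (om x (W ! p) * ch (V ! i) (W ! p)) * F (ix (len W) i p)"
 by (simp add: ubr_def)

text \<open>The inverse half-braiding \<open>X \<otimes> M \<rightarrow> M \<otimes> X\<^sup>#\<close> determined by a right coaction \<open>%\<close> of \<open>H\<close> on \<open>M\<close>,
 for an object \<open>M\<close> whose half-braiding with trivial modules is the braiding scaled by \<open>om x\<close>.\<close>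

definition swm :: "'g \<Rightarrow> 'g list \<Rightarrow> 'k mat \<Rightarrow> 'g list \<times> 'k mat \<Rightarrow> 'k mat" where
 "swm x V l = (%(W, sg). (idm V <*> sg) * (l <*> idm W) * ubr x W V)"

text \<open>With \<open>yd_right\<close>, the two sides of H-linearity of \<open>swm\<close> after
  everything depending on the module W has been removed: here H acts before the coaction is taken,
  in \<open>yd_right\<close> afterwards. F is a functional on V \<otimes> A.\<close>

definition yd_left :: "'g \<Rightarrow> 'g list \<Rightarrow> 'k mat \<Rightarrow> 'k mat \<Rightarrow> nat \<Rightarrow> nat \<Rightarrow> (nat \<Rightarrow> nat \<Rightarrow> 'k) \<Rightarrow> 'k" where
 "yd_left x V rh l h i F = dl h (%h1 h2. ap rh (ix (len V) h2 i) (%i'. sc (len V) n l i' (%j a.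
 inverse (om x (g h1)) * inverse (ch (V ! i') (g h1)) * ml a h1 (%r. F j r))))"

definition yd_right :: "'g list \<Rightarrow> 'k mat \<Rightarrow> 'k mat \<Rightarrow> nat \<Rightarrow> nat \<Rightarrow> (nat \<Rightarrow> nat \<Rightarrow> 'k) \<Rightarrow> 'k" where
 "yd_right V rh l h i F = dl h (%h1 h2. sc (len V) n l i (%j a.
 ch (g h2) (V ! j) * ap Q h2 (%s. ml s a (%r. ap rh (ix (len V) h1 j) (%j'. F j' r)))))"

text \<open>The axioms of a right H-comodule, tested on all functionals.\<close>

definition coaction :: "'g list \<Rightarrow> 'k mat \<Rightarrow> bool" where
 "coaction V l \<longleftrightarrow> l \<in> grhom V (V <&> A) &
 (\<forall>i<len V. \<forall>F. sc (len V) n l i (%j c. sc (len V) n l j (%k b. F k b c)) =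
 sc (len V) n l i (%k a. dl a (%b c. F k b c))) &
 (\<forall>i<len V. \<forall>F. sc (len V) n l i (%j a. ep a * F j) = F i)"

text \<open>The type x enters only through the scalar \<open>om x\<close> in \<open>yd_left\<close>.
  That this compatibility amounts to linearity of \<open>swm\<close> is the content of
  \<open>swm_Hom\<close> and \<open>yd_of_regular\<close>.\<close>

definition yd :: "'g \<Rightarrow> 'g list \<Rightarrow> 'k mat \<Rightarrow> 'k mat \<Rightarrow> bool" where
 "yd x V rh l \<longleftrightarrow> act_on V rh & coaction V l &
 (\<forall>h<n. \<forall>i<len V. \<forall>F. yd_left x V rh l h i F = yd_right V rh l h i F)"

lemma coaction_dims: "coaction V l ==> drow l = len V * n" "coaction V l ==> dcol l = len V"
 unfolding coaction_def using grhom_dims[of l V "V <&> A"] by auto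

lemma coaction_degree:
 assumes "coaction V l" "i < len V" "!!j a. j < len V ==> a < n ==> V ! i = V ! j + g a ==> F j a = G j a"
 shows "sc (len V) n l i F = sc (len V) n l i G"
 using sc_grhom_cong[of l V V A i F G] assms unfolding coaction_def by blast

lemma swm_dims:
 assumes "coaction V l" "act_on W sg"
 shows "drow (swm x V l (W, sg)) = len V * len W" "dcol (swm x V l (W, sg)) = len W * len V"
 using act_dims[OF assms(2)] by (simp_all add: swm_def)

lemma ap_swm:
 assumes l: "drow l = len V * n" "dcol l = len V" and W: "drow sg = len W" "dcol sg = n * len W"
 and "p < len W" "i < len V"
 shows "ap (swm x V l (W, sg)) (ix (len V) p i) F =
 inverse (om x (W ! p) * ch (V ! i) (W ! p)) * sc (len V) n l i (%j a. ap sg (ix (len W) a p) (%q. F (ix (len W) j q)))"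
proof -
 have "ap (swm x V l (W, sg)) (ix (len V) p i) F =
 inverse (om x (W ! p) * ch (V ! i) (W ! p)) * ap l i (%r. ap (idm V <*> sg) (ix (len W) r p) F)"
 unfolding swm_def using assms by (simp add: ap_ubr ap_kron mult.assoc)
 also have "ap l i (%r. ap (idm V <*> sg) (ix (len W) r p) F) =
 sc (len V) n l i (%j a. ap sg (ix (len W) a p) (%q. F (ix (len W) j q)))"
 using assms by (simp add: ap_sc[of l "len V" n] ap_kron2)
 finally show ?thesis .
qed

lemma ubr_grhom: "ubr x W V \<in> grhom (W <&> V) (V <&> W)"
 unfolding ubr_def by (rule braid_grhom)

lemma swm_grhom:
 assumes "coaction V l" "act_on W sg"
 shows "swm x V l (W, sg) \<in> grhom (W <&> V) (V <&> W)"
proof -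
 have "(idm V <*> sg) * (l <*> idm W) * ubr x W V \<in> grhom (W <&> V) (V <&> W)"
 using assms grhom_kron[OF grhom_one act_grhom[OF assms(2)], of V] grhom_kron[OF _ grhom_one, of l V "V <&> A" W]
 by (intro grhom_mult[where V = "V <&> W"] grhom_mult[where V = "V <&> A <&> W"] ubr_grhom)
 (auto simp: coaction_def grtensor_assoc)
 then show ?thesis by (simp add: swm_def)
qed

lemma ubr_natural:
 assumes f: "f \<in> grhom W U" and h: "h \<in> grhom V V'"
 shows "ubr x U V' * (f <*> h) = (h <*> f) * ubr x W V"
proof (rule kron_ap_eqI[where p = "len W" and q = "len V"])
 note d = grhom_dims[OF f] grhom_dims[OF h]
 fix p i F assume p: "p < len W" and i: "i < len V"
 have "ap f p (%q. ap h i (%j. inverse (om x (U ! q) * ch (V' ! j) (U ! q)) * F (ix (len U) j q))) =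
 ap f p (%q. ap h i (%j. inverse (om x (W ! p) * ch (V ! i) (W ! p)) * F (ix (len U) j q)))"
 by (rule ap_grhom_cong[OF f p], rule ap_grhom_cong[OF h i]) simp
 also have "... = inverse (om x (W ! p) * ch (V ! i) (W ! p)) * ap h i (%j. ap f p (%q. F (ix (len U) j q)))"
 unfolding ap_scale by (rule arg_cong2[where f = "(*)", OF refl ap_swap])
 finally show "ap (ubr x U V' * (f <*> h)) (ix (len V) p i) F = ap ((h <*> f) * ubr x W V) (ix (len V) p i) F"
 using p i d by (simp add: ap_kron ap_ubr)
qed (use grhom_dims[OF f] grhom_dims[OF h] in simp_all)

lemma swm_natural:
 assumes l: "coaction V l" and X: "act_on W sg" and Y: "act_on U ta" and f: "f \<in> Hom C (W, sg) (U, ta)"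
 shows "swm x V l (U, ta) * (f <*> idm V) = (idm V <*> f) * swm x V l (W, sg)"
proof -
 have fg: "f \<in> grhom W U" and fl: "f * sg = ta * (idm A <*> f)" using f by simp_all
 note d = grhom_dims[OF fg] act_dims[OF X] act_dims[OF Y] coaction_dims[OF l]
 have "swm x V l (U, ta) * (f <*> idm V) = (idm V <*> ta) * ((l <*> idm U) * (ubr x U V * (f <*> idm V)))"
 by (simp add: swm_def mat_assoc d mult_ac)
 also have "ubr x U V * (f <*> idm V) = (idm V <*> f) * ubr x W V"
 by (rule ubr_natural[OF fg grhom_one])
 also have "(l <*> idm U) * ((idm V <*> f) * ubr x W V) = ((l <*> idm U) * (idm V <*> f)) * ubr x W V"
 by (simp add: mat_assoc d)
 also have "(l <*> idm U) * (idm V <*> f) = (idm (V <&> A) <*> f) * (l <*> idm W)"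
 by (simp add: kron_mult d)
 also have "idm (V <&> A) <*> f = idm V <*> (idm A <*> f)"
 using kron_assoc[of "idm V" "idm A" f] by simp
 also have "(idm V <*> ta) * ((idm V <*> (idm A <*> f)) * (l <*> idm W) * ubr x W V) =
 ((idm V <*> ta) * (idm V <*> (idm A <*> f))) * ((l <*> idm W) * ubr x W V)"
 by (simp add: mat_assoc d mult.assoc)
 also have "(idm V <*> ta) * (idm V <*> (idm A <*> f)) = (idm V <*> f) * (idm V <*> sg)"
 by (simp add: kron_mult d fl)
 finally show ?thesis by (simp add: swm_def mat_assoc d mult.assoc)
qed

text \<open>The counit axiom of the coaction, read at the unit object.\<close>

lemma swm_unit:
 assumes l: "coaction V l"
 shows "swm x V l ([0], hcounit H) = idm V"
proof (rule ap_eqI)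
 fix i and F :: "nat \<Rightarrow> 'k" assume "i < dcol (idm V :: 'k mat)"
 then have i: "i < len V" by simp
 have "ap (swm x V l ([0], hcounit H)) (ix (len V) 0 i) F = sc (len V) n l i (%j a. ep a * F j)"
 using i by (subst ap_swm) (simp_all add: coaction_dims[OF l] om_simps chi)
 then show "ap (swm x V l ([0], hcounit H)) i F = ap (idm V) i F"
 using l i unfolding coaction_def by simp
qed (simp_all add: swm_dims[OF l act_unit_object])

text \<open>H acts on W \<otimes> U through \<Delta>; coassociativity replaces that coproduct by a
  second coaction, and the remaining scalars agree in each degree.\<close>

lemma swm_tensor:
 assumes l: "coaction V l" and X: "act_on W sg" and Y: "act_on U ta"
 shows "swm x V l (W <&> U, tensor_action ch H W sg U ta) =
 (swm x V l (W, sg) <*> idm U) * (idm W <*> swm x V l (U, ta))"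
proof (rule kron_ap_eqI[where p = "len W * len U" and q = "len V"])
 let ?v = "len V" and ?w = "len W" and ?u = "len U"
 note d = act_dims[OF X] act_dims[OF Y] coaction_dims[OF l]
 note td = act_dims[OF act_tensor[OF X Y]]
 fix pq i F assume "pq < ?w * ?u" and i: "i < ?v"
 then obtain p q where pq: "pq = ix ?u p q" and p: "p < ?w" and q: "q < ?u" by (elim ix_decompose)
 let ?c = "%y i. inverse (om x y * ch (V ! i) y)"
 have "ap (swm x V l (W <&> U, tensor_action ch H W sg U ta)) (ix ?v pq i) F =
 ?c (W ! p + U ! q) i * sc ?v n l i (%j a. ap (tensor_action ch H W sg U ta) (ix ?u (ix ?w a p) q) (%r. F (ix (?w * ?u) j r)))"
 unfolding pq using p q i d td by (subst ap_swm) simp_all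
 also have "... = ?c (W ! p + U ! q) i * sc ?v n l i (%j a. dl a (%b c. ch (g c) (W ! p) *
 ap sg (ix ?w b p) (%p'. ap ta (ix ?u c q) (%q'. F (ix ?u (ix ?w j p') q')))))"
 by (intro arg_cong2[where f = "(*)"] refl sc_weak_cong, subst ap_tensor_action) (simp_all add: d p q)
 also have "... = ?c (W ! p + U ! q) i * sc ?v n l i (%k c. sc ?v n l k (%j b. ch (g c) (W ! p) *
 ap sg (ix ?w b p) (%p'. ap ta (ix ?u c q) (%q'. F (ix ?u (ix ?w j p') q')))))"
 using l i unfolding coaction_def by simp
 also have "... = sc ?v n l i (%k c. sc ?v n l k (%j b. ?c (W ! p + U ! q) i * (ch (g c) (W ! p) *
 ap ta (ix ?u c q) (%q'. ap sg (ix ?w b p) (%p'. F (ix ?u (ix ?w j p') q'))))))"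
 unfolding sc_scale by (intro arg_cong2[where f = "(*)"] refl sc_weak_cong ap_swap)
 also have "... = sc ?v n l i (%k c. sc ?v n l k (%j b. ?c (U ! q) i * (?c (W ! p) k *
 ap ta (ix ?u c q) (%q'. ap sg (ix ?w b p) (%p'. F (ix ?u (ix ?w j p') q'))))))"
 by (intro coaction_degree[OF l i] sc_weak_cong refl) (simp add: chi om_simps field_simps)
 also have "... = ?c (U ! q) i * sc ?v n l i (%k c. ap ta (ix ?u c q) (%q'. ?c (W ! p) k *
 sc ?v n l k (%j b. ap sg (ix ?w b p) (%p'. F (ix ?u (ix ?w j p') q')))))"
 unfolding sc_scale ap_scale by (intro arg_cong2[where f = "(*)"] refl sc_weak_cong sc_swap)
 also have "... = ?c (U ! q) i * sc ?v n l i (%k c. ap ta (ix ?u c q) (%q'. ap (swm x V l (W, sg)) (ix ?v p k) (%r. F (ix ?u r q'))))"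
 by (intro arg_cong2[where f = "(*)"] refl sc_weak_cong ap_cong, subst ap_swm) (simp_all add: d p)
 also have "... = ap ((swm x V l (W, sg) <*> idm U) * (idm W <*> swm x V l (U, ta))) (ix ?v pq i) F"
 unfolding pq using p q i by (simp add: ap_kron ap_kron2 ap_swm d swm_dims[OF l X] swm_dims[OF l Y] mult.assoc[symmetric])
 finally show "ap (swm x V l (W <&> U, tensor_action ch H W sg U ta)) (ix ?v pq i) F =
 ap ((swm x V l (W, sg) <*> idm U) * (idm W <*> swm x V l (U, ta))) (ix ?v pq i) F" .
qed (simp_all add: swm_dims[OF l X] swm_dims[OF l Y] swm_dims[OF l act_tensor[OF X Y]] mult.assoc)

text \<open>Inserting the antipode between coaction and action gives the inverse of
  \<open>?T\<close>: the product contains b S(c) for \<Delta>(a) = b \<otimes> c and reduces to the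
  counit. The factor \<open>ubr\<close> is inverted by inverting its scalars.\<close>

lemma swm_invertible:
 assumes l: "coaction V l" and X: "act_on W sg"
 obtains R where "drow R = len W * len V" "dcol R = len V * len W"
 "R * swm x V l (W, sg) = idm (W <&> V)" "swm x V l (W, sg) * R = idm (V <&> W)"
proof -
 let ?v = "len V" and ?w = "len W"
 note d = act_dims[OF X] coaction_dims[OF l]
 let ?T = "(idm V <*> sg) * (l <*> idm W)"
 let ?T' = "(idm V <*> sg) * (idm V <*> (hantipode H <*> idm W)) * (l <*> idm W)"
 have TT': "?T * ?T' = idm (V <&> W)"
 proof (rule kron_ap_eqI[where p = ?v and q = ?w])
 fix i p F assume i: "i < ?v" and p: "p < ?w"
 have "ap (?T * ?T') (ix ?w i p) F = sc ?v n l i (%j c. an c (%s. ap sg (ix ?w s p) (%q. sc ?v n l j (%k b. ap sg (ix ?w b q) (%r. F (ix ?w k r))))))"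
 using i p d by (simp add: ap_kron ap_kron2 ap_sc[of l ?v n] mult.assoc[symmetric])
 also have "... = sc ?v n l i (%j c. sc ?v n l j (%k b. an c (%s. ap sg (ix ?w s p) (%q. ap sg (ix ?w b q) (%r. F (ix ?w k r))))))"
 by (simp only: sc_swap)
 also have "... = sc ?v n l i (%k a. dl a (%b c. an c (%s. ap sg (ix ?w s p) (%q. ap sg (ix ?w b q) (%r. F (ix ?w k r))))))"
 using l i unfolding coaction_def by simp
 also have "... = sc ?v n l i (%k a. dl a (%b c. an c (%s. ml b s (%t. ap sg (ix ?w t p) (%r. F (ix ?w k r))))))"
 using p by (simp add: act_mult[OF X])
 also have "... = sc ?v n l i (%k a. ep a * F (ix ?w k p))"
 using p by (intro sc_weak_cong refl) (simp add: an_right act_unit[OF X])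
 also have "... = F (ix ?w i p)" using l i unfolding coaction_def by simp
 finally show "ap (?T * ?T') (ix ?w i p) F = ap (idm (V <&> W)) (ix ?w i p) F"
 using i p by simp
 qed (simp_all add: d)
 \<comment> \<open>Both matrices are square of the same size, so a right inverse is also a left
   inverse.\<close>
 then have T'T: "?T' * ?T = idm (V <&> W)"
 using mat_mult_left_right_inverse[of ?T "?v * ?w" ?T'] by (simp add: carrier_matI d)
 define U where "U = braid (%m y. om x y * ch m y) V W"
 have UD: "drow U = ?w * ?v" "dcol U = ?v * ?w" by (simp_all add: U_def)
 have e: "inverse a * (inverse b * (a * b)) = 1" "a * (b * (inverse a * inverse b)) = 1"
 if "a ~= 0" "b ~= 0" for a b :: 'k
 using that by (simp_all add: field_simps)
 have UU: "U * ubr x W V = idm (W <&> V)"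
 by (rule kron_ap_eqI[where p = ?w and q = ?v]) (simp_all add: U_def ap_ubr om_simps(1) chi(1) e)
 have UU': "ubr x W V * U = idm (V <&> W)"
 by (rule kron_ap_eqI[where p = ?v and q = ?w]) (simp_all add: U_def ap_ubr om_simps(1) chi(1) e)
 have Td: "drow ?T = ?v * ?w" "dcol ?T = ?v * ?w" "drow ?T' = ?v * ?w" "dcol ?T' = ?v * ?w"
 by (simp_all add: d)
 have s: "swm x V l (W, sg) = ?T * ubr x W V" by (simp add: swm_def)
 have "(U * ?T') * (?T * ubr x W V) = U * ((?T' * ?T) * ubr x W V)"
 using UD Td by (simp only: mat_assoc index_mult_mat ubr_dims)
 then have 1: "(U * ?T') * (?T * ubr x W V) = idm (W <&> V)" unfolding T'T using UU by simp
 have "(?T * ubr x W V) * (U * ?T') = ?T * ((ubr x W V * U) * ?T')"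
 using UD Td by (simp only: mat_assoc index_mult_mat ubr_dims)
 then have 2: "(?T * ubr x W V) * (U * ?T') = idm (V <&> W)" unfolding UU' using TT' Td by simp
 show ?thesis by (rule that[of "U * ?T'"]) (use 1 2 s UD Td in simp_all)
qed

end

section \<open>Linearity of \<open>swm\<close> and the compatibility of action and coaction\<close>

context braided_hopf
begin


text \<open>The module W enters only through the scalar at the basis vector p, which factors out,
  and through the functional sending r to the action of r on p. The remaining expression involves H
  and V alone.\<close>

lemma swm_linear_left:
 assumes V: "act_on V rh" and l: "coaction V l" and X: "act_on W sg"
 and h: "h < n" and p: "p < len W" and i: "i < len V"
 shows "ap (swm x V l (W, sg) * tensor_action ch H W sg V rh) (ix (len V) (ix (len W) h p) i) F =
 inverse (om x (W ! p) * ch (V ! i) (W ! p)) * yd_left x V rh l h i (%j r. ap sg (ix (len W) r p) (%q. F (ix (len W) j q)))"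
proof -
 let ?v = "len V" and ?w = "len W"
 note d = act_dims[OF X] act_dims[OF V] coaction_dims[OF l]
 let ?G = "%j q. F (ix ?w j q)" and ?c = "inverse (om x (W ! p) * ch (V ! i) (W ! p))"
 have "ap (swm x V l (W, sg) * tensor_action ch H W sg V rh) (ix ?v (ix ?w h p) i) F =
 dl h (%h1 h2. ch (g h2) (W ! p) * ap sg (ix ?w h1 p) (%p'. ap rh (ix ?v h2 i) (%i'.
 inverse (om x (W ! p') * ch (V ! i') (W ! p')) * sc ?v n l i' (%j a. ap sg (ix ?w a p') (%q. ?G j q)))))"
 using h p i d by (simp add: swm_dims[OF l X] tensor_dims ap_tensor_action ap_swm mult.assoc[symmetric])
 also have "... = dl h (%h1 h2. ch (g h2) (W ! p) * ap sg (ix ?w h1 p) (%p'. ap rh (ix ?v h2 i) (%i'.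
 inverse (om x (g h1 + W ! p) * ch (V ! i') (g h1 + W ! p)) * sc ?v n l i' (%j a. ap sg (ix ?w a p') (%q. ?G j q)))))"
 by (intro sc_weak_cong refl arg_cong2[where f = "(*)"] act_degree[OF X] p ap_weak_cong) simp_all
 also have "... = dl h (%h1 h2. ch (g h2) (W ! p) * ap rh (ix ?v h2 i) (%i'. inverse (om x (g h1 + W ! p) * ch (V ! i') (g h1 + W ! p)) *
 sc ?v n l i' (%j a. ap sg (ix ?w h1 p) (%p'. ap sg (ix ?w a p') (%q. ?G j q)))))"
 proof (intro sc_weak_cong refl arg_cong2[where f = "(*)"])
 fix h1 h2
 have "ap sg (ix ?w h1 p) (%p'. ap rh (ix ?v h2 i) (%i'. inverse (om x (g h1 + W ! p) * ch (V ! i') (g h1 + W ! p)) * sc ?v n l i' (%j a. ap sg (ix ?w a p') (%q. ?G j q)))) =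
 ap rh (ix ?v h2 i) (%i'. ap sg (ix ?w h1 p) (%p'. inverse (om x (g h1 + W ! p) * ch (V ! i') (g h1 + W ! p)) * sc ?v n l i' (%j a. ap sg (ix ?w a p') (%q. ?G j q))))"
 by (rule ap_swap)
 also have "... = ap rh (ix ?v h2 i) (%i'. inverse (om x (g h1 + W ! p) * ch (V ! i') (g h1 + W ! p)) *
 sc ?v n l i' (%j a. ap sg (ix ?w h1 p) (%p'. ap sg (ix ?w a p') (%q. ?G j q))))"
 by (simp only: ap_scale sc_swap)
 finally show "ap sg (ix ?w h1 p) (%p'. ap rh (ix ?v h2 i) (%i'. inverse (om x (g h1 + W ! p) * ch (V ! i') (g h1 + W ! p)) * sc ?v n l i' (%j a. ap sg (ix ?w a p') (%q. ?G j q)))) =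
 ap rh (ix ?v h2 i) (%i'. inverse (om x (g h1 + W ! p) * ch (V ! i') (g h1 + W ! p)) *
 sc ?v n l i' (%j a. ap sg (ix ?w h1 p) (%p'. ap sg (ix ?w a p') (%q. ?G j q))))" .
 qed
 also have "... = dl h (%h1 h2. ap rh (ix ?v h2 i) (%i'. ch (g h2) (W ! p) * inverse (om x (g h1 + W ! p) * ch (V ! i') (g h1 + W ! p)) *
 sc ?v n l i' (%j a. ml a h1 (%r. ap sg (ix ?w r p) (%q. ?G j q)))))"
 using p by (intro sc_weak_cong refl) (simp add: act_mult[OF X] ap_scale mult.assoc)
 also have "... = dl h (%h1 h2. ap rh (ix ?v h2 i) (%i'. ?c * (inverse (om x (g h1)) * inverse (ch (V ! i') (g h1))) *
 sc ?v n l i' (%j a. ml a h1 (%r. ap sg (ix ?w r p) (%q. ?G j q)))))"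
 by (intro sc_weak_cong refl act_degree[OF V] i, assumption, rule arg_cong2[where f = "(*)", OF _ refl])
 (simp add: chi om_simps field_simps)
 also have "... = ?c * yd_left x V rh l h i (%j r. ap sg (ix ?w r p) (%q. ?G j q))"
 unfolding yd_left_def by (simp only: sc_scale ap_scale mult.assoc)
 finally show ?thesis .
qed

text \<open>The target carries the double dual of W, on which h2 acts as Q(h2); this is the origin
  of \<open>Q\<close> in \<open>yd_right\<close>.\<close>

lemma swm_linear_right:
 assumes V: "act_on V rh" and l: "coaction V l" and X: "act_on W sg"
 and h: "h < n" and p: "p < len W" and i: "i < len V"
 shows "ap (tensor_action ch H V rh W (sg * (Q <*> idm W)) * (idm A <*> swm x V l (W, sg))) (ix (len V) (ix (len W) h p) i) F =
 inverse (om x (W ! p) * ch (V ! i) (W ! p)) * yd_right V rh l h i (%j r. ap sg (ix (len W) r p) (%q. F (ix (len W) j q)))"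
proof -
 let ?v = "len V" and ?w = "len W"
 note d = act_dims[OF X] act_dims[OF V] coaction_dims[OF l]
 let ?G = "%j q. F (ix ?w j q)" and ?c = "inverse (om x (W ! p) * ch (V ! i) (W ! p))"
 have "ap (tensor_action ch H V rh W (sg * (Q <*> idm W)) * (idm A <*> swm x V l (W, sg))) (ix ?v (ix ?w h p) i) F =
 ?c * sc ?v n l i (%k a. ap sg (ix ?w a p) (%q. dl h (%h1 h2. ch (g h2) (V ! k) *
 ap rh (ix ?v h1 k) (%j. ap Q h2 (%s. ap sg (ix ?w s q) (%q'. ?G j q'))))))"
 using h p i d by (simp add: swm_dims[OF l X] tensor_dims ap_tensor_action ap_swm ap_kron ap_kron2 mult.assoc[symmetric])
 also have "... = ?c * sc ?v n l i (%k a. dl h (%h1 h2. ap sg (ix ?w a p) (%q. ch (g h2) (V ! k) *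
 ap rh (ix ?v h1 k) (%j. ap Q h2 (%s. ap sg (ix ?w s q) (%q'. ?G j q'))))))"
 by (intro arg_cong2[where f = "(*)"] refl sc_weak_cong sc_swap[symmetric])
 also have "... = ?c * dl h (%h1 h2. sc ?v n l i (%k a. ap sg (ix ?w a p) (%q. ch (g h2) (V ! k) *
 ap rh (ix ?v h1 k) (%j. ap Q h2 (%s. ap sg (ix ?w s q) (%q'. ?G j q'))))))"
 by (rule arg_cong2[where f = "(*)", OF refl sc_swap2])
 also have "... = ?c * dl h (%h1 h2. sc ?v n l i (%k a. ch (g h2) (V ! k) *
 ap Q h2 (%s. ml s a (%r. ap rh (ix ?v h1 k) (%j. ap sg (ix ?w r p) (%q. ?G j q))))))"
 proof (intro arg_cong2[where f = "(*)"] refl sc_weak_cong)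
 fix h1 h2 k a assume a: "a < n"
 have "ap sg (ix ?w a p) (%q. ch (g h2) (V ! k) * ap rh (ix ?v h1 k) (%j. ap Q h2 (%s. ap sg (ix ?w s q) (%q'. ?G j q')))) =
 ch (g h2) (V ! k) * ap rh (ix ?v h1 k) (%j. ap sg (ix ?w a p) (%q. ap Q h2 (%s. ap sg (ix ?w s q) (%q'. ?G j q'))))"
 unfolding ap_scale by (rule arg_cong2[where f = "(*)", OF refl ap_swap])
 also have "... = ch (g h2) (V ! k) * ap rh (ix ?v h1 k) (%j. ap Q h2 (%s. ap sg (ix ?w a p) (%q. ap sg (ix ?w s q) (%q'. ?G j q'))))"
 by (rule arg_cong2[where f = "(*)", OF refl], rule ap_cong, rule ap_swap)
 also have "... = ch (g h2) (V ! k) * ap rh (ix ?v h1 k) (%j. ap Q h2 (%s. ml s a (%r. ap sg (ix ?w r p) (%q. ?G j q))))"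
 using a p by (intro arg_cong2[where f = "(*)"] refl ap_cong) (simp add: act_mult[OF X])
 also have "... = ch (g h2) (V ! k) * ap Q h2 (%s. ap rh (ix ?v h1 k) (%j. ml s a (%r. ap sg (ix ?w r p) (%q. ?G j q))))"
 by (rule arg_cong2[where f = "(*)", OF refl ap_swap])
 also have "... = ch (g h2) (V ! k) * ap Q h2 (%s. ml s a (%r. ap rh (ix ?v h1 k) (%j. ap sg (ix ?w r p) (%q. ?G j q))))"
 unfolding ml_def by (rule arg_cong2[where f = "(*)", OF refl], rule ap_cong, rule ap_swap)
 finally show "ap sg (ix ?w a p) (%q. ch (g h2) (V ! k) * ap rh (ix ?v h1 k) (%j. ap Q h2 (%s. ap sg (ix ?w s q) (%q'. ?G j q')))) =
 ch (g h2) (V ! k) * ap Q h2 (%s. ml s a (%r. ap rh (ix ?v h1 k) (%j. ap sg (ix ?w r p) (%q. ?G j q))))" .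
 qed
 finally show ?thesis unfolding yd_right_def .
qed

lemma swm_Hom:
 assumes yd: "yd x V rh l" and X: "act_on W sg"
 shows "swm x V l (W, sg) \<in> Hom C (tenO C (W, sg) (V, rh)) (tenO C (V, rh) (tw Q (W, sg)))"
proof -
 have V: "act_on V rh" and l: "coaction V l" using yd by (simp_all add: yd_def)
 note d = act_dims[OF X] act_dims[OF V] coaction_dims[OF l] swm_dims[OF l X]
 have "swm x V l (W, sg) * tensor_action ch H W sg V rh =
 tensor_action ch H V rh W (sg * (Q <*> idm W)) * (idm A <*> swm x V l (W, sg))"
 proof (rule kron_ap_eqI[where p = "n * len W" and q = "len V"])
 fix c i F assume "c < n * len W" and i: "i < len V"
 then obtain h p where "c = ix (len W) h p" "h < n" "p < len W" by (elim ix_decompose)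
 then show "ap (swm x V l (W, sg) * tensor_action ch H W sg V rh) (ix (len V) c i) F =
 ap (tensor_action ch H V rh W (sg * (Q <*> idm W)) * (idm A <*> swm x V l (W, sg))) (ix (len V) c i) F"
 using yd i by (simp only: swm_linear_left[OF V l X] swm_linear_right[OF V l X]) (simp add: yd_def)
 qed (simp_all add: d tensor_dims mult.assoc)
 then show ?thesis using swm_grhom[OF l X] by (simp add: tw_def)
qed

text \<open>Linearity of \<open>swm\<close> at the regular module alone forces the compatibility condition: evaluate at
 the unit of \<open>H\<close>.\<close>

lemma yd_of_regular:
 assumes V: "act_on V rh" and l: "coaction V l"
 and lin: "swm x V l (A, hmult H) * tensor_action ch H A (hmult H) V rh =
 tensor_action ch H V rh A (hmult H * (Q <*> idm A)) * (idm A <*> swm x V l (A, hmult H))"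
 shows "yd x V rh l"
 unfolding yd_def
proof (intro conjI V l allI impI)
 fix h i and F :: "nat \<Rightarrow> nat \<Rightarrow> 'k" assume h: "h < n" and i: "i < len V"
 let ?E = "%p j r. ml r p (F j)"
 have eq: "yd_left x V rh l h i (?E p) = yd_right V rh l h i (?E p)" if p: "p < n" for p
 proof -
 have "yd_left x V rh l h i (%j r. ml r p (%q. F (ix n j q div n) (ix n j q mod n))) =
 yd_right V rh l h i (%j r. ml r p (%q. F (ix n j q div n) (ix n j q mod n)))"
 using swm_linear_left[OF V l act_regular h p i, of x "%r. F (r div n) (r mod n)"]
 swm_linear_right[OF V l act_regular h p i, of x "%r. F (r div n) (r mod n)"]
 by (simp add: lin chi om_simps)
 moreover have "ml r p (%q. F (ix n j q div n) (ix n j q mod n)) = ml r p (F j)" for j r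
 by (rule ml_cong) simp_all
 ultimately show ?thesis by (simp only:)
 qed
 have "un (%p. yd_left x V rh l h i (?E p)) = yd_left x V rh l h i (%j r. un (%p. ?E p j r))"
 unfolding yd_left_def ml_def
 by (simp only: sc_swap[where B = "hunit H", symmetric] ap_swap[of "hunit H"] ap_scale)
 moreover have "un (%p. yd_right V rh l h i (?E p)) = yd_right V rh l h i (%j r. un (%p. ?E p j r))"
 unfolding yd_right_def ml_def
 by (simp only: sc_swap[where B = "hunit H", symmetric] ap_swap[of "hunit H"] ap_scale)
 moreover have "un (%p. yd_left x V rh l h i (?E p)) = un (%p. yd_right V rh l h i (?E p))"
 by (rule ap_cong) (simp add: eq)
 moreover have "yd_left x V rh l h i (%j r. un (%p. ?E p j r)) = yd_left x V rh l h i F"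
 unfolding yd_left_def by (intro sc_weak_cong ap_cong refl arg_cong2[where f = "(*)"] ml_cong) (simp add: ml_un)
 moreover have "yd_right V rh l h i (%j r. un (%p. ?E p j r)) = yd_right V rh l h i F"
 unfolding yd_right_def by (intro sc_weak_cong refl arg_cong2[where f = "(*)"] ap_cong ml_cong) (simp add: ml_un)
 ultimately show "yd_left x V rh l h i F = yd_right V rh l h i F" by simp
qed

end

text \<open>Invertibility with row and column dimensions as separate terms. For half-braidings these
  are products of the same two lengths in opposite orders.\<close>

definition unit_mat :: "'k::field mat \<Rightarrow> bool" where
 "unit_mat M \<longleftrightarrow> (\<exists>R. drow R = dcol M & dcol R = drow M & R * M = 1\<^sub>m (dcol M) & M * R = 1\<^sub>m (drow M))"

lemma unit_minv:
 assumes "unit_mat M"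
 shows "drow (minv M) = dcol M" "dcol (minv M) = drow M" "minv M * M = 1\<^sub>m (dcol M)" "M * minv M = 1\<^sub>m (drow M)"
proof -
 let ?P = "%R. drow R = dcol M & dcol R = drow M & R * M = 1\<^sub>m (dcol M) & M * R = 1\<^sub>m (drow M)"
 define R where "R = (SOME R. ?P R)"
 have "?P R" unfolding R_def by (rule someI_ex[OF assms[unfolded unit_mat_def]])
 then have R: "drow R = dcol M" "dcol R = drow M" "R * M = 1\<^sub>m (dcol M)" "M * R = 1\<^sub>m (drow M)"
 by (rule conjunct1, rule conjunct2[THEN conjunct1], rule conjunct2[THEN conjunct2, THEN conjunct1],
 rule conjunct2[THEN conjunct2, THEN conjunct2])
 have "minv M = R" by (rule minv_eqI) (fact R)+
 then show "drow (minv M) = dcol M" "dcol (minv M) = drow M" "minv M * M = 1\<^sub>m (dcol M)" "M * minv M = 1\<^sub>m (drow M)"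
 by (simp_all only: R)
qed

lemma unit_matI: "drow R = dcol M ==> dcol R = drow M ==> R * M = 1\<^sub>m (dcol M) ==> M * R = 1\<^sub>m (drow M) ==> unit_mat M"
 unfolding unit_mat_def by (intro exI conjI)

lemma minv_minv: "unit_mat M ==> minv (minv M) = M"
 by (rule minv_eqI) (simp_all add: unit_minv)

lemma minv_mult:
 assumes "unit_mat M" "unit_mat N" "dcol M = drow N"
 shows "unit_mat (M * N)" "minv (M * N) = minv N * minv M"
proof -
 note d = unit_minv(1,2)[OF assms(1)] unit_minv(1,2)[OF assms(2)] assms(3)
 have "(minv N * minv M) * (M * N) = minv N * ((minv M * M) * N)"
 using d by (simp add: mat_assoc)
 then have 1: "(minv N * minv M) * (M * N) = 1\<^sub>m (dcol N)"
 using d unit_minv[OF assms(1)] unit_minv[OF assms(2)] by simp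
 have "(M * N) * (minv N * minv M) = M * ((N * minv N) * minv M)"
 using d by (simp add: mat_assoc)
 then have 2: "(M * N) * (minv N * minv M) = 1\<^sub>m (drow M)"
 using d unit_minv[OF assms(1)] unit_minv[OF assms(2)] by simp
 show "unit_mat (M * N)" by (rule unit_matI[of "minv N * minv M"]) (use 1 2 d in simp_all)
 show "minv (M * N) = minv N * minv M" by (rule minv_eqI) (use 1 2 d in simp_all)
qed

lemma minv_kron:
 assumes "unit_mat M"
 shows "unit_mat (M <*> 1\<^sub>m m)" "minv (M <*> 1\<^sub>m m) = minv M <*> 1\<^sub>m m"
 "unit_mat (1\<^sub>m m <*> M)" "minv (1\<^sub>m m <*> M) = 1\<^sub>m m <*> minv M"
proof -
 note d = unit_minv[OF assms]
 show "unit_mat (M <*> 1\<^sub>m m)" by (rule unit_matI[of "minv M <*> 1\<^sub>m m"]) (simp_all add: d kron_mult)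
 show "minv (M <*> 1\<^sub>m m) = minv M <*> 1\<^sub>m m" by (rule minv_eqI) (simp_all add: d kron_mult)
 show "unit_mat (1\<^sub>m m <*> M)" by (rule unit_matI[of "1\<^sub>m m <*> minv M"]) (simp_all add: d kron_mult)
 show "minv (1\<^sub>m m <*> M) = 1\<^sub>m m <*> minv M" by (rule minv_eqI) (simp_all add: d kron_mult)
qed

text \<open>This transfers naturality between a half-braiding and its inverse
  \<open>swm\<close>.\<close>

lemma minv_natural:
 assumes "unit_mat M" "unit_mat N" and e: "N * F = G * M"
 and d: "drow F = dcol N" "dcol F = dcol M" "drow G = drow N" "dcol G = drow M"
 shows "minv N * G = F * minv M"
proof -
 note u = unit_minv(1,2)[OF assms(1)] unit_minv(1,2)[OF assms(2)]
 have "minv N * G = minv N * (G * (M * minv M))" using d unit_minv[OF assms(1)] by simp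
 also have "... = minv N * ((G * M) * minv M)" using d u by (simp add: mat_assoc)
 also have "... = minv N * ((N * F) * minv M)" by (simp only: e)
 also have "... = (minv N * N) * (F * minv M)" using d u by (simp add: mat_assoc)
 finally show ?thesis using d u unit_minv[OF assms(2)] by simp
qed

section \<open>From compatible actions and coactions to objects of HH\<close>

context braided_hopf
begin

text \<open>The definition after the identifications \<open>sharp_eq\<close> and
  \<open>rsharp_arrow_eq\<close>.\<close>

lemma HH_Obj: "(M, t) \<in> Obj (HH C) \<longleftrightarrow> M \<in> Obj C & t \<in> extensional (Obj C) &
 (\<forall>X \<in> Obj C. is_iso C (tenO C M X) (tenO C (tw P X) M) (t X)) &
 (\<forall>X \<in> Obj C. \<forall>Y \<in> Obj C. \<forall>f \<in> Hom C X Y. t Y * (Idn C M <*> f) = (f <*> Idn C M) * t X) &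
 t (unitO C) = Idn C M &
 (\<forall>X \<in> Obj C. \<forall>Y \<in> Obj C. t (tenO C X Y) = (Idn C (tw P X) <*> t Y) * (t X <*> Idn C Y))"
proof -
 have "(\<forall>X \<in> Obj C. \<forall>Y \<in> Obj C. \<forall>f \<in> Hom C X Y. t Y * (Idn C M <*> f) = (rsharp_arrow C X Y f <*> Idn C M) * t X) \<longleftrightarrow>
 (\<forall>X \<in> Obj C. \<forall>Y \<in> Obj C. \<forall>f \<in> Hom C X Y. t Y * (Idn C M <*> f) = (f <*> Idn C M) * t X)"
 by (intro ball_cong refl) (simp only: rsharp_arrow_eq)
 moreover have "(\<forall>X \<in> Obj C. is_iso C (tenO C M X) (tenO C (rsharp C X) M) (t X)) \<longleftrightarrow>
 (\<forall>X \<in> Obj C. is_iso C (tenO C M X) (tenO C (tw P X) M) (t X))"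
 by (intro ball_cong refl) (simp only: sharp_eq)
 moreover have "(\<forall>X \<in> Obj C. \<forall>Y \<in> Obj C. t (tenO C X Y) = (Idn C (rsharp C X) <*> t Y) * (t X <*> Idn C Y)) \<longleftrightarrow>
 (\<forall>X \<in> Obj C. \<forall>Y \<in> Obj C. t (tenO C X Y) = (Idn C (tw P X) <*> t Y) * (t X <*> Idn C Y))"
 by (intro ball_cong refl) (simp only: sharp_eq)
 ultimately show ?thesis by (simp add: HH_def)
qed

lemma Idn_tw[simp]: "Idn C (tw f X) = Idn C X"
 by (cases X) (simp add: tw_def)

text \<open>\<open>Q\<close> and hence \<open>P\<close> preserve the counit, so one-dimensional
  trivial modules are their own double duals.\<close>

lemma tw_unit: "tw P ([y], hcounit H) = ([y], hcounit H)" "tw Q ([y], hcounit H) = ([y], hcounit H)"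
proof -
 have q: "hcounit H * Q = hcounit H"
 proof (rule ap_eqI)
 fix c and F :: "nat \<Rightarrow> 'k" assume "c < dcol (hcounit H)"
 then show "ap (hcounit H * Q) c F = ap (hcounit H) c F"
 using ap_scale[of Q c "F 0" ep] by (simp add: Q_ep mult.commute)
 qed simp_all
 then show 1: "tw Q ([y], hcounit H) = ([y], hcounit H)" by (simp add: tw_def)
 have "hcounit H * P = (hcounit H * Q) * P" by (simp add: q)
 also have "... = hcounit H" by (simp add: mat_assoc QP)
 finally show "tw P ([y], hcounit H) = ([y], hcounit H)" by (simp add: tw_def)
qed

lemma act_point: "act_on [y] (hcounit H)"
 using act_trivial[of "[y]"] by simp

lemma tw_Hom:
 assumes "f \<in> Hom C X Y" "X \<in> Obj C" "Y \<in> Obj C" "drow q = n" "dcol q = n"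
 shows "f \<in> Hom C (tw q X) (tw q Y)"
proof -
 obtain V rh W sg where XY: "X = (V, rh)" "Y = (W, sg)" by (cases X; cases Y)
 have fg: "f \<in> grhom V W" and fl: "f * rh = sg * (idm A <*> f)" using assms(1) XY by simp_all
 have V: "act_on V rh" and W: "act_on W sg" using assms XY by simp_all
 note d = grhom_dims[OF fg] act_dims[OF V] act_dims[OF W]
 have "f * (rh * (q <*> idm V)) = (sg * (idm A <*> f)) * (q <*> idm V)"
 using d assms by (simp add: mat_assoc[symmetric] fl)
 also have "... = (sg * (q <*> idm W)) * (idm A <*> f)"
 using d assms by (simp add: mat_assoc kron_mult)
 finally show ?thesis using fg by (simp add: XY tw_def)
qed

lemma unit_swm:
 assumes "coaction V l" "act_on W sg"
 shows "unit_mat (swm x V l (W, sg))"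
proof -
 obtain R where "drow R = len W * len V" "dcol R = len V * len W"
 "R * swm x V l (W, sg) = idm (W <&> V)" "swm x V l (W, sg) * R = idm (V <&> W)"
 by (rule swm_invertible[OF assms])
 then show ?thesis by (intro unit_matI[of R]) (simp_all add: swm_dims[OF assms])
qed

text \<open>\<open>swm\<close> at X inverts the half-braiding at the left double dual of X, so at X
  itself one has to invert \<open>swm\<close> at the right double dual. The restriction to objects
  makes the family extensional, as \<open>HH\<close> demands.\<close>

definition half_braiding :: "'g \<Rightarrow> 'g list \<Rightarrow> 'k mat \<Rightarrow> 'g list \<times> 'k mat \<Rightarrow> 'k mat" where
 "half_braiding x V l = (\<lambda>X\<in>Obj C. minv (swm x V l (tw P X)))"

text \<open>Each axiom of a half-braiding is the inverse of a statement about \<open>swm\<close>: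
  linearity from the compatibility condition, naturality from linearity of arrows, the tensor axiom
  from coassociativity and the unit axiom from the counit.\<close>

lemma HH_of_yd:
 assumes yd: "yd x V rh l"
 shows "((V, rh), half_braiding x V l) \<in> Obj (HH C)"
 unfolding HH_Obj
proof (intro conjI ballI)
 have V: "act_on V rh" and l: "coaction V l" using yd by (simp_all add: yd_def)
 let ?t = "half_braiding x V l"
 show "(V, rh) \<in> Obj C" using V by simp
 show "?t \<in> extensional (Obj C)" by (simp add: half_braiding_def)
 have t: "?t X = minv (swm x V l (tw P X))" if "X \<in> Obj C" for X
 using that by (simp add: half_braiding_def)
 have u: "unit_mat (swm x V l (tw P X))" "drow (swm x V l (tw P X)) = len V * len (fst X)"
 "dcol (swm x V l (tw P X)) = len (fst X) * len V" if "X \<in> Obj C" for X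
 using tw_Obj(1)[OF that] unit_swm[OF l] swm_dims[OF l] by (cases X; simp add: tw_def)+
 note um = unit_minv[OF u(1)]
 fix X assume X: "X \<in> Obj C"
 show "is_iso C (tenO C (V, rh) X) (tenO C (tw P X) (V, rh)) (?t X)"
 proof -
 obtain W sg where XW: "X = (W, sg)" by (cases X)
 note X' = X[unfolded XW]
 obtain sg' where PX: "tw P (W, sg) = (W, sg')" by (simp add: tw_def)
 have W: "act_on W sg" "act_on W sg'" using X' tw_Obj(1)[OF X'] PX by simp_all
 let ?a = "tensor_action ch H W sg' V rh" and ?b = "tensor_action ch H V rh W sg"
 let ?s = "swm x V l (W, sg')"
 have S: "?s \<in> Hom C (W <&> V, ?a) (V <&> W, ?b)"
 using swm_Hom[OF yd W(2)] tw_tw(2)[OF X'] by (simp only: PX H_mod_simps(7))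
 note d = act_dims[OF act_tensor[OF V W(1)]] act_dims[OF act_tensor[OF W(2) V]]
 have i: "drow (?t X) = len (W <&> V)" "dcol (?t X) = len (V <&> W)"
 "?t X * ?s = idm (W <&> V)" "?s * ?t X = idm (V <&> W)"
 unfolding XW t[OF X'] using um[OF X'] u[OF X'] by (simp_all only: PX length_grtensor fst_conv)
 have "?t X \<in> Hom C (V <&> W, ?b) (W <&> V, ?a)"
 by (rule Hom_inverse[OF S d(3,4,1,2) i])
 then have "inverse_arrows C (tenO C (V, rh) X) (tenO C (tw P X) (V, rh)) (?t X) ?s"
 using S i unfolding inverse_arrows_def XW PX H_mod_simps(3,4,7) by simp
 then show ?thesis unfolding is_iso_def by blast
 qed
 fix Y assume Y: "Y \<in> Obj C"
 show "?t Y * (Idn C (V, rh) <*> f) = (f <*> Idn C (V, rh)) * ?t X" if f: "f \<in> Hom C X Y" for f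
 proof -
 have f': "f \<in> Hom C (tw P X) (tw P Y)" by (rule tw_Hom[OF f X Y]) simp_all
 have "f \<in> grhom (fst X) (fst Y)" using f by (cases X; cases Y) simp
 note d = grhom_dims[OF this]
 have nat: "swm x V l (tw P Y) * (f <*> idm V) = (idm V <*> f) * swm x V l (tw P X)"
 using f' tw_Obj(1)[OF X] tw_Obj(1)[OF Y] by (cases "tw P X"; cases "tw P Y") (simp add: swm_natural[OF l])
 show ?thesis unfolding t[OF X] t[OF Y] H_mod_simps
 by (rule minv_natural[OF u(1)[OF X] u(1)[OF Y] nat]) (simp_all add: u[OF X] u[OF Y] d)
 qed
 show "?t (tenO C X Y) = (Idn C (tw P X) <*> ?t Y) * (?t X <*> Idn C Y)"
 proof -
 have XY: "tenO C X Y \<in> Obj C" using X Y by (cases X; cases Y) (simp add: act_tensor)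
 have s: "swm x V l (tenO C (tw P X) (tw P Y)) = (swm x V l (tw P X) <*> Idn C Y) * (Idn C X <*> swm x V l (tw P Y))"
 using tw_Obj(1)[OF X] tw_Obj(1)[OF Y] by (cases X; cases Y) (simp add: tw_def swm_tensor[OF l])
 show ?thesis unfolding t[OF XY] t[OF X] t[OF Y] tw_tensor(2)[OF X Y] s Idn_tw
 using
 minv_mult(2)[OF minv_kron(1)[OF u(1)[OF X], of "len (fst Y)"] minv_kron(3)[OF u(1)[OF Y], of "len (fst X)"]]
 minv_kron(2)[OF u(1)[OF X]] minv_kron(4)[OF u(1)[OF Y]] u[OF X] u[OF Y]
 by (cases X; cases Y) (simp add: mult.assoc)
 qed
next
 have l: "coaction V l" using yd by (simp add: yd_def)
 have "swm x V l (tw P (unitO C)) = idm V" by (simp add: tw_unit swm_unit[OF l])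
 moreover have "minv (idm V) = (idm V :: 'k mat)" by (rule minv_eqI) simp_all
 ultimately show "half_braiding x V l (unitO C) = Idn C (V, rh)"
 by (simp add: half_braiding_def act_unit_object)
qed

text \<open>Only the one-dimensional trivial modules are tested. On them the half-braiding is the
  braiding times the character \<open>om x\<close>.\<close>

definition has_type :: "'g \<Rightarrow> 'g list \<Rightarrow> ('g list \<times> 'k mat \<Rightarrow> 'k mat) \<Rightarrow> bool" where
 "has_type x V t \<longleftrightarrow> (\<forall>y. minv (t ([y], hcounit H)) = ubr x [y] V)"

lemma half_braiding_type:
 assumes l: "coaction V l"
 shows "has_type x V (half_braiding x V l)"
 unfolding has_type_def
proof
 fix y
 have "swm x V l ([y], hcounit H) = ubr x [y] V"
 proof (rule kron_ap_eqI[where p = 1 and q = "len V"])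
 fix p i F assume p: "p < (1::nat)" and i: "i < len V"
 have "ap (swm x V l ([y], hcounit H)) (ix (len V) 0 i) F =
 inverse (om x y * ch (V ! i) y) * sc (len V) n l i (%j a. ep a * F j)"
 using i by (subst ap_swm) (simp_all add: coaction_dims[OF l])
 then have "ap (swm x V l ([y], hcounit H)) (ix (len V) 0 i) F = inverse (om x y * ch (V ! i) y) * F i"
 using l i unfolding coaction_def by simp
 moreover have "ap (ubr x [y] V) (ix (len V) 0 i) F = inverse (om x y * ch (V ! i) y) * F i"
 using i by (subst ap_ubr) simp_all
 ultimately show "ap (swm x V l ([y], hcounit H)) (ix (len V) p i) F = ap (ubr x [y] V) (ix (len V) p i) F"
 using p by simp
 qed (simp_all add: swm_dims[OF l act_point])
 moreover from this have "unit_mat (ubr x [y] V)" using unit_swm[OF l act_point, of x y] by (simp only:)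
 ultimately show "minv (half_braiding x V l ([y], hcounit H)) = ubr x [y] V"
 by (simp add: half_braiding_def act_point tw_unit minv_minv)
qed

end

section \<open>From half-braidings of type x back to coactions\<close>

context braided_hopf
begin

text \<open>Conversely, a half-braiding of type \<open>x\<close> is determined by the coaction obtained from its
 inverse at the regular module by evaluating at the unit of \<open>H\<close>.\<close>

definition coaction_of :: "'g list \<Rightarrow> ('g list \<times> 'k mat \<Rightarrow> 'k mat) \<Rightarrow> 'k mat" where
 "coaction_of V t = minv (t (tw Q (A, hmult H))) * (hunit H <*> idm V)"

lemma HH_inverse:
 assumes "((V, rh), t) \<in> Obj (HH C)" and X: "act_on W sg"
 shows "unit_mat (t (tw Q (W, sg)))" "drow (t (tw Q (W, sg))) = len W * len V"
 "dcol (t (tw Q (W, sg))) = len V * len W"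
 "minv (t (tw Q (W, sg))) \<in> Hom C (tenO C (W, sg) (V, rh)) (tenO C (V, rh) (tw Q (W, sg)))"
 "t (tw Q (W, sg)) \<in> Hom C (tenO C (V, rh) (tw Q (W, sg))) (tenO C (W, sg) (V, rh))"
proof -
 have X': "(W, sg) \<in> Obj C" using X by simp
 obtain sg' where QX: "tw Q (W, sg) = (W, sg')" by (simp add: tw_def)
 have V: "act_on V rh" using assms(1) unfolding HH_Obj by simp
 have "is_iso C (tenO C (V, rh) (tw Q (W, sg))) (tenO C (W, sg) (V, rh)) (t (tw Q (W, sg)))"
 using assms(1) tw_Obj(2)[OF X'] tw_tw(1)[OF X'] unfolding HH_Obj by metis
 then obtain r where r: "inverse_arrows C (tenO C (V, rh) (tw Q (W, sg))) (tenO C (W, sg) (V, rh)) (t (tw Q (W, sg))) r"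
 unfolding is_iso_def by blast
 have g: "t (tw Q (W, sg)) \<in> grhom (V <&> W) (W <&> V)" "r \<in> grhom (W <&> V) (V <&> W)"
 using r unfolding inverse_arrows_def by (simp_all add: QX)
 have i: "r * t (tw Q (W, sg)) = idm (V <&> W)" "t (tw Q (W, sg)) * r = idm (W <&> V)"
 using r unfolding inverse_arrows_def by (simp_all add: QX)
 note d = grhom_dims[OF g(1)] grhom_dims[OF g(2)]
 show "drow (t (tw Q (W, sg))) = len W * len V" "dcol (t (tw Q (W, sg))) = len V * len W"
 using d(1,2) by simp_all
 show "unit_mat (t (tw Q (W, sg)))" by (rule unit_matI[of r]) (simp_all only: d i)
 have m: "minv (t (tw Q (W, sg))) = r" by (rule minv_eqI) (simp_all only: d i)
 show "minv (t (tw Q (W, sg))) \<in> Hom C (tenO C (W, sg) (V, rh)) (tenO C (V, rh) (tw Q (W, sg)))"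
 using r unfolding m inverse_arrows_def by blast
 show "t (tw Q (W, sg)) \<in> Hom C (tenO C (V, rh) (tw Q (W, sg))) (tenO C (W, sg) (V, rh))"
 using r unfolding inverse_arrows_def by blast
qed

lemma HH_natural:
 assumes M: "((V, rh), t) \<in> Obj (HH C)" and X: "act_on W sg" and Y: "act_on U ta" and f: "f \<in> Hom C (W, sg) (U, ta)"
 shows "minv (t (tw Q (U, ta))) * (f <*> idm V) = (idm V <*> f) * minv (t (tw Q (W, sg)))"
proof -
 have XY: "(W, sg) \<in> Obj C" "(U, ta) \<in> Obj C" using X Y by simp_all
 have "f \<in> Hom C (tw Q (W, sg)) (tw Q (U, ta))" by (rule tw_Hom[OF f XY]) simp_all
 then have nat: "t (tw Q (U, ta)) * (idm V <*> f) = (f <*> idm V) * t (tw Q (W, sg))"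
 using M tw_Obj(2)[OF XY(1)] tw_Obj(2)[OF XY(2)] unfolding HH_Obj by (simp only: H_mod_simps)
 have "f \<in> grhom W U" using f by simp
 note d = grhom_dims[OF this]
 show ?thesis
 by (rule minv_natural[OF HH_inverse(1)[OF M X] HH_inverse(1)[OF M Y] nat]) (simp_all add: d HH_inverse[OF M X] HH_inverse[OF M Y])
qed

lemma HH_tensor:
 assumes M: "((V, rh), t) \<in> Obj (HH C)" and X: "act_on W sg" and Y: "act_on U ta"
 shows "minv (t (tw Q (W <&> U, tensor_action ch H W sg U ta))) =
 (minv (t (tw Q (W, sg))) <*> idm U) * (idm W <*> minv (t (tw Q (U, ta))))"
proof -
 have XY: "(W, sg) \<in> Obj C" "(U, ta) \<in> Obj C" using X Y by simp_all
 have e: "t (tw Q (W <&> U, tensor_action ch H W sg U ta)) = (idm W <*> t (tw Q (U, ta))) * (t (tw Q (W, sg)) <*> idm U)"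
 proof -
 have "t (tenO C (tw Q (W, sg)) (tw Q (U, ta))) =
 (Idn C (tw P (tw Q (W, sg))) <*> t (tw Q (U, ta))) * (t (tw Q (W, sg)) <*> Idn C (tw Q (U, ta)))"
 using M tw_Obj(2)[OF XY(1)] tw_Obj(2)[OF XY(2)] unfolding HH_Obj by blast
 then show ?thesis using tw_tensor(1)[OF XY] by (simp only: H_mod_simps Idn_tw)
 qed
 show ?thesis unfolding e
 using minv_mult(2)[OF minv_kron(3)[OF HH_inverse(1)[OF M Y], of "len W"] minv_kron(1)[OF HH_inverse(1)[OF M X], of "len U"]]
 minv_kron(2)[OF HH_inverse(1)[OF M X]] minv_kron(4)[OF HH_inverse(1)[OF M Y]] HH_inverse(2,3)[OF M X] HH_inverse(2,3)[OF M Y]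
 by (simp add: mult.assoc)
qed

text \<open>A trivial module is spanned by trivial lines, and naturality along their inclusions
  reduces the claim to the lines, where it is the definition of the type.\<close>

lemma HH_trivial:
 assumes M: "((V, rh), t) \<in> Obj (HH C)" and x: "has_type x V t"
 shows "minv (t (tw Q (W, hcounit H <*> idm W))) = ubr x W V"
proof (rule kron_ap_eqI[where p = "len W" and q = "len V"])
 let ?s = "minv (t (tw Q (W, hcounit H <*> idm W)))"
 note d = unit_minv(1,2)[OF HH_inverse(1)[OF M act_trivial]] HH_inverse(2,3)[OF M act_trivial]
 show "drow ?s = drow (ubr x W V)" "dcol ?s = len W * len V"
 using d by simp_all
 fix p i F assume p: "p < len W" and i: "i < len V"
 \<comment> \<open>The inclusion of the line spanned by the basis vector p.\<close>
 define f :: "'k mat" where "f = mat (len W) 1 (%(r, _). if r = p then 1 else 0)"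
 have fd: "drow f = len W" "dcol f = 1" by (simp_all add: f_def)
 have apf: "ap f 0 G = G p" for G
 using p unfolding ap_def fd by (simp add: f_def if_distrib[of "%x. x * _"] sum.delta cong: if_cong)
 have "f \<in> Hom C ([W ! p], hcounit H) (W, hcounit H <*> idm W)"
 proof -
 have "f \<in> grhom [W ! p] W" by (rule grhomI) (auto simp: f_def split: if_splits)
 moreover have "f * hcounit H = (hcounit H <*> idm W) * (idm A <*> f)"
 by (rule ap_eqI) (simp_all add: fd apf ap_kron ap_kron_scalar_right)
 ultimately show ?thesis by simp
 qed
 from HH_natural[OF M act_point act_trivial this]
 have "?s * (f <*> idm V) = (idm V <*> f) * ubr x [W ! p] V"
 using x by (simp add: tw_unit has_type_def)
 then have "ap (?s * (f <*> idm V)) i F = ap ((idm V <*> f) * ubr x [W ! p] V) (ix (len V) 0 i) F" by simp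
 moreover have "ap ((idm V <*> f) * ubr x [W ! p] V) (ix (len V) 0 i) F =
 ap (ubr x [W ! p] V) (ix (len V) 0 i) (%k. ap (idm V <*> f) k F)"
 using i by (simp add: fd)
 moreover have "... = inverse (om x (W ! p) * ch (V ! i) (W ! p)) * F (ix (len W) i p)"
 using i by (subst ap_ubr) (simp_all add: ap_kron_scalar_right fd apf)
 moreover have "ap (?s * (f <*> idm V)) i F = ap ?s (ix (len V) p i) F"
 using i d by (simp add: fd apf ap_kron_scalar_left)
 ultimately show "ap ?s (ix (len V) p i) F = ap (ubr x W V) (ix (len V) p i) F"
 using p i by (simp add: ap_ubr)
qed simp

text \<open>Naturality along the action A \<otimes> W_0 -> W, with W_0 trivial, and the tensor axiom
  reduce the half-braiding of W to those of A and W_0. Precomposing with the unit of H in the factor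
  A removes the action and leaves the formula.\<close>

lemma HH_formula:
 assumes M: "((V, rh), t) \<in> Obj (HH C)" and x: "has_type x V t" and X: "act_on W sg"
 shows "minv (t (tw Q (W, sg))) = swm x V (coaction_of V t) (W, sg)"
proof -
 let ?s = "%X. minv (t (tw Q X))" and ?T = "tensor_action ch H A (hmult H) W (hcounit H <*> idm W)"
 let ?sH = "?s (A, hmult H)"
 note d = act_dims[OF X] unit_minv(1,2)[OF HH_inverse(1)[OF M X]] HH_inverse(2,3)[OF M X]
 unit_minv(1,2)[OF HH_inverse(1)[OF M act_regular]] HH_inverse(2,3)[OF M act_regular]
 have T: "?T = hmult H <*> idm W"
 proof (rule kron_ap_eqI[where p = "n * n" and q = "len W"])
 fix c p F assume "c < n * n" and p: "p < len W"
 then obtain a b where c: "c = ix n a b" "a < n" "b < n" by (elim ix_decompose)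
 have "ap ?T (ix (len W) c p) F = dl a (%a1 a2. ch (g a2) (g b) * (ml a1 b (%j. ep a2 * F (ix (len W) j p))))"
 using c p by (simp add: ap_tensor_action ap_kron)
 also have "... = dl a (%a1 a2. ep a2 * ml a1 b (%j. F (ix (len W) j p)))"
 proof (intro sc_weak_cong refl)
 fix a1 a2 assume a: "a2 < n"
 have "ep a2 * (ch (g a2) (g b) * ml a1 b (%j. F (ix (len W) j p))) = ep a2 * (1 * ml a1 b (%j. F (ix (len W) j p)))"
 by (rule ep_cong[OF a]) (simp add: chi)
 then show "ch (g a2) (g b) * (ml a1 b (%j. ep a2 * F (ix (len W) j p))) = ep a2 * ml a1 b (%j. F (ix (len W) j p))"
 unfolding ml_scale by (simp only: mult_1_left mult.left_commute[of "ch (g a2) (g b)"])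
 qed
 also have "... = ap (hmult H <*> idm W) (ix (len W) c p) F"
 using c p by (simp add: dl_ep ap_kron)
 finally show "ap ?T (ix (len W) c p) F = ap (hmult H <*> idm W) (ix (len W) c p) F" .
 qed (simp_all add: tensor_dims)
 \<comment> \<open>On A \<otimes> W with W made trivial, H acts by left multiplication on A alone,
   so linearity of the action map is associativity of the action.\<close>
 have "sg \<in> Hom C (A <&> W, ?T) (W, sg)"
 using X by (simp add: T act_grhom) (simp add: is_action_def)
 from HH_natural[OF M act_tensor[OF act_regular act_trivial] X this]
 have nat: "?s (W, sg) * (sg <*> idm V) = (idm V <*> sg) * ((?sH <*> idm W) * (idm A <*> ubr x W V))"
 unfolding HH_tensor[OF M act_regular act_trivial] HH_trivial[OF M x] .
 have u1: "sg * (hunit H <*> idm W) = idm W" using X by (simp add: is_action_def)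
 have "?s (W, sg) = ?s (W, sg) * ((sg <*> idm V) * ((hunit H <*> idm W) <*> idm V))"
 using d by (simp add: kron_mult u1)
 also have "... = (?s (W, sg) * (sg <*> idm V)) * ((hunit H <*> idm W) <*> idm V)"
 by (rule mat_assoc[symmetric]) (simp_all add: d)
 also have "... = (idm V <*> sg) * ((?sH <*> idm W) * ((idm A <*> ubr x W V) * (hunit H <*> idm (W <&> V))))"
 unfolding nat kron_assoc[of "hunit H"] using d by (simp add: mat_assoc mult.assoc)
 also have "(idm A <*> ubr x W V) * (hunit H <*> idm (W <&> V)) = (hunit H <*> idm (V <&> W)) * ubr x W V"
 proof -
 have "(hunit H <*> idm (V <&> W)) * (1\<^sub>m 1 <*> ubr x W V) = (idm A <*> ubr x W V) * (hunit H <*> idm (W <&> V))"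
 by (simp add: kron_mult del: kron_one1)
 then show ?thesis by simp
 qed
 also have "(?sH <*> idm W) * ((hunit H <*> idm (V <&> W)) * ubr x W V) = (coaction_of V t <*> idm W) * ubr x W V"
 proof -
 have "hunit H <*> idm (V <&> W) = (hunit H <*> idm V) <*> idm W"
 by (simp add: kron_assoc)
 then show ?thesis using d by (simp add: mat_assoc[symmetric] kron_mult coaction_of_def)
 qed
 finally show ?thesis using d by (simp add: swm_def mat_assoc coaction_of_def mult.assoc)
qed

text \<open>The counit axiom is \<open>HH_formula\<close> at the unit object. Coassociativity
  results from computing the half-braiding at A \<otimes> A twice, by \<open>HH_formula\<close> and
  by the tensor axiom, and evaluating both at 1 \<otimes> 1.\<close>

lemma HH_coaction:
 assumes M: "((V, rh), t) \<in> Obj (HH C)" and x: "has_type x V t"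
 shows "coaction V (coaction_of V t)"
proof -
 let ?s = "%X. minv (t (tw Q X))" and ?l = "coaction_of V t"
 let ?sH = "?s (A, hmult H)" and ?T = "tensor_action ch H A (hmult H) A (hmult H)"
 note d = unit_minv(1,2)[OF HH_inverse(1)[OF M act_regular]] HH_inverse(2,3)[OF M act_regular]
 have gr: "?l \<in> grhom V (V <&> A)"
 proof -
 have "?sH \<in> grhom (A <&> V) (V <&> A)"
 using HH_inverse(4)[OF M act_regular] by (simp add: tw_def)
 moreover have "hunit H <*> idm V \<in> grhom ([0] <&> V) (A <&> V)" by (intro grhom_kron hopf_grhom grhom_one)
 ultimately show ?thesis unfolding coaction_of_def by (metis grhom_mult grtensor_unit(2))
 qed
 note ld = grhom_dims[OF gr, simplified]
 have unit: "sc (len V) n ?l i (%j a. ep a * F j) = F i" if i: "i < len V" for i F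
 proof -
 have "t ([0], hcounit H) = idm V" using M unfolding HH_Obj by simp
 moreover have "minv (idm V) = (idm V :: 'k mat)" by (rule minv_eqI) simp_all
 ultimately have "swm x V ?l ([0], hcounit H) = idm V"
 using HH_formula[OF M x act_unit_object] by (simp add: tw_unit)
 moreover have "ap (swm x V ?l ([0], hcounit H)) (ix (len V) 0 i) F = sc (len V) n ?l i (%j a. ep a * F j)"
 using i by (subst ap_swm) (simp_all add: ld om_simps chi)
 ultimately show ?thesis using i by simp
 qed
 have co: "(idm V <*> hcomult H) * ?l = (?l <*> idm A) * ?l"
 proof -
 let ?u = "hunit H <*> hunit H"
 have ug: "?u \<in> grhom [0] (A <&> A)" using grhom_kron[OF hopf_grhom(2) hopf_grhom(2)] by simp
 have Td: "drow ?T = n * n" "dcol ?T = n * n * n" by (simp_all add: tensor_dims)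
 have ub1: "ubr x [0] V = idm V"
 proof (rule ap_eqI)
 fix i and F :: "nat \<Rightarrow> 'k" assume "i < dcol (idm V :: 'k mat)"
 then show "ap (ubr x [0] V) i F = ap (idm V) i F"
 using ap_ubr[of 0 "[0]" i V x F] by (simp add: om_simps chi)
 qed simp_all
 have Tu: "?T * (idm A <*> ?u) = hcomult H"
 proof (rule ap_eqI)
 fix a and F :: "nat \<Rightarrow> 'k" assume "a < dcol (hcomult H)"
 then have a: "a < n" by simp
 have "ap (?T * (idm A <*> ?u)) a F = un (%r. un (%s. ap ?T (ix n (ix n a r) s) F))"
 using a by (simp add: ap_kron_scalar_right Td ap_kron_scalar_left mult.assoc)
 also have "... = un (%r. un (%s. dl a (%b c. ch (g c) 0 * ml b r (%j. ml c s (%q. F (ix n j q))))))"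
 by (rule un_degree, rule ap_cong) (use a in \<open>simp add: ap_tensor_action\<close>)
 also have "... = dl a (%b c. un (%r. ml b r (%j. un (%s. ml c s (%q. F (ix n j q))))))"
 by (simp only: chi mult_1_left sc_swap[where B = "hunit H", symmetric] ap_swap[of "hunit H" 0 "hmult H"] ml_def)
 also have "... = ap (hcomult H) a F" by (simp add: ml_un)
 finally show "ap (?T * (idm A <*> ?u)) a F = ap (hcomult H) a F" .
 qed (simp_all add: Td)
 have "?s (A <&> A, ?T) * (?u <*> idm V) = (idm V <*> ?T) * ((?l <*> idm (A <&> A)) * (ubr x (A <&> A) V * (?u <*> idm V)))"
 unfolding HH_formula[OF M x act_tensor[OF act_regular act_regular]] swm_def
 by (simp add: mat_assoc ld Td mult.assoc)
 also have "ubr x (A <&> A) V * (?u <*> idm V) = (idm V <*> ?u) * ubr x [0] V"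
 by (rule ubr_natural[OF ug grhom_one])
 also have "(idm V <*> ?T) * ((?l <*> idm (A <&> A)) * ((idm V <*> ?u) * ubr x [0] V)) =
 (idm V <*> ?T) * ((idm V <*> (idm A <*> ?u)) * ?l)"
 proof -
 have "(?l <*> idm (A <&> A)) * (idm V <*> ?u) = (idm (V <&> A) <*> ?u) * (?l <*> 1\<^sub>m 1)"
 by (simp add: kron_mult ld del: kron_one1)
 moreover have "idm (V <&> A) <*> ?u = idm V <*> (idm A <*> ?u)"
 using kron_assoc[of "idm V" "idm A" ?u] by simp
 ultimately show ?thesis by (simp add: ub1 ld)
 qed
 also have "... = (idm V <*> hcomult H) * ?l"
 by (subst mat_assoc[symmetric]) (simp_all add: ld Td kron_mult Tu mult.assoc)
 finally have 1: "?s (A <&> A, ?T) * (?u <*> idm V) = (idm V <*> hcomult H) * ?l" .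
 have "?s (A <&> A, ?T) * (?u <*> idm V) = (?sH <*> idm A) * ((idm A <*> ?sH) * (hunit H <*> (hunit H <*> idm V)))"
 unfolding HH_tensor[OF M act_regular act_regular] kron_assoc using d by (simp add: mat_assoc mult.assoc)
 also have "(idm A <*> ?sH) * (hunit H <*> (hunit H <*> idm V)) = hunit H <*> ?l"
 using d by (simp add: kron_mult coaction_of_def)
 also have "hunit H <*> ?l = (hunit H <*> idm (V <&> A)) * ?l"
 using kron_mult[of "hunit H" "1\<^sub>m 1" "idm (V <&> A)" ?l] ld by simp
 also have "hunit H <*> idm (V <&> A) = (hunit H <*> idm V) <*> idm A" by (simp add: kron_assoc)
 also have "(?sH <*> idm A) * (((hunit H <*> idm V) <*> idm A) * ?l) = (?l <*> idm A) * ?l"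
 using d ld by (subst mat_assoc[symmetric]) (simp_all add: kron_mult coaction_of_def)
 finally show ?thesis using 1 by simp
 qed
 have "sc (len V) n ?l i (%j c. sc (len V) n ?l j (%k b. F k b c)) = sc (len V) n ?l i (%k a. dl a (%b c. F k b c))"
 if i: "i < len V" for i F
 using arg_cong[OF co, of "%M. ap M i (%r. F (r div n div n) (r div n mod n) (r mod n))"] i
 by (simp add: ld ap_kron ap_kron2 ap_sc[of ?l "len V" n])
 then show ?thesis using gr unit unfolding coaction_def by simp
qed

text \<open>Linearity at the regular module already gives the compatibility, and
  \<open>HH_formula\<close> recovers t on every module.\<close>

lemma yd_of_HH:
 assumes M: "((V, rh), t) \<in> Obj (HH C)" and x: "has_type x V t"
 shows "yd x V rh (coaction_of V t)" "t = half_braiding x V (coaction_of V t)"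
proof -
 have V: "act_on V rh" using M unfolding HH_Obj by simp
 note l = HH_coaction[OF M x]
 have "swm x V (coaction_of V t) (A, hmult H) \<in> Hom C (tenO C (A, hmult H) (V, rh)) (tenO C (V, rh) (tw Q (A, hmult H)))"
 using HH_inverse(4)[OF M act_regular] unfolding HH_formula[OF M x act_regular] .
 then show "yd x V rh (coaction_of V t)"
 by (intro yd_of_regular V l) (simp add: tw_def)
 show "t = half_braiding x V (coaction_of V t)"
 proof (rule extensionalityI[of _ "Obj C"])
 show "t \<in> extensional (Obj C)" using M unfolding HH_Obj by simp
 show "half_braiding x V (coaction_of V t) \<in> extensional (Obj C)" by (simp add: half_braiding_def)
 fix X assume X: "X \<in> Obj C"
 obtain W sg where PX: "tw P X = (W, sg)" by (cases "tw P X")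
 have W: "act_on W sg" using tw_Obj(1)[OF X] PX by simp
 have "t X = minv (minv (t (tw Q (tw P X))))"
 using HH_inverse(1)[OF M W] PX tw_tw(2)[OF X] by (simp add: minv_minv)
 also have "... = minv (swm x V (coaction_of V t) (tw P X))"
 unfolding PX HH_formula[OF M x W] ..
 finally show "t X = half_braiding x V (coaction_of V t) X" using X by (simp add: half_braiding_def)
 qed
qed

lemma coaction_of_half_braiding:
 assumes l: "coaction V l"
 shows "coaction_of V (half_braiding x V l) = l"
proof -
 have "tw Q (A, hmult H) \<in> Obj C" "tw P (tw Q (A, hmult H)) = (A, hmult H)"
 using tw_Obj(2)[of "(A, hmult H)"] tw_tw(1)[of "(A, hmult H)"] act_regular by simp_all
 then have "coaction_of V (half_braiding x V l) = swm x V l (A, hmult H) * (hunit H <*> idm V)"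
 using unit_swm[OF l act_regular] by (simp add: coaction_of_def half_braiding_def minv_minv)
 also have "... = l"
 proof (rule ap_eqI)
 note ld = coaction_dims[OF l]
 fix i and F :: "nat \<Rightarrow> 'k" assume "i < dcol l"
 then have i: "i < len V" using ld by simp
 have "ap (swm x V l (A, hmult H) * (hunit H <*> idm V)) i F = un (%p. ap (swm x V l (A, hmult H)) (ix (len V) p i) F)"
 using i by (simp add: swm_dims[OF l act_regular] ap_kron_scalar_left)
 also have "... = un (%p. sc (len V) n l i (%j a. ml a p (%q. F (ix n j q))))"
 by (rule un_degree, subst ap_swm) (simp_all add: i ld chi om_simps)
 also have "... = sc (len V) n l i (%j a. un (%p. ml a p (%q. F (ix n j q))))"
 by (rule sc_swap[symmetric])
 also have "... = ap l i F" by (simp add: ml_un ap_sc[of l "len V" n] ld)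
 finally show "ap (swm x V l (A, hmult H) * (hunit H <*> idm V)) i F = ap l i F" .
 qed (simp_all add: swm_dims[OF l act_regular] coaction_dims[OF l])
 finally show ?thesis .
qed

end

section \<open>Two equivalent forms of the compatibility condition\<close>

context braided_hopf
begin

text \<open>S applied to the antipode axiom for S(a) b: anti-multiplicativity turns it into S(b)
  S^2(a), and S^2 is \<open>Q\<close> up to \<theta>.\<close>

lemma antipode_Q_left:
 assumes q: "q < n"
 shows "dl q (%a b. ch (g a) (g a) * ch (g a) (g b) * ap Q a (%s. an b (%t. ml t s F))) = ep q * un F"
proof -
 have "dl q (%a b. ch (g a) (g a) * ch (g a) (g b) * ap Q a (%s. an b (%t. ml t s F))) =
 dl q (%a b. an a (%r. ml r b (%p. an p F)))"
 proof (intro sc_weak_cong refl)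
 fix a b assume a: "a < n" and b: "b < n"
 have "an a (%r. ml r b (%p. an p F)) = an a (%r. ch (g a) (g b) * an b (%t. an r (%s. ml t s F)))"
 by (rule an_degree[OF a]) (simp add: antipode_mult b)
 also have "... = ch (g a) (g b) * an a (%r. an r (%s. an b (%t. ml t s F)))"
 unfolding ap_scale by (rule arg_cong2[where f = "(*)", OF refl], rule ap_cong, rule ap_swap)
 finally show "ch (g a) (g a) * ch (g a) (g b) * ap Q a (%s. an b (%t. ml t s F)) = an a (%r. ml r b (%p. an p F))"
 using a by (simp add: ap_Q chi)
 qed
 then show ?thesis using an_left[OF q, of "%p. an p F"] by (simp add: un_an)
qed

text \<open>The same with a S(b), which S sends to S^2(b) S(a) up to a braiding scalar.\<close>

lemma antipode_Q_right:
 assumes q: "q < n"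
 shows "dl q (%a b. ch (g b) (g b) * ch (g a) (g b) * an a (%s. ap Q b (%t. ml t s F))) = ep q * un F"
proof -
 have "dl q (%a b. ch (g b) (g b) * ch (g a) (g b) * an a (%s. ap Q b (%t. ml t s F))) =
 dl q (%a b. an b (%r. ml a r (%p. an p F)))"
 proof (intro sc_weak_cong refl)
 fix a b assume a: "a < n" and b: "b < n"
 have "an b (%r. ml a r (%p. an p F)) = an b (%r. ch (g a) (g b) * an r (%t. an a (%s. ml t s F)))"
 by (rule an_degree[OF b]) (simp add: antipode_mult a)
 also have "... = ch (g a) (g b) * an b (%r. an a (%s. an r (%t. ml t s F)))"
 unfolding ap_scale by (rule arg_cong2[where f = "(*)", OF refl], rule ap_cong, rule ap_swap)
 also have "an b (%r. an a (%s. an r (%t. ml t s F))) = an a (%s. an b (%r. an r (%t. ml t s F)))"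
 by (rule ap_swap)
 finally have e: "an b (%r. ml a r (%p. an p F)) = ch (g a) (g b) * an a (%s. an b (%r. an r (%t. ml t s F)))" .
 show "ch (g b) (g b) * ch (g a) (g b) * an a (%s. ap Q b (%t. ml t s F)) = an b (%r. ml a r (%p. an p F))"
 using b by (simp add: e ap_Q ap_scale chi)
 qed
 then show ?thesis using an_right[OF q, of "%p. an p F"] by (simp add: un_an)
qed

text \<open>The anti-Yetter-Drinfeld condition of \<open>aYD\<close>, written with the coaction.\<close>

definition ayd_left :: "'g list \<Rightarrow> 'k mat \<Rightarrow> 'k mat \<Rightarrow> nat \<Rightarrow> nat \<Rightarrow> (nat \<Rightarrow> nat \<Rightarrow> 'k) \<Rightarrow> 'k" where
 "ayd_left V rh l h i F = sc (len V) n l i (%j a. inverse (ch (g a) (V ! j)) * ap rh (ix (len V) h j) (%k. F k a))"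

definition ayd_right :: "'g \<Rightarrow> 'g list \<Rightarrow> 'k mat \<Rightarrow> 'k mat \<Rightarrow> nat \<Rightarrow> nat \<Rightarrow> (nat \<Rightarrow> nat \<Rightarrow> 'k) \<Rightarrow> 'k" where
 "ayd_right x V rh l h i F = dl h (%h' h3. yd_left x V rh l h' i (%k c.
 ch (g c) (g h) * inverse (ch (g c) (V ! k)) * an h3 (%s. ml s c (%p. F k p))))"

text \<open>In \<open>ayd_right\<close> the last leg of h enters through S(h3). Substituting the
  hypothesis puts Q(h2) next to it, and S(h3) Q(h2) collapses to a counit by
  \<open>antipode_Q_left\<close>.\<close>

lemma ayd_of_yd:
 assumes V: "act_on V rh" and l: "coaction V l" and h: "h < n" and i: "i < len V"
 and yd: "!!h F. h < n ==> yd_left x V rh l h i F = yd_right V rh l h i F"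
 shows "ayd_left V rh l h i F = ayd_right x V rh l h i F"
proof -
 let ?v = "len V"
 let ?X = "%h1 h2 h3 j a. ch (g h2) (V ! j) * ap Q h2 (%s2. ml s2 a (%r. ap rh (ix ?v h1 j) (%k.
 ch (g r) (g h) * inverse (ch (g r) (V ! k)) * an h3 (%s. ml s r (%p. F k p)))))"
 let ?Y = "%h1 h2 h3 j a. inverse (ch (g a) (V ! j)) * (ch (g h2) (g h2) * ch (g h2) (g h3) * ch (g a) (g h2 + g h3) *
 ap Q h2 (%s2. an h3 (%s. ml s s2 (%t. ml t a (%p. ap rh (ix ?v h1 j) (%k. F k p))))))"
 have "ayd_right x V rh l h i F = dl h (%h' h3. dl h' (%h1 h2. sc ?v n l i (%j a. ?X h1 h2 h3 j a)))"
 unfolding ayd_right_def by (intro sc_weak_cong refl) (simp only: yd yd_right_def)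
 also have "... = dl h (%h1 h'. dl h' (%h2 h3. sc ?v n l i (%j a. ?X h1 h2 h3 j a)))"
 by (rule dl_coassoc[OF h])
 also have "... = dl h (%h1 h'. dl h' (%h2 h3. sc ?v n l i (%j a. ?Y h1 h2 h3 j a)))"
 proof (rule dl_degree[OF h], rule dl_degree, assumption, intro sc_weak_cong refl)
 fix h1 h' h2 h3 j a
 assume r: "h1 < n" "h2 < n" "h3 < n" "j < ?v" "a < n" and d: "g h = g h1 + g h'" "g h' = g h2 + g h3"
 have "?X h1 h2 h3 j a = ch (g h2) (V ! j) * ap Q h2 (%s2. ml s2 a (%r. ap rh (ix ?v h1 j) (%k.
 (ch (g h2 + g a) (g h) * inverse (ch (g h2 + g a) (g h1 + V ! j))) * an h3 (%s. ml s r (%p. F k p)))))"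
 by (rule arg_cong2[where f = "(*)", OF refl], rule Q_degree[OF r(2)], rule ml_degree, assumption, rule r(5), rule act_degree[OF V r(1,4)])
 simp
 also have "... = ch (g h2) (V ! j) * (ch (g h2 + g a) (g h) * inverse (ch (g h2 + g a) (g h1 + V ! j))) *
 ap Q h2 (%s2. ml s2 a (%r. ap rh (ix ?v h1 j) (%k. an h3 (%s. ml s r (%p. F k p)))))"
 by (simp only: ap_scale ml_scale mult.assoc)
 also have "... = inverse (ch (g a) (V ! j)) * (ch (g h2) (g h2) * ch (g h2) (g h3) * ch (g a) (g h2 + g h3)) *
 ap Q h2 (%s2. ml s2 a (%r. ap rh (ix ?v h1 j) (%k. an h3 (%s. ml s r (%p. F k p)))))"
 by (rule arg_cong2[where f = "(*)", OF _ refl]) (simp add: d chi field_simps)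
 also have "ap Q h2 (%s2. ml s2 a (%r. ap rh (ix ?v h1 j) (%k. an h3 (%s. ml s r (%p. F k p))))) =
 ap Q h2 (%s2. an h3 (%s. ml s s2 (%t. ml t a (%p. ap rh (ix ?v h1 j) (%k. F k p)))))"
 proof (rule ap_cong)
 fix s2 assume "s2 < drow Q"
 then have s2: "s2 < n" by simp
 have "ml s2 a (%r. ap rh (ix ?v h1 j) (%k. an h3 (%s. ml s r (%p. F k p)))) =
 ml s2 a (%r. an h3 (%s. ap rh (ix ?v h1 j) (%k. ml s r (%p. F k p))))"
 by (rule ml_cong[OF refl refl ap_swap])
 also have "... = ml s2 a (%r. an h3 (%s. ml s r (%p. ap rh (ix ?v h1 j) (%k. F k p))))"
 unfolding ml_def by (rule ap_cong, rule ap_cong, rule ap_swap)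
 also have "... = an h3 (%s. ml s2 a (%r. ml s r (%p. ap rh (ix ?v h1 j) (%k. F k p))))"
 unfolding ml_def by (rule ap_swap)
 also have "... = an h3 (%s. ml s s2 (%t. ml t a (%p. ap rh (ix ?v h1 j) (%k. F k p))))"
 by (rule ap_cong) (simp add: ml_assoc s2 r)
 finally show "ml s2 a (%r. ap rh (ix ?v h1 j) (%k. an h3 (%s. ml s r (%p. F k p)))) =
 an h3 (%s. ml s s2 (%t. ml t a (%p. ap rh (ix ?v h1 j) (%k. F k p))))" .
 qed
 finally show "?X h1 h2 h3 j a = ?Y h1 h2 h3 j a" by (simp only: mult.assoc)
 qed
 also have "... = dl h (%h1 h'. sc ?v n l i (%j a. dl h' (%h2 h3. ?Y h1 h2 h3 j a)))"
 by (intro sc_weak_cong refl sc_swap2)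
 also have "... = dl h (%h1 h'. sc ?v n l i (%j a. ep h' * (inverse (ch (g a) (V ! j)) * ap rh (ix ?v h1 j) (%k. F k a))))"
 proof (intro sc_weak_cong refl)
 fix h1 h' j a assume r: "h1 < n" "h' < n" "j < ?v" "a < n"
 have "dl h' (%h2 h3. ?Y h1 h2 h3 j a) = dl h' (%h2 h3. (inverse (ch (g a) (V ! j)) * ch (g a) (g h')) * (ch (g h2) (g h2) * ch (g h2) (g h3) *
 ap Q h2 (%s2. an h3 (%s. ml s s2 (%t. ml t a (%p. ap rh (ix ?v h1 j) (%k. F k p)))))))"
 by (rule dl_degree[OF r(2)]) (simp add: mult_ac)
 also have "... = (inverse (ch (g a) (V ! j)) * ch (g a) (g h')) * (ep h' * un (%t. ml t a (%p. ap rh (ix ?v h1 j) (%k. F k p))))"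
 by (simp only: sc_scale antipode_Q_left[OF r(2)])
 also have "... = ep h' * ((inverse (ch (g a) (V ! j)) * ch (g a) (g h')) * ap rh (ix ?v h1 j) (%k. F k a))"
 using r by (simp add: un_ml mult_ac)
 also have "... = ep h' * (inverse (ch (g a) (V ! j)) * ap rh (ix ?v h1 j) (%k. F k a))"
 by (rule ep_cong[OF r(2)]) (simp add: chi)
 finally show "dl h' (%h2 h3. ?Y h1 h2 h3 j a) = ep h' * (inverse (ch (g a) (V ! j)) * ap rh (ix ?v h1 j) (%k. F k a))" .
 qed
 also have "... = ayd_left V rh l h i F"
 unfolding sc_scale ayd_left_def by (rule dl_ep[OF h])
 finally show ?thesis ..
qed

text \<open>The inverse manipulation: multiplying by Q of a further leg produces Q(h4) S(h3), which
  collapses by \<open>antipode_Q_right\<close>.\<close>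

lemma yd_of_ayd:
 assumes V: "act_on V rh" and l: "coaction V l" and h: "h < n" and i: "i < len V"
 and ayd: "!!h F. h < n ==> ayd_left V rh l h i F = ayd_right x V rh l h i F"
 shows "yd_left x V rh l h i F = yd_right V rh l h i F"
proof -
 let ?v = "len V"
 \<comment> \<open>On the image h1 v_j this weight equals \<chi>(h2 + a, \<open>V ! j\<close>). It
   is expressed through the degree of the image because the functional in \<open>ayd_left\<close> is
   evaluated only after h1 has acted.\<close>
 let ?w = "%h1 h2 a k. ch (g h2 + g a) (V ! k) * inverse (ch (g h2 + g a) (g h1))"
 let ?G = "%h1 h2 k a. ?w h1 h2 a k * ap Q h2 (%s. ml s a (%r. F k r))"
 have "yd_right V rh l h i F = dl h (%h1 h2. ayd_left V rh l h1 i (?G h1 h2))"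
 unfolding yd_right_def ayd_left_def
 proof (intro sc_weak_cong refl)
 fix h1 h2 j a assume r: "h1 < n" "h2 < n" "j < ?v" "a < n"
 have "inverse (ch (g a) (V ! j)) * ap rh (ix ?v h1 j) (%k. ?G h1 h2 k a) =
 inverse (ch (g a) (V ! j)) * ap rh (ix ?v h1 j) (%k. (ch (g h2) (V ! j) * ch (g a) (V ! j)) * ap Q h2 (%s. ml s a (%r. F k r)))"
 by (rule arg_cong2[where f = "(*)", OF refl], rule act_degree[OF V r(1,3)], rule arg_cong2[where f = "(*)", OF _ refl])
 (simp add: chi field_simps)
 also have "... = ch (g h2) (V ! j) * ap rh (ix ?v h1 j) (%k. ap Q h2 (%s. ml s a (%r. F k r)))"
 by (simp add: ap_scale chi)
 also have "ap rh (ix ?v h1 j) (%k. ap Q h2 (%s. ml s a (%r. F k r))) = ap Q h2 (%s. ap rh (ix ?v h1 j) (%k. ml s a (%r. F k r)))"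
 by (rule ap_swap)
 also have "... = ap Q h2 (%s. ml s a (%r. ap rh (ix ?v h1 j) (%k. F k r)))"
 unfolding ml_def by (rule ap_cong, rule ap_swap)
 finally show "ch (g h2) (V ! j) * ap Q h2 (%s. ml s a (%r. ap rh (ix ?v h1 j) (%k. F k r))) =
 inverse (ch (g a) (V ! j)) * ap rh (ix ?v h1 j) (%k. ?G h1 h2 k a)" ..
 qed
 also have "... = dl h (%h0 h4. dl h0 (%h' h3. yd_left x V rh l h' i (%k c.
 ch (g c) (g h0) * inverse (ch (g c) (V ! k)) * an h3 (%s. ml s c (%p. ?G h0 h4 k p)))))"
 by (intro sc_weak_cong refl) (simp only: ayd ayd_right_def)
 also have "... = dl h (%h0 h4. dl h0 (%h' h3. yd_left x V rh l h' i (%k c. ch (g h3 + g h4) (V ! k) * inverse (ch (g h3 + g h4) (g h' + g h3)) *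
 an h3 (%s. ap Q h4 (%t. ml t s (%u. ml u c (%r. F k r)))))))"
 proof (intro sc_weak_cong refl dl_degree h, assumption)
 fix h0 h4 h' h3 assume r: "h0 < n" "h4 < n" "h' < n" "h3 < n" and d: "g h0 = g h' + g h3"
 have e: "ch (g c) (g h0) * inverse (ch (g c) (V ! k)) * an h3 (%s. ml s c (%p. ?G h0 h4 k p)) =
 ch (g h3 + g h4) (V ! k) * inverse (ch (g h3 + g h4) (g h' + g h3)) * an h3 (%s. ap Q h4 (%t. ml t s (%u. ml u c (%r. F k r))))"
 if c: "c < n" for k c
 proof -
 have "an h3 (%s. ml s c (%p. ?G h0 h4 k p)) = an h3 (%s. ml s c (%p.
 (ch (g h4 + (g h3 + g c)) (V ! k) * inverse (ch (g h4 + (g h3 + g c)) (g h0))) * ap Q h4 (%t. ml t p (%r. F k r))))"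
 by (rule an_degree[OF r(4)], rule ml_degree[OF _ c], assumption) simp
 also have "... = (ch (g h4 + (g h3 + g c)) (V ! k) * inverse (ch (g h4 + (g h3 + g c)) (g h0))) *
 an h3 (%s. ml s c (%p. ap Q h4 (%t. ml t p (%r. F k r))))"
 by (simp only: ap_scale ml_scale)
 finally have 1: "an h3 (%s. ml s c (%p. ?G h0 h4 k p)) = (ch (g h4 + (g h3 + g c)) (V ! k) * inverse (ch (g h4 + (g h3 + g c)) (g h0))) *
 an h3 (%s. ml s c (%p. ap Q h4 (%t. ml t p (%r. F k r))))" .
 have 2: "an h3 (%s. ml s c (%p. ap Q h4 (%t. ml t p (%r. F k r)))) = an h3 (%s. ap Q h4 (%t. ml t s (%u. ml u c (%r. F k r))))"
 proof (rule ap_cong)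
 fix s assume "s < drow (hantipode H)"
 then have s: "s < n" by simp
 have "ml s c (%p. ap Q h4 (%t. ml t p (%r. F k r))) = ap Q h4 (%t. ml s c (%p. ml t p (%r. F k r)))"
 unfolding ml_def by (rule ap_swap)
 also have "... = ap Q h4 (%t. ml t s (%u. ml u c (%r. F k r)))"
 by (rule ap_cong) (simp add: ml_assoc s c)
 finally show "ml s c (%p. ap Q h4 (%t. ml t p (%r. F k r))) = ap Q h4 (%t. ml t s (%u. ml u c (%r. F k r)))" .
 qed
 have 3: "ch (g c) (g h0) * inverse (ch (g c) (V ! k)) * (ch (g h4 + (g h3 + g c)) (V ! k) * inverse (ch (g h4 + (g h3 + g c)) (g h0))) =
 ch (g h3 + g h4) (V ! k) * inverse (ch (g h3 + g h4) (g h' + g h3))"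
 by (simp add: d chi field_simps)
 show ?thesis unfolding 1 2 3[symmetric] by (simp only: mult.assoc)
 qed
 show "yd_left x V rh l h' i (%k c. ch (g c) (g h0) * inverse (ch (g c) (V ! k)) * an h3 (%s. ml s c (%p. ?G h0 h4 k p))) =
 yd_left x V rh l h' i (%k c. ch (g h3 + g h4) (V ! k) * inverse (ch (g h3 + g h4) (g h' + g h3)) * an h3 (%s. ap Q h4 (%t. ml t s (%u. ml u c (%r. F k r)))))"
 unfolding yd_left_def by (intro sc_weak_cong ap_cong refl arg_cong2[where f = "(*)", OF refl] ml_cong e)
 qed
 also have "... = dl h (%h' q. dl q (%h3 h4. yd_left x V rh l h' i (%k c. ch (g h3 + g h4) (V ! k) * inverse (ch (g h3 + g h4) (g h' + g h3)) *
 an h3 (%s. ap Q h4 (%t. ml t s (%u. ml u c (%r. F k r)))))))"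
 by (rule dl_coassoc[OF h])
 also have "... = dl h (%h' q. yd_left x V rh l h' i (%k c. dl q (%h3 h4. ch (g h3 + g h4) (V ! k) * inverse (ch (g h3 + g h4) (g h' + g h3)) *
 an h3 (%s. ap Q h4 (%t. ml t s (%u. ml u c (%r. F k r)))))))"
 proof (intro sc_weak_cong refl)
 fix h' q
 show "dl q (%h3 h4. yd_left x V rh l h' i (G h3 h4)) = yd_left x V rh l h' i (%k c. dl q (%h3 h4. G h3 h4 k c))" for G
 proof -
 have "dl q (%h3 h4. yd_left x V rh l h' i (G h3 h4)) = dl h' (%h1 h2. dl q (%h3 h4. ap rh (ix ?v h2 i) (%i'. sc ?v n l i' (%j a.
 inverse (om x (g h1)) * inverse (ch (V ! i') (g h1)) * ml a h1 (%r. G h3 h4 j r)))))"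
 unfolding yd_left_def by (rule sc_swap2)
 also have "... = dl h' (%h1 h2. ap rh (ix ?v h2 i) (%i'. sc ?v n l i' (%j a. dl q (%h3 h4.
 inverse (om x (g h1)) * inverse (ch (V ! i') (g h1)) * ml a h1 (%r. G h3 h4 j r)))))"
 by (intro sc_weak_cong refl trans[OF sc_swap] ap_cong sc_swap2)
 also have "... = yd_left x V rh l h' i (%k c. dl q (%h3 h4. G h3 h4 k c))"
 unfolding yd_left_def sc_scale ml_def sc_swap ..
 finally show ?thesis .
 qed
 qed
 also have "... = dl h (%h' q. yd_left x V rh l h' i (%k c. ep q * F k c))"
 unfolding yd_left_def
 proof (intro sc_weak_cong ap_cong refl arg_cong2[where f = "(*)", OF refl] ml_cong)
 fix h' q k c assume q: "q < n" and c: "c < n"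
 have "dl q (%h3 h4. ch (g h3 + g h4) (V ! k) * inverse (ch (g h3 + g h4) (g h' + g h3)) * an h3 (%s. ap Q h4 (%t. ml t s (%u. ml u c (%r. F k r))))) =
 dl q (%h3 h4. (ch (g q) (V ! k) * inverse (ch (g q) (g h')) * inverse (ch (g q) (g q))) * (ch (g h4) (g h4) * ch (g h3) (g h4) *
 an h3 (%s. ap Q h4 (%t. ml t s (%u. ml u c (%r. F k r))))))"
 by (rule dl_degree[OF q]) (simp add: chi field_simps)
 also have "... = (ch (g q) (V ! k) * inverse (ch (g q) (g h')) * inverse (ch (g q) (g q))) * (ep q * un (%u. ml u c (%r. F k r)))"
 by (simp only: sc_scale antipode_Q_right[OF q])
 also have "... = ep q * ((ch (g q) (V ! k) * inverse (ch (g q) (g h')) * inverse (ch (g q) (g q))) * F k c)"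
 using c by (simp add: un_ml mult_ac)
 also have "... = ep q * F k c" by (rule ep_cong[OF q]) (simp add: chi)
 finally show "dl q (%h3 h4. ch (g h3 + g h4) (V ! k) * inverse (ch (g h3 + g h4) (g h' + g h3)) * an h3 (%s. ap Q h4 (%t. ml t s (%u. ml u c (%r. F k r))))) =
 ep q * F k c" .
 qed
 also have "... = dl h (%h' q. ep q * yd_left x V rh l h' i F)"
 proof (intro sc_weak_cong refl)
 fix h' q
 show "yd_left x V rh l h' i (%k c. ep q * F k c) = ep q * yd_left x V rh l h' i F"
 unfolding yd_left_def sc_scale[symmetric] ap_scale[symmetric] ml_def
 by (intro sc_weak_cong ap_cong refl) (simp only: ap_scale mult_ac)
 qed
 also have "... = yd_left x V rh l h i F" by (rule dl_ep[OF h])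
 finally show ?thesis ..
qed

end

section \<open>Anti-Yetter-Drinfeld modules as comodules\<close>

text \<open>Stated for arbitrary structure maps on B, because it is applied to the dual of
  H.\<close>

lemma is_action_iff:
 fixes rh :: "'k::field mat" and V :: "'g::ab_group_add list"
 assumes m: "drow m = len B" "dcol m = len B * len B" and u: "drow u = len B" "dcol u = 1"
 and gr: "rh \<in> grhom (B <&> V) V"
 shows "is_action B m u V rh \<longleftrightarrow>
 (\<forall>a<len B. \<forall>b<len B. \<forall>i<len V. \<forall>F. ap m (ix (len B) a b) (%c. ap rh (ix (len V) c i) F) =
 ap rh (ix (len V) b i) (%j. ap rh (ix (len V) a j) F)) &
 (\<forall>i<len V. \<forall>F. ap u 0 (%a. ap rh (ix (len V) a i) F) = F i)" (is "_ \<longleftrightarrow> ?M & ?U")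
proof -
 have d: "drow rh = len V" "dcol rh = len B * len V" using grhom_dims[OF gr] by simp_all
 have M1: "ap (rh * (m <*> idm V)) (ix (len V) (ix (len B) a b) i) F = ap m (ix (len B) a b) (%c. ap rh (ix (len V) c i) F)"
 and M2: "ap (rh * (idm B <*> rh)) (ix (len V) (ix (len B) a b) i) F = ap rh (ix (len V) b i) (%j. ap rh (ix (len V) a j) F)"
 if "a < len B" "b < len B" "i < len V" for a b i F
 using that by (simp_all add: d m ap_kron ap_kron2 mult.assoc[symmetric])
 have "rh * (m <*> idm V) = rh * (idm B <*> rh) \<longleftrightarrow> ?M"
 proof
 assume e: "rh * (m <*> idm V) = rh * (idm B <*> rh)"
 show ?M using M1 M2 unfolding e by simp
 next
 assume e: ?M
 show "rh * (m <*> idm V) = rh * (idm B <*> rh)"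
 proof (rule kron_ap_eqI[where p = "len B * len B" and q = "len V"])
 fix c i F assume "c < len B * len B" and i: "i < len V"
 then obtain a b where "a < len B" "b < len B" "c = ix (len B) a b" by (elim ix_decompose)
 then show "ap (rh * (m <*> idm V)) (ix (len V) c i) F = ap (rh * (idm B <*> rh)) (ix (len V) c i) F"
 using i e M1 M2 by simp
 qed (simp_all add: d m)
 qed
 moreover have U1: "ap (rh * (u <*> idm V)) i F = ap u 0 (%a. ap rh (ix (len V) a i) F)" if "i < len V" for i F
 using that by (simp add: d u ap_kron_scalar_left)
 have "rh * (u <*> idm V) = idm V \<longleftrightarrow> ?U"
 proof
 assume e: "rh * (u <*> idm V) = idm V"
 show ?U using U1 unfolding e by simp
 next
 assume e: ?U
 show "rh * (u <*> idm V) = idm V"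
 proof (rule ap_eqI)
 fix i and F :: "nat \<Rightarrow> 'k" assume "i < dcol (idm V :: 'k mat)"
 then have i: "i < len V" by simp
 show "ap (rh * (u <*> idm V)) i F = ap (idm V) i F"
 unfolding U1[OF i] ap_one[OF i] using e i by blast
 qed (simp_all add: d u)
 qed
 ultimately show ?thesis unfolding is_action_def using gr by blast
qed

text \<open>The basis and its order are kept, so a graded map, and likewise an action, is
  represented by the same matrix before and after the shift.\<close>

definition shift :: "'g::ab_group_add \<Rightarrow> 'g list \<Rightarrow> 'g list" where
 "shift x V = map (%d. d + x) V"

lemma length_shift[simp]: "len (shift x V) = len V"
 and nth_shift[simp]: "i < len V ==> shift x V ! i = V ! i + x"
 and shift_shift[simp]: "shift x (shift y V) = shift (y + x) V"
 and shift_zero[simp]: "shift 0 V = V"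
 by (simp_all add: shift_def comp_def add.assoc)

lemma grhom_shift: "f \<in> grhom (shift x V) (shift x W) \<longleftrightarrow> f \<in> grhom V W"
 unfolding grhom_def by auto

lemma grhom_shift_right: "f \<in> grhom (U <&> shift x V) (shift x W) \<longleftrightarrow> f \<in> grhom (U <&> V) W"
proof -
 have "(U <&> shift x V) = shift x (U <&> V)"
 proof (rule nth_equalityI)
 fix r assume "r < len (U <&> shift x V)"
 then obtain i j where "r = ix (len V) i j" "i < len U" "j < len V" by (auto elim: ix_decompose)
 then show "(U <&> shift x V) ! r = shift x (U <&> V) ! r"
 using nth_grtensor[of i U j "shift x V"] by (simp add: add.assoc)
 qed simp
 then show ?thesis by (simp add: grhom_shift)
qed

context braided_hopf
begin

lemma act_shift: "act_on (shift x V) rh \<longleftrightarrow> act_on V rh"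
 unfolding is_action_def by (simp add: grhom_shift_right)

text \<open>Turns an action of the dual of H into a right coaction of H by contracting with dual
  bases; \<open>del\<close> goes back. The scalar \<chi>(a, \<open>V ! j\<close>) compensates for
  the inverse braiding in the multiplication of the dual.\<close>

definition lam :: "'g list \<Rightarrow> 'k mat \<Rightarrow> 'k mat" where
 "lam V r = mat (len V * n) (len V) (%(s, i). ch (g (s mod n)) (V ! (s div n)) * r $$ (s div n, ix (len V) (s mod n) i))"

definition del :: "'g list \<Rightarrow> 'k mat \<Rightarrow> 'k mat" where
 "del V l = mat (len V) (n * len V) (%(j, c). inverse (ch (g (c div len V)) (V ! j)) * l $$ (ix n j (c div len V), c mod len V))"

lemma lam_dims[simp]: "drow (lam V r) = len V * n" "dcol (lam V r) = len V"
 and del_dims[simp]: "drow (del V l) = len V" "dcol (del V l) = n * len V"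
 by (simp_all add: lam_def del_def)

lemma lam_index: "j < len V ==> a < n ==> i < len V ==> lam V r $$ (ix n j a, i) = ch (g a) (V ! j) * r $$ (j, ix (len V) a i)"
 and del_index: "j < len V ==> a < n ==> i < len V ==> del V l $$ (j, ix (len V) a i) = inverse (ch (g a) (V ! j)) * l $$ (ix n j a, i)"
 by (simp_all add: lam_def del_def)

lemma lam_del: "drow l = len V * n ==> dcol l = len V ==> lam V (del V l) = l"
 by (rule kron_eqI[where p = "len V" and q = n and p' = "len V" and q' = 1])
 (simp_all add: lam_index del_index chi)

lemma sc_lam:
 assumes "drow r = len V" "i < len V"
 shows "sc (len V) n (lam V r) i F = (\<Sum>a<n. ap r (ix (len V) a i) (%j. ch (g a) (V ! j) * F j a))"
 unfolding sc_def ap_def assms by (subst sum.swap) (use assms in \<open>simp add: lam_index mult_ac\<close>)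

lemma dual_grhom_iff:
 assumes "drow r = len V" "dcol r = n * len V"
 shows "r \<in> grhom (grdual A <&> shift x V) (shift x V) \<longleftrightarrow> lam V r \<in> grhom V (V <&> A)"
 unfolding grhom_shift_right
proof
 assume r: "r \<in> grhom (grdual A <&> V) V"
 show "lam V r \<in> grhom V (V <&> A)"
 proof (rule grhomI)
 fix s i assume "s < len (V <&> A)" and i: "i < len V" and nz: "lam V r $$ (s, i) ~= 0"
 then obtain j a where s: "s = ix n j a" "j < len V" "a < n" by (auto elim: ix_decompose)
 then have "r $$ (j, ix (len V) a i) ~= 0" using nz i by (simp add: lam_index)
 then have "V ! j = - g a + V ! i"
 using grhom_degree[OF r, of j "ix (len V) a i"] s i nth_grtensor[of a "grdual A" i V] by simp
 then show "(V <&> A) ! s = V ! i" using s by simp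
 qed simp_all
next
 assume l: "lam V r \<in> grhom V (V <&> A)"
 show "r \<in> grhom (grdual A <&> V) V"
 proof (rule grhomI)
 fix j c assume j: "j < len V" and "c < len (grdual A <&> V)" and nz: "r $$ (j, c) ~= 0"
 then obtain a i where c: "c = ix (len V) a i" "a < n" "i < len V" by (auto elim: ix_decompose)
 then have "lam V r $$ (ix n j a, i) ~= 0" using nz j by (simp add: lam_index chi)
 then have "V ! j + g a = V ! i"
 using grhom_degree[OF l, of "ix n j a" i] c j by simp
 then have "V ! j = - g a + V ! i" by (simp add: algebra_simps)
 then show "V ! j = (grdual A <&> V) ! c" using c nth_grtensor[of a "grdual A" i V] by simp
 qed (use assms in simp_all)
qed

lemma ap_adjunct:
 assumes "dcol G = n * len U" "u < len U"
 shows "ap (adjunct A U G) u F = (\<Sum>c<n. ap G (ix (len U) c u) (%j. F (ix (drow G) c j)))"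
proof -
 have "ap (adjunct A U G) u F = (\<Sum>c<n. ap (idm (grdual A) <*> G) (ix (len U) (ix n c c) u) F)"
 unfolding adjunct_def using assms by (simp add: ap_kron_scalar_left mult.assoc)
 also have "... = (\<Sum>c<n. ap G (ix (len U) c u) (%j. F (ix (drow G) c j)))"
 using assms by (intro sum.cong refl) (simp add: ap_kron2)
 finally show ?thesis .
qed

lemma adjunct_dims[simp]: "drow (adjunct A U G) = n * drow G" "dcol (adjunct A U G) = len U"
 by (simp_all add: adjunct_def)

lemma sc_single: "a < p ==> b < q ==> sc p q M c (%s t. if s = a then if t = b then X else 0 else 0) = M $$ (ix q a b, c) * X"
proof -
 assume ab: "a < p" "b < q"
 have "sc p q M c (%s t. if s = a then if t = b then X else 0 else 0) =
 (\<Sum>s<p. \<Sum>t<q. if s = a then if t = b then M $$ (ix q a b, c) * X else 0 else 0)"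
 unfolding sc_def by (intro sum.cong refl) auto
 also have "... = (\<Sum>s<p. if s = a then M $$ (ix q a b, c) * X else 0)"
 using ab by (intro sum.cong refl) simp
 finally show ?thesis using ab by simp
qed

lemma dual_mult_dims[simp]: "drow (dual_mult ch H) = n" "dcol (dual_mult ch H) = n * n"
 and dual_unit_dims[simp]: "drow (dual_unit H) = n" "dcol (dual_unit H) = 1"
 by (simp_all add: dual_mult_def dual_unit_def Let_def)

lemma ap_dual_mult:
 assumes a: "a < n" and b: "b < n"
 shows "ap (dual_mult ch H) (ix n a b) F = (\<Sum>c<n. inverse (ch (g b) (g a)) * (hcomult H $$ (ix n a b, c) * F c))"
proof -
 have "ap (dual_mult ch H) (ix n a b) F = (\<Sum>c<n. dl c (%c1 c2. inverse (ch (g c2) (g c1)) * (if c1 = a then if c2 = b then F c else 0 else 0)))"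
 unfolding dual_mult_def Let_def using a b
 by (subst ap_adjunct) (simp_all add: ap_kron ap_kron2 braid_inv_eq[OF chi(1)] mult.assoc[symmetric] cong: if_cong)
 also have "... = (\<Sum>c<n. dl c (%c1 c2. if c1 = a then if c2 = b then inverse (ch (g b) (g a)) * F c else 0 else 0))"
 by (intro sum.cong sc_weak_cong refl) simp
 also have "... = (\<Sum>c<n. inverse (ch (g b) (g a)) * (hcomult H $$ (ix n a b, c) * F c))"
 using a b by (simp add: sc_single mult_ac)
 finally show ?thesis .
qed

lemma ap_dual_unit: "ap (dual_unit H) 0 F = (\<Sum>c<n. ep c * F c)"
 unfolding dual_unit_def by (subst ap_adjunct) simp_all

lemma ap_sum: "ap M c (%r. \<Sum>s\<in>S. F s r) = (\<Sum>s\<in>S. ap M c (%r. F s r))"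
 unfolding ap_def sum_distrib_left by (rule sum.swap)

lemma sc_sum: "sc p q M c (%a b. \<Sum>s\<in>S. F s a b) = (\<Sum>s\<in>S. sc p q M c (%a b. F s a b))"
 unfolding sc_flat sum_distrib_left by (rule sum.swap)

lemma dual_degree:
 assumes r: "r \<in> grhom (grdual A <&> V) V" and "a < n" "i < len V"
 and "!!j. j < len V ==> V ! i = V ! j + g a ==> F j = G j"
 shows "ap r (ix (len V) a i) F = ap r (ix (len V) a i) G"
proof (rule ap_grhom_cong[OF r])
 show "ix (len V) a i < len (grdual A <&> V)" using assms by simp
 fix j assume "j < len V" "V ! j = (grdual A <&> V) ! ix (len V) a i"
 then show "F j = G j" using assms(2,3) nth_grtensor[of a "grdual A" i V] by (intro assms(4)) simp_all
qed

text \<open>Both sides of coassociativity, and both sides of associativity of the action, are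
  expanded over pairs (b, c) of basis elements. The same weight appears on both sides, and testing
  on a single pair separates the summands.\<close>

lemma dual_action_iff:
 assumes r: "r \<in> grhom (grdual A <&> V) V"
 shows "is_action (grdual A) (dual_mult ch H) (dual_unit H) (shift x V) r \<longleftrightarrow> coaction V (lam V r)"
proof -
 let ?v = "len V" and ?l = "lam V r"
 have d: "drow r = ?v" "dcol r = n * ?v" using grhom_dims[OF r] by simp_all
 have rs: "r \<in> grhom (grdual A <&> shift x V) (shift x V)" using r by (simp add: grhom_shift_right)
 have l: "?l \<in> grhom V (V <&> A)" using dual_grhom_iff[OF d, of x] rs by simp
 let ?X = "%b c i F. ap r (ix ?v c i) (%j. ap r (ix ?v b j) F)"
 let ?Y = "%b c i F. ap (dual_mult ch H) (ix n b c) (%e. ap r (ix ?v e i) F)"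
 \<comment> \<open>The common weight, obtained after the degree of the intermediate vector, or of
   the element before comultiplication, is expressed through b, c and the final vector.\<close>
 let ?w = "%b c k. ch (g c) (g b) * ch (g c) (V ! k) * ch (g b) (V ! k)"
 have L: "sc ?v n ?l i (%j c. sc ?v n ?l j (%k b. G k b c)) = (\<Sum>c<n. \<Sum>b<n. ?X b c i (%k. ?w b c k * G k b c))"
 if i: "i < ?v" for i G
 proof -
 have "sc ?v n ?l i (%j c. sc ?v n ?l j (%k b. G k b c)) =
 (\<Sum>c<n. ap r (ix ?v c i) (%j. \<Sum>b<n. ch (g c) (V ! j) * ap r (ix ?v b j) (%k. ch (g b) (V ! k) * G k b c)))"
 using i d by (simp add: sc_lam sum_distrib_left)
 also have "... = (\<Sum>c<n. \<Sum>b<n. ap r (ix ?v c i) (%j. ap r (ix ?v b j) (%k. ch (g c) (V ! j) * (ch (g b) (V ! k) * G k b c))))"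
 by (simp add: ap_sum ap_scale)
 also have "... = (\<Sum>c<n. \<Sum>b<n. ?X b c i (%k. ?w b c k * G k b c))"
 proof (intro sum.cong refl)
 fix c b assume "b \<in> {..<n}"
 then have b: "b < n" by simp
 show "ap r (ix ?v c i) (%j. ap r (ix ?v b j) (%k. ch (g c) (V ! j) * (ch (g b) (V ! k) * G k b c))) = ?X b c i (%k. ?w b c k * G k b c)"
 by (rule ap_cong, rule dual_degree[OF r b]) (simp_all add: d chi mult_ac)
 qed
 finally show ?thesis .
 qed
 have R: "sc ?v n ?l i (%k e. dl e (%b c. G k b c)) = (\<Sum>c<n. \<Sum>b<n. ?Y b c i (%k. ?w b c k * G k b c))"
 if i: "i < ?v" for i G
 proof -
 have "sc ?v n ?l i (%k e. dl e (%b c. G k b c)) = (\<Sum>e<n. ap r (ix ?v e i) (%k. dl e (%b c. ch (g e) (V ! k) * G k b c)))"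
 using i d by (simp add: sc_lam sc_scale)
 also have "... = (\<Sum>e<n. ap r (ix ?v e i) (%k. dl e (%b c. inverse (ch (g c) (g b)) * (?w b c k * G k b c))))"
 by (intro sum.cong refl ap_cong, rule dl_degree) (simp_all add: chi)
 also have "... = (\<Sum>e<n. \<Sum>b<n. \<Sum>c<n. hcomult H $$ (ix n b c, e) * (inverse (ch (g c) (g b)) * ap r (ix ?v e i) (%k. ?w b c k * G k b c)))"
 unfolding sc_def ap_sum ap_scale ..
 also have "... = (\<Sum>b<n. \<Sum>e<n. \<Sum>c<n. hcomult H $$ (ix n b c, e) * (inverse (ch (g c) (g b)) * ap r (ix ?v e i) (%k. ?w b c k * G k b c)))"
 by (rule sum.swap)
 also have "... = (\<Sum>b<n. \<Sum>c<n. \<Sum>e<n. hcomult H $$ (ix n b c, e) * (inverse (ch (g c) (g b)) * ap r (ix ?v e i) (%k. ?w b c k * G k b c)))"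
 by (rule sum.cong[OF refl], rule sum.swap)
 also have "... = (\<Sum>b<n. \<Sum>c<n. ?Y b c i (%k. ?w b c k * G k b c))"
 by (intro sum.cong refl) (simp add: ap_dual_mult mult_ac)
 also have "... = (\<Sum>c<n. \<Sum>b<n. ?Y b c i (%k. ?w b c k * G k b c))" by (rule sum.swap)
 finally show ?thesis .
 qed
 have assoc: "(\<forall>b<n. \<forall>c<n. \<forall>i<?v. \<forall>F. ?Y b c i F = ?X b c i F) \<longleftrightarrow>
 (\<forall>i<?v. \<forall>F. sc ?v n ?l i (%j c. sc ?v n ?l j (%k b. F k b c)) = sc ?v n ?l i (%k a. dl a (%b c. F k b c)))"
 (is "?P \<longleftrightarrow> ?Q")
 proof
 assume ?P
 then show ?Q by (auto simp: L R intro!: sum.cong)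
 next
 assume Q: ?Q
 show ?P
 proof (intro allI impI)
 fix b c i and F :: "nat \<Rightarrow> 'k" assume b: "b < n" and c: "c < n" and i: "i < ?v"
 \<comment> \<open>The test functional lives on the single pair (b, c) and has the weight divided
   out.\<close>
 let ?G = "%k b' c'. if c' = c then if b' = b then inverse (?w b c k) * F k else 0 else 0"
 have wG: "?w b' c' k * ?G k b' c' = (if c' = c then if b' = b then F k else 0 else 0)" for b' c' k
 proof -
 have nz: "?w b c k ~= 0" by (simp add: chi)
 have "?w b c k * (inverse (?w b c k) * F k) = (?w b c k * inverse (?w b c k)) * F k" by (rule mult.assoc[symmetric])
 also have "... = F k" unfolding right_inverse[OF nz] by (rule mult_1_left)
 finally have "?w b c k * (inverse (?w b c k) * F k) = F k" .
 then show ?thesis by auto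
 qed
 have X: "(\<Sum>c'<n. \<Sum>b'<n. Z b' c' (%k. ?w b' c' k * ?G k b' c')) = Z b c F"
 if z: "!!b c. Z b c (%k. 0) = 0" for Z :: "nat \<Rightarrow> nat \<Rightarrow> (nat \<Rightarrow> 'k) \<Rightarrow> 'k"
 proof -
 have "(\<Sum>c'<n. \<Sum>b'<n. Z b' c' (%k. ?w b' c' k * ?G k b' c')) = (\<Sum>c'<n. \<Sum>b'<n. if c' = c then if b' = b then Z b c F else 0 else 0)"
 unfolding wG by (intro sum.cong refl) (auto simp: z)
 also have "... = (\<Sum>c'<n. if c' = c then Z b c F else 0)" using b by (intro sum.cong refl) simp
 finally show ?thesis using c by simp
 qed
 have "?Y b c i F = (\<Sum>c'<n. \<Sum>b'<n. ?Y b' c' i (%k. ?w b' c' k * ?G k b' c'))" by (rule X[symmetric]) simp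
 also have "... = (\<Sum>c'<n. \<Sum>b'<n. ?X b' c' i (%k. ?w b' c' k * ?G k b' c'))"
 unfolding L[OF i, symmetric] R[OF i, symmetric] using Q i by simp
 also have "... = ?X b c i F" by (rule X) simp
 finally show "?Y b c i F = ?X b c i F" .
 qed
 qed
 have unit: "ap (dual_unit H) 0 (%a. ap r (ix ?v a i) F) = sc ?v n ?l i (%j a. ep a * F j)" if i: "i < ?v" for i F
 proof -
 have "ep a * ap r (ix ?v a i) F = ap r (ix ?v a i) (%j. ch (g a) (V ! j) * (ep a * F j))" if a: "a < n" for a
 proof (cases "ep a = 0")
 case False
 then have "g a = 0" using ep_degree a by blast
 then show ?thesis by (simp add: chi ap_scale)
 qed simp
 then show ?thesis using i d by (simp add: ap_dual_unit sc_lam)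
 qed
 show ?thesis
 using is_action_iff[OF _ _ _ _ rs, of "dual_mult ch H" "dual_unit H"] assoc unit l
 unfolding coaction_def by simp
qed

end

section \<open>The anti-Yetter-Drinfeld equation in coordinates\<close>

context braided_hopf
begin

lemma ap_r_one:
 assumes "h < n" "c < n" "j < len N"
 shows "ap (r_one H N) (ix (len N) (ix n h c) j) F = (\<Sum>e<n. ml e h (%p. if p = c then F (ix (len N) e j) else 0))"
 unfolding r_one_def Let_def using assms
 by (subst ap_adjunct) (simp_all add: ap_kron ap_kron2 mult.assoc[symmetric] cong: if_cong)

lemma r_dims[simp]: "drow (r_one H N) = n * len N" "dcol (r_one H N) = n * n * len N"
 and r_zero_dims[simp]: "drow rh = len N ==> drow (r_zero ch H N rh) = n * len N" "dcol (r_zero ch H N rh) = n * n * len N"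
 by (simp_all add: r_one_def r_zero_def Let_def)

lemma ap_r_zero:
 assumes rh: "drow rh = len N" "dcol rh = n * len N" and h: "h < n" "b < n" "i < len N"
 shows "ap (r_zero ch H N rh) (ix (len N) (ix n h b) i) F = (\<Sum>c<n. ch (g c) (g h) * dl h (%h2 h3. an h3 (%s. ml s c (%p.
 if p = b then ap rh (ix (len N) h2 i) (%j. F (ix (len N) c j)) else 0))))"
 unfolding r_zero_def Let_def using assms
 by (subst ap_adjunct) (simp_all add: ap_kron ap_kron2 mult.assoc[symmetric] cong: if_cong)

lemma twist_E_dims[simp]: "drow (twist_E ch V N) = len V * len N" "dcol (twist_E ch V N) = len V * len N"
 by (simp_all add: twist_E_def minv_one_kron_twist[where ch = ch, OF chi(1)])

lemma ap_twist_E: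
 assumes "h < len V" "j < len N"
 shows "ap (twist_E ch V N) (ix (len N) h j) F =
 inverse (ch (V ! h + N ! j) (V ! h + N ! j)) * ch (N ! j) (N ! j) * F (ix (len N) h j)"
 unfolding twist_E_def using assms by (simp add: minv_one_kron_twist[where ch = ch, OF chi(1)] ap_kron ap_mat_diag)

text \<open>Of the three legs of h, the first multiplies on the right in \<open>r_one\<close>, the
  second acts on N, and the third is multiplied through the antipode onto c. The indicators come
  from evaluations against b and c.\<close>

lemma ap_act:
 assumes rh: "drow rh = len N" "dcol rh = n * len N" and h: "h < n" "b < n" "i < len N"
 shows "ap (act ch H N rh) (ix (len N) (ix n h b) i) F = dl h (%h1 h'. \<Sum>c<n. ch (g c) (g h') * dl h' (%h2 h3. an h3 (%s. ml s c (%p.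
 if p = b then ap rh (ix (len N) h2 i) (%j. inverse (ch (g h1 + (- g c + N ! j)) (g h1 + (- g c + N ! j))) * ch (- g c + N ! j) (- g c + N ! j) *
 (\<Sum>e<n. ml e h1 (%p. if p = c then F (ix (len N) e j) else 0))) else 0))))"
proof -
 have E: "ap (twist_E ch A (grdual A <&> N)) (ix (len N) (ix n h1 c) j) G =
 inverse (ch (g h1 + (- g c + N ! j)) (g h1 + (- g c + N ! j))) * ch (- g c + N ! j) (- g c + N ! j) * G (ix (len N) (ix n h1 c) j)"
 if "h1 < n" "c < n" "j < len N" for h1 c j G
 using ap_twist_E[of h1 A "ix (len N) c j" "grdual A <&> N" G] that nth_grtensor[of c "grdual A" j N] by simp
 show ?thesis
 unfolding act_def Let_def using assms
 by (simp add: ap_kron ap_kron2 ap_kron3 ap_r_zero E ap_r_one mult.assoc[symmetric] cong: if_cong)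
qed

lemma act_dims'[simp]: "drow (act ch H N rh) = n * len N" "dcol (act ch H N rh) = n * n * len N"
 by (simp_all add: act_def Let_def)

text \<open>Here u is an unshifted degree and u + e + x the shifted degree of the vector before the
  dual acts. The right side contains the scalar of \<open>twist_E\<close> in shifted degrees.
  Expanding it at y = u + x releases \<chi>(h, x)^-1 \<chi>(x, h)^-1, which is the inverse of
  \<open>om x h\<close>: this is why the shift by x absorbs the type.\<close>

lemma ayd_scalar:
 "ch e u * (inverse (om x h) * inverse (ch (u + e) h) * (ch (e + h) (h + p) * inverse (ch (e + h) u))) =
 ch (e + h) p * (inverse (ch (h + (- (e + h) + (u + e + x))) (h + (- (e + h) + (u + e + x)))) *
 ch (- (e + h) + (u + e + x)) (- (e + h) + (u + e + x)))"
proof -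
 define y where "y = u + x"
 have m: "- (e + h) + (u + e + x) = y - h" "h + (y - h) = y" by (simp_all add: y_def)
 have E: "inverse (ch y y) * ch (y - h) (y - h) = ch h h * inverse (ch h y) * inverse (ch y h)"
 by (simp add: chi field_simps)
 have "ch e u * (inverse (om x h) * inverse (ch (u + e) h) * (ch (e + h) (h + p) * inverse (ch (e + h) u))) =
 (ch e u * inverse (ch e u)) * (ch e h * inverse (ch e h)) * (ch (e + h) p * (ch h h * inverse (ch h y) * inverse (ch y h)))"
 unfolding y_def om_def by (simp only: chi(2,3) inverse_mult_distrib mult_ac)
 also have "... = ch (e + h) p * (ch h h * inverse (ch h y) * inverse (ch y h))"
 by (simp add: chi(1))
 finally show ?thesis unfolding m E .
qed

text \<open>After reducing to structure constants, both sides are sums over the same indices, and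
  their scalars agree by \<open>ayd_scalar\<close> wherever the structure constants are
  nonzero.\<close>

lemma ayd_condition:
 assumes V: "act_on V rh" and r: "r \<in> grhom (grdual A <&> V) V" and h: "h < n" "b < n" "i < len V"
 shows "ap (r * act ch H (shift x V) rh) (ix (len V) (ix n h b) i) F =
 ayd_right x V rh (lam V r) h i (%k p. if p = b then F k else 0)"
proof -
 let ?v = "len V" and ?N = "shift x V"
 have d: "drow r = ?v" "dcol r = n * ?v" using grhom_dims[OF r] by simp_all
 note drh = act_dims[OF V]
 \<comment> \<open>\<open>I e h1 c\<close> is the coefficient of c in e h1, and
   \<open>B h3 c\<close> is the coefficient of b in S(h3) c.\<close>
 define I where "I e h1 c = ml e h1 (%p. if p = c then 1 else 0)" for e h1 c
 define B where "B h3 c = an h3 (%s. I s c b)" for h3 c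
 let ?E = "%h1 c j. inverse (ch (g h1 + (- g c + ?N ! j)) (g h1 + (- g c + ?N ! j))) * ch (- g c + ?N ! j) (- g c + ?N ! j)"
 have ind: "ml e h1 (%p. if p = c then X else 0) = X * I e h1 c" for e h1 c X
 unfolding I_def ml_scale[symmetric] by (rule ml_cong) auto
 have B: "an h3 (%s. ml s c (%p. if p = b then X else 0)) = X * B h3 c" for h3 c X
 unfolding B_def by (simp only: ind ap_scale)
 have expand: "ml e h1 Z = (\<Sum>c<n. Z c * I e h1 c)" for e h1 Z
 proof -
 have "ml e h1 Z = ml e h1 (%p. \<Sum>c<n. if p = c then Z c else 0)"
 by (rule ml_cong) simp_all
 also have "... = (\<Sum>c<n. ml e h1 (%p. if p = c then Z c else 0))" unfolding ml_def by (rule ap_sum)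
 finally show ?thesis by (simp only: ind)
 qed
 have step: "(\<Sum>c<n. ch (g c) (g h2 + g h3) * (ap rh (ix ?v h2 i) (%j. ?E h1 c j * (\<Sum>e<n. ap r (ix ?v e j) F * I e h1 c)) * B h3 c)) =
 ap rh (ix ?v h2 i) (%i'. sc ?v n (lam V r) i' (%j a. inverse (om x (g h1)) * inverse (ch (V ! i') (g h1)) *
 ml a h1 (%c. ch (g c) (g h1 + (g h2 + g h3)) * inverse (ch (g c) (V ! j)) * (F j * B h3 c))))"
 if h1: "h1 < n" and h2: "h2 < n" and h3: "h3 < n" for h1 h2 h3
 proof -
 have "ap rh (ix ?v h2 i) (%i'. sc ?v n (lam V r) i' (%j a. inverse (om x (g h1)) * inverse (ch (V ! i') (g h1)) *
 ml a h1 (%c. ch (g c) (g h1 + (g h2 + g h3)) * inverse (ch (g c) (V ! j)) * (F j * B h3 c)))) =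
 ap rh (ix ?v h2 i) (%i'. \<Sum>e<n. ap r (ix ?v e i') (%j. \<Sum>c<n. ch (g e) (V ! j) * (inverse (om x (g h1)) * inverse (ch (V ! i') (g h1)) *
 (ch (g c) (g h1 + (g h2 + g h3)) * inverse (ch (g c) (V ! j)) * (F j * B h3 c) * I e h1 c))))"
 by (rule ap_cong) (simp add: sc_lam d drh expand sum_distrib_left)
 also have "... = ap rh (ix ?v h2 i) (%i'. \<Sum>e<n. ap r (ix ?v e i') (%j. \<Sum>c<n. ch (g c) (g h2 + g h3) * ?E h1 c i' * B h3 c * I e h1 c * F j))"
 proof (rule ap_cong, rule sum.cong[OF refl], rule dual_degree[OF r])
 fix i' e assume "e \<in> {..<n}" "i' < drow rh"
 then show l: "e < n" "i' < ?v" using drh by auto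
 fix j assume Vi: "V ! i' = V ! j + g e"
 show "(\<Sum>c<n. ch (g e) (V ! j) * (inverse (om x (g h1)) * inverse (ch (V ! i') (g h1)) *
 (ch (g c) (g h1 + (g h2 + g h3)) * inverse (ch (g c) (V ! j)) * (F j * B h3 c) * I e h1 c))) =
 (\<Sum>c<n. ch (g c) (g h2 + g h3) * ?E h1 c i' * B h3 c * I e h1 c * F j)"
 proof (rule sum.cong[OF refl])
 fix c assume "c \<in> {..<n}"
 show "ch (g e) (V ! j) * (inverse (om x (g h1)) * inverse (ch (V ! i') (g h1)) *
 (ch (g c) (g h1 + (g h2 + g h3)) * inverse (ch (g c) (V ! j)) * (F j * B h3 c) * I e h1 c)) =
 ch (g c) (g h2 + g h3) * ?E h1 c i' * B h3 c * I e h1 c * F j" (is "?L = ?R")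
 proof (cases "I e h1 c = 0")
 case False
 \<comment> \<open>A nonzero structure constant fixes the degree of c, which is the degree for which
   \<open>ayd_scalar\<close> is stated.\<close>
 then have gc: "g c = g e + g h1"
 proof (rule contrapos_np)
 assume ne: "g c ~= g e + g h1"
 have "I e h1 c = ml e h1 (%p. 0)" unfolding I_def by (rule ml_degree[OF l(1) h1]) (use ne in auto)
 then show "I e h1 c = 0" by simp
 qed
 have k: "ch (g e) (V ! j) * (inverse (om x (g h1)) * inverse (ch (V ! i') (g h1)) * (ch (g c) (g h1 + (g h2 + g h3)) * inverse (ch (g c) (V ! j)))) =
 ch (g c) (g h2 + g h3) * ?E h1 c i'"
 using ayd_scalar[of "g e" "V ! j" x "g h1" "g h2 + g h3"] l by (simp only: gc Vi nth_shift)
 have "?L = (ch (g e) (V ! j) * (inverse (om x (g h1)) * inverse (ch (V ! i') (g h1)) * (ch (g c) (g h1 + (g h2 + g h3)) * inverse (ch (g c) (V ! j))))) * (B h3 c * I e h1 c * F j)"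
 by (simp only: mult_ac)
 also have "... = ?R" unfolding k by (simp only: mult_ac)
 finally show ?thesis .
 qed simp
 qed
 qed
 also have "... = ap rh (ix ?v h2 i) (%i'. \<Sum>c<n. ch (g c) (g h2 + g h3) * (B h3 c * (?E h1 c i' * (\<Sum>e<n. ap r (ix ?v e i') F * I e h1 c))))"
 proof (rule ap_cong)
 fix i'
 have "(\<Sum>e<n. ap r (ix ?v e i') (%j. \<Sum>c<n. ch (g c) (g h2 + g h3) * ?E h1 c i' * B h3 c * I e h1 c * F j)) =
 (\<Sum>e<n. \<Sum>c<n. ch (g c) (g h2 + g h3) * ?E h1 c i' * B h3 c * I e h1 c * ap r (ix ?v e i') F)"
 by (simp only: ap_sum ap_scale)
 also have "... = (\<Sum>c<n. \<Sum>e<n. ch (g c) (g h2 + g h3) * ?E h1 c i' * B h3 c * I e h1 c * ap r (ix ?v e i') F)"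
 by (rule sum.swap)
 also have "... = (\<Sum>c<n. ch (g c) (g h2 + g h3) * (B h3 c * (?E h1 c i' * (\<Sum>e<n. ap r (ix ?v e i') F * I e h1 c))))"
 unfolding sum_distrib_left by (intro sum.cong refl) (simp only: mult_ac)
 finally show "(\<Sum>e<n. ap r (ix ?v e i') (%j. \<Sum>c<n. ch (g c) (g h2 + g h3) * ?E h1 c i' * B h3 c * I e h1 c * F j)) =
 (\<Sum>c<n. ch (g c) (g h2 + g h3) * (B h3 c * (?E h1 c i' * (\<Sum>e<n. ap r (ix ?v e i') F * I e h1 c))))" .
 qed
 also have "... = (\<Sum>c<n. ch (g c) (g h2 + g h3) * (B h3 c * ap rh (ix ?v h2 i) (%i'. ?E h1 c i' * (\<Sum>e<n. ap r (ix ?v e i') F * I e h1 c))))"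
 by (simp only: ap_sum ap_scale)
 also have "... = (\<Sum>c<n. ch (g c) (g h2 + g h3) * (ap rh (ix ?v h2 i) (%j. ?E h1 c j * (\<Sum>e<n. ap r (ix ?v e j) F * I e h1 c)) * B h3 c))"
 by (intro sum.cong refl) (simp only: mult_ac)
 finally show ?thesis ..
 qed
 have "ap (r * act ch H ?N rh) (ix ?v (ix n h b) i) F = ap (act ch H ?N rh) (ix (len ?N) (ix n h b) i) (%k. ap r k F)"
 using h d by simp
 also have "... = dl h (%h1 h'. \<Sum>c<n. ch (g c) (g h') * dl h' (%h2 h3. ap rh (ix ?v h2 i) (%j. ?E h1 c j * (\<Sum>e<n. ap r (ix ?v e j) F * I e h1 c)) * B h3 c))"
 using h drh by (subst ap_act) (simp_all only: length_shift B_def ind ap_scale)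
 also have "... = dl h (%h1 h'. dl h' (%h2 h3. \<Sum>c<n. ch (g c) (g h') * (ap rh (ix ?v h2 i) (%j. ?E h1 c j * (\<Sum>e<n. ap r (ix ?v e j) F * I e h1 c)) * B h3 c)))"
 by (simp only: sc_sum sc_scale)
 also have "... = dl h (%h1 h'. dl h' (%h2 h3. ap rh (ix ?v h2 i) (%i'. sc ?v n (lam V r) i' (%j a. inverse (om x (g h1)) * inverse (ch (V ! i') (g h1)) *
 ml a h1 (%c. ch (g c) (g h) * inverse (ch (g c) (V ! j)) * (F j * B h3 c))))))"
 proof (rule dl_degree[OF h(1)], rule dl_degree, assumption)
 fix h1 h' h2 h3 assume l: "h1 < n" "h2 < n" "h3 < n" and e: "g h = g h1 + g h'" "g h' = g h2 + g h3"
 show "(\<Sum>c<n. ch (g c) (g h') * (ap rh (ix ?v h2 i) (%j. ?E h1 c j * (\<Sum>e<n. ap r (ix ?v e j) F * I e h1 c)) * B h3 c)) =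
 ap rh (ix ?v h2 i) (%i'. sc ?v n (lam V r) i' (%j a. inverse (om x (g h1)) * inverse (ch (V ! i') (g h1)) *
 ml a h1 (%c. ch (g c) (g h) * inverse (ch (g c) (V ! j)) * (F j * B h3 c))))"
 unfolding e by (rule step[OF l])
 qed
 also have "... = dl h (%h' h3. dl h' (%h1 h2. ap rh (ix ?v h2 i) (%i'. sc ?v n (lam V r) i' (%j a. inverse (om x (g h1)) * inverse (ch (V ! i') (g h1)) *
 ml a h1 (%c. ch (g c) (g h) * inverse (ch (g c) (V ! j)) * (F j * B h3 c))))))"
 by (rule dl_coassoc[OF h(1), symmetric])
 also have "... = ayd_right x V rh (lam V r) h i (%k p. if p = b then F k else 0)"
 unfolding ayd_right_def yd_left_def B ..
 finally show ?thesis .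
qed

lemma ayd_condition_left:
 assumes V: "act_on V rh" and r: "r \<in> grhom (grdual A <&> V) V" and h: "h < n" "b < n" "i < len V"
 shows "ap (rh * (idm A <*> r)) (ix (len V) (ix n h b) i) F =
 ayd_left V rh (lam V r) h i (%k p. if p = b then F k else 0)"
proof -
 let ?v = "len V"
 have d: "drow r = ?v" "dcol r = n * ?v" using grhom_dims[OF r] by simp_all
 note drh = act_dims[OF V]
 have "ayd_left V rh (lam V r) h i (%k p. if p = b then F k else 0) =
 (\<Sum>a<n. ap r (ix ?v a i) (%j. ap rh (ix ?v h j) (%k. if a = b then F k else 0)))"
 unfolding ayd_left_def using h d by (simp add: sc_lam chi ap_scale[symmetric] mult.assoc[symmetric])
 also have "... = (\<Sum>a<n. if a = b then ap r (ix ?v a i) (%j. ap rh (ix ?v h j) F) else 0)"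
 by (intro sum.cong refl) auto
 finally show ?thesis using h d drh by (simp add: ap_kron ap_kron2 mult.assoc[symmetric])
qed

lemma yd_left_sum: "yd_left x V rh l h i (%k p. \<Sum>b\<in>B. F b k p) = (\<Sum>b\<in>B. yd_left x V rh l h i (F b))"
 unfolding yd_left_def ml_def by (simp only: ap_sum sc_sum sum_distrib_left)

lemma ayd_right_sum: "ayd_right x V rh l h i (%k p. \<Sum>b\<in>B. F b k p) = (\<Sum>b\<in>B. ayd_right x V rh l h i (F b))"
 unfolding ayd_right_def ml_def by (simp only: ap_sum sum_distrib_left yd_left_sum sc_sum)

lemma ayd_left_sum: "ayd_left V rh l h i (%k p. \<Sum>b\<in>B. F b k p) = (\<Sum>b\<in>B. ayd_left V rh l h i (F b))"
 unfolding ayd_left_def by (simp only: ap_sum sum_distrib_left sc_sum)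

text \<open>The module axioms are matched by \<open>dual_action_iff\<close>. The
  anti-Yetter-Drinfeld equation, tested on basis vectors, is \<open>ayd_left\<close> =
  \<open>ayd_right\<close>, which is equivalent to the compatibility in \<open>yd\<close>.\<close>

lemma aYD_iff_yd:
 assumes d: "drow r = len V" "dcol r = n * len V"
 shows "(shift x V, rh, r) \<in> Obj (aYD ch H) \<longleftrightarrow> yd x V rh (lam V r)"
proof -
 let ?l = "lam V r" and ?v = "len V"
 let ?D = "is_action (grdual A) (dual_mult ch H) (dual_unit H) (shift x V) r"
 have o: "(shift x V, rh, r) \<in> Obj (aYD ch H) \<longleftrightarrow> act_on V rh & ?D & rh * (idm A <*> r) = r * act ch H (shift x V) rh"
 by (simp add: aYD_def Let_def act_shift)
 have D: "?D \<longleftrightarrow> coaction V ?l"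
 proof (cases "r \<in> grhom (grdual A <&> V) V")
 case True then show ?thesis by (rule dual_action_iff)
 next
 case False
 then have "\<not> r \<in> grhom (grdual A <&> shift x V) (shift x V)" by (simp add: grhom_shift_right)
 moreover from this have "\<not> ?l \<in> grhom V (V <&> A)" using dual_grhom_iff[OF d] by blast
 ultimately show ?thesis unfolding is_action_def coaction_def by blast
 qed
 have "rh * (idm A <*> r) = r * act ch H (shift x V) rh \<longleftrightarrow> (\<forall>h<n. \<forall>i<?v. \<forall>F. yd_left x V rh ?l h i F = yd_right V rh ?l h i F)"
 if V: "act_on V rh" and l: "coaction V ?l"
 proof -
 have r: "r \<in> grhom (grdual A <&> V) V"
 using l dual_grhom_iff[OF d] unfolding coaction_def by (simp add: grhom_shift_right)
 note drh = act_dims[OF V]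
 have 1: "rh * (idm A <*> r) = r * act ch H (shift x V) rh \<longleftrightarrow> (\<forall>h<n. \<forall>i<?v. \<forall>F. ayd_left V rh ?l h i F = ayd_right x V rh ?l h i F)"
 proof
 assume e: "rh * (idm A <*> r) = r * act ch H (shift x V) rh"
 show "\<forall>h<n. \<forall>i<?v. \<forall>F. ayd_left V rh ?l h i F = ayd_right x V rh ?l h i F"
 proof (intro allI impI)
 fix h i and F :: "nat \<Rightarrow> nat \<Rightarrow> 'k" assume h: "h < n" and i: "i < ?v"
 \<comment> \<open>F is cut into pieces supported at one basis element b of A, for which the matrix
   equation speaks; linearity puts the pieces together again.\<close>
 let ?F = "%b k p. if p = b then F k b else 0"
 have b: "ayd_left V rh ?l h i (?F b) = ayd_right x V rh ?l h i (?F b)" if "b < n" for b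
 using ayd_condition[OF V r h that i, of x "%k. F k b"] ayd_condition_left[OF V r h that i, of "%k. F k b"] e by simp
 have "ayd_left V rh ?l h i F = ayd_left V rh ?l h i (%k p. \<Sum>b<n. ?F b k p)"
 unfolding ayd_left_def by (intro sc_weak_cong refl arg_cong2[where f = "(*)"] ap_cong) simp
 also have "... = ayd_right x V rh ?l h i (%k p. \<Sum>b<n. ?F b k p)"
 unfolding ayd_left_sum ayd_right_sum by (intro sum.cong refl b) simp
 also have "... = ayd_right x V rh ?l h i F"
 unfolding ayd_right_def yd_left_def by (intro sc_weak_cong refl arg_cong2[where f = "(*)"] ap_cong ml_cong) simp
 finally show "ayd_left V rh ?l h i F = ayd_right x V rh ?l h i F" .
 qed
 next
 assume e: "\<forall>h<n. \<forall>i<?v. \<forall>F. ayd_left V rh ?l h i F = ayd_right x V rh ?l h i F"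
 show "rh * (idm A <*> r) = r * act ch H (shift x V) rh"
 proof (rule kron_ap_eqI[where p = "n * n" and q = ?v])
 fix c i F assume "c < n * n" and i: "i < ?v"
 then obtain h b where "c = ix n h b" "h < n" "b < n" by (elim ix_decompose)
 then show "ap (rh * (idm A <*> r)) (ix ?v c i) F = ap (r * act ch H (shift x V) rh) (ix ?v c i) F"
 using e i by (simp only: ayd_condition[OF V r] ayd_condition_left[OF V r])
 qed (simp_all add: d drh)
 qed
 also have "... \<longleftrightarrow> (\<forall>h<n. \<forall>i<?v. \<forall>F. yd_left x V rh ?l h i F = yd_right V rh ?l h i F)"
 using ayd_of_yd[OF V l] yd_of_ayd[OF V l] by blast
 finally show ?thesis .
 qed
 then show ?thesis unfolding o D yd_def by blast
qed

end

section \<open>Morphisms, the embedding of anti-Yetter-Drinfeld modules, and its effect on the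
  stability map\<close>

context braided_hopf
begin

lemma HH_Hom: "Hom (HH C) (M, t) (N, u) = {f \<in> Hom C M N. \<forall>X\<in>Obj C. u X * (f <*> Idn C X) = (Idn C X <*> f) * t X}"
proof -
 have "(\<forall>X\<in>Obj C. u X * (f <*> Idn C X) = (Idn C (rsharp C X) <*> f) * t X) \<longleftrightarrow>
 (\<forall>X\<in>Obj C. u X * (f <*> Idn C X) = (Idn C X <*> f) * t X)" for f
 by (intro ball_cong refl) (simp only: sharp_eq Idn_tw)
 then show ?thesis by (simp add: HH_def)
qed

lemma half_braiding_unit_mat:
 assumes l: "coaction V l" and X: "X \<in> Obj C"
 shows "unit_mat (swm x V l (tw P X))" "drow (swm x V l (tw P X)) = len V * len (fst X)"
 "dcol (swm x V l (tw P X)) = len (fst X) * len V" "half_braiding x V l X = minv (swm x V l (tw P X))"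
 using tw_Obj(1)[OF X] unit_swm[OF l] swm_dims[OF l] X by (cases X; simp add: tw_def half_braiding_def)+

text \<open>\<open>swm\<close> is built from the coaction, which gives one direction. For the other,
  compatibility at the regular module is evaluated at the unit of H, where the half-braiding becomes
  the coaction.\<close>

lemma coaction_Hom_iff:
 assumes M: "yd x V rh l" and N: "yd x W sg k" and f: "f \<in> grhom V W"
 shows "(\<forall>X\<in>Obj C. half_braiding x W k X * (f <*> Idn C X) = (Idn C X <*> f) * half_braiding x V l X) \<longleftrightarrow>
 (f <*> idm A) * l = k * f"
proof
 have l: "coaction V l" and k: "coaction W k" using M N by (simp_all add: yd_def)
 note d = grhom_dims[OF f] coaction_dims[OF l] coaction_dims[OF k]
 {
 assume eq: "(f <*> idm A) * l = k * f"
 show "\<forall>X\<in>Obj C. half_braiding x W k X * (f <*> Idn C X) = (Idn C X <*> f) * half_braiding x V l X"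
 proof
 fix X assume X: "X \<in> Obj C"
 obtain U ta where PX: "tw P X = (U, ta)" by (cases "tw P X")
 have U: "act_on U ta" using tw_Obj(1)[OF X] PX by simp
 have XU: "fst X = U" "Idn C X = idm U" using PX by (cases X; simp add: tw_def)+
 note dU = act_dims[OF U]
 have "swm x W k (U, ta) * (idm U <*> f) = (idm W <*> ta) * ((k <*> idm U) * (ubr x U W * (idm U <*> f)))"
 by (simp add: swm_def mat_assoc d dU mult_ac)
 also have "ubr x U W * (idm U <*> f) = (f <*> idm U) * ubr x U V"
 by (rule ubr_natural[OF grhom_one f])
 also have "(idm W <*> ta) * ((k <*> idm U) * ((f <*> idm U) * ubr x U V)) =
 (idm W <*> ta) * ((((f <*> idm A) * l) <*> idm U) * ubr x U V)"
 by (subst mat_assoc[symmetric]) (simp_all add: kron_mult d eq)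
 also have "... = (idm W <*> ta) * (((f <*> idm A) <*> idm U) * ((l <*> idm U) * ubr x U V))"
 by (subst mat_assoc[symmetric]) (simp_all add: kron_mult d)
 also have "... = ((idm W <*> ta) * (f <*> idm (A <&> U))) * ((l <*> idm U) * ubr x U V)"
 by (subst mat_assoc) (simp_all add: kron_assoc d dU mult.assoc)
 also have "(idm W <*> ta) * (f <*> idm (A <&> U)) = (f <*> idm U) * (idm V <*> ta)"
 by (simp add: kron_mult d dU)
 finally have s: "swm x W k (tw P X) * (idm U <*> f) = (f <*> idm U) * swm x V l (tw P X)"
 unfolding PX by (simp add: swm_def mat_assoc d dU mult.assoc)
 show "half_braiding x W k X * (f <*> Idn C X) = (Idn C X <*> f) * half_braiding x V l X"
 unfolding half_braiding_unit_mat(4)[OF l X] half_braiding_unit_mat(4)[OF k X] XU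
 by (rule minv_natural[OF half_braiding_unit_mat(1)[OF l X] half_braiding_unit_mat(1)[OF k X] s])
 (simp_all add: half_braiding_unit_mat(2,3)[OF l X] half_braiding_unit_mat(2,3)[OF k X] d XU)
 qed
 }
 assume "\<forall>X\<in>Obj C. half_braiding x W k X * (f <*> Idn C X) = (Idn C X <*> f) * half_braiding x V l X"
 then have t: "half_braiding x W k X * (f <*> Idn C X) = (Idn C X <*> f) * half_braiding x V l X" if "X \<in> Obj C" for X
 using that by blast
 have A: "(A, hmult H) \<in> Obj C" using act_regular by simp
 have M': "((V, rh), half_braiding x V l) \<in> Obj (HH C)" and N': "((W, sg), half_braiding x W k) \<in> Obj (HH C)"
 by (rule HH_of_yd, fact)+
 note i = HH_inverse(1-3)[OF M' act_regular] HH_inverse(1-3)[OF N' act_regular]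
 have "minv (half_braiding x W k (tw Q (A, hmult H))) * (idm A <*> f) = (f <*> idm A) * minv (half_braiding x V l (tw Q (A, hmult H)))"
 by (rule minv_natural) (use t[OF tw_Obj(2)[OF A]] i d in \<open>simp_all add: Idn_tw\<close>)
 then have "minv (half_braiding x W k (tw Q (A, hmult H))) * (idm A <*> f) * (hunit H <*> idm V) =
 (f <*> idm A) * minv (half_braiding x V l (tw Q (A, hmult H))) * (hunit H <*> idm V)" by simp
 moreover have "(idm A <*> f) * (hunit H <*> idm V) = (hunit H <*> idm W) * f"
 using kron_mult[of "hunit H" "1\<^sub>m 1" "idm W" f] d by (simp add: kron_mult)
 ultimately have "coaction_of W (half_braiding x W k) * f = (f <*> idm A) * coaction_of V (half_braiding x V l)"
 unfolding coaction_of_def using unit_minv(1,2)[OF i(1)] unit_minv(1,2)[OF i(4)] i(2,3,5,6) d by (simp add: mat_assoc)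
 then show "(f <*> idm A) * l = k * f"
 by (simp add: coaction_of_half_braiding[OF l] coaction_of_half_braiding[OF k])
qed

text \<open>The scalar in \<open>lam\<close> depends only on a degree, and f preserves degrees, so
  the scalars on both sides cancel.\<close>

lemma dual_Hom_iff:
 assumes r: "r \<in> grhom (grdual A <&> V) V" and s: "s \<in> grhom (grdual A <&> W) W" and f: "f \<in> grhom V W"
 shows "f * r = s * (idm (grdual A) <*> f) \<longleftrightarrow> (f <*> idm A) * lam V r = lam W s * f"
proof -
 let ?v = "len V" and ?w = "len W"
 have d: "drow r = ?v" "dcol r = n * ?v" "drow s = ?w" "dcol s = n * ?w"
 using grhom_dims[OF r] grhom_dims[OF s] by simp_all
 note df = grhom_dims[OF f]
 have L: "ap ((f <*> idm A) * lam V r) i F = (\<Sum>a<n. ap r (ix ?v a i) (%j. ap f j (%k. ch (g a) (W ! k) * F (ix n k a))))" if i: "i < ?v" for i F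
 proof -
 have "ap ((f <*> idm A) * lam V r) i F = (\<Sum>a<n. ap r (ix ?v a i) (%j. ch (g a) (V ! j) * ap f j (%k. F (ix n k a))))"
 using i d df by (simp add: ap_sc[of "lam V r" ?v n] ap_kron sc_lam)
 also have "... = (\<Sum>a<n. ap r (ix ?v a i) (%j. ap f j (%k. ch (g a) (W ! k) * F (ix n k a))))"
 proof (rule sum.cong[OF refl], rule ap_cong)
 fix a j assume "j < drow r"
 then have j: "j < ?v" using d by simp
 show "ch (g a) (V ! j) * ap f j (%k. F (ix n k a)) = ap f j (%k. ch (g a) (W ! k) * F (ix n k a))"
 unfolding ap_scale[symmetric] by (rule ap_grhom_cong[OF f j]) simp
 qed
 finally show ?thesis .
 qed
 have R: "ap (lam W s * f) i F = (\<Sum>a<n. ap f i (%j. ap s (ix ?w a j) (%k. ch (g a) (W ! k) * F (ix n k a))))" if i: "i < ?v" for i F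
 using i d df by (simp add: ap_sc[of "lam W s" ?w n] sc_lam ap_sum)
 show ?thesis
 proof
 assume e: "f * r = s * (idm (grdual A) <*> f)"
 have e': "ap r (ix ?v a i) (%j. ap f j F) = ap f i (%j. ap s (ix ?w a j) F)" if "a < n" "i < ?v" for a i F
 using arg_cong[OF e, of "%M. ap M (ix ?v a i) F"] that d df by (simp add: ap_kron)
 show "(f <*> idm A) * lam V r = lam W s * f"
 proof (rule ap_eqI)
 fix i F assume "i < dcol (lam W s * f)"
 then have i: "i < ?v" using df by simp
 show "ap ((f <*> idm A) * lam V r) i F = ap (lam W s * f) i F"
 unfolding L[OF i] R[OF i] using i by (intro sum.cong refl e') auto
 qed (simp_all add: df)
 next
 assume e: "(f <*> idm A) * lam V r = lam W s * f"
 show "f * r = s * (idm (grdual A) <*> f)"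
 proof (rule kron_ap_eqI[where p = n and q = ?v])
 fix a i F assume a: "a < n" and i: "i < ?v"
 define G where "G q = (if q mod n = a then inverse (ch (g a) (W ! (q div n))) * F (q div n) else 0)" for q
 have G: "ch (g b) (W ! k) * G (ix n k b) = (if b = a then F k else 0)" if "b < n" for b k
 using that by (simp add: G_def chi)
 have "ap r (ix ?v a i) (%j. ap f j F) = (\<Sum>b<n. if b = a then ap r (ix ?v b i) (%j. ap f j F) else 0)" using a by simp
 also have "... = (\<Sum>b<n. ap r (ix ?v b i) (%j. ap f j (%k. ch (g b) (W ! k) * G (ix n k b))))"
 by (intro sum.cong refl) (auto simp: G)
 also have "... = (\<Sum>b<n. ap f i (%j. ap s (ix ?w b j) (%k. ch (g b) (W ! k) * G (ix n k b))))"
 unfolding L[OF i, symmetric] R[OF i, symmetric] e ..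
 also have "... = (\<Sum>b<n. if b = a then ap f i (%j. ap s (ix ?w b j) F) else 0)"
 by (intro sum.cong refl) (auto simp: G)
 finally show "ap (f * r) (ix ?v a i) F = ap (s * (idm (grdual A) <*> f)) (ix ?v a i) F"
 using a i d df by (simp add: ap_kron)
 qed (simp_all add: d df)
 qed
qed

lemma aYD_grhom:
 assumes "(N, rh, r) \<in> Obj (aYD ch H)"
 shows "act_on N rh" "r \<in> grhom (grdual A <&> N) N" "drow r = len N" "dcol r = n * len N"
proof -
 show "act_on N rh" and r: "r \<in> grhom (grdual A <&> N) N"
 using assms by (simp_all add: aYD_def Let_def) (simp add: is_action_def)
 show "drow r = len N" "dcol r = n * len N" using grhom_dims[OF r] by simp_all
qed

text \<open>The functor into the summand of type \<open>x\<close> of the center is a shift of degrees on objects and the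
 identity on matrices.\<close>

definition center_obj :: "'g \<Rightarrow> 'g list \<times> 'k mat \<times> 'k mat \<Rightarrow> ('g list \<times> 'k mat) \<times> ('g list \<times> 'k mat \<Rightarrow> 'k mat)" where
 "center_obj x = (%(N, rh, r). ((shift (- x) N, rh), half_braiding x (shift (- x) N) (lam (shift (- x) N) r)))"

lemma yd_of_aYD:
 assumes "(N, rh, r) \<in> Obj (aYD ch H)"
 shows "yd x (shift (- x) N) rh (lam (shift (- x) N) r)"
 using aYD_iff_yd[of r "shift (- x) N" x rh] assms aYD_grhom[OF assms] by simp

lemma center_obj_HH: "a \<in> Obj (aYD ch H) ==> center_obj x a \<in> Obj (HH C)"
 by (cases a) (simp add: center_obj_def HH_of_yd yd_of_aYD)

lemma center_obj_Hom:
 assumes a: "a \<in> Obj (aYD ch H)" and b: "b \<in> Obj (aYD ch H)"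
 shows "Hom (HH C) (center_obj x a) (center_obj x b) = Hom (aYD ch H) a b"
proof -
 obtain N rh r where a': "a = (N, rh, r)" by (cases a)
 obtain K sg s where b': "b = (K, sg, s)" by (cases b)
 let ?V = "shift (- x) N" and ?W = "shift (- x) K"
 note ra = aYD_grhom[OF a[unfolded a']] and rb = aYD_grhom[OF b[unfolded b']]
 have r: "r \<in> grhom (grdual A <&> ?V) ?V" and s: "s \<in> grhom (grdual A <&> ?W) ?W"
 using ra(2) rb(2) by (simp_all add: grhom_shift_right)
 have "f \<in> Hom (HH C) (center_obj x a) (center_obj x b) \<longleftrightarrow> f \<in> Hom (aYD ch H) a b" for f
 proof (cases "f \<in> grhom ?V ?W")
 case f: True
 then have fN: "f \<in> grhom N K" by (simp add: grhom_shift)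
 show ?thesis
 using coaction_Hom_iff[OF yd_of_aYD[OF a[unfolded a']] yd_of_aYD[OF b[unfolded b']] f] dual_Hom_iff[OF r s f] f fN
 unfolding center_obj_def a' b' by (simp add: HH_Hom aYD_def Let_def)
 next
 case False
 then show ?thesis by (simp add: a' b' center_obj_def HH_Hom aYD_def Let_def grhom_shift)
 qed
 then show ?thesis by blast
qed

lemma center_obj_surj:
 assumes M: "((V, rh), t) \<in> Obj (HH C)" and x: "has_type x V t"
 obtains a where "a \<in> Obj (aYD ch H)" "center_obj x a = ((V, rh), t)"
proof
 let ?l = "coaction_of V t"
 let ?a = "(shift x V, rh, del V ?l)"
 note y = yd_of_HH[OF M x]
 have l: "lam V (del V ?l) = ?l" using y(1) coaction_dims[of V ?l] by (intro lam_del) (simp_all add: yd_def)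
 show "?a \<in> Obj (aYD ch H)" using aYD_iff_yd[of "del V ?l" V x rh] y(1) l by simp
 show "center_obj x ?a = ((V, rh), t)" by (simp add: center_obj_def l y(2)[symmetric])
qed

lemma center_obj_type: "a \<in> Obj (aYD ch H) ==> has_type x (shift (- x) (fst a)) (snd (center_obj x a))"
 by (cases a) (auto simp: center_obj_def intro!: half_braiding_type dest!: yd_of_aYD[of _ _ _ x] simp: yd_def)


lemma swapped_eq:
 assumes M: "((V, rh), t) \<in> Obj (HH C)" and X: "act_on W sg"
 shows "swapped C (V, rh) t (W, sg) = minv (t (tw Q (W, sg)))"
proof -
 have X': "(W, sg) \<in> Obj C" using X by simp
 obtain sg' where QX: "tw Q (W, sg) = (W, sg')" by (simp add: tw_def)
 note i = HH_inverse[OF M X] and u = unit_minv[OF HH_inverse(1)[OF M X]]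
 show ?thesis unfolding swapped_def inv_arrow_def sharp_eq(2)[OF X']
 proof (rule the_equality)
 show "inverse_arrows C (tenO C (V, rh) (tw Q (W, sg))) (tenO C (W, sg) (V, rh)) (t (tw Q (W, sg))) (minv (t (tw Q (W, sg))))"
 unfolding inverse_arrows_def using i(4,5) u i(2,3) by (simp add: QX)
 next
 fix h assume h: "inverse_arrows C (tenO C (V, rh) (tw Q (W, sg))) (tenO C (W, sg) (V, rh)) (t (tw Q (W, sg))) h"
 then have "h \<in> grhom (W <&> V) (V <&> W)" by (simp add: inverse_arrows_def QX)
 from grhom_dims[OF this] h i(2,3) show "h = minv (t (tw Q (W, sg)))"
 by (intro minv_eqI[symmetric]) (simp_all add: inverse_arrows_def QX)
 qed
qed

lemma sigma_HH_expand:
 assumes M: "((V, rh), t) \<in> Obj (HH C)"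
 shows "sigma_HH C ((V, rh), t) = (idm V <*> evm (grdual V)) * (minv (t (tw Q (V, rh))) <*> idm V) * (idm V <*> coevm V)"
 and "drow (sigma_HH C ((V, rh), t)) = len V" "dcol (sigma_HH C ((V, rh), t)) = len V"
proof -
 have V: "act_on V rh" using M unfolding HH_Obj by simp
 show e: "sigma_HH C ((V, rh), t) = (idm V <*> evm (grdual V)) * (minv (t (tw Q (V, rh))) <*> idm V) * (idm V <*> coevm V)"
 by (simp add: sigma_HH_def swapped_eq[OF M V])
 show "drow (sigma_HH C ((V, rh), t)) = len V" "dcol (sigma_HH C ((V, rh), t)) = len V"
 unfolding e by simp_all
qed

text \<open>Coevaluation and evaluation close up the second tensor factor: the stability map is a
  partial trace of the inverse half-braiding on M \<otimes> M.\<close>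

lemma sigma_HH_eq:
 assumes M: "((V, rh), t) \<in> Obj (HH C)" and i: "i < len V"
 shows "ap (sigma_HH C ((V, rh), t)) i F =
 (\<Sum>k<len V. ap (minv (t (tw Q (V, rh)))) (ix (len V) i k) (%r. if r mod len V = k then F (r div len V) else 0))"
proof -
 let ?v = "len V"
 have V: "act_on V rh" using M unfolding HH_Obj by simp
 note d = unit_minv(1,2)[OF HH_inverse(1)[OF M V]] HH_inverse(2,3)[OF M V]
 have "ap (sigma_HH C ((V, rh), t)) i F =
 (\<Sum>k<?v. ap (minv (t (tw Q (V, rh)))) (ix ?v i k) (%r. ap (idm V <*> evm (grdual V)) (ix ?v r k) F))"
 unfolding sigma_HH_expand(1)[OF M] using i d by (simp add: ap_kron ap_kron2 ap_kron_scalar_right mult.assoc)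
 also have "... = (\<Sum>k<?v. ap (minv (t (tw Q (V, rh)))) (ix ?v i k) (%r. if r mod ?v = k then F (r div ?v) else 0))"
 proof (rule sum.cong[OF refl], rule ap_cong)
 fix k r assume "k \<in> {..<?v}" "r < drow (minv (t (tw Q (V, rh))))"
 then obtain j q where "r = ix ?v j q" "j < ?v" "q < ?v" "k < ?v" using d by (metis ix_decompose lessThan_iff)
 moreover have "ap (evm (grdual V)) (ix ?v q k) (%p. F (ix (Suc 0) j p)) = (if q = k then F j else 0)"
 if "q < ?v" "k < ?v" for q k j
 using ap_evm[of q "grdual V" k "%p. F (ix (Suc 0) j p)"] that by (simp add: ix_def cong: if_cong)
 ultimately show "ap (idm V <*> evm (grdual V)) (ix ?v r k) F = (if r mod ?v = k then F (r div ?v) else 0)"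
 by (simp add: ap_kron2)
 qed
 finally show "ap (sigma_HH C ((V, rh), t)) i F =
 (\<Sum>k<?v. ap (minv (t (tw Q (V, rh)))) (ix ?v i k) (%r. if r mod ?v = k then F (r div ?v) else 0))" .
qed

text \<open>A summand survives only if \<open>?V ! k\<close> = b + v with v = \<open>?V ! i\<close>.
  There its scalar is (\<omega>(x, v) \<theta>(v))^-1 = \<theta>(x) \<theta>(v + x)^-1, and v + x is
  the degree \<open>N ! i\<close>, so \<theta>(x) is left besides the twist.\<close>

lemma sigma_center_obj:
 assumes a: "a \<in> Obj (aYD ch H)"
 shows "sigma_HH C (center_obj x a) = ch x x \<cdot>\<^sub>m sigma_aYD ch H a"
proof -
 obtain N rh r where a': "a = (N, rh, r)" by (cases a)
 let ?V = "shift (- x) N" and ?v = "len N"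
 let ?l = "lam ?V r"
 note ra = aYD_grhom[OF a[unfolded a']]
 have V: "act_on ?V rh" using ra(1) by (simp add: act_shift)
 have r: "r \<in> grhom (grdual A <&> ?V) ?V" using ra(2) by (simp add: grhom_shift_right)
 have yd: "yd x ?V rh ?l" by (rule yd_of_aYD[OF a[unfolded a']])
 then have l: "coaction ?V ?l" by (simp add: yd_def)
 have M: "((?V, rh), half_braiding x ?V ?l) \<in> Obj (HH C)" by (rule HH_of_yd[OF yd])
 have c: "center_obj x a = ((?V, rh), half_braiding x ?V ?l)" by (simp add: center_obj_def a')
 have s: "minv (half_braiding x ?V ?l (tw Q (?V, rh))) = swm x ?V ?l (?V, rh)"
 using HH_formula[OF M half_braiding_type[OF l] V] by (simp add: coaction_of_half_braiding[OF l])
 note drh = act_dims[OF V]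
 have sd: "drow (sigma_aYD ch H a) = ?v" "dcol (sigma_aYD ch H a) = ?v"
 using ra drh by (simp_all add: sigma_aYD_def a')
 show ?thesis unfolding c
 proof (rule ap_eqI)
 fix i F assume "i < dcol (ch x x \<cdot>\<^sub>m sigma_aYD ch H a)"
 then have i: "i < ?v" using sd by simp
 have lhs: "ap (sigma_HH C ((?V, rh), half_braiding x ?V ?l)) i F =
 (\<Sum>k<?v. inverse (om x (?V ! i) * ch (?V ! k) (?V ! i)) * (\<Sum>b<n. ap r (ix ?v b k) (%j. ch (g b) (?V ! j) *
 ap rh (ix ?v b i) (%q. if q = k then F j else 0))))"
 proof -
 have "ap (swm x ?V ?l (?V, rh)) (ix ?v i k) (%r. if r mod ?v = k then F (r div ?v) else 0) =
 inverse (om x (?V ! i) * ch (?V ! k) (?V ! i)) * (\<Sum>b<n. ap r (ix ?v b k) (%j. ch (g b) (?V ! j) *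
 ap rh (ix ?v b i) (%q. if q = k then F j else 0)))" if k: "k < ?v" for k
 using ap_swm[of ?l ?V rh ?V i k x "%r. if r mod ?v = k then F (r div ?v) else 0"] i k drh ra sc_lam[of r ?V k]
 by (simp cong: if_cong del: nth_shift)
 then show ?thesis unfolding sigma_HH_eq[OF M, unfolded length_shift, OF i] s by (intro sum.cong[OF refl]) (simp only: lessThan_iff)
 qed
 have summand: "inverse (om x (?V ! i) * ch (?V ! k) (?V ! i)) * ap r (ix ?v b k) (%j. ch (g b) (?V ! j) * ap rh (ix ?v b i) (%q. if q = k then F j else 0)) =
 ch x x * (inverse (ch (N ! i) (N ! i)) * ap rh (ix ?v b i) (%q. if q = k then ap r (ix ?v b k) F else 0))"
 if b: "b < n" and k: "k < ?v" for b k
 proof (cases "?V ! k = g b + ?V ! i")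
 case False
 have "ap rh (ix ?v b i) (%q. if q = k then X else 0) = 0" for X
 
 by (rule trans[OF act_degree[OF V b, unfolded length_shift, of i _ "%q. 0"]]) (use i False in \<open>auto simp del: nth_shift\<close>)
 then show ?thesis by simp
 next
 case True
 \<comment> \<open>The expression is linear in X; K is its coefficient, which can then be moved past
   the action of the dual.\<close>
 obtain K where K: "ap rh (ix ?v b i) (%q. if q = k then X else 0) = X * K" for X
 proof
 show "ap rh (ix ?v b i) (%q. if q = k then X else 0) = X * ap rh (ix ?v b i) (%q. if q = k then 1 else 0)" for X
 unfolding ap_scale[symmetric] by (rule ap_cong) simp
 qed
 have "ap r (ix ?v b k) (%j. ch (g b) (?V ! j) * (F j * K)) = ap r (ix ?v b k) (%j. (ch (g b) (?V ! i) * K) * F j)"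
 using dual_degree[OF r b, of k "%j. ch (g b) (?V ! j) * (F j * K)" "%j. (ch (g b) (?V ! i) * K) * F j"] k True
 by (simp add: add.commute)
 then have "inverse (om x (?V ! i) * ch (?V ! k) (?V ! i)) * ap r (ix ?v b k) (%j. ch (g b) (?V ! j) * (F j * K)) =
 (inverse (om x (?V ! i) * ch (?V ! k) (?V ! i)) * ch (g b) (?V ! i)) * (K * ap r (ix ?v b k) F)"
 by (simp only: ap_scale mult.assoc)
 also have "inverse (om x (?V ! i) * ch (?V ! k) (?V ! i)) * ch (g b) (?V ! i) = inverse (om x (?V ! i) * ch (?V ! i) (?V ! i))"
 unfolding True by (simp add: chi om_simps)
 also have "... = ch x x * inverse (ch (N ! i) (N ! i))"
 proof -
 have "inverse (om x v * ch v v) = ch x x * inverse (ch (v + x) (v + x))" for v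
 proof -
 have "inverse (p * q * s) = c * inverse (s * q' * (p' * c))" if "c ~= 0" "p' = p" "q' = q" for p q s c p' q' :: 'k
 using that by simp
 from this[OF chi(1) refl refl] show ?thesis unfolding om_def chi(2,3) by (simp only: mult_ac)
 qed
 from this[of "N ! i + - x"] show ?thesis by (simp only: nth_shift[OF i] add.assoc left_minus add_0_right)
 qed
 finally show ?thesis unfolding K by (simp only: mult_ac)
 qed
 have "ap (ch x x \<cdot>\<^sub>m sigma_aYD ch H a) i F = ch x x * (inverse (ch (N ! i) (N ! i)) * (\<Sum>b<n. ap rh (ix ?v b i) (%k. ap r (ix ?v b k) F)))"
 using i ra drh unfolding sigma_aYD_def a' by (simp add: ap_kron ap_kron2 ap_kron_scalar_left mult.assoc[symmetric])
 also have "... = (\<Sum>b<n. \<Sum>k<?v. ch x x * (inverse (ch (N ! i) (N ! i)) * ap rh (ix ?v b i) (%q. if q = k then ap r (ix ?v b k) F else 0)))"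
 proof -
 have "ap rh (ix ?v b i) (%k. ap r (ix ?v b k) F) = (\<Sum>k<?v. ap rh (ix ?v b i) (%q. if q = k then ap r (ix ?v b k) F else 0))" for b
 unfolding ap_sum[symmetric] by (rule ap_cong) (use drh in simp)
 then show ?thesis by (simp add: sum_distrib_left)
 qed
 also have "... = (\<Sum>k<?v. \<Sum>b<n. ch x x * (inverse (ch (N ! i) (N ! i)) * ap rh (ix ?v b i) (%q. if q = k then ap r (ix ?v b k) F else 0)))"
 by (rule sum.swap)
 also have "... = ap (sigma_HH C ((?V, rh), half_braiding x ?V ?l)) i F"
 unfolding lhs sum_distrib_left by (intro sum.cong refl) (simp only: summand lessThan_iff)
 finally show "ap (sigma_HH C ((?V, rh), half_braiding x ?V ?l)) i F = ap (ch x x \<cdot>\<^sub>m sigma_aYD ch H a) i F" ..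
 qed (use sd sigma_HH_expand(2,3)[OF M] in \<open>simp_all\<close>)
qed

end

section \<open>An equivalence criterion\<close>

text \<open>Only closure of the Hom sets. In the domain D of the functor, equations are verified
  after applying a faithful functor into a category with all laws.\<close>

locale lin_category =
 fixes C :: "('o, 'm, 'k) lincat"
 assumes Idn_Hom: "X \<in> Obj C ==> Idn C X \<in> Hom C X X"
 and Cmp_Hom: "X \<in> Obj C ==> Y \<in> Obj C ==> Z \<in> Obj C ==> f \<in> Hom C X Y ==> g \<in> Hom C Y Z ==> Cmp C g f \<in> Hom C X Z"
 and Add_Hom: "X \<in> Obj C ==> Y \<in> Obj C ==> f \<in> Hom C X Y ==> f' \<in> Hom C X Y ==> Add C f f' \<in> Hom C X Y"
 and Scl_Hom: "X \<in> Obj C ==> Y \<in> Obj C ==> f \<in> Hom C X Y ==> Scl C c f \<in> Hom C X Y"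

locale lin_category_laws = lin_category C for C :: "('o, 'm, 'k) lincat" +
 assumes Idn_left: "X \<in> Obj C ==> Y \<in> Obj C ==> f \<in> Hom C X Y ==> Cmp C (Idn C Y) f = f"
 and Idn_right: "X \<in> Obj C ==> Y \<in> Obj C ==> f \<in> Hom C X Y ==> Cmp C f (Idn C X) = f"
 and assoc: "X \<in> Obj C ==> Y \<in> Obj C ==> Z \<in> Obj C ==> W \<in> Obj C ==>
 f \<in> Hom C X Y ==> g \<in> Hom C Y Z ==> h \<in> Hom C Z W ==> Cmp C (Cmp C h g) f = Cmp C h (Cmp C g f)"
 and Add_left: "X \<in> Obj C ==> Y \<in> Obj C ==> Z \<in> Obj C ==> f \<in> Hom C X Y ==> f' \<in> Hom C X Y ==> g \<in> Hom C Y Z ==>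
 Cmp C g (Add C f f') = Add C (Cmp C g f) (Cmp C g f')"
 and Add_right: "X \<in> Obj C ==> Y \<in> Obj C ==> Z \<in> Obj C ==> f \<in> Hom C X Y ==> g \<in> Hom C Y Z ==> g' \<in> Hom C Y Z ==>
 Cmp C (Add C g g') f = Add C (Cmp C g f) (Cmp C g' f)"
 and Scl_left: "X \<in> Obj C ==> Y \<in> Obj C ==> Z \<in> Obj C ==> f \<in> Hom C X Y ==> g \<in> Hom C Y Z ==>
 Cmp C g (Scl C c f) = Scl C c (Cmp C g f)"
 and Scl_right: "X \<in> Obj C ==> Y \<in> Obj C ==> Z \<in> Obj C ==> f \<in> Hom C X Y ==> g \<in> Hom C Y Z ==>
 Cmp C (Scl C c g) f = Scl C c (Cmp C g f)"
begin

text \<open>The functor back conjugates an arrow by chosen isomorphisms and takes the unique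
  preimage; its functoriality and linearity are checked through faithfulness of G.\<close>

lemma equivalence_criterion:
 fixes D :: "('p, 'n, 'k) lincat"
 assumes D: "lin_category D" and G: "linear_functor D C Go Gm"
 and ff: "!!X Y h. X \<in> Obj D ==> Y \<in> Obj D ==> h \<in> Hom C (Go X) (Go Y) ==> \<exists>!f. f \<in> Hom D X Y & Gm X Y f = h"
 and es: "!!X. X \<in> Obj C ==> \<exists>d \<in> Obj D. \<exists>u v. inverse_arrows C X (Go d) v u"
 shows "linearly_equivalent C D"
proof -
 interpret D: lin_category D by (rule D)
 obtain d v u where duv: "!!X. X \<in> Obj C ==> d X \<in> Obj D & inverse_arrows C X (Go (d X)) (v X) (u X)"
 using es by metis
 have d: "d X \<in> Obj D" "v X \<in> Hom C X (Go (d X))" "u X \<in> Hom C (Go (d X)) X"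
 "Cmp C (u X) (v X) = Idn C X" "Cmp C (v X) (u X) = Idn C (Go (d X))" if "X \<in> Obj C" for X
 using duv[OF that] by (auto simp: inverse_arrows_def)
 have Go: "Go X \<in> Obj C" if "X \<in> Obj D" for X using G that by (simp add: linear_functor_def)
 have Gm: "Gm X Y f \<in> Hom C (Go X) (Go Y)" if "X \<in> Obj D" "Y \<in> Obj D" "f \<in> Hom D X Y" for X Y f
 using G that by (simp add: linear_functor_def)
 have GI: "Gm X X (Idn D X) = Idn C (Go X)" if "X \<in> Obj D" for X using G that by (simp add: linear_functor_def)
 have GC: "Gm X Z (Cmp D g f) = Cmp C (Gm Y Z g) (Gm X Y f)"
 if "X \<in> Obj D" "Y \<in> Obj D" "Z \<in> Obj D" "f \<in> Hom D X Y" "g \<in> Hom D Y Z" for X Y Z f g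
 using G that by (simp add: linear_functor_def)
 have GA: "Gm X Y (Add D f g) = Add C (Gm X Y f) (Gm X Y g)"
 if "X \<in> Obj D" "Y \<in> Obj D" "f \<in> Hom D X Y" "g \<in> Hom D X Y" for X Y f g
 using G that by (simp add: linear_functor_def)
 have GS: "Gm X Y (Scl D c f) = Scl C c (Gm X Y f)"
 if "X \<in> Obj D" "Y \<in> Obj D" "f \<in> Hom D X Y" for X Y f c
 using G that by (simp add: linear_functor_def)
 have inj: "f = g" if "X \<in> Obj D" "Y \<in> Obj D" "f \<in> Hom D X Y" "g \<in> Hom D X Y" "Gm X Y f = Gm X Y g" for X Y f g
 using ff[OF that(1,2) Gm[OF that(1-3)]] that by metis
 \<comment> \<open>The inverse of G on Hom sets.\<close>
 define L where "L X Y h = (THE f. f \<in> Hom D X Y & Gm X Y f = h)" for X Y h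
 have L: "L X Y h \<in> Hom D X Y" "Gm X Y (L X Y h) = h" if "X \<in> Obj D" "Y \<in> Obj D" "h \<in> Hom C (Go X) (Go Y)" for X Y h
 using theI'[OF ff[OF that]] by (auto simp: L_def)
 \<comment> \<open>Conjugation by the chosen isomorphisms between X and its model
   \<open>Go (d X)\<close>.\<close>
 define h where "h X Y f = Cmp C (v Y) (Cmp C f (u X))" for X Y f
 have h: "h X Y f \<in> Hom C (Go (d X)) (Go (d Y))" if "X \<in> Obj C" "Y \<in> Obj C" "f \<in> Hom C X Y" for X Y f
 unfolding h_def using that by (meson Cmp_Hom d Go)
 have hG: "h Y Z (Cmp C g f) = Cmp C (h Y' Z g) (h Y Y' f)"
 if "Y \<in> Obj C" "Y' \<in> Obj C" "Z \<in> Obj C" "f \<in> Hom C Y Y'" "g \<in> Hom C Y' Z" for Y Y' Z f g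
 proof -
 note o = that(1-3) Go[OF d(1)[OF that(1)]] Go[OF d(1)[OF that(2)]] Go[OF d(1)[OF that(3)]]
 note a = d(2,3)[OF that(1)] d(2,3)[OF that(2)] d(2,3)[OF that(3)] that(4,5)
 have fu: "Cmp C f (u Y) \<in> Hom C (Go (d Y)) Y'" by (rule Cmp_Hom[OF o(4) o(1) o(2)]) (rule a)+
 have vfu: "Cmp C (v Y') (Cmp C f (u Y)) \<in> Hom C (Go (d Y)) (Go (d Y'))" by (rule Cmp_Hom[OF o(4) o(2) o(5) fu]) (rule a)
 have gu: "Cmp C g (u Y') \<in> Hom C (Go (d Y')) Z" by (rule Cmp_Hom[OF o(5) o(2) o(3)]) (rule a)+
 have "Cmp C (h Y' Z g) (h Y Y' f) = Cmp C (v Z) (Cmp C (Cmp C g (u Y')) (Cmp C (v Y') (Cmp C f (u Y))))"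
 unfolding h_def by (rule assoc[OF o(4) o(5) o(3) o(6) vfu gu]) (rule a)
 also have "Cmp C (Cmp C g (u Y')) (Cmp C (v Y') (Cmp C f (u Y))) = Cmp C g (Cmp C (u Y') (Cmp C (v Y') (Cmp C f (u Y))))"
 by (rule assoc[OF o(4) o(5) o(2) o(3) vfu]) (rule a)+
 also have "Cmp C (u Y') (Cmp C (v Y') (Cmp C f (u Y))) = Cmp C (Cmp C (u Y') (v Y')) (Cmp C f (u Y))"
 by (rule assoc[OF o(4) o(2) o(5) o(2) fu, symmetric]) (rule a)+
 also have "... = Cmp C f (u Y)" unfolding d(4)[OF that(2)] by (rule Idn_left[OF o(4) o(2) fu])
 also have "Cmp C g (Cmp C f (u Y)) = Cmp C (Cmp C g f) (u Y)"
 by (rule assoc[OF o(4) o(1) o(2) o(3), symmetric]) (rule a)+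
 finally show ?thesis by (simp add: h_def)
 qed
 have hI: "h X X (Idn C X) = Idn C (Go (d X))" if X: "X \<in> Obj C" for X
 unfolding h_def using Idn_left[OF Go[OF d(1)[OF X]] X d(3)[OF X]] d(5)[OF X] by simp
 have hA: "h X Y (Add C f g) = Add C (h X Y f) (h X Y g)" and hS: "h X Y (Scl C c f) = Scl C c (h X Y f)"
 if "X \<in> Obj C" "Y \<in> Obj C" "f \<in> Hom C X Y" "g \<in> Hom C X Y" for X Y f g c
 proof -
 note X = Go[OF d(1)[OF that(1)]] and Y = Go[OF d(1)[OF that(2)]]
 note k = Cmp_Hom[OF X that(1,2) d(3)[OF that(1)]]
 show "h X Y (Add C f g) = Add C (h X Y f) (h X Y g)" unfolding h_def
 by (simp only: Add_right[OF X that(1,2) d(3)[OF that(1)] that(3,4)] Add_left[OF X that(2) Y k[OF that(3)] k[OF that(4)] d(2)[OF that(2)]])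
 show "h X Y (Scl C c f) = Scl C c (h X Y f)" unfolding h_def
 by (simp only: Scl_right[OF X that(1,2) d(3)[OF that(1)] that(3)] Scl_left[OF X that(2) Y k[OF that(3)] d(2)[OF that(2)]])
 qed
 define Fm where "Fm X Y f = L (d X) (d Y) (h X Y f)" for X Y f
 have Fm: "Fm X Y f \<in> Hom D (d X) (d Y)" "Gm (d X) (d Y) (Fm X Y f) = h X Y f"
 if "X \<in> Obj C" "Y \<in> Obj C" "f \<in> Hom C X Y" for X Y f
 unfolding Fm_def using L d(1) h that by simp_all
 have F: "linear_functor C D d Fm"
 unfolding linear_functor_def
 proof (intro conjI ballI allI)
 show "Fm X X (Idn C X) = Idn D (d X)" if X: "X \<in> Obj C" for X
 by (rule inj[OF d(1)[OF X] d(1)[OF X]]) (simp_all add: X d Fm Idn_Hom D.Idn_Hom GI hI)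
 show "Fm X Z (Cmp C g f) = Cmp D (Fm Y Z g) (Fm X Y f)"
 if X: "X \<in> Obj C" "Y \<in> Obj C" "Z \<in> Obj C" "f \<in> Hom C X Y" "g \<in> Hom C Y Z" for X Y Z f g
 proof (rule inj[OF d(1)[OF X(1)] d(1)[OF X(3)]])
 note c = Cmp_Hom[OF X]
 show "Fm X Z (Cmp C g f) \<in> Hom D (d X) (d Z)" by (rule Fm(1)[OF X(1,3) c])
 show "Cmp D (Fm Y Z g) (Fm X Y f) \<in> Hom D (d X) (d Z)"
 by (rule D.Cmp_Hom[OF d(1)[OF X(1)] d(1)[OF X(2)] d(1)[OF X(3)] Fm(1)[OF X(1,2,4)] Fm(1)[OF X(2,3,5)]])
 show "Gm (d X) (d Z) (Fm X Z (Cmp C g f)) = Gm (d X) (d Z) (Cmp D (Fm Y Z g) (Fm X Y f))"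
 unfolding Fm(2)[OF X(1,3) c] hG[OF X]
 GC[OF d(1)[OF X(1)] d(1)[OF X(2)] d(1)[OF X(3)] Fm(1)[OF X(1,2,4)] Fm(1)[OF X(2,3,5)]]
 Fm(2)[OF X(1,2,4)] Fm(2)[OF X(2,3,5)] by simp
 qed
 show "Fm X Y (Add C f g) = Add D (Fm X Y f) (Fm X Y g)"
 if X: "X \<in> Obj C" "Y \<in> Obj C" "f \<in> Hom C X Y" "g \<in> Hom C X Y" for X Y f g
 by (rule inj[OF d(1)[OF X(1)] d(1)[OF X(2)]]) (simp_all add: X d Fm Add_Hom D.Add_Hom GA hA)
 show "Fm X Y (Scl C c f) = Scl D c (Fm X Y f)"
 if X: "X \<in> Obj C" "Y \<in> Obj C" "f \<in> Hom C X Y" for X Y f c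
 by (rule inj[OF d(1)[OF X(1)] d(1)[OF X(2)]]) (simp_all add: X d Fm Scl_Hom D.Scl_Hom GS hS[OF X X(3)])
 qed (simp_all add: d Fm)
 have N1: "natural_iso C C id (%X Y f. f) (Go \<circ> d) (%X Y f. Gm (d X) (d Y) (Fm X Y f)) v"
 unfolding natural_iso_def
 proof (intro conjI ballI)
 show "is_iso C (id X) ((Go \<circ> d) X) (v X)" if "X \<in> Obj C" for X
 using duv[OF that] by (auto simp: is_iso_def)
 show "Cmp C (v Y) f = Cmp C (Gm (d X) (d Y) (Fm X Y f)) (v X)" if X: "X \<in> Obj C" "Y \<in> Obj C" "f \<in> Hom C X Y" for X Y f
 proof -
 note GX = Go[OF d(1)[OF X(1)]] and GY = Go[OF d(1)[OF X(2)]]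
 have fu: "Cmp C f (u X) \<in> Hom C (Go (d X)) Y" by (rule Cmp_Hom[OF GX X(1,2) d(3)[OF X(1)] X(3)])
 have "Cmp C (h X Y f) (v X) = Cmp C (v Y) (Cmp C (Cmp C f (u X)) (v X))"
 unfolding h_def by (rule assoc[OF X(1) GX X(2) GY d(2)[OF X(1)] fu d(2)[OF X(2)]])
 also have "Cmp C (Cmp C f (u X)) (v X) = f"
 unfolding assoc[OF X(1) GX X(1,2) d(2,3)[OF X(1)] X(3)] d(4)[OF X(1)] by (rule Idn_right[OF X])
 finally show ?thesis using Fm(2)[OF X] by simp
 qed
 qed
 define e where "e X = L (d (Go X)) X (u (Go X))" for X
 define e' where "e' X = L X (d (Go X)) (v (Go X))" for X
 have e: "e X \<in> Hom D (d (Go X)) X" "Gm (d (Go X)) X (e X) = u (Go X)"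
 "e' X \<in> Hom D X (d (Go X))" "Gm X (d (Go X)) (e' X) = v (Go X)" if X: "X \<in> Obj D" for X
 unfolding e_def e'_def using L d[OF Go[OF X]] X by simp_all
 have N2: "natural_iso D D (d \<circ> Go) (%X Y f. Fm (Go X) (Go Y) (Gm X Y f)) id (%X Y f. f) e"
 unfolding natural_iso_def
 proof (intro conjI ballI)
 fix X assume X: "X \<in> Obj D"
 note o = X d(1)[OF Go[OF X]]
 have "Cmp D (e' X) (e X) = Idn D (d (Go X))"
 by (rule inj[OF o(2) o(2)]) (simp_all add: D.Cmp_Hom[OF o(2) o(1) o(2) e(1)[OF X] e(3)[OF X]] D.Idn_Hom o
 GC[OF o(2) o(1) o(2) e(1)[OF X] e(3)[OF X]] e[OF X] GI d[OF Go[OF X]])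
 moreover have "Cmp D (e X) (e' X) = Idn D X"
 by (rule inj[OF o(1) o(1)]) (simp_all add: D.Cmp_Hom[OF o(1) o(2) o(1) e(3)[OF X] e(1)[OF X]] D.Idn_Hom o
 GC[OF o(1) o(2) o(1) e(3)[OF X] e(1)[OF X]] e[OF X] GI d[OF Go[OF X]])
 ultimately show "is_iso D ((d \<circ> Go) X) (id X) (e X)"
 using e[OF X] by (auto simp: is_iso_def inverse_arrows_def)
 fix Y f assume Y: "Y \<in> Obj D" and f: "f \<in> Hom D X Y"
 note Gf = Gm[OF X Y f]
 note F1 = Fm[OF Go[OF X] Go[OF Y] Gf]
 note oY = d(1)[OF Go[OF Y]]
 note GX = Go[OF o(2)] and GY = Go[OF oY]
 have gu: "Cmp C (Gm X Y f) (u (Go X)) \<in> Hom C (Go (d (Go X))) (Go Y)"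
 by (rule Cmp_Hom[OF GX Go[OF X] Go[OF Y] d(3)[OF Go[OF X]] Gf])
 have "Cmp C (u (Go Y)) (h (Go X) (Go Y) (Gm X Y f)) = Cmp C (Gm X Y f) (u (Go X))"
 unfolding h_def assoc[OF GX Go[OF Y] GY Go[OF Y] gu d(2,3)[OF Go[OF Y]], symmetric] d(4)[OF Go[OF Y]]
 by (rule Idn_left[OF GX Go[OF Y] gu])
 then show "Cmp D (e Y) (Fm (Go X) (Go Y) (Gm X Y f)) = Cmp D f (e X)"
 by (intro inj[OF o(2) Y]) (simp_all add: D.Cmp_Hom[OF o(2) oY Y F1(1) e(1)[OF Y]] D.Cmp_Hom[OF o(2) X Y e(1)[OF X] f]
 GC[OF o(2) oY Y F1(1) e(1)[OF Y]] GC[OF o(2) X Y e(1)[OF X] f] e[OF X] e[OF Y] F1(2))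
 qed
 show ?thesis unfolding linearly_equivalent_def using F G N1 N2 by blast
qed

end

section \<open>Finite sums of matrices\<close>

text \<open>The dimensions are arguments because an empty sum must still have a size.\<close>

definition msum :: "nat \<Rightarrow> nat \<Rightarrow> ('s \<Rightarrow> 'k::field mat) \<Rightarrow> 's set \<Rightarrow> 'k mat" where
 "msum a b f J = mat a b (%(r, c). \<Sum>s\<in>J. f s $$ (r, c))"

lemma msum_dims[simp]: "drow (msum a b f J) = a" "dcol (msum a b f J) = b"
 by (simp_all add: msum_def)

lemma msum_index[simp]: "r < a ==> c < b ==> msum a b f J $$ (r, c) = (\<Sum>s\<in>J. f s $$ (r, c))"
 by (simp add: msum_def)

lemma ap_sum: "ap A c (%r. \<Sum>s\<in>J. F s r) = (\<Sum>s\<in>J. ap A c (F s))"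
 unfolding ap_def sum_distrib_left by (rule sum.swap)

lemma ap_msum:
 assumes "!!s. s \<in> J ==> drow (f s) = a" "c < b"
 shows "ap (msum a b f J) c F = (\<Sum>s\<in>J. ap (f s) c F)"
proof -
 have "ap (msum a b f J) c F = (\<Sum>r<a. \<Sum>s\<in>J. f s $$ (r, c) * F r)"
 unfolding ap_def using assms(2) by (simp add: sum_distrib_right)
 also have "... = (\<Sum>s\<in>J. ap (f s) c F)" unfolding ap_def by (subst sum.swap) (simp add: assms(1))
 finally show ?thesis .
qed

lemma msum_mult_left:
 assumes "!!s. s \<in> J ==> f s \<in> carrier_mat a b" "drow B = b"
 shows "msum a b f J * B = msum a (dcol B) (%s. f s * B) J"
proof (rule ap_eqI)
 fix c F assume "c < dcol (msum a (dcol B) (%s. f s * B) J)"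
 then have c: "c < dcol B" by simp
 have d: "drow (f s) = a" "dcol (f s) = b" if "s \<in> J" for s using assms(1)[OF that] by auto
 have "ap (msum a b f J * B) c F = ap B c (%k. \<Sum>s\<in>J. ap (f s) k F)"
 using c assms d ap_msum[of J f a _ b F] by simp
 also have "... = (\<Sum>s\<in>J. ap (f s * B) c F)" unfolding ap_sum using c assms(2) d by simp
 finally show "ap (msum a b f J * B) c F = ap (msum a (dcol B) (%s. f s * B) J) c F"
 using c d by (simp add: ap_msum)
qed simp_all

lemma msum_mult_right:
 assumes "!!s. s \<in> J ==> f s \<in> carrier_mat a b" "dcol B = a"
 shows "B * msum a b f J = msum (drow B) b (%s. B * f s) J"
proof (rule ap_eqI)
 fix c F assume "c < dcol (msum (drow B) b (%s. B * f s) J)"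
 then have c: "c < b" by simp
 have d: "drow (f s) = a" "dcol (f s) = b" if "s \<in> J" for s using assms(1)[OF that] by auto
 have "ap (B * msum a b f J) c F = ap (msum a b f J) c (%k. ap B k F)" using c assms(2) by simp
 also have "... = (\<Sum>s\<in>J. ap (B * f s) c F)" using c d assms(2) by (simp add: ap_msum)
 finally show "ap (B * msum a b f J) c F = ap (msum (drow B) b (%s. B * f s) J) c F"
 using c d by (simp add: ap_msum)
qed simp_all

lemma msum_kron:
 assumes "!!s. s \<in> J ==> f s \<in> carrier_mat a b"
 shows "1\<^sub>m m <*> msum a b f J <*> 1\<^sub>m l = msum (m * a * l) (m * b * l) (%s. 1\<^sub>m m <*> f s <*> 1\<^sub>m l) J"
proof (rule kron_ap_eqI[of _ _ "m * b" l])
 fix i j F assume i: "i < m * b" and j: "j < l"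
 obtain p q where p: "p < m" and q: "q < b" and iq: "i = ix b p q" using i by (rule ix_decompose)
 have d: "drow (f s) = a" "dcol (f s) = b" if "s \<in> J" for s using assms(1)[OF that] by auto
 have "ap (msum (m * a * l) (m * b * l) (%s. 1\<^sub>m m <*> f s <*> 1\<^sub>m l) J) (ix l i j) F = (\<Sum>s\<in>J. ap (f s) q (%r. F (ix l (ix a p r) j)))"
 unfolding iq using p q j d by (subst ap_msum) (auto simp: ap_kron intro!: sum.cong)
 then show "ap (1\<^sub>m m <*> msum a b f J <*> 1\<^sub>m l) (ix l i j) F =
 ap (msum (m * a * l) (m * b * l) (%s. 1\<^sub>m m <*> f s <*> 1\<^sub>m l) J) (ix l i j) F"
 unfolding iq using p q j d by (simp add: ap_kron ap_msum)
qed simp_all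

lemma msum_cong: "(!!s. s \<in> J ==> f s = f' s) ==> msum a b f J = msum a b f' J"
 by (simp add: msum_def)

lemma msum_delta:
 assumes "finite J" "s \<in> J" "X \<in> carrier_mat a b"
 shows "msum a b (%s'. if s' = s then X else 0\<^sub>m a b) J = X"
proof (rule eq_matI)
 fix r c assume "r < drow X" "c < dcol X"
 then show "msum a b (%s'. if s' = s then X else 0\<^sub>m a b) J $$ (r, c) = X $$ (r, c)"
 using assms by (simp add: if_distrib[of "%M. M $$ (r, c)"] sum.delta cong: if_cong)
qed (use assms in auto)

lemma msum_carrier[simp]: "msum a b f J \<in> carrier_mat a b"
 by (simp add: carrier_matI)

section \<open>Arrows of \<open>A \<boxtimes> Vec_power n\<close> as matrices of arrows of \<open>A\<close>\<close>

lemma Vec_power_simps[simp]: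
 "Obj (Vec_power n) = (\<Pi>\<^sub>E l\<in>{..<n}. UNIV)"
 "Hom (Vec_power n) v w = (\<Pi>\<^sub>E l\<in>{..<n}. carrier_mat (w l) (v l))"
 "Idn (Vec_power n) v = (\<lambda>l\<in>{..<n}. 1\<^sub>m (v l))"
 "Cmp (Vec_power n) g f = (\<lambda>l\<in>{..<n}. g l * f l)"
 "Add (Vec_power n) f g = (\<lambda>l\<in>{..<n}. f l + g l)"
 "Scl (Vec_power n) c f = (\<lambda>l\<in>{..<n}. c \<cdot>\<^sub>m f l)"
 by (simp_all add: Vec_power_def direct_sum_def Vec_def)

lemma full_sub_simps[simp]:
 "Obj (full_sub A P) = {X \<in> Obj A. P X}" "Hom (full_sub A P) = Hom A" "Idn (full_sub A P) = Idn A"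
 "Cmp (full_sub A P) = Cmp A" "Add (full_sub A P) = Add A" "Scl (full_sub A P) = Scl A"
 by (simp_all add: full_sub_def)

text \<open>Index set of the matrix unit basis of a Hom space of \<open>Vec_power n\<close>:
  component, row and column. The basis itself is \<open>elem_arrow\<close>.\<close>

definition slots :: "nat \<Rightarrow> (nat \<Rightarrow> nat) \<Rightarrow> (nat \<Rightarrow> nat) \<Rightarrow> (nat \<times> nat \<times> nat) set" where
 "slots n v w = (SIGMA l:{..<n}. {..<w l} \<times> {..<v l})"

definition elem_arrow :: "nat \<Rightarrow> (nat \<Rightarrow> nat) \<Rightarrow> (nat \<Rightarrow> nat) \<Rightarrow> nat \<times> nat \<times> nat \<Rightarrow> nat \<Rightarrow> 'k::field mat" where
 "elem_arrow n v w j = (\<lambda>l\<in>{..<n}. mat (w l) (v l) (%i. if (l, i) = j then 1 else 0))"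

text \<open>The bilinear form that multiplies one matrix entry of f with one coordinate of g in the
  basis of matrix units.\<close>

definition entry :: "nat \<times> nat \<Rightarrow> nat \<times> nat \<times> nat \<Rightarrow> 'k::field mat \<Rightarrow> (nat \<Rightarrow> 'k mat) \<Rightarrow> 'k" where
 "entry i j = (%f g. f $$ i * g (fst j) $$ (snd j))"

text \<open>A tensor has a unique expansion as a sum of f_j \<otimes> E_j over the matrix units E_j;
  evaluation at the forms \<open>entry\<close> reads off f_j. \<open>list_mat\<close> computes the
  same matrix from a representing list.\<close>

definition comp_mat :: "nat \<Rightarrow> nat \<Rightarrow> (('k::field mat \<Rightarrow> (nat \<Rightarrow> 'k mat) \<Rightarrow> 'k) \<Rightarrow> 'k) \<Rightarrow> nat \<times> nat \<times> nat \<Rightarrow> 'k mat" where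
 "comp_mat b a t j = mat b a (%i. t (entry i j))"

definition list_mat :: "nat \<Rightarrow> nat \<Rightarrow> ('k::field mat \<times> (nat \<Rightarrow> 'k mat)) list \<Rightarrow> nat \<times> nat \<times> nat \<Rightarrow> 'k mat" where
 "list_mat b a fgs j = mat b a (%i. \<Sum>(f, g)\<leftarrow>fgs. entry i j f g)"

lemma comp_mat_dims[simp]: "drow (comp_mat b a t j) = b" "dcol (comp_mat b a t j) = a"
 by (simp_all add: comp_mat_def)

lemma finite_slots[simp]: "finite (slots n v w)"
 by (simp add: slots_def)

lemma elem_arrow_Hom[simp]: "elem_arrow n v w j \<in> Hom (Vec_power n) v w"
 by (auto simp: elem_arrow_def)

text \<open>Linear categories whose arrows are matrices with sizes given by the objects, such as
  \<open>HH C\<close>, \<open>HC C\<close> and \<open>aYD ch H\<close>; full subcategories remain in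
  this class.\<close>

locale mat_category =
 fixes A :: "('o, 'k::field mat, 'k) lincat" and dm :: "'o \<Rightarrow> nat"
 assumes Hom_carrier: "X \<in> Obj A ==> Y \<in> Obj A ==> f \<in> Hom A X Y ==> f \<in> carrier_mat (dm Y) (dm X)"
 and zero_Hom: "X \<in> Obj A ==> Y \<in> Obj A ==> 0\<^sub>m (dm Y) (dm X) \<in> Hom A X Y"
 and one_Hom: "X \<in> Obj A ==> 1\<^sub>m (dm X) \<in> Hom A X X"
 and mult_Hom: "X \<in> Obj A ==> Y \<in> Obj A ==> Z \<in> Obj A ==> f \<in> Hom A X Y ==> g \<in> Hom A Y Z ==> g * f \<in> Hom A X Z"
 and add_Hom: "X \<in> Obj A ==> Y \<in> Obj A ==> f \<in> Hom A X Y ==> f' \<in> Hom A X Y ==> f + f' \<in> Hom A X Y"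
 and smult_Hom: "X \<in> Obj A ==> Y \<in> Obj A ==> f \<in> Hom A X Y ==> c \<cdot>\<^sub>m f \<in> Hom A X Y"
 and ops: "Cmp A = (*)" "Add A = (+)" "Scl A = (\<cdot>\<^sub>m)" "X \<in> Obj A ==> Idn A X = 1\<^sub>m (dm X)"
begin

lemma category_laws: "lin_category_laws A"
proof (unfold_locales, goal_cases)
 case (5 X Y f)
 then show ?case using Hom_carrier[OF 5] by (simp add: ops)
next
 case (6 X Y f)
 then show ?case using Hom_carrier[OF 6] by (simp add: ops)
next
 case (7 X Y Z W f g h)
 show ?case unfolding ops(1)
 by (rule assoc_mult_mat[OF Hom_carrier[OF 7(3,4,7)] Hom_carrier[OF 7(2,3,6)] Hom_carrier[OF 7(1,2,5)]])
next
 case (8 X Y Z f f' g)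
 show ?case unfolding ops(1,2)
 by (rule mult_add_distrib_mat[OF Hom_carrier[OF 8(2,3,6)] Hom_carrier[OF 8(1,2,4)] Hom_carrier[OF 8(1,2,5)]])
next
 case (9 X Y Z f g g')
 show ?case unfolding ops(1,2)
 by (rule add_mult_distrib_mat[OF Hom_carrier[OF 9(2,3,5)] Hom_carrier[OF 9(2,3,6)] Hom_carrier[OF 9(1,2,4)]])
next
 case (10 X Y Z f g c)
 show ?case unfolding ops(1,3)
 by (rule mult_smult_distrib[OF Hom_carrier[OF 10(2,3,5)] Hom_carrier[OF 10(1,2,4)]])
next
 case (11 X Y Z f g c)
 show ?case unfolding ops(1,3)
 by (rule mult_smult_assoc_mat[OF Hom_carrier[OF 11(2,3,5)] Hom_carrier[OF 11(1,2,4)]])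
qed (simp_all add: ops one_Hom mult_Hom add_Hom smult_Hom)

lemma full_sub_mat_category: "mat_category (full_sub A P) dm"
 by unfold_locales (use Hom_carrier zero_Hom one_Hom mult_Hom add_Hom smult_Hom ops in auto)

lemma msum_Hom:
 assumes X: "X \<in> Obj A" "Y \<in> Obj A" and J: "finite J" and f: "!!s. s \<in> J ==> f s \<in> Hom A X Y"
 shows "msum (dm Y) (dm X) f J \<in> Hom A X Y"
 using J f
proof (induction J)
 case empty
 have "msum (dm Y) (dm X) f {} = 0\<^sub>m (dm Y) (dm X)" by (rule eq_matI) auto
 then show ?case using zero_Hom[OF X] by simp
next
 case (insert s J)
 have c: "f s \<in> carrier_mat (dm Y) (dm X)" by (rule Hom_carrier[OF X]) (use insert in simp)
 have "msum (dm Y) (dm X) f (insert s J) = f s + msum (dm Y) (dm X) f J"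
 by (rule eq_matI) (use insert c in auto)
 then show ?case using insert add_Hom[OF X] by simp
qed

context
 fixes n :: nat
begin

abbreviation "B \<equiv> Vec_power n :: (nat \<Rightarrow> nat, nat \<Rightarrow> 'k mat, 'k) lincat"

lemma entry_bilinear:
 assumes X: "a \<in> Obj A" "b \<in> Obj A" and i: "fst i < dm b" "snd i < dm a" and j: "j \<in> slots n v w"
 shows "entry i j \<in> bilinear_forms A B (a, v) (b, w)"
proof -
 obtain x y where i': "i = (x, y)" by (cases i)
 obtain l r' r where j': "j = (l, r', r)" "l < n" "r' < w l" "r < v l" using j by (auto simp: slots_def)
 note c = Hom_carrier[OF X, THEN carrier_matD(1)] Hom_carrier[OF X, THEN carrier_matD(2)]
 have g: "drow (g l) = w l" "dcol (g l) = v l" if "g \<in> (\<Pi>\<^sub>E l\<in>{..<n}. carrier_mat (w l) (v l))" for g :: "nat \<Rightarrow> 'k mat"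
 using PiE_mem[OF that, of l] j' by auto
 show ?thesis unfolding bilinear_forms_def
 using i i' j' by (auto simp: entry_def ops c g algebra_simps)
qed

text \<open>The second argument is expanded in the basis of matrix units.\<close>

lemma bilinear_right:
 assumes be: "\<beta> \<in> bilinear_forms A B (a, v) (b, w)" and f: "f \<in> Hom A a b" and g: "g \<in> Hom B v w"
 shows "\<beta> f g = (\<Sum>j\<in>slots n v w. g (fst j) $$ snd j * \<beta> f (elem_arrow n v w j))"
proof -
 \<comment> \<open>The coordinates of g outside S are set to 0, so that the expansion can be built
   up by induction on a finite set S.\<close>
 define part where "part S = (\<lambda>l\<in>{..<n}. mat (w l) (v l) (%i. if (l, i) \<in> S then g l $$ i else 0))" for S
 have part: "part S \<in> Hom B v w" for S by (auto simp: part_def)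
 have gl: "drow (g l) = w l" "dcol (g l) = v l" if "l < n" for l
 using PiE_mem[of g _ _ l] g that by auto
 have add: "\<beta> f (Add B h h') = \<beta> f h + \<beta> f h'" and scl: "\<beta> f (Scl B c h) = c * \<beta> f h" if "h \<in> Hom B v w" "h' \<in> Hom B v w" for h h' c
 using be f that unfolding bilinear_forms_def by auto
 have *: "\<beta> f (part S) = (\<Sum>j\<in>S. g (fst j) $$ snd j * \<beta> f (elem_arrow n v w j))" if "finite S" for S
 using that
 proof induction
 case empty
 have "part {} = Scl B 0 g"
 unfolding part_def Vec_power_simps by (intro restrict_ext eq_matI) (auto simp: gl)
 then show ?case using scl[OF g g, of 0] by (simp del: Vec_power_simps)
 next
 case (insert j S)
 have "part (insert j S) = Add B (Scl B (g (fst j) $$ snd j) (elem_arrow n v w j)) (part S)"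
 unfolding part_def elem_arrow_def Vec_power_simps using insert(2) by (intro restrict_ext eq_matI) (auto simp: gl)
 moreover have "Scl B c (elem_arrow n v w j) \<in> Hom B v w" for c by (auto simp: elem_arrow_def)
 ultimately show ?case using insert add[OF _ part] scl[OF elem_arrow_Hom elem_arrow_Hom] by (simp del: Vec_power_simps)
 qed
 have "part (slots n v w) = (\<lambda>l\<in>{..<n}. g l)"
 unfolding part_def by (intro restrict_ext eq_matI) (auto simp: gl slots_def)
 also have "... = g" using g by (auto simp: PiE_def extensional_restrict)
 finally show ?thesis using *[OF finite_slots[of n v w]] by simp
qed

lemma list_mat_Nil: "list_mat b a [] j = 0\<^sub>m b a"
 by (rule eq_matI) (auto simp: list_mat_def)

lemma list_mat_Cons:
 assumes "f \<in> carrier_mat b a"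
 shows "list_mat b a ((f, g) # L) j = (g (fst j) $$ snd j) \<cdot>\<^sub>m f + list_mat b a L j"
 by (rule eq_matI) (use assms in \<open>auto simp: list_mat_def entry_def\<close>)

lemma list_mat_Hom:
 assumes X: "a \<in> Obj A" "b \<in> Obj A" and L: "set L \<subseteq> Hom A a b \<times> G"
 shows "list_mat (dm b) (dm a) L j \<in> Hom A a b"
 using L
proof (induction L)
 case Nil
 then show ?case using zero_Hom[OF X] by (simp add: list_mat_Nil)
next
 case (Cons fg L)
 obtain f g where fg: "fg = (f, g)" by (cases fg)
 then have f: "f \<in> Hom A a b" using Cons by simp
 show ?case unfolding fg list_mat_Cons[OF Hom_carrier[OF X f]]
 using Cons add_Hom[OF X smult_Hom[OF X f]] by simp
qed

lemma bilinear_left: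
 assumes X: "a \<in> Obj A" "b \<in> Obj A" and L: "set L \<subseteq> Hom A a b \<times> G"
 and be: "\<beta> \<in> bilinear_forms A B (a, v) (b, w)" and e: "e \<in> Hom B v w"
 shows "\<beta> (list_mat (dm b) (dm a) L j) e = (\<Sum>(f, g)\<leftarrow>L. g (fst j) $$ snd j * \<beta> f e)"
proof -
 have add: "\<beta> (f + f') e = \<beta> f e + \<beta> f' e" and scl: "\<beta> (c \<cdot>\<^sub>m f) e = c * \<beta> f e" if "f \<in> Hom A a b" "f' \<in> Hom A a b" for f f' c
 using be e that unfolding bilinear_forms_def ops by auto
 show ?thesis using L
 proof (induction L)
 case Nil
 have "0\<^sub>m (dm b) (dm a) = 0 \<cdot>\<^sub>m (0\<^sub>m (dm b) (dm a) :: 'k mat)" by (rule eq_matI) auto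
 then show ?case using scl[OF zero_Hom[OF X] zero_Hom[OF X], of 0] by (simp add: list_mat_Nil)
 next
 case (Cons fg L)
 obtain f g where fg: "fg = (f, g)" by (cases fg)
 then have f: "f \<in> Hom A a b" using Cons by simp
 have L: "list_mat (dm b) (dm a) L j \<in> Hom A a b" by (rule list_mat_Hom[OF X]) (use Cons in auto)
 show ?case unfolding fg list_mat_Cons[OF Hom_carrier[OF X f]]
 using Cons add[OF smult_Hom[OF X f] L] scl[OF f f] by simp
 qed
qed

text \<open>Moving all coefficients of the second factors to the first ones leaves one summand for
  each matrix unit. Hence a tensor is determined by the matrices \<open>comp_mat\<close>.\<close>

lemma tensor_normal_form:
 assumes X: "a \<in> Obj A" "b \<in> Obj A" and L: "set L \<subseteq> Hom A a b \<times> Hom B v w"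
 and be: "\<beta> \<in> bilinear_forms A B (a, v) (b, w)"
 shows "tensor A B (a, v) (b, w) L \<beta> = (\<Sum>j\<in>slots n v w. \<beta> (list_mat (dm b) (dm a) L j) (elem_arrow n v w j))"
proof -
 have "(\<Sum>(f, g)\<leftarrow>L. \<beta> f g) = (\<Sum>(f, g)\<leftarrow>L. \<Sum>j\<in>slots n v w. g (fst j) $$ snd j * \<beta> f (elem_arrow n v w j))"
 by (intro arg_cong[of _ _ sum_list] map_cong refl) (use L bilinear_right[OF be] in auto)
 also have "... = (\<Sum>j\<in>slots n v w. \<Sum>(f, g)\<leftarrow>L. g (fst j) $$ snd j * \<beta> f (elem_arrow n v w j))"
 by (induction L) (auto simp: sum.distrib)
 also have "... = (\<Sum>j\<in>slots n v w. \<beta> (list_mat (dm b) (dm a) L j) (elem_arrow n v w j))"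
 by (simp only: bilinear_left[OF X L be elem_arrow_Hom])
 finally show ?thesis using be by (simp add: tensor_def)
qed

lemma comp_mat_tensor:
 assumes X: "a \<in> Obj A" "b \<in> Obj A" and j: "j \<in> slots n v w"
 shows "comp_mat (dm b) (dm a) (tensor A B (a, v) (b, w) L) j = list_mat (dm b) (dm a) L j"
 by (rule eq_matI) (auto simp: comp_mat_def list_mat_def tensor_def entry_bilinear[OF X _ _ j])

lemma tensor_homE:
 assumes "t \<in> tensor_hom A B (a, v) (b, w)"
 obtains L where "t = tensor A B (a, v) (b, w) L" "set L \<subseteq> Hom A a b \<times> Hom B v w"
 using assms by (auto simp: tensor_hom_def)

lemma tensor_homI: "set L \<subseteq> Hom A a b \<times> Hom B v w ==> tensor A B (a, v) (b, w) L \<in> tensor_hom A B (a, v) (b, w)"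
 by (auto simp: tensor_hom_def)

lemma comp_mat_Hom:
 assumes X: "a \<in> Obj A" "b \<in> Obj A" and j: "j \<in> slots n v w" and t: "t \<in> tensor_hom A B (a, v) (b, w)"
 shows "comp_mat (dm b) (dm a) t j \<in> Hom A a b"
 using t by (elim tensor_homE) (simp add: comp_mat_tensor[OF X j] list_mat_Hom[OF X])

lemma tensor_hom_eqI:
 assumes X: "a \<in> Obj A" "b \<in> Obj A" and t: "t \<in> tensor_hom A B (a, v) (b, w)" "t' \<in> tensor_hom A B (a, v) (b, w)"
 and e: "!!j. j \<in> slots n v w ==> comp_mat (dm b) (dm a) t j = comp_mat (dm b) (dm a) t' j"
 shows "t = t'"
proof -
 obtain L where L: "t = tensor A B (a, v) (b, w) L" "set L \<subseteq> Hom A a b \<times> Hom B v w" using t(1) by (rule tensor_homE)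
 obtain L' where L': "t' = tensor A B (a, v) (b, w) L'" "set L' \<subseteq> Hom A a b \<times> Hom B v w" using t(2) by (rule tensor_homE)
 have "t \<beta> = t' \<beta>" for \<beta>
 proof (cases "\<beta> \<in> bilinear_forms A B (a, v) (b, w)")
 case True
 show ?thesis unfolding L L' tensor_normal_form[OF X L(2) True] tensor_normal_form[OF X L'(2) True]
 by (intro sum.cong refl) (use e in \<open>simp add: L L' comp_mat_tensor[OF X]\<close>)
 qed (simp add: L L' tensor_def)
 then show ?thesis by blast
qed

lemma tensor_hom_exists:
 assumes X: "a \<in> Obj A" "b \<in> Obj A" and K: "!!j. j \<in> slots n v w ==> K j \<in> Hom A a b"
 shows "\<exists>t \<in> tensor_hom A B (a, v) (b, w). \<forall>j\<in>slots n v w. comp_mat (dm b) (dm a) t j = K j"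
proof -
 obtain xs where xs: "set xs = slots n v w" "distinct xs" using finite_distinct_list[OF finite_slots] by blast
 let ?L = "map (%j. (K j, elem_arrow n v w j)) xs"
 have "list_mat (dm b) (dm a) ?L j = K j" if j: "j \<in> slots n v w" for j
 proof (rule eq_matI)
 note c = Hom_carrier[OF X K[OF j]]
 fix x y assume "x < drow (K j)" "y < dcol (K j)"
 then have xy: "x < dm b" "y < dm a" using c by auto
 have "list_mat (dm b) (dm a) ?L j $$ (x, y) = (\<Sum>i\<in>slots n v w. K i $$ (x, y) * elem_arrow n v w i (fst j) $$ snd j)"
 using xy xs by (simp add: list_mat_def comp_def entry_def sum_list_distinct_conv_sum_set)
 also have "... = (\<Sum>i\<in>slots n v w. if i = j then K j $$ (x, y) else 0)"
 by (intro sum.cong refl) (use j in \<open>auto simp: elem_arrow_def slots_def split: if_splits\<close>)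
 also have "... = K j $$ (x, y)" using j by simp
 finally show "list_mat (dm b) (dm a) ?L j $$ (x, y) = K j $$ (x, y)" .
 qed (use Hom_carrier[OF X K[OF j]] in \<open>auto simp: list_mat_def\<close>)
 moreover have "set ?L \<subseteq> Hom A a b \<times> Hom B v w" using xs K elem_arrow_Hom by (auto simp del: Vec_power_simps)
 ultimately show ?thesis using comp_mat_tensor[OF X] tensor_homI by (metis (no_types, lifting))
qed

definition comp_list :: "('k mat \<times> (nat \<Rightarrow> 'k mat)) list \<Rightarrow> ('k mat \<times> (nat \<Rightarrow> 'k mat)) list \<Rightarrow> ('k mat \<times> (nat \<Rightarrow> 'k mat)) list" where
 "comp_list L L' = concat (map (%(f, g). map (%(f', g'). (f * f', Cmp B g g')) L') L)"

lemma sum_comp_list: "(\<Sum>(f, g)\<leftarrow>comp_list L L'. F f g) = (\<Sum>(f, g)\<leftarrow>L. \<Sum>(f', g')\<leftarrow>L'. F (f * f') (Cmp B g g'))"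
 by (induction L) (auto simp: comp_list_def comp_def split_def simp del: Vec_power_simps)

lemma Cmp_B_Hom: "g \<in> Hom B v w ==> h \<in> Hom B w u ==> Cmp B h g \<in> Hom B v u"
 by (auto simp: PiE_iff intro!: mult_carrier_mat)

lemma comp_list_set:
 assumes X: "a \<in> Obj A" "b \<in> Obj A" "c \<in> Obj A" and L: "set L \<subseteq> Hom A b c \<times> Hom B w u" "set L' \<subseteq> Hom A a b \<times> Hom B v w"
 shows "set (comp_list L L') \<subseteq> Hom A a c \<times> Hom B v u"
proof -
 have "(f * f', Cmp B g g') \<in> Hom A a c \<times> Hom B v u" if "(f, g) \<in> set L" "(f', g') \<in> set L'" for f g f' g'
 by (intro SigmaI mult_Hom[OF X] Cmp_B_Hom[where w = w]) (use that L in \<open>auto simp del: Vec_power_simps\<close>)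
 then show ?thesis unfolding comp_list_def set_concat set_map by (auto simp del: Vec_power_simps)
qed

text \<open>\<open>tensor\<close> evaluates to \<open>undefined\<close> away from bilinear forms. So
  the inner form must be shown bilinear for each fixed outer pair, and then \<gamma> must be shown
  bilinear, before the lists can be multiplied out.\<close>

lemma tensor_comp_tensor:
 assumes X: "a \<in> Obj A" "b \<in> Obj A" "c \<in> Obj A"
 and L: "set L \<subseteq> Hom A b c \<times> Hom B w u" "set L' \<subseteq> Hom A a b \<times> Hom B v w"
 shows "tensor_comp A B (a, v) (c, u) (tensor A B (b, w) (c, u) L) (tensor A B (a, v) (b, w) L') =
 tensor A B (a, v) (c, u) (comp_list L L')"
proof
 fix \<beta>
 show "tensor_comp A B (a, v) (c, u) (tensor A B (b, w) (c, u) L) (tensor A B (a, v) (b, w) L') \<beta> =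
 tensor A B (a, v) (c, u) (comp_list L L') \<beta>"
 proof (cases "\<beta> \<in> bilinear_forms A B (a, v) (c, u)")
 case True
 define \<gamma> where "\<gamma> = (%f g. tensor A B (a, v) (b, w) L' (%f' g'. \<beta> (f * f') (Cmp B g g')))"
 have b1: "\<beta> (f + f') g = \<beta> f g + \<beta> f' g" "\<beta> (x \<cdot>\<^sub>m f) g = x * \<beta> f g"
 if "f \<in> Hom A a c" "f' \<in> Hom A a c" "g \<in> Hom B v u" for f f' g x
 using True that unfolding bilinear_forms_def ops by auto
 have b2: "\<beta> f (Add B g g') = \<beta> f g + \<beta> f g'" "\<beta> f (Scl B x g) = x * \<beta> f g"
 if "f \<in> Hom A a c" "g \<in> Hom B v u" "g' \<in> Hom B v u" for f g' g x
 using True that unfolding bilinear_forms_def ops by auto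
 note m = mult_Hom[OF X]
 have gl: "g l \<in> carrier_mat (w' l) (v' l)" if "g \<in> Hom B v' w'" "l < n" for g l v' w'
 using that by (auto simp: PiE_iff)
 have A1: "f * (f1 + f2) = f * f1 + f * f2" "f * (x \<cdot>\<^sub>m f1) = x \<cdot>\<^sub>m (f * f1)"
 if "f \<in> Hom A b c" "f1 \<in> Hom A a b" "f2 \<in> Hom A a b" for f f1 f2 x
 using Hom_carrier[OF X(2,3) that(1)] Hom_carrier[OF X(1,2) that(2)] Hom_carrier[OF X(1,2) that(3)]
 by (auto intro!: mult_add_distrib_mat mult_smult_distrib)
 have A2: "(f1 + f2) * f = f1 * f + f2 * f" "(x \<cdot>\<^sub>m f1) * f = x \<cdot>\<^sub>m (f1 * f)"
 if "f1 \<in> Hom A b c" "f2 \<in> Hom A b c" "f \<in> Hom A a b" for f f1 f2 x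
 using Hom_carrier[OF X(2,3) that(1)] Hom_carrier[OF X(2,3) that(2)] Hom_carrier[OF X(1,2) that(3)]
 by (auto intro!: add_mult_distrib_mat mult_smult_assoc_mat)
 have B1: "Cmp B g (Add B g1 g2) = Add B (Cmp B g g1) (Cmp B g g2)" "Cmp B g (Scl B x g1) = Scl B x (Cmp B g g1)"
 if "g \<in> Hom B w u" "g1 \<in> Hom B v w" "g2 \<in> Hom B v w" for g g1 g2 x
 unfolding Vec_power_simps using gl[OF that(1)] gl[OF that(2)] gl[OF that(3)]
 by (auto intro!: restrict_ext mult_add_distrib_mat mult_smult_distrib)
 have B2: "Cmp B (Add B g1 g2) g = Add B (Cmp B g1 g) (Cmp B g2 g)" "Cmp B (Scl B x g1) g = Scl B x (Cmp B g1 g)"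
 if "g1 \<in> Hom B w u" "g2 \<in> Hom B w u" "g \<in> Hom B v w" for g g1 g2 x
 unfolding Vec_power_simps using gl[OF that(1)] gl[OF that(2)] gl[OF that(3)]
 by (auto intro!: restrict_ext add_mult_distrib_mat mult_smult_assoc_mat)
 have sc: "\<beta> (x \<cdot>\<^sub>m f) g = x * \<beta> f g" "\<beta> f (Scl B x g) = x * \<beta> f g" if "f \<in> Hom A a c" "g \<in> Hom B v u" for f g x
 using b1(2)[OF that(1,1,2)] b2(2)[OF that(1,2,2)] .
 have sA: "f * (x \<cdot>\<^sub>m f1) = x \<cdot>\<^sub>m (f * f1)" "(x \<cdot>\<^sub>m f) * f1 = x \<cdot>\<^sub>m (f * f1)" if "f \<in> Hom A b c" "f1 \<in> Hom A a b" for f f1 x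
 using A1(2)[OF that(1,2,2)] A2(2)[OF that(1,1,2)] .
 have sB: "Cmp B g (Scl B x g1) = Scl B x (Cmp B g g1)" "Cmp B (Scl B x g) g1 = Scl B x (Cmp B g g1)"
 if "g \<in> Hom B w u" "g1 \<in> Hom B v w" for g g1 x
 using B1(2)[OF that(1,2,2)] B2(2)[OF that(1,1,2)] .
 note mB = Cmp_B_Hom[of _ v w _ u]
 have inner: "(%f' g'. \<beta> (f * f') (Cmp B g g')) \<in> bilinear_forms A B (a, v) (b, w)"
 if "f \<in> Hom A b c" "g \<in> Hom B w u" for f g
 unfolding bilinear_forms_def ops using that
 by (simp add: A1(1) B1(1) b1(1) b2(1) sc sA sB m mB del: Vec_power_simps)
 have g: "\<gamma> f g = (\<Sum>(f', g')\<leftarrow>L'. \<beta> (f * f') (Cmp B g g'))" if "f \<in> Hom A b c" "g \<in> Hom B w u" for f g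
 using inner[OF that] by (simp add: \<gamma>_def tensor_def del: Vec_power_simps)
 have clos: "g' \<in> Hom B w u ==> Add B g g' \<in> Hom B w u" "Scl B x g \<in> Hom B w u" if "g \<in> Hom B w u" for g g' x
 using that by (auto simp: PiE_iff)
 have L2: "f' \<in> Hom A a b" "g' \<in> Hom B v w" if "(f', g') \<in> set L'" for f' g'
 using L(2) that by auto
 have sl: "(\<Sum>(f', g')\<leftarrow>M. F f' g') = (\<Sum>(f', g')\<leftarrow>M. G f' g') + (\<Sum>(f', g')\<leftarrow>M. G' f' g')"
 if "!!f' g'. (f', g') \<in> set M ==> F f' g' = G f' g' + G' f' g'" for M F and G G' :: "'k mat \<Rightarrow> (nat \<Rightarrow> 'k mat) \<Rightarrow> 'k"
 using that by (induction M) (auto simp: algebra_simps)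
 have ss: "(\<Sum>(f', g')\<leftarrow>M. F f' g') = x * (\<Sum>(f', g')\<leftarrow>M. G f' g')"
 if "!!f' g'. (f', g') \<in> set M ==> F f' g' = x * G f' g'" for M F x and G :: "'k mat \<Rightarrow> (nat \<Rightarrow> 'k mat) \<Rightarrow> 'k"
 using that by (induction M) (auto simp: algebra_simps)
 have outer: "\<gamma> \<in> bilinear_forms A B (b, w) (c, u)"
 unfolding bilinear_forms_def ops mem_Collect_eq fst_conv snd_conv
 by (intro conjI ballI allI; simp only: g add_Hom[OF X(2,3)] smult_Hom[OF X(2,3)] clos)
 (auto intro!: sl ss simp: A2(1) B2(1) b1(1) b2(1) sc sA sB L2 m mB simp del: Vec_power_simps)
 have "tensor A B (b, w) (c, u) L \<gamma> = (\<Sum>(f, g)\<leftarrow>L. \<Sum>(f', g')\<leftarrow>L'. \<beta> (f * f') (Cmp B g g'))"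
 using outer unfolding tensor_def restrict_apply'[OF outer]
 by (intro arg_cong[of _ _ sum_list] map_cong refl) (use L(1) g in \<open>auto simp del: Vec_power_simps\<close>)
 then show ?thesis
 using True by (simp add: tensor_comp_def ops \<gamma>_def[symmetric] tensor_def[of _ _ "(a, v)" "(c, u)"] sum_comp_list del: Vec_power_simps)
 qed (simp add: tensor_comp_def tensor_def)
qed

lemma sum_rearrange:
 fixes p' :: "'i \<Rightarrow> 'z \<Rightarrow> 'k" and q' :: "'h \<Rightarrow> 'z \<Rightarrow> 'k" and s :: "'i \<Rightarrow> 'r \<Rightarrow> 'k" and d :: "'h \<Rightarrow> 'r \<Rightarrow> 'k"
 shows "(\<Sum>i\<in>I. \<Sum>k\<in>K. (\<Sum>z\<in>Z. p' i z * q' k z) * (\<Sum>r\<in>R. s i r * d k r)) =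
 (\<Sum>r\<in>R. \<Sum>z\<in>Z. (\<Sum>i\<in>I. p' i z * s i r) * (\<Sum>k\<in>K. q' k z * d k r))"
proof -
 have "(\<Sum>r\<in>R. \<Sum>z\<in>Z. (\<Sum>i\<in>I. p' i z * s i r) * (\<Sum>k\<in>K. q' k z * d k r)) =
 (\<Sum>r\<in>R. \<Sum>z\<in>Z. \<Sum>i\<in>I. \<Sum>k\<in>K. p' i z * s i r * (q' k z * d k r))"
 by (simp only: sum_product)
 also have "... = (\<Sum>r\<in>R. \<Sum>i\<in>I. \<Sum>z\<in>Z. \<Sum>k\<in>K. p' i z * s i r * (q' k z * d k r))"
 by (intro sum.cong refl, rule sum.swap)
 also have "... = (\<Sum>i\<in>I. \<Sum>r\<in>R. \<Sum>z\<in>Z. \<Sum>k\<in>K. p' i z * s i r * (q' k z * d k r))"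
 by (rule sum.swap)
 also have "... = (\<Sum>i\<in>I. \<Sum>r\<in>R. \<Sum>k\<in>K. \<Sum>z\<in>Z. p' i z * s i r * (q' k z * d k r))"
 by (intro sum.cong refl, rule sum.swap)
 also have "... = (\<Sum>i\<in>I. \<Sum>k\<in>K. \<Sum>r\<in>R. \<Sum>z\<in>Z. p' i z * s i r * (q' k z * d k r))"
 by (intro sum.cong refl, rule sum.swap)
 also have "... = (\<Sum>i\<in>I. \<Sum>k\<in>K. \<Sum>z\<in>Z. \<Sum>r\<in>R. p' i z * s i r * (q' k z * d k r))"
 by (intro sum.cong refl, rule sum.swap)
 also have "... = (\<Sum>i\<in>I. \<Sum>k\<in>K. (\<Sum>z\<in>Z. p' i z * q' k z) * (\<Sum>r\<in>R. s i r * d k r))"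
 by (simp only: sum_product) (simp add: ac_simps)
 finally show ?thesis ..
qed

text \<open>In the l-th component matrix units compose as E_(r'', r') E_(r', r) = E_(r'', r); the
  component matrices are therefore multiplied with summation over the middle index r'.\<close>

lemma tensor_comp_Hom:
 assumes X: "a \<in> Obj A" "b \<in> Obj A" "c \<in> Obj A"
 and t: "t \<in> tensor_hom A B (b, w) (c, u)" "t' \<in> tensor_hom A B (a, v) (b, w)"
 shows "tensor_comp A B (a, v) (c, u) t t' \<in> tensor_hom A B (a, v) (c, u)"
 and "l < n ==> r'' < u l ==> r < v l ==> comp_mat (dm c) (dm a) (tensor_comp A B (a, v) (c, u) t t') (l, r'', r) =
 msum (dm c) (dm a) (%r'. comp_mat (dm c) (dm b) t (l, r'', r') * comp_mat (dm b) (dm a) t' (l, r', r)) {..<w l}"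
proof -
 obtain L where L: "t = tensor A B (b, w) (c, u) L" "set L \<subseteq> Hom A b c \<times> Hom B w u" using t(1) by (rule tensor_homE)
 obtain L' where L': "t' = tensor A B (a, v) (b, w) L'" "set L' \<subseteq> Hom A a b \<times> Hom B v w" using t(2) by (rule tensor_homE)
 note e = tensor_comp_tensor[OF X L(2) L'(2)]
 show "tensor_comp A B (a, v) (c, u) t t' \<in> tensor_hom A B (a, v) (c, u)"
 unfolding L L' e by (rule tensor_homI[OF comp_list_set[OF X L(2) L'(2)]])
 assume l: "l < n" and r: "r'' < u l" "r < v l"
 have j: "(l, r'', r) \<in> slots n v u" "!!r'. r' < w l ==> (l, r'', r') \<in> slots n w u" "!!r'. r' < w l ==> (l, r', r) \<in> slots n v w"
 using l r by (auto simp: slots_def)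
 show "comp_mat (dm c) (dm a) (tensor_comp A B (a, v) (c, u) t t') (l, r'', r) =
 msum (dm c) (dm a) (%r'. comp_mat (dm c) (dm b) t (l, r'', r') * comp_mat (dm b) (dm a) t' (l, r', r)) {..<w l}"
 unfolding L(1) L'(1) e
 proof (rule eq_matI)
 fix x y assume "x < drow (msum (dm c) (dm a) (%r'. comp_mat (dm c) (dm b) (tensor A B (b, w) (c, u) L) (l, r'', r') *
 comp_mat (dm b) (dm a) (tensor A B (a, v) (b, w) L') (l, r', r)) {..<w l})"
 "y < dcol (msum (dm c) (dm a) (%r'. comp_mat (dm c) (dm b) (tensor A B (b, w) (c, u) L) (l, r'', r') *
 comp_mat (dm b) (dm a) (tensor A B (a, v) (b, w) L') (l, r', r)) {..<w l})"
 then have xy: "x < dm c" "y < dm a" by simp_all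
 have sc: "(M * N) $$ (p, q) = (\<Sum>z<d. M $$ (p, z) * N $$ (z, q))"
 if "M \<in> carrier_mat d1 d" "N \<in> carrier_mat d d2" "p < d1" "q < d2" for M N :: "'k mat" and p q d d1 d2
 using that by (auto simp: scalar_prod_def atLeast0LessThan)
 have Lf: "fst (L ! i) \<in> carrier_mat (dm c) (dm b)" "snd (L ! i) l \<in> carrier_mat (u l) (w l)" if "i < len L" for i
 proof -
 have "L ! i \<in> Hom A b c \<times> Hom B w u" using nth_mem[OF that] L(2) by blast
 then show "fst (L ! i) \<in> carrier_mat (dm c) (dm b)" "snd (L ! i) l \<in> carrier_mat (u l) (w l)" using Hom_carrier[OF X(2,3)] l by (auto simp: mem_Times_iff PiE_iff)
 qed
 have Lf': "fst (L' ! i) \<in> carrier_mat (dm b) (dm a)" "snd (L' ! i) l \<in> carrier_mat (w l) (v l)" if "i < len L'" for i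
 proof -
 have "L' ! i \<in> Hom A a b \<times> Hom B v w" using nth_mem[OF that] L'(2) by blast
 then show "fst (L' ! i) \<in> carrier_mat (dm b) (dm a)" "snd (L' ! i) l \<in> carrier_mat (w l) (v l)" using Hom_carrier[OF X(1,2)] l by (auto simp: mem_Times_iff PiE_iff)
 qed
 have sn: "(\<Sum>(f, g)\<leftarrow>M. F f g) = (\<Sum>i<len M. F (fst (M ! i)) (snd (M ! i)))" for M and F :: "'k mat \<Rightarrow> (nat \<Rightarrow> 'k mat) \<Rightarrow> 'k"
 by (simp add: sum_list_sum_nth atLeast0LessThan split_def)
 have "comp_mat (dm c) (dm a) (tensor A B (a, v) (c, u) (comp_list L L')) (l, r'', r) $$ (x, y) =
 (\<Sum>(f, g)\<leftarrow>L. \<Sum>(f', g')\<leftarrow>L'. (f * f') $$ (x, y) * (Cmp B g g' l) $$ (r'', r))"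
 unfolding comp_mat_tensor[OF X(1,3) j(1)] using xy by (simp add: list_mat_def entry_def sum_comp_list del: Vec_power_simps)
 also have "... = (\<Sum>i<len L. \<Sum>k<len L'. (fst (L ! i) * fst (L' ! k)) $$ (x, y) * (snd (L ! i) l * snd (L' ! k) l) $$ (r'', r))"
 unfolding sn using l by simp
 also have "... = (\<Sum>i<len L. \<Sum>k<len L'. (\<Sum>z<dm b. fst (L ! i) $$ (x, z) * fst (L' ! k) $$ (z, y)) *
 (\<Sum>r'<w l. snd (L ! i) l $$ (r'', r') * snd (L' ! k) l $$ (r', r)))"
 by (intro sum.cong refl) (simp add: sc[OF Lf(1) Lf'(1)] sc[OF Lf(2) Lf'(2)] xy r del: index_mult_mat(1))
 also have "... = (\<Sum>r'<w l. \<Sum>z<dm b. (\<Sum>i<len L. fst (L ! i) $$ (x, z) * snd (L ! i) l $$ (r'', r')) *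
 (\<Sum>k<len L'. fst (L' ! k) $$ (z, y) * snd (L' ! k) l $$ (r', r)))"
 by (rule sum_rearrange)
 also have "... = (\<Sum>r'<w l. \<Sum>z<dm b. comp_mat (dm c) (dm b) (tensor A B (b, w) (c, u) L) (l, r'', r') $$ (x, z) *
 comp_mat (dm b) (dm a) (tensor A B (a, v) (b, w) L') (l, r', r) $$ (z, y))"
 by (intro sum.cong refl) (use xy j comp_mat_tensor[OF X(2,3)] comp_mat_tensor[OF X(1,2)] in \<open>simp add: list_mat_def entry_def sn\<close>)
 also have "... = msum (dm c) (dm a) (%r'. comp_mat (dm c) (dm b) (tensor A B (b, w) (c, u) L) (l, r'', r') *
 comp_mat (dm b) (dm a) (tensor A B (a, v) (b, w) L') (l, r', r)) {..<w l} $$ (x, y)"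
 using xy by (simp add: scalar_prod_def atLeast0LessThan)
 finally show "comp_mat (dm c) (dm a) (tensor A B (a, v) (c, u) (comp_list L L')) (l, r'', r) $$ (x, y) =
 msum (dm c) (dm a) (%r'. comp_mat (dm c) (dm b) (tensor A B (b, w) (c, u) L) (l, r'', r') *
 comp_mat (dm b) (dm a) (tensor A B (a, v) (b, w) L') (l, r', r)) {..<w l} $$ (x, y)" .
 qed simp_all
qed

lemma tensor_sum_Hom:
 fixes m :: nat
 assumes "!!i. i < m ==> t i \<in> tensor_hom A B (a, v) (b, w)"
 shows "(\<lambda>\<beta>\<in>bilinear_forms A B (a, v) (b, w). \<Sum>i<m. t i \<beta>) \<in> tensor_hom A B (a, v) (b, w)"
proof -
 have "\<exists>L. t i = tensor A B (a, v) (b, w) L & set L \<subseteq> Hom A a b \<times> Hom B v w" if "i < m" for i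
 using tensor_homE[OF assms[OF that]] by metis
 then obtain L where L: "!!i. i < m ==> t i = tensor A B (a, v) (b, w) (L i) & set (L i) \<subseteq> Hom A a b \<times> Hom B v w"
 by metis
 have s: "(\<Sum>(f, g)\<leftarrow>concat (map L [0..<m]). \<beta> f g) = (\<Sum>i<m. \<Sum>(f, g)\<leftarrow>L i. \<beta> f g)" for \<beta> :: "'k mat \<Rightarrow> (nat \<Rightarrow> 'k mat) \<Rightarrow> 'k"
 by (induction m) auto
 have "(\<lambda>\<beta>\<in>bilinear_forms A B (a, v) (b, w). \<Sum>i<m. t i \<beta>) = tensor A B (a, v) (b, w) (concat (map L [0..<m]))"
 unfolding tensor_def s by (intro restrict_ext sum.cong refl) (use L in \<open>simp add: tensor_def\<close>)
 moreover have "set (concat (map L [0..<m])) \<subseteq> Hom A a b \<times> Hom B v w"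
 unfolding set_concat set_map using L by fastforce
 ultimately show ?thesis using tensor_homI by metis
qed

lemma tensor_add_Hom:
 assumes "t \<in> tensor_hom A B (a, v) (b, w)" "t' \<in> tensor_hom A B (a, v) (b, w)"
 shows "(\<lambda>\<beta>\<in>bilinear_forms A B (a, v) (b, w). t \<beta> + t' \<beta>) \<in> tensor_hom A B (a, v) (b, w)"
 using tensor_sum_Hom[of 2 "%i. if i = 0 then t else t'" a v b w] assms by (simp add: numeral_2_eq_2)

lemma tensor_scale_Hom:
 assumes X: "a \<in> Obj A" "b \<in> Obj A" and t: "t \<in> tensor_hom A B (a, v) (b, w)"
 shows "(\<lambda>\<beta>\<in>bilinear_forms A B (a, v) (b, w). x * t \<beta>) \<in> tensor_hom A B (a, v) (b, w)"
proof -
 obtain L where L: "t = tensor A B (a, v) (b, w) L" "set L \<subseteq> Hom A a b \<times> Hom B v w" using t by (rule tensor_homE)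
 have s: "(\<Sum>(f, g)\<leftarrow>map (%(f, g). (x \<cdot>\<^sub>m f, g)) L. \<beta> f g) = x * (\<Sum>(f, g)\<leftarrow>L. \<beta> f g)"
 if "\<beta> \<in> bilinear_forms A B (a, v) (b, w)" for \<beta>
 using L(2) that
 proof (induction L)
 case (Cons y L)
 have "\<beta> (x \<cdot>\<^sub>m fst y) (snd y) = x * \<beta> (fst y) (snd y)"
 using Cons(2,3) unfolding bilinear_forms_def ops by auto
 then show ?case using Cons by (simp add: split_def algebra_simps)
 qed simp
 have "(\<lambda>\<beta>\<in>bilinear_forms A B (a, v) (b, w). x * t \<beta>) = tensor A B (a, v) (b, w) (map (%(f, g). (x \<cdot>\<^sub>m f, g)) L)"
 proof
 fix \<beta>
 show "(\<lambda>\<beta>\<in>bilinear_forms A B (a, v) (b, w). x * t \<beta>) \<beta> = tensor A B (a, v) (b, w) (map (%(f, g). (x \<cdot>\<^sub>m f, g)) L) \<beta>"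
 unfolding L(1) tensor_def by (cases "\<beta> \<in> bilinear_forms A B (a, v) (b, w)") (simp_all only: s restrict_apply if_True if_False)
 qed
 moreover have "set (map (%(f, g). (x \<cdot>\<^sub>m f, g)) L) \<subseteq> Hom A a b \<times> Hom B v w" using L(2) smult_Hom[OF X] by auto
 ultimately show ?thesis using tensor_homI by metis
qed

end

end

section \<open>Finite biproducts\<close>

context mat_category
begin

definition biprod :: "'s set \<Rightarrow> ('s \<Rightarrow> 'o) \<Rightarrow> 'o \<Rightarrow> ('s \<Rightarrow> 'k mat) \<Rightarrow> ('s \<Rightarrow> 'k mat) \<Rightarrow> bool" where
 "biprod J Z X p q \<longleftrightarrow> finite J & X \<in> Obj A & (\<forall>s\<in>J. Z s \<in> Obj A & p s \<in> Hom A (Z s) X & q s \<in> Hom A X (Z s)) &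
 (\<forall>s\<in>J. \<forall>s'\<in>J. q s' * p s = (if s' = s then 1\<^sub>m (dm (Z s)) else 0\<^sub>m (dm (Z s')) (dm (Z s)))) &
 msum (dm X) (dm X) (%s. p s * q s) J = 1\<^sub>m (dm X)"

text \<open>The arrow between biproducts with prescribed matrix of components, the row index first
  (\<open>assemble_coeff\<close>, \<open>assemble_unique\<close>).\<close>

definition assemble :: "'s set \<Rightarrow> 'o \<Rightarrow> ('s \<Rightarrow> 'k mat) \<Rightarrow> 't set \<Rightarrow> 'o \<Rightarrow> ('t \<Rightarrow> 'k mat) \<Rightarrow> ('t \<Rightarrow> 's \<Rightarrow> 'k mat) \<Rightarrow> 'k mat" where
 "assemble J X q J' X' p' K = msum (dm X') (dm X) (%s. p' (fst s) * K (fst s) (snd s) * q (snd s)) (J' \<times> J)"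

lemma biprodD:
 assumes "biprod J Z X p q"
 shows "finite J" "X \<in> Obj A" "s \<in> J ==> Z s \<in> Obj A" "s \<in> J ==> p s \<in> Hom A (Z s) X" "s \<in> J ==> q s \<in> Hom A X (Z s)"
 "s \<in> J ==> s' \<in> J ==> q s' * p s = (if s' = s then 1\<^sub>m (dm (Z s)) else 0\<^sub>m (dm (Z s')) (dm (Z s)))"
 "msum (dm X) (dm X) (%s. p s * q s) J = 1\<^sub>m (dm X)"
 "s \<in> J ==> p s \<in> carrier_mat (dm X) (dm (Z s))" "s \<in> J ==> q s \<in> carrier_mat (dm (Z s)) (dm X)"
 using assms Hom_carrier unfolding biprod_def by (metis, metis, metis, metis, metis, metis, metis, metis, metis)

lemma msum_zero: "(!!s. s \<in> J ==> f s = 0\<^sub>m a b) ==> msum a b f J = 0\<^sub>m a b"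
 by (rule eq_matI) simp_all

context
 fixes J :: "'s set" and Z X p q and J' :: "'t set" and Z' X' p' q'
 assumes b: "biprod J Z X p q" and b': "biprod J' Z' X' p' q'"
begin

lemma assemble_Hom:
 assumes "!!s s'. s \<in> J ==> s' \<in> J' ==> K s' s \<in> Hom A (Z s) (Z' s')"
 shows "assemble J X q J' X' p' K \<in> Hom A X X'"
 unfolding assemble_def
proof (rule msum_Hom[OF biprodD(2)[OF b] biprodD(2)[OF b']])
 fix s assume "s \<in> J' \<times> J"
 then obtain s1 s2 where s: "s = (s1, s2)" "s1 \<in> J'" "s2 \<in> J" by auto
 show "p' (fst s) * K (fst s) (snd s) * q (snd s) \<in> Hom A X X'"
 unfolding s fst_conv snd_conv
 by (intro mult_Hom[OF biprodD(2)[OF b] biprodD(3)[OF b s(3)] biprodD(2)[OF b']]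
 mult_Hom[OF biprodD(3)[OF b s(3)] biprodD(3)[OF b' s(2)] biprodD(2)[OF b']] biprodD(5)[OF b s(3)] biprodD(4)[OF b' s(2)] assms s)
qed (simp add: biprodD(1)[OF b] biprodD(1)[OF b'])

lemma assemble_coeff:
 assumes K: "!!s s'. s \<in> J ==> s' \<in> J' ==> K s' s \<in> Hom A (Z s) (Z' s')" and t: "t \<in> J" "t' \<in> J'"
 shows "q' t' * assemble J X q J' X' p' K * p t = K t' t"
proof -
 note c = biprodD(8,9)[OF b] biprodD(8,9)[OF b']
 have Kc: "K s' s \<in> carrier_mat (dm (Z' s')) (dm (Z s))" if "s \<in> J" "s' \<in> J'" for s s'
 by (rule Hom_carrier[OF biprodD(3)[OF b that(1)] biprodD(3)[OF b' that(2)] K[OF that]])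
 have m1: "p' (fst s) * K (fst s) (snd s) * q (snd s) \<in> carrier_mat (dm X') (dm X)" if "s \<in> J' \<times> J" for s
 proof -
 obtain s1 s2 where s: "s = (s1, s2)" "s1 \<in> J'" "s2 \<in> J" using \<open>s \<in> J' \<times> J\<close> by auto
 show ?thesis unfolding s fst_conv snd_conv
 by (rule mult_carrier_mat[OF mult_carrier_mat[OF c(3)[OF s(2)] Kc[OF s(3,2)]] c(2)[OF s(3)]])
 qed
 have m2: "q' t' * (p' (fst s) * K (fst s) (snd s) * q (snd s)) \<in> carrier_mat (dm (Z' t')) (dm X)" if "s \<in> J' \<times> J" for s
 by (rule mult_carrier_mat[OF c(4)[OF t(2)] m1[OF that]])
 have "q' t' * assemble J X q J' X' p' K * p t =
 msum (dm (Z' t')) (dm (Z t)) (%s. q' t' * (p' (fst s) * K (fst s) (snd s) * q (snd s)) * p t) (J' \<times> J)"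
 proof -
 let ?F = "%s. p' (fst s) * K (fst s) (snd s) * q (snd s)"
 have "q' t' * msum (dm X') (dm X) ?F (J' \<times> J) = msum (dm (Z' t')) (dm X) (%s. q' t' * ?F s) (J' \<times> J)"
 using msum_mult_right[of "J' \<times> J" ?F "dm X'" "dm X" "q' t'"] m1 carrier_matD[OF c(4)[OF t(2)]] by simp
 moreover have "msum (dm (Z' t')) (dm X) (%s. q' t' * ?F s) (J' \<times> J) * p t = msum (dm (Z' t')) (dm (Z t)) (%s. q' t' * ?F s * p t) (J' \<times> J)"
 using msum_mult_left[of "J' \<times> J" "%s. q' t' * ?F s" "dm (Z' t')" "dm X" "p t"] m2 carrier_matD[OF c(1)[OF t(1)]] by simp
 ultimately show ?thesis unfolding assemble_def by simp
 qed
 also have "... = msum (dm (Z' t')) (dm (Z t)) (%s. if s = (t', t) then K t' t else 0\<^sub>m (dm (Z' t')) (dm (Z t))) (J' \<times> J)"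
 proof (rule msum_cong)
 fix s assume "s \<in> J' \<times> J"
 then obtain s' s2 where s: "s = (s', s2)" "s' \<in> J'" "s2 \<in> J" by auto
 note d = carrier_matD[OF c(1)[OF s(3)]] carrier_matD[OF c(2)[OF s(3)]] carrier_matD[OF c(1)[OF t(1)]] carrier_matD[OF c(2)[OF t(1)]]
 carrier_matD[OF c(3)[OF s(2)]] carrier_matD[OF c(4)[OF s(2)]] carrier_matD[OF c(3)[OF t(2)]] carrier_matD[OF c(4)[OF t(2)]]
 carrier_matD[OF Kc[OF s(3,2)]]
 have "q' t' * (p' s' * K s' s2 * q s2) * p t = (q' t' * p' s') * K s' s2 * (q s2 * p t)"
 using d by (simp add: mat_assoc)
 also have "... = (if s = (t', t) then K t' t else 0\<^sub>m (dm (Z' t')) (dm (Z t)))"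
 unfolding biprodD(6)[OF b t(1) s(3)] biprodD(6)[OF b' s(2) t(2)] using d s(1) by auto
 finally show "q' t' * (p' (fst s) * K (fst s) (snd s) * q (snd s)) * p t = (if s = (t', t) then K t' t else 0\<^sub>m (dm (Z' t')) (dm (Z t)))"
 by (simp add: s(1))
 qed
 also have "... = K t' t"
 by (rule msum_delta) (use t Kc[OF t] in \<open>simp_all add: biprodD(1)[OF b] biprodD(1)[OF b']\<close>)
 finally show ?thesis .
qed

lemma biprod_expand:
 assumes f: "f \<in> Hom A X X'"
 shows "assemble J X q J' X' p' (%s' s. q' s' * f * p s) = f"
proof (rule ap_eqI)
 note c = biprodD(8,9)[OF b] biprodD(8,9)[OF b'] and fc = Hom_carrier[OF biprodD(2)[OF b] biprodD(2)[OF b'] f]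
 note d = c[THEN carrier_matD(1)] c[THEN carrier_matD(2)] fc[THEN carrier_matD(1)] fc[THEN carrier_matD(2)]
 fix c' F assume "c' < dcol f"
 then have c': "c' < dm X" using fc by simp
 have one: "(\<Sum>s\<in>J. ap (p s * q s) c' G) = G c'" for G
 using arg_cong[OF biprodD(7)[OF b], of "%M. ap M c' G"] c' d by (subst (asm) ap_msum) simp_all
 have one': "(\<Sum>s\<in>J'. ap (p' s * q' s) k G) = G k" if "k < dm X'" for G k
 using arg_cong[OF biprodD(7)[OF b'], of "%M. ap M k G"] that d by (subst (asm) ap_msum) simp_all
 have "ap (assemble J X q J' X' p' (%s' s. q' s' * f * p s)) c' F =
 (\<Sum>s\<in>J' \<times> J. ap (p' (fst s) * (q' (fst s) * f * p (snd s)) * q (snd s)) c' F)"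
 unfolding assemble_def using c' d by (subst ap_msum) auto
 also have "... = (\<Sum>s'\<in>J'. \<Sum>s\<in>J. ap (p s * q s) c' (%i. ap f i (%k. ap (p' s' * q' s') k F)))"
 unfolding sum.cartesian_product by (intro sum.cong refl) (use c' d in auto)
 also have "... = (\<Sum>s'\<in>J'. ap f c' (%k. ap (p' s' * q' s') k F))" by (simp only: one)
 also have "... = ap f c' F" unfolding ap_sum[symmetric] by (rule ap_cong) (simp only: one' d)
 finally show "ap (assemble J X q J' X' p' (%s' s. q' s' * f * p s)) c' F = ap f c' F" .
qed (use Hom_carrier[OF biprodD(2)[OF b] biprodD(2)[OF b'] f] in \<open>auto simp: assemble_def\<close>)

lemma assemble_unique:
 assumes f: "f \<in> Hom A X X'" and K: "!!s s'. s \<in> J ==> s' \<in> J' ==> q' s' * f * p s = K s' s"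
 shows "f = assemble J X q J' X' p' K"
proof -
 have "assemble J X q J' X' p' (%s' s. q' s' * f * p s) = assemble J X q J' X' p' K"
 unfolding assemble_def by (rule msum_cong) (use K in auto)
 then show ?thesis using biprod_expand[OF f] by simp
qed

end

text \<open>The identity of the middle object is resolved into the sum of the p' q'; then components
  can be compared.\<close>

lemma assemble_mult:
 assumes b: "biprod J Z X p q" and b': "biprod J' Z' X' p' q'" and b'': "biprod J'' Z'' X'' p'' q''"
 and K: "!!s s'. s \<in> J ==> s' \<in> J' ==> K s' s \<in> Hom A (Z s) (Z' s')"
 and K': "!!s s'. s \<in> J' ==> s' \<in> J'' ==> K' s' s \<in> Hom A (Z' s) (Z'' s')"
 shows "assemble J' X' q' J'' X'' p'' K' * assemble J X q J' X' p' K =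
 assemble J X q J'' X'' p'' (%s'' s. msum (dm (Z'' s'')) (dm (Z s)) (%s'. K' s'' s' * K s' s) J')"
proof (rule assemble_unique[OF b b''])
 let ?f = "assemble J X q J' X' p' K" and ?g = "assemble J' X' q' J'' X'' p'' K'"
 have f: "?f \<in> Hom A X X'" by (rule assemble_Hom[OF b b' K])
 have g: "?g \<in> Hom A X' X''" by (rule assemble_Hom[OF b' b'' K'])
 note o = biprodD(2)[OF b] biprodD(2)[OF b'] biprodD(2)[OF b'']
 show "?g * ?f \<in> Hom A X X''" by (rule mult_Hom[OF o f g])
 fix s s'' assume s: "s \<in> J" "s'' \<in> J''"
 note d = carrier_matD[OF Hom_carrier[OF o(1,2) f]] carrier_matD[OF Hom_carrier[OF o(2,3) g]]
 carrier_matD[OF biprodD(8)[OF b s(1)]] carrier_matD[OF biprodD(9)[OF b'' s(2)]]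
 have c': "p' s' * q' s' \<in> carrier_mat (dm X') (dm X')" if "s' \<in> J'" for s'
 by (rule mult_carrier_mat[OF biprodD(8,9)[OF b' that]])
 have c'': "q'' s'' * ?g * (p' s' * q' s') \<in> carrier_mat (dm (Z'' s'')) (dm X')" if "s' \<in> J'" for s'
 by (rule mult_carrier_mat[OF _ c'[OF that]]) (use d in auto)
 have "q'' s'' * (?g * ?f) * p s = q'' s'' * ?g * 1\<^sub>m (dm X') * (?f * p s)"
 using d by (simp add: mat_assoc)
 also have "... = msum (dm (Z'' s'')) (dm (Z s)) (%s'. q'' s'' * ?g * (p' s' * q' s') * (?f * p s)) J'"
 proof -
 have "q'' s'' * ?g * msum (dm X') (dm X') (%s'. p' s' * q' s') J' = msum (dm (Z'' s'')) (dm X') (%s'. q'' s'' * ?g * (p' s' * q' s')) J'"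
 using msum_mult_right[of J' "%s'. p' s' * q' s'" "dm X'" "dm X'" "q'' s'' * ?g"] c' d by simp
 moreover have "msum (dm (Z'' s'')) (dm X') (%s'. q'' s'' * ?g * (p' s' * q' s')) J' * (?f * p s) =
 msum (dm (Z'' s'')) (dm (Z s)) (%s'. q'' s'' * ?g * (p' s' * q' s') * (?f * p s)) J'"
 using msum_mult_left[of J' "%s'. q'' s'' * ?g * (p' s' * q' s')" "dm (Z'' s'')" "dm X'" "?f * p s"] c'' d by simp
 ultimately show ?thesis unfolding biprodD(7)[OF b', symmetric] by simp
 qed
 also have "... = msum (dm (Z'' s'')) (dm (Z s)) (%s'. K' s'' s' * K s' s) J'"
 proof (rule msum_cong)
 fix s' assume s': "s' \<in> J'"
 have "q'' s'' * ?g * (p' s' * q' s') * (?f * p s) = (q'' s'' * ?g * p' s') * (q' s' * ?f * p s)"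
 using d carrier_matD[OF biprodD(8)[OF b' s']] carrier_matD[OF biprodD(9)[OF b' s']] by (simp add: mat_assoc)
 moreover have "q' s' * ?f * p s = K s' s" by (rule assemble_coeff[OF b b' K s(1) s'])
 moreover have "q'' s'' * ?g * p' s' = K' s'' s'" by (rule assemble_coeff[OF b' b'' K' s' s(2)])
 ultimately show "q'' s'' * ?g * (p' s' * q' s') * (?f * p s) = K' s'' s' * K s' s" by simp
 qed
 finally show "q'' s'' * (?g * ?f) * p s = msum (dm (Z'' s'')) (dm (Z s)) (%s'. K' s'' s' * K s' s) J'" .
qed

lemma assemble_one:
 assumes b: "biprod J Z X p q"
 shows "assemble J X q J X p (%s' s. if s' = s then 1\<^sub>m (dm (Z s)) else 0\<^sub>m (dm (Z s')) (dm (Z s))) = 1\<^sub>m (dm X)"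
 by (rule assemble_unique[OF b b, symmetric, OF one_Hom[OF biprodD(2)[OF b]]])
 (simp add: biprodD(6)[OF b] right_mult_one_mat[OF biprodD(9)[OF b]])

lemma biprod_reindex:
 assumes b: "biprod J Z X p q" and h: "bij_betw h J' J" and Z: "!!s. s \<in> J' ==> Z' s = Z (h s)"
 shows "biprod J' Z' X (p \<circ> h) (q \<circ> h)"
proof -
 have m: "h s \<in> J" if "s \<in> J'" for s using h that by (auto simp: bij_betw_def)
 have inj: "h s = h s' \<longleftrightarrow> s = s'" if "s \<in> J'" "s' \<in> J'" for s s'
 using h that by (auto simp: bij_betw_def inj_on_def)
 have "msum (dm X) (dm X) (%s. p (h s) * q (h s)) J' = msum (dm X) (dm X) (%s. p s * q s) J"
 unfolding msum_def by (intro arg_cong[of _ _ "mat (dm X) (dm X)"] ext)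
 (simp add: split_def sum.reindex_bij_betw[OF h, of "%s. (p s * q s) $$ x" for x])
 then show ?thesis unfolding biprod_def
 using biprodD[OF b] m inj Z bij_betw_finite[OF h] by simp
qed

text \<open>The identity matrix of components, assembled in both directions.\<close>

lemma biprod_iso:
 assumes b: "biprod J Z X p q" and b': "biprod J Z X' p' q'"
 shows "\<exists>u v. inverse_arrows A X X' v u"
proof -
 let ?\<delta> = "%s' s. if s' = s then 1\<^sub>m (dm (Z s)) else 0\<^sub>m (dm (Z s')) (dm (Z s)) :: 'k mat"
 have \<delta>: "?\<delta> s' s \<in> Hom A (Z s) (Z s')" if "s \<in> J" "s' \<in> J" for s s'
 using one_Hom zero_Hom biprodD(3)[OF b] that by auto
 have m: "msum (dm (Z s'')) (dm (Z s)) (%s'. ?\<delta> s'' s' * ?\<delta> s' s) J = ?\<delta> s'' s" if "s \<in> J" "s'' \<in> J" for s s''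
 proof -
 have "msum (dm (Z s'')) (dm (Z s)) (%s'. ?\<delta> s'' s' * ?\<delta> s' s) J =
 msum (dm (Z s'')) (dm (Z s)) (%s'. if s' = s'' then ?\<delta> s'' s else 0\<^sub>m (dm (Z s'')) (dm (Z s))) J"
 by (rule msum_cong) auto
 also have "... = ?\<delta> s'' s" by (rule msum_delta) (use that biprodD(1)[OF b] in auto)
 finally show ?thesis .
 qed
 have e: "assemble J Y' y J Y p'' (%s'' s. msum (dm (Z s'')) (dm (Z s)) (%s'. ?\<delta> s'' s' * ?\<delta> s' s) J) = assemble J Y' y J Y p'' ?\<delta>"
 for Y' y Y p''
 unfolding assemble_def
 proof (rule msum_cong)
 fix s assume "s \<in> J \<times> J"
 then obtain s1 s2 where s: "s = (s1, s2)" "s1 \<in> J" "s2 \<in> J" by auto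
 show "p'' (fst s) * msum (dm (Z (fst s))) (dm (Z (snd s))) (%s'. ?\<delta> (fst s) s' * ?\<delta> s' (snd s)) J * y (snd s) =
 p'' (fst s) * ?\<delta> (fst s) (snd s) * y (snd s)"
 unfolding s fst_conv snd_conv m[OF s(3,2)] ..
 qed
 have h: "assemble J X q J X' p' ?\<delta> \<in> Hom A X X'" "assemble J X' q' J X p ?\<delta> \<in> Hom A X' X"
 by (rule assemble_Hom[OF b b' \<delta>] assemble_Hom[OF b' b \<delta>]; assumption)+
 have "assemble J X' q' J X p ?\<delta> * assemble J X q J X' p' ?\<delta> = assemble J X q J X p (%s'' s. msum (dm (Z s'')) (dm (Z s)) (%s'. ?\<delta> s'' s' * ?\<delta> s' s) J)"
 by (rule assemble_mult[OF b b' b \<delta> \<delta>])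
 moreover have "assemble J X q J X' p' ?\<delta> * assemble J X' q' J X p ?\<delta> = assemble J X' q' J X' p' (%s'' s. msum (dm (Z s'')) (dm (Z s)) (%s'. ?\<delta> s'' s' * ?\<delta> s' s) J)"
 by (rule assemble_mult[OF b' b b' \<delta> \<delta>])
 ultimately have "inverse_arrows A X X' (assemble J X q J X' p' ?\<delta>) (assemble J X' q' J X p ?\<delta>)"
 unfolding inverse_arrows_def ops(1) ops(4)[OF biprodD(2)[OF b]] ops(4)[OF biprodD(2)[OF b']]
 using h by (simp only: e assemble_one[OF b] assemble_one[OF b'] simp_thms)
 then show ?thesis by blast
qed

end

section \<open>The functor from the direct sum of the products with \<open>Vec_power\<close>\<close>

text \<open>\<Phi> i l embeds the full subcategory P i of A as the l-th of nn i copies inside C.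
  Distinct copies have no arrows between them, and every object of C is a biproduct of one object
  from each copy. The index type in \<open>biprod_exists\<close> is that of
  \<open>slot_set\<close>.\<close>

locale box_decomposition = A: mat_category A dmA + C: mat_category C dmC
 for A :: "('o, 'k::field mat, 'k) lincat" and dmA and C :: "('p, 'k mat, 'k) lincat" and dmC +
 fixes I :: "'i set" and P :: "'i \<Rightarrow> 'o \<Rightarrow> bool" and nn :: "'i \<Rightarrow> nat" and \<Phi> :: "'i \<Rightarrow> nat \<Rightarrow> 'o \<Rightarrow> 'p"
 assumes finite_I: "finite I"
 and \<Phi>_Obj: "i \<in> I ==> l < nn i ==> a \<in> Obj A ==> P i a ==> \<Phi> i l a \<in> Obj C"
 and \<Phi>_dm: "i \<in> I ==> l < nn i ==> a \<in> Obj A ==> P i a ==> dmC (\<Phi> i l a) = dmA a"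
 and \<Phi>_Hom: "i \<in> I ==> l < nn i ==> a \<in> Obj A ==> P i a ==> a' \<in> Obj A ==> P i a' ==>
 Hom C (\<Phi> i l a) (\<Phi> i l a') = Hom A a a'"
 and \<Phi>_zero: "i \<in> I ==> l < nn i ==> a \<in> Obj A ==> P i a ==> i' \<in> I ==> l' < nn i' ==> a' \<in> Obj A ==> P i' a' ==>
 (i, l) ~= (i', l') ==> f \<in> Hom C (\<Phi> i l a) (\<Phi> i' l' a') ==> f = 0\<^sub>m (dmA a') (dmA a)"
 and biprod_exists: "finite J ==> (!!s. s \<in> J ==> Z s \<in> Obj C) ==> \<exists>X p q. C.biprod (J :: ('i \<times> nat \<times> nat \<times> nat) set) Z X p q"
 and decomposition: "X \<in> Obj C ==> \<exists>a p q. (\<forall>i\<in>I. \<forall>l<nn i. a i l \<in> Obj A & P i (a i l)) &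
 C.biprod (SIGMA i:I. {..<nn i}) (%(i, l). \<Phi> i l (a i l)) X p q"
begin

abbreviation "AP i \<equiv> full_sub A (P i)"
abbreviation "VP i \<equiv> Vec_power (nn i) :: (nat \<Rightarrow> nat, nat \<Rightarrow> 'k mat, 'k) lincat"

definition "D = direct_sum I (%i. AP i \<boxtimes> VP i)"

definition part :: "('x \<Rightarrow> 'y \<times> 'z \<times> 'w) \<Rightarrow> 'x \<Rightarrow> 'z" where "part f i = fst (snd (f i))"

text \<open>The j-th entry of the list d i is a pair (a, v), standing for v l copies of \<Phi> i l a
  for each l. A slot (i, j, l, r) names the r-th of these copies.\<close>

definition slot_set :: "('i \<Rightarrow> ('o \<times> (nat \<Rightarrow> nat)) list) \<Rightarrow> ('i \<times> nat \<times> nat \<times> nat) set" where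
 "slot_set d = (SIGMA i:I. SIGMA j:{..<len (d i)}. SIGMA l:{..<nn i}. {..<snd (d i ! j) l})"

definition slot_obj :: "('i \<Rightarrow> ('o \<times> (nat \<Rightarrow> nat)) list) \<Rightarrow> 'i \<times> nat \<times> nat \<times> nat \<Rightarrow> 'p" where
 "slot_obj d = (%(i, j, l, r). \<Phi> i l (fst (d i ! j)))"

text \<open>Components of an arrow between slots. They are zero between different copies (i, l), as
  every arrow of C between them is.\<close>

definition coeff :: "('i \<Rightarrow> ('o \<times> (nat \<Rightarrow> nat)) list) \<Rightarrow> ('i \<Rightarrow> ('o \<times> (nat \<Rightarrow> nat)) list) \<Rightarrow>
 ('i \<Rightarrow> ('o, nat \<Rightarrow> nat, 'k mat, nat \<Rightarrow> 'k mat, 'k) box_arrow) \<Rightarrow> 'i \<times> nat \<times> nat \<times> nat \<Rightarrow> 'i \<times> nat \<times> nat \<times> nat \<Rightarrow> 'k mat" where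
 "coeff d d' f = (%(i', j', l', r') (i, j, l, r). if i' = i & l' = l
 then comp_mat (dmA (fst (d' i ! j'))) (dmA (fst (d i ! j))) (part f i (j', j)) (l, r', r)
 else 0\<^sub>m (dmA (fst (d' i' ! j'))) (dmA (fst (d i ! j))))"

lemma Obj_D: "d \<in> Obj D \<longleftrightarrow> d \<in> extensional I & (\<forall>i\<in>I. set (d i) \<subseteq> Obj (AP i) \<times> Obj (VP i))"
 by (auto simp: D_def direct_sum_def box_def PiE_iff)

lemma Obj_D_nth:
 assumes "d \<in> Obj D" "i \<in> I" "j < len (d i)"
 shows "fst (d i ! j) \<in> Obj A" "P i (fst (d i ! j))"
proof -
 have "d i ! j \<in> Obj (AP i) \<times> Obj (VP i)" using assms(1,2) nth_mem[OF assms(3)] unfolding Obj_D by blast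
 then show "fst (d i ! j) \<in> Obj A" "P i (fst (d i ! j))" by (auto simp: mem_Times_iff)
qed

lemma Hom_D: "f \<in> Hom D d d' \<longleftrightarrow> f \<in> extensional I & (\<forall>i\<in>I. f i = (d i, part f i, d' i) &
 part f i \<in> extensional ({..<len (d' i)} \<times> {..<len (d i)}) &
 (\<forall>j'<len (d' i). \<forall>j<len (d i). part f i (j', j) \<in> tensor_hom (AP i) (VP i) (d i ! j) (d' i ! j')))"
 by (fastforce simp: D_def direct_sum_def box_def PiE_iff part_def)

lemma D_ops:
 "Idn D d = (\<lambda>i\<in>I. (d i, (\<lambda>(j', j)\<in>{..<len (d i)} \<times> {..<len (d i)}. tensor (AP i) (VP i) (d i ! j) (d i ! j')
 (if j' = j then [(Idn A (fst (d i ! j')), Idn (VP i) (snd (d i ! j')))] else [])), d i))"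
 "f \<in> Hom D d d' ==> g \<in> Hom D d' d'' ==> Cmp D g f = (\<lambda>i\<in>I. (d i, (\<lambda>(j'', j)\<in>{..<len (d'' i)} \<times> {..<len (d i)}.
 \<lambda>\<beta>\<in>bilinear_forms (AP i) (VP i) (d i ! j) (d'' i ! j''). \<Sum>j'<len (d' i).
 tensor_comp (AP i) (VP i) (d i ! j) (d'' i ! j'') (part g i (j'', j')) (part f i (j', j)) \<beta>), d'' i))"
 "f \<in> Hom D d d' ==> h \<in> Hom D d d' ==> Add D f h = (\<lambda>i\<in>I. (d i, (\<lambda>(j', j)\<in>{..<len (d' i)} \<times> {..<len (d i)}.
 \<lambda>\<beta>\<in>bilinear_forms (AP i) (VP i) (d i ! j) (d' i ! j'). part f i (j', j) \<beta> + part h i (j', j) \<beta>), d' i))"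
 "f \<in> Hom D d d' ==> Scl D c f = (\<lambda>i\<in>I. (d i, (\<lambda>(j', j)\<in>{..<len (d' i)} \<times> {..<len (d i)}.
 \<lambda>\<beta>\<in>bilinear_forms (AP i) (VP i) (d i ! j) (d' i ! j'). c * part f i (j', j) \<beta>), d' i))"
proof -
 have f: "f i = (d i, part f i, d' i)" if "f \<in> Hom D d d'" "i \<in> I" for f i d d' using that by (simp add: Hom_D)
 show "Idn D d = (\<lambda>i\<in>I. (d i, (\<lambda>(j', j)\<in>{..<len (d i)} \<times> {..<len (d i)}. tensor (AP i) (VP i) (d i ! j) (d i ! j')
 (if j' = j then [(Idn A (fst (d i ! j')), Idn (VP i) (snd (d i ! j')))] else [])), d i))"
 by (simp add: D_def direct_sum_def box_def del: Vec_power_simps cong: if_cong)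
 show "Cmp D g f = (\<lambda>i\<in>I. (d i, (\<lambda>(j'', j)\<in>{..<len (d'' i)} \<times> {..<len (d i)}.
 \<lambda>\<beta>\<in>bilinear_forms (AP i) (VP i) (d i ! j) (d'' i ! j''). \<Sum>j'<len (d' i).
 tensor_comp (AP i) (VP i) (d i ! j) (d'' i ! j'') (part g i (j'', j')) (part f i (j', j)) \<beta>), d'' i))"
 if "f \<in> Hom D d d'" "g \<in> Hom D d' d''"
 unfolding D_def direct_sum_def lincat.simps by (intro restrict_ext) (simp add: f[OF that(1)] f[OF that(2)] box_def)
 show "Add D f h = (\<lambda>i\<in>I. (d i, (\<lambda>(j', j)\<in>{..<len (d' i)} \<times> {..<len (d i)}.
 \<lambda>\<beta>\<in>bilinear_forms (AP i) (VP i) (d i ! j) (d' i ! j'). part f i (j', j) \<beta> + part h i (j', j) \<beta>), d' i))"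
 if "f \<in> Hom D d d'" "h \<in> Hom D d d'"
 unfolding D_def direct_sum_def lincat.simps by (intro restrict_ext) (simp add: f[OF that(1)] f[OF that(2)] box_def)
 show "Scl D c f = (\<lambda>i\<in>I. (d i, (\<lambda>(j', j)\<in>{..<len (d' i)} \<times> {..<len (d i)}.
 \<lambda>\<beta>\<in>bilinear_forms (AP i) (VP i) (d i ! j) (d' i ! j'). c * part f i (j', j) \<beta>), d' i))"
 if "f \<in> Hom D d d'"
 unfolding D_def direct_sum_def lincat.simps by (intro restrict_ext) (simp add: f[OF that] box_def)
qed

lemma part_tensor_hom:
 "f \<in> Hom D d d' ==> i \<in> I ==> j' < len (d' i) ==> j < len (d i) ==>
 part f i (j', j) \<in> tensor_hom (AP i) (VP i) (d i ! j) (d' i ! j')"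
 by (simp add: Hom_D)

lemma Hom_DI:
 assumes "!!i j' j. i \<in> I ==> j' < len (d' i) ==> j < len (d i) ==> T i (j', j) \<in> tensor_hom (AP i) (VP i) (d i ! j) (d' i ! j')"
 "!!i. i \<in> I ==> T i \<in> extensional ({..<len (d' i)} \<times> {..<len (d i)})"
 shows "(\<lambda>i\<in>I. (d i, T i, d' i)) \<in> Hom D d d'"
 unfolding Hom_D using assms by (simp add: part_def)

lemma part_restrict[simp]: "i \<in> I ==> part (\<lambda>i\<in>I. (d i, T i, d' i)) i = T i"
 by (simp add: part_def)

lemma AP_cat: "mat_category (AP i) dmA" by (rule A.full_sub_mat_category)

context
 fixes d d' d'' i j j' j''
 assumes d: "d \<in> Obj D" "d' \<in> Obj D" "d'' \<in> Obj D" and i: "i \<in> I"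
 and j: "j < len (d i)" "j' < len (d' i)" "j'' < len (d'' i)"
begin

lemma AP_Obj: "fst (d i ! j) \<in> Obj (AP i)" "fst (d' i ! j') \<in> Obj (AP i)" "fst (d'' i ! j'') \<in> Obj (AP i)"
 using Obj_D_nth[OF d(1) i j(1)] Obj_D_nth[OF d(2) i j(2)] Obj_D_nth[OF d(3) i j(3)] by simp_all

text \<open>The facts on tensors speak of explicit pairs (a, v); these instances speak of list
  entries d i ! j.\<close>

lemmas box_entry_bilinear = mat_category.entry_bilinear[OF AP_cat AP_Obj(1,2), where v = "snd (d i ! j)" and w = "snd (d' i ! j')" and n = "nn i", unfolded prod.collapse]
 and box_comp_mat_Hom = mat_category.comp_mat_Hom[OF AP_cat AP_Obj(1,2), where v = "snd (d i ! j)" and w = "snd (d' i ! j')" and n = "nn i", unfolded prod.collapse]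
 and box_hom_eqI = mat_category.tensor_hom_eqI[OF AP_cat AP_Obj(1,2), where v = "snd (d i ! j)" and w = "snd (d' i ! j')" and n = "nn i", unfolded prod.collapse]
 and box_hom_exists = mat_category.tensor_hom_exists[OF AP_cat AP_Obj(1,2), where v = "snd (d i ! j)" and w = "snd (d' i ! j')" and n = "nn i", unfolded prod.collapse]
 and box_comp_mat_tensor = mat_category.comp_mat_tensor[OF AP_cat AP_Obj(1,2), where v = "snd (d i ! j)" and w = "snd (d' i ! j')" and n = "nn i", unfolded prod.collapse]
 and box_comp_Hom = mat_category.tensor_comp_Hom[OF AP_cat AP_Obj, where v = "snd (d i ! j)" and w = "snd (d' i ! j')" and u = "snd (d'' i ! j'')" and n = "nn i", unfolded prod.collapse]
 and box_scale_Hom = mat_category.tensor_scale_Hom[OF AP_cat AP_Obj(1,2), where v = "snd (d i ! j)" and w = "snd (d' i ! j')" and n = "nn i", unfolded prod.collapse]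
 and box_homI = mat_category.tensor_homI[OF AP_cat, where a = "fst (d i ! j)" and b = "fst (d' i ! j')" and v = "snd (d i ! j)" and w = "snd (d' i ! j')" and n = "nn i", unfolded prod.collapse]

end

lemmas box_sum_Hom = mat_category.tensor_sum_Hom[OF AP_cat, where n = "nn i" and a = "fst p" and v = "snd p" and b = "fst q" and w = "snd q" for i p q, unfolded prod.collapse]
 and box_add_Hom = mat_category.tensor_add_Hom[OF AP_cat, where n = "nn i" and a = "fst p" and v = "snd p" and b = "fst q" and w = "snd q" for i p q, unfolded prod.collapse]

lemma D_category: "lin_category D"
proof
 fix d assume d: "d \<in> Obj D"
 show "Idn D d \<in> Hom D d d" unfolding D_ops
 proof (rule Hom_DI)
 fix i j' j assume i: "i \<in> I" and j: "j' < len (d i)" "j < len (d i)"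
 note o = AP_Obj[OF d d d i j(2,1,1)]
 have "tensor (AP i) (VP i) (d i ! j) (d i ! j') [] \<in> tensor_hom (AP i) (VP i) (d i ! j) (d i ! j')"
 by (rule box_homI[OF d d d i j(2,1,1)]) simp
 moreover have "tensor (AP i) (VP i) (d i ! j) (d i ! j) [(Idn A (fst (d i ! j)), Idn (VP i) (snd (d i ! j)))] \<in> tensor_hom (AP i) (VP i) (d i ! j) (d i ! j)"
 by (rule box_homI[OF d d d i j(2,2,2)]) (use o A.one_Hom in \<open>simp add: A.ops\<close>)
 ultimately show "(\<lambda>(j', j)\<in>{..<len (d i)} \<times> {..<len (d i)}. tensor (AP i) (VP i) (d i ! j) (d i ! j')
 (if j' = j then [(Idn A (fst (d i ! j')), Idn (VP i) (snd (d i ! j')))] else [])) (j', j) \<in> tensor_hom (AP i) (VP i) (d i ! j) (d i ! j')"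
 using j by (cases "j' = j") (simp_all del: Vec_power_simps)
 qed auto
next
 fix d d' d'' f g assume d: "d \<in> Obj D" "d' \<in> Obj D" "d'' \<in> Obj D" and f: "f \<in> Hom D d d'" and g: "g \<in> Hom D d' d''"
 show "Cmp D g f \<in> Hom D d d''" unfolding D_ops(2)[OF f g]
 proof (rule Hom_DI)
 fix i j'' j assume i: "i \<in> I" and j: "j'' < len (d'' i)" "j < len (d i)"
 show "(\<lambda>(j'', j)\<in>{..<len (d'' i)} \<times> {..<len (d i)}.
 \<lambda>\<beta>\<in>bilinear_forms (AP i) (VP i) (d i ! j) (d'' i ! j''). \<Sum>j'<len (d' i).
 tensor_comp (AP i) (VP i) (d i ! j) (d'' i ! j'') (part g i (j'', j')) (part f i (j', j)) \<beta>) (j'', j) \<in>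
 tensor_hom (AP i) (VP i) (d i ! j) (d'' i ! j'')"
 using j box_sum_Hom[where m = "len (d' i)" and t = "%j'. tensor_comp (AP i) (VP i) (d i ! j) (d'' i ! j'') (part g i (j'', j')) (part f i (j', j))" and i = i and p = "d i ! j" and q = "d'' i ! j''"]
 box_comp_Hom(1)[OF d i j(2) _ j(1) part_tensor_hom[OF g i j(1)] part_tensor_hom[OF f i _ j(2)]] by simp
 qed auto
next
 fix d d' f g assume d: "d \<in> Obj D" "d' \<in> Obj D" and f: "f \<in> Hom D d d'" and g: "g \<in> Hom D d d'"
 show "Add D f g \<in> Hom D d d'" unfolding D_ops(3)[OF f g]
 by (rule Hom_DI) (use box_add_Hom[OF part_tensor_hom[OF f] part_tensor_hom[OF g]] in auto)
next
 fix d d' f c assume d: "d \<in> Obj D" "d' \<in> Obj D" and f: "f \<in> Hom D d d'"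
 show "Scl D c f \<in> Hom D d d'" unfolding D_ops(4)[OF f]
 by (rule Hom_DI) (use box_scale_Hom[OF d d(2) _ _ _ _ part_tensor_hom[OF f]] in auto)
qed

lemma slot_set_iff: "(i, j, l, r) \<in> slot_set d \<longleftrightarrow> i \<in> I & j < len (d i) & l < nn i & r < snd (d i ! j) l"
 by (auto simp: slot_set_def)

lemma finite_slot_set: "finite (slot_set d)"
 unfolding slot_set_def using finite_I by (intro finite_SigmaI) auto

lemma slot_obj:
 assumes d: "d \<in> Obj D" and s: "(i, j, l, r) \<in> slot_set d"
 shows "slot_obj d (i, j, l, r) \<in> Obj C" "dmC (slot_obj d (i, j, l, r)) = dmA (fst (d i ! j))"
 using s Obj_D_nth[OF d, of i j] by (simp_all add: slot_set_iff slot_obj_def \<Phi>_Obj \<Phi>_dm)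

lemma coeff_Hom:
 assumes d: "d \<in> Obj D" "d' \<in> Obj D" and f: "f \<in> Hom D d d'" and s: "s \<in> slot_set d" "s' \<in> slot_set d'"
 shows "coeff d d' f s' s \<in> Hom C (slot_obj d s) (slot_obj d' s')"
proof -
 obtain i j l r where s1: "s = (i, j, l, r)" by (cases s)
 obtain i' j' l' r' where s2: "s' = (i', j', l', r')" by (cases s')
 note s1' = s(1)[unfolded s1 slot_set_iff] and s2' = s(2)[unfolded s2 slot_set_iff]
 show ?thesis
 proof (cases "i' = i & l' = l")
 case False
 have "0\<^sub>m (dmC (slot_obj d' s')) (dmC (slot_obj d s)) \<in> Hom C (slot_obj d s) (slot_obj d' s')"
 by (rule C.zero_Hom) (use slot_obj(1)[OF d(1)] slot_obj(1)[OF d(2)] s in \<open>auto simp: s1 s2\<close>)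
 then show ?thesis using slot_obj(2)[OF d(1)] slot_obj(2)[OF d(2)] s False by (auto simp: s1 s2 coeff_def)
 next
 case True
 have j: "j < len (d i)" "j' < len (d' i)" and i: "i \<in> I" using s1' s2' True by auto
 have "comp_mat (dmA (fst (d' i ! j'))) (dmA (fst (d i ! j))) (part f i (j', j)) (l, r', r) \<in> Hom (AP i) (fst (d i ! j)) (fst (d' i ! j'))"
 by (rule box_comp_mat_Hom[OF d d(2) i j j(2) _ part_tensor_hom[OF f i j(2,1)]]) (use s1' s2' True in \<open>simp add: slots_def\<close>)
 moreover have "Hom C (\<Phi> i l (fst (d i ! j))) (\<Phi> i l (fst (d' i ! j'))) = Hom A (fst (d i ! j)) (fst (d' i ! j'))"
 by (rule \<Phi>_Hom) (use s1' Obj_D_nth[OF d(1) i j(1)] Obj_D_nth[OF d(2) i j(2)] in auto)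
 ultimately show ?thesis using True by (simp add: s1 s2 coeff_def slot_obj_def)
 qed
qed

text \<open>Faithfulness: a tensor is determined by its component matrices, and the remaining data
  of an arrow are fixed by source and target.\<close>

lemma coeff_inject:
 assumes d: "d \<in> Obj D" "d' \<in> Obj D" and f: "f \<in> Hom D d d'" "g \<in> Hom D d d'"
 and e: "!!s s'. s \<in> slot_set d ==> s' \<in> slot_set d' ==> coeff d d' f s' s = coeff d d' g s' s"
 shows "f = g"
proof (rule extensionalityI[of _ I])
 fix i assume i: "i \<in> I"
 have "part f i = part g i"
 proof (rule extensionalityI[of _ "{..<len (d' i)} \<times> {..<len (d i)}"])
 fix p assume "p \<in> {..<len (d' i)} \<times> {..<len (d i)}"
 then obtain j' j where p: "p = (j', j)" and j: "j < len (d i)" "j' < len (d' i)" by auto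
 show "part f i p = part g i p" unfolding p
 proof (rule box_hom_eqI[OF d d(2) i j j(2) part_tensor_hom[OF f(1) i j(2,1)] part_tensor_hom[OF f(2) i j(2,1)]])
 fix k assume "k \<in> slots (nn i) (snd (d i ! j)) (snd (d' i ! j'))"
 then obtain l r' r where k: "k = (l, r', r)" "l < nn i" "r' < snd (d' i ! j') l" "r < snd (d i ! j) l" by (auto simp: slots_def)
 show "comp_mat (dmA (fst (d' i ! j'))) (dmA (fst (d i ! j))) (part f i (j', j)) k = comp_mat (dmA (fst (d' i ! j'))) (dmA (fst (d i ! j))) (part g i (j', j)) k"
 using e[of "(i, j, l, r)" "(i, j', l, r')"] k i j by (simp add: slot_set_iff coeff_def)
 qed
 qed (use f i in \<open>simp_all add: Hom_D\<close>)
 then show "f i = g i" using f i by (metis Hom_D)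
qed (use f in \<open>simp_all add: Hom_D\<close>)

text \<open>Fullness: within one copy (i, l) any family of components comes from a tensor; between
  different copies the given components vanish by \<Phi>_zero and so agree with
  \<open>coeff\<close>.\<close>

lemma coeff_surj:
 assumes d: "d \<in> Obj D" "d' \<in> Obj D"
 and K: "!!s s'. s \<in> slot_set d ==> s' \<in> slot_set d' ==> K s' s \<in> Hom C (slot_obj d s) (slot_obj d' s')"
 shows "\<exists>f \<in> Hom D d d'. \<forall>s\<in>slot_set d. \<forall>s'\<in>slot_set d'. coeff d d' f s' s = K s' s"
proof -
 have "\<exists>t \<in> tensor_hom (AP i) (VP i) (d i ! j) (d' i ! j'). \<forall>k\<in>slots (nn i) (snd (d i ! j)) (snd (d' i ! j')).
 comp_mat (dmA (fst (d' i ! j'))) (dmA (fst (d i ! j))) t k = K (i, j', fst k, fst (snd k)) (i, j, fst k, snd (snd k))"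
 if i: "i \<in> I" and j: "j < len (d i)" "j' < len (d' i)" for i j j'
 proof (rule box_hom_exists[OF d d(2) i j j(2)])
 fix k assume "k \<in> slots (nn i) (snd (d i ! j)) (snd (d' i ! j'))"
 then obtain l r' r where k: "k = (l, r', r)" "l < nn i" "r' < snd (d' i ! j') l" "r < snd (d i ! j) l" by (auto simp: slots_def)
 have "Hom C (\<Phi> i l (fst (d i ! j))) (\<Phi> i l (fst (d' i ! j'))) = Hom A (fst (d i ! j)) (fst (d' i ! j'))"
 by (rule \<Phi>_Hom) (use i k Obj_D_nth[OF d(1) i j(1)] Obj_D_nth[OF d(2) i j(2)] in auto)
 then show "K (i, j', fst k, fst (snd k)) (i, j, fst k, snd (snd k)) \<in> Hom (AP i) (fst (d i ! j)) (fst (d' i ! j'))"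
 using K[of "(i, j, l, r)" "(i, j', l, r')"] i j k by (simp add: slot_set_iff slot_obj_def)
 qed
 then obtain T where T: "!!i j j'. i \<in> I ==> j < len (d i) ==> j' < len (d' i) ==> T i j j' \<in> tensor_hom (AP i) (VP i) (d i ! j) (d' i ! j') &
 (\<forall>k\<in>slots (nn i) (snd (d i ! j)) (snd (d' i ! j')).
 comp_mat (dmA (fst (d' i ! j'))) (dmA (fst (d i ! j))) (T i j j') k = K (i, j', fst k, fst (snd k)) (i, j, fst k, snd (snd k)))"
 by metis
 let ?f = "\<lambda>i\<in>I. (d i, (\<lambda>(j', j)\<in>{..<len (d' i)} \<times> {..<len (d i)}. T i j j'), d' i)"
 have "?f \<in> Hom D d d'" by (rule Hom_DI) (use T in auto)
 moreover have "coeff d d' ?f s' s = K s' s" if s: "s \<in> slot_set d" "s' \<in> slot_set d'" for s s'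
 proof -
 obtain i j l r where s1: "s = (i, j, l, r)" by (cases s)
 obtain i' j' l' r' where s2: "s' = (i', j', l', r')" by (cases s')
 note s1' = s(1)[unfolded s1 slot_set_iff] and s2' = s(2)[unfolded s2 slot_set_iff]
 show ?thesis
 proof (cases "i' = i & l' = l")
 case True
 then show ?thesis using s1' s2' T[of i j j'] by (auto simp: s1 s2 coeff_def slots_def)
 next
 case False
 have "K s' s = 0\<^sub>m (dmA (fst (d' i' ! j'))) (dmA (fst (d i ! j)))"
 by (rule \<Phi>_zero[of i l _ i' l']) (use s1' s2' False Obj_D_nth[OF d(1), of i j] Obj_D_nth[OF d(2), of i' j'] K[OF s] in \<open>auto simp: s1 s2 slot_obj_def\<close>)
 then show ?thesis using False by (auto simp: s1 s2 coeff_def)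
 qed
 qed
 ultimately show ?thesis by blast
qed

lemma coeff_one:
 assumes d: "d \<in> Obj D" and s: "s \<in> slot_set d" "s' \<in> slot_set d"
 shows "coeff d d (Idn D d) s' s = (if s' = s then 1\<^sub>m (dmC (slot_obj d s)) else 0\<^sub>m (dmC (slot_obj d s')) (dmC (slot_obj d s)))"
proof -
 obtain i j l r where s1: "s = (i, j, l, r)" by (cases s)
 obtain i' j' l' r' where s2: "s' = (i', j', l', r')" by (cases s')
 note s1' = s(1)[unfolded s1 slot_set_iff] and s2' = s(2)[unfolded s2 slot_set_iff]
 have dm: "dmC (slot_obj d s) = dmA (fst (d i ! j))" "dmC (slot_obj d s') = dmA (fst (d i' ! j'))"
 using slot_obj(2)[OF d] s by (simp_all add: s1 s2)
 show ?thesis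
 proof (cases "i' = i & l' = l")
 case False
 then show ?thesis unfolding dm by (auto simp: s1 s2 coeff_def)
 next
 case True
 have j: "j < len (d i)" "j' < len (d i)" and i: "i \<in> I" using s1' s2' True by auto
 have k: "(l, r', r) \<in> slots (nn i) (snd (d i ! j)) (snd (d i ! j'))" using s1' s2' True by (simp add: slots_def)
 have "coeff d d (Idn D d) s' s = list_mat (dmA (fst (d i ! j'))) (dmA (fst (d i ! j)))
 (if j' = j then [(Idn A (fst (d i ! j')), Idn (VP i) (snd (d i ! j')))] else []) (l, r', r)"
 using True i j box_comp_mat_tensor[OF d d d i j j(2) k] by (simp add: s1 s2 coeff_def D_ops(1) del: Vec_power_simps)
 also have "... = (if s' = s then 1\<^sub>m (dmA (fst (d i ! j))) else 0\<^sub>m (dmA (fst (d i' ! j'))) (dmA (fst (d i ! j))))"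
 using True s1' s2' Obj_D_nth[OF d i j(1)] by (intro eq_matI) (auto simp: s1 s2 list_mat_def entry_def A.ops)
 finally show ?thesis unfolding dm .
 qed
qed

lemma coeff_add:
 assumes d: "d \<in> Obj D" "d' \<in> Obj D" and f: "f \<in> Hom D d d'" "g \<in> Hom D d d'" and s: "s \<in> slot_set d" "s' \<in> slot_set d'"
 shows "coeff d d' (Add D f g) s' s = coeff d d' f s' s + coeff d d' g s' s"
 and "coeff d d' (Scl D c f) s' s = c \<cdot>\<^sub>m coeff d d' f s' s"
proof -
 obtain i j l r where s1: "s = (i, j, l, r)" by (cases s)
 obtain i' j' l' r' where s2: "s' = (i', j', l', r')" by (cases s')
 note s1' = s(1)[unfolded s1 slot_set_iff] and s2' = s(2)[unfolded s2 slot_set_iff]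
 have "coeff d d' (Add D f g) s' s = coeff d d' f s' s + coeff d d' g s' s & coeff d d' (Scl D c f) s' s = c \<cdot>\<^sub>m coeff d d' f s' s"
 proof (cases "i' = i & l' = l")
 case False
 then show ?thesis by (auto simp: s1 s2 coeff_def)
 next
 case True
 have j: "j < len (d i)" "j' < len (d' i)" and i: "i \<in> I" using s1' s2' True by auto
 have k: "(l, r', r) \<in> slots (nn i) (snd (d i ! j)) (snd (d' i ! j'))" using s1' s2' True by (simp add: slots_def)
 have e: "entry p (l, r', r) \<in> bilinear_forms (AP i) (VP i) (d i ! j) (d' i ! j')"
 if "fst p < dmA (fst (d' i ! j'))" "snd p < dmA (fst (d i ! j))" for p
 by (rule box_entry_bilinear[OF d d(2) i j j(2) that k])
 show ?thesis
 using True i j e by (auto simp: s1 s2 coeff_def D_ops(3)[OF f] D_ops(4)[OF f(1)] comp_mat_def intro!: eq_matI)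
 qed
 then show "coeff d d' (Add D f g) s' s = coeff d d' f s' s + coeff d d' g s' s"
 "coeff d d' (Scl D c f) s' s = c \<cdot>\<^sub>m coeff d d' f s' s" by auto
qed

lemma sum_slot_set:
 fixes F :: "nat \<Rightarrow> nat \<Rightarrow> 'k"
 assumes i: "i \<in> I" and l: "l < nn i"
 shows "(\<Sum>(i', j, l', r)\<in>slot_set d. if i' = i & l' = l then F j r else 0) =
 (\<Sum>j<len (d i). \<Sum>r<snd (d i ! j) l. F j r)"
proof -
 have "(\<Sum>(i', j, l', r)\<in>slot_set d. if i' = i & l' = l then F j r else 0) =
 (\<Sum>s\<in>{s \<in> slot_set d. fst s = i & fst (snd (snd s)) = l}. F (fst (snd s)) (snd (snd (snd s))))"
 unfolding sum.inter_filter[OF finite_slot_set] by (intro sum.cong refl) auto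
 also have "... = (\<Sum>(j, r)\<in>(SIGMA j:{..<len (d i)}. {..<snd (d i ! j) l}). F j r)"
 by (rule sum.reindex_bij_witness[where i = "%(j, r). (i, j, l, r)" and j = "%(i, j, l, r). (j, r)"])
 (use i l in \<open>auto simp: slot_set_iff\<close>)
 also have "... = (\<Sum>j<len (d i). \<Sum>r<snd (d i ! j) l. F j r)" by (rule sum.Sigma[symmetric]) auto
 finally show ?thesis .
qed

text \<open>Of the sum over all middle slots only those in the same copy (i, l) contribute. This is
  the sum over summands j' in the composition of the box product and over r' in the composition of
  tensors.\<close>

lemma coeff_comp:
 assumes d: "d \<in> Obj D" "d' \<in> Obj D" "d'' \<in> Obj D" and f: "f \<in> Hom D d d'" and g: "g \<in> Hom D d' d''"
 and s: "s \<in> slot_set d" "s'' \<in> slot_set d''"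
 shows "coeff d d'' (Cmp D g f) s'' s =
 msum (dmC (slot_obj d'' s'')) (dmC (slot_obj d s)) (%s'. coeff d' d'' g s'' s' * coeff d d' f s' s) (slot_set d')"
proof -
 obtain i j l r where s1: "s = (i, j, l, r)" by (cases s)
 obtain i'' j'' l'' r'' where s2: "s'' = (i'', j'', l'', r'')" by (cases s'')
 note s1' = s(1)[unfolded s1 slot_set_iff] and s2' = s(2)[unfolded s2 slot_set_iff]
 let ?a = "dmA (fst (d i ! j))" and ?c = "dmA (fst (d'' i'' ! j''))"
 have dm: "dmC (slot_obj d s) = ?a" "dmC (slot_obj d'' s'') = ?c"
 using slot_obj(2)[OF d(1)] slot_obj(2)[OF d(3)] s by (simp_all add: s1 s2)
 show ?thesis
 proof (cases "i'' = i & l'' = l")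
 case False
 have "msum ?c ?a (%s'. coeff d' d'' g s'' s' * coeff d d' f s' s) (slot_set d') = 0\<^sub>m ?c ?a"
 by (rule A.msum_zero) (use False in \<open>auto simp: s1 s2 coeff_def\<close>)
 then show ?thesis unfolding dm using False by (auto simp: s1 s2 coeff_def)
 next
 case True
 then have j: "j < len (d i)" "j'' < len (d'' i)" and i: "i \<in> I" and l: "l < nn i" and r: "r < snd (d i ! j) l" "r'' < snd (d'' i ! j'') l"
 using s1' s2' by auto
 have k: "(l, r'', r) \<in> slots (nn i) (snd (d i ! j)) (snd (d'' i ! j''))" using l r by (simp add: slots_def)
 let ?G = "%j' r'. comp_mat ?c (dmA (fst (d' i ! j'))) (part g i (j'', j')) (l, r'', r')"
 and ?F = "%j' r'. comp_mat (dmA (fst (d' i ! j'))) ?a (part f i (j', j)) (l, r', r)"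
 show ?thesis unfolding dm
 proof (rule eq_matI)
 fix x y assume "x < drow (msum ?c ?a (%s'. coeff d' d'' g s'' s' * coeff d d' f s' s) (slot_set d'))"
 "y < dcol (msum ?c ?a (%s'. coeff d' d'' g s'' s' * coeff d d' f s' s) (slot_set d'))"
 then have xy: "x < ?c" "y < ?a" by simp_all
 have e: "entry (x, y) (l, r'', r) \<in> bilinear_forms (AP i) (VP i) (d i ! j) (d'' i ! j'')"
 by (rule box_entry_bilinear[OF d(1,3,3) i j j(2) _ _ k]) (use xy True in auto)
 have "coeff d d'' (Cmp D g f) s'' s $$ (x, y) =
 (\<Sum>j'<len (d' i). tensor_comp (AP i) (VP i) (d i ! j) (d'' i ! j'') (part g i (j'', j')) (part f i (j', j)) (entry (x, y) (l, r'', r)))"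
 using True i j xy e by (simp add: s1 s2 coeff_def D_ops(2)[OF f g] comp_mat_def)
 also have "... = (\<Sum>j'<len (d' i). \<Sum>r'<snd (d' i ! j') l. (?G j' r' * ?F j' r') $$ (x, y))"
 proof (rule sum.cong[OF refl])
 fix j' assume "j' \<in> {..<len (d' i)}"
 then have j': "j' < len (d' i)" by simp
 have "comp_mat ?c ?a (tensor_comp (AP i) (VP i) (d i ! j) (d'' i ! j'') (part g i (j'', j')) (part f i (j', j))) (l, r'', r) =
 msum ?c ?a (%r'. ?G j' r' * ?F j' r') {..<snd (d' i ! j') l}"
 using box_comp_Hom(2)[OF d i j(1) j' j(2) part_tensor_hom[OF g i j(2) j'] part_tensor_hom[OF f i j' j(1)] l r(2,1)] True by simp
 from arg_cong[OF this, of "%M. M $$ (x, y)"]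
 show "tensor_comp (AP i) (VP i) (d i ! j) (d'' i ! j'') (part g i (j'', j')) (part f i (j', j)) (entry (x, y) (l, r'', r)) =
 (\<Sum>r'<snd (d' i ! j') l. (?G j' r' * ?F j' r') $$ (x, y))"
 using xy by (simp add: comp_mat_def[of ?c ?a] del: index_mult_mat(1))
 qed
 also have "... = (\<Sum>(i', j', l', r')\<in>slot_set d'. if i' = i & l' = l then (?G j' r' * ?F j' r') $$ (x, y) else 0)"
 by (rule sum_slot_set[OF i l, symmetric])
 also have "... = (\<Sum>s'\<in>slot_set d'. (coeff d' d'' g s'' s' * coeff d d' f s' s) $$ (x, y))"
 by (intro sum.cong refl) (use True xy in \<open>auto simp: s1 s2 coeff_def simp del: index_mult_mat(1)\<close>)
 finally show "coeff d d'' (Cmp D g f) s'' s $$ (x, y) =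
 msum ?c ?a (%s'. coeff d' d'' g s'' s' * coeff d d' f s' s) (slot_set d') $$ (x, y)"
 using xy by (simp del: index_mult_mat(1))
 qed (use True in \<open>auto simp: s1 s2 coeff_def\<close>)
 qed
qed

text \<open>A formal sum goes to a chosen biproduct of its slots, and an arrow to the assembled
  matrix of its components; \<open>coeff_inject\<close> and \<open>coeff_surj\<close> make this
  fully faithful.\<close>

theorem box_equivalence: "linearly_equivalent C D"
proof -
 have "\<exists>X p q. C.biprod (slot_set d) (slot_obj d) X p q" if "d \<in> Obj D" for d
 by (rule biprod_exists[OF finite_slot_set]) (use slot_obj(1)[OF that] in auto)
 then obtain Go p q where b: "!!d. d \<in> Obj D ==> C.biprod (slot_set d) (slot_obj d) (Go d) (p d) (q d)" by metis
 define Gm where "Gm d d' f = C.assemble (slot_set d) (Go d) (q d) (slot_set d') (Go d') (p d') (coeff d d' f)" for d d' f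
 interpret L: lin_category_laws C by (rule C.category_laws)
 note o = C.biprodD(2)[OF b]
 have Gm: "Gm d d' f \<in> Hom C (Go d) (Go d')" if "d \<in> Obj D" "d' \<in> Obj D" "f \<in> Hom D d d'" for d d' f
 unfolding Gm_def by (rule C.assemble_Hom[OF b[OF that(1)] b[OF that(2)]]) (rule coeff_Hom[OF that])
 have Gc: "q d' s' * Gm d d' f * p d s = coeff d d' f s' s"
 if "d \<in> Obj D" "d' \<in> Obj D" "f \<in> Hom D d d'" "s \<in> slot_set d" "s' \<in> slot_set d'" for d d' f s s'
 unfolding Gm_def by (rule C.assemble_coeff[OF b[OF that(1)] b[OF that(2)] coeff_Hom[OF that(1-3)] that(4,5)])
 have G: "linear_functor D C Go Gm"
 unfolding linear_functor_def
 proof (intro conjI ballI allI)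
 fix d assume d: "d \<in> Obj D"
 have "Gm d d (Idn D d) = C.assemble (slot_set d) (Go d) (q d) (slot_set d) (Go d) (p d)
 (%s' s. if s' = s then 1\<^sub>m (dmC (slot_obj d s)) else 0\<^sub>m (dmC (slot_obj d s')) (dmC (slot_obj d s)))"
 unfolding Gm_def C.assemble_def by (rule msum_cong) (use coeff_one[OF d] in auto)
 then show "Gm d d (Idn D d) = Idn C (Go d)" by (simp add: C.assemble_one[OF b[OF d]] C.ops o[OF d])
 fix d' assume d': "d' \<in> Obj D"
 {
 fix f g assume f: "f \<in> Hom D d d'" and g: "g \<in> Hom D d d'"
 note m = C.Hom_carrier[OF o[OF d] o[OF d'] Gm[OF d d' f]] C.Hom_carrier[OF o[OF d] o[OF d'] Gm[OF d d' g]]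
 have *: "q d' s' * (Gm d d' f + Gm d d' g) * p d s = coeff d d' f s' s + coeff d d' g s' s"
 "q d' s' * (c \<cdot>\<^sub>m Gm d d' f) * p d s = c \<cdot>\<^sub>m coeff d d' f s' s"
 if s: "s \<in> slot_set d" "s' \<in> slot_set d'" for s s' c
 proof -
 note P = C.biprodD(8)[OF b[OF d] s(1)] and Q = C.biprodD(9)[OF b[OF d'] s(2)]
 show "q d' s' * (Gm d d' f + Gm d d' g) * p d s = coeff d d' f s' s + coeff d d' g s' s"
 unfolding mult_add_distrib_mat[OF Q m] add_mult_distrib_mat[OF mult_carrier_mat[OF Q m(1)] mult_carrier_mat[OF Q m(2)] P]
 using Gc[OF d d' f s] Gc[OF d d' g s] by simp
 show "q d' s' * (c \<cdot>\<^sub>m Gm d d' f) * p d s = c \<cdot>\<^sub>m coeff d d' f s' s"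
 unfolding mult_smult_distrib[OF Q m(1)] mult_smult_assoc_mat[OF mult_carrier_mat[OF Q m(1)] P] using Gc[OF d d' f s] by simp
 qed
 have "Gm d d' f + Gm d d' g = Gm d d' (Add D f g)"
 unfolding Gm_def[of d d' "Add D f g"]
 by (rule C.assemble_unique[OF b[OF d] b[OF d'] C.add_Hom[OF o[OF d] o[OF d'] Gm[OF d d' f] Gm[OF d d' g]]])
 (simp add: * coeff_add(1)[OF d d' f g])
 then show "Gm d d' (Add D f g) = Add C (Gm d d' f) (Gm d d' g)" by (simp add: C.ops)
 fix c
 have "c \<cdot>\<^sub>m Gm d d' f = Gm d d' (Scl D c f)"
 unfolding Gm_def[of d d' "Scl D c f"]
 by (rule C.assemble_unique[OF b[OF d] b[OF d'] C.smult_Hom[OF o[OF d] o[OF d'] Gm[OF d d' f]]])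
 (simp add: * coeff_add(2)[OF d d' f g])
 then have "Gm d d' (Scl D c f) = Scl C c (Gm d d' f)" by (simp add: C.ops)
 }
 note scl = this
 show "Gm d d' (Scl D c f) = Scl C c (Gm d d' f)" if "f \<in> Hom D d d'" for f c by (rule scl[OF that that])
 fix d'' f g assume d'': "d'' \<in> Obj D" and f: "f \<in> Hom D d d'" and g: "g \<in> Hom D d' d''"
 have "Gm d' d'' g * Gm d d' f = C.assemble (slot_set d) (Go d) (q d) (slot_set d'') (Go d'') (p d'')
 (%s'' s. msum (dmC (slot_obj d'' s'')) (dmC (slot_obj d s)) (%s'. coeff d' d'' g s'' s' * coeff d d' f s' s) (slot_set d'))"
 unfolding Gm_def by (rule C.assemble_mult[OF b[OF d] b[OF d'] b[OF d''] coeff_Hom[OF d d' f] coeff_Hom[OF d' d'' g]])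
 also have "... = Gm d d'' (Cmp D g f)"
 unfolding Gm_def C.assemble_def by (rule msum_cong) (use coeff_comp[OF d d' d'' f g] in auto)
 finally show "Gm d d'' (Cmp D g f) = Cmp C (Gm d' d'' g) (Gm d d' f)" by (simp add: C.ops)
 qed (use o Gm in auto)
 show ?thesis
 proof (rule L.equivalence_criterion[OF D_category G])
 fix d d' h assume d: "d \<in> Obj D" "d' \<in> Obj D" and h: "h \<in> Hom C (Go d) (Go d')"
 have "q d' s' * h * p d s \<in> Hom C (slot_obj d s) (slot_obj d' s')" if "s \<in> slot_set d" "s' \<in> slot_set d'" for s s'
 by (intro C.mult_Hom[OF C.biprodD(3)[OF b[OF d(1)] that(1)] o[OF d(1)] C.biprodD(3)[OF b[OF d(2)] that(2)]]
 C.mult_Hom[OF o[OF d(1)] o[OF d(2)] C.biprodD(3)[OF b[OF d(2)] that(2)] h] C.biprodD(4)[OF b[OF d(1)] that(1)]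
 C.biprodD(5)[OF b[OF d(2)] that(2)])
 from coeff_surj[OF d this] obtain f where f: "f \<in> Hom D d d'"
 "!!s s'. s \<in> slot_set d ==> s' \<in> slot_set d' ==> coeff d d' f s' s = q d' s' * h * p d s" by blast
 have "h = Gm d d' f" unfolding Gm_def
 by (rule C.assemble_unique[OF b[OF d(1)] b[OF d(2)] h]) (simp add: f(2))
 moreover have "f' = f" if f': "f' \<in> Hom D d d'" "Gm d d' f' = h" for f'
 by (rule coeff_inject[OF d f'(1) f(1)]) (simp add: f(2) Gc[OF d f'(1), symmetric] f'(2))
 ultimately show "\<exists>!f. f \<in> Hom D d d' & Gm d d' f = h" using f(1) by metis
 next
 fix X assume "X \<in> Obj C"
 then obtain a p' q' where a: "!!i l. i \<in> I ==> l < nn i ==> a i l \<in> Obj A & P i (a i l)"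
 and X: "C.biprod (SIGMA i:I. {..<nn i}) (%(i, l). \<Phi> i l (a i l)) X p' q'"
 using decomposition by metis
 \<comment> \<open>For each i the list has one entry for every l, namely a i l with the l-th unit
   dimension vector. Its slots are exactly the (i, l, l, 0), one for each summand of X.\<close>
 define d where "d = (\<lambda>i\<in>I. map (%l. (a i l, \<lambda>l'\<in>{..<nn i}. if l' = l then 1 else 0 :: nat)) [0..<nn i])"
 have d: "d \<in> Obj D" unfolding Obj_D using a by (auto simp: d_def split: if_splits)
 have ss: "(i, j, l, r) \<in> slot_set d \<longleftrightarrow> i \<in> I & l < nn i & j = l & r = 0" for i j l r
 by (auto simp: slot_set_iff d_def split: if_splits)
 have "C.biprod (slot_set d) (slot_obj d) X (p' \<circ> (%(i, j, l, r). (i, l))) (q' \<circ> (%(i, j, l, r). (i, l)))"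
 proof (rule C.biprod_reindex[OF X])
 show "bij_betw (%(i, j, l, r). (i, l)) (slot_set d) (SIGMA i:I. {..<nn i})"
 by (rule bij_betw_byWitness[where f' = "%(i, l). (i, l, l, 0)"]) (auto simp: ss)
 show "slot_obj d s = (case (%(i, j, l, r). (i, l)) s of (i, l) \<Rightarrow> \<Phi> i l (a i l))" if "s \<in> slot_set d" for s
 proof -
 obtain i j l r where s: "s = (i, j, l, r)" by (cases s)
 have "i \<in> I" "l < nn i" "j = l" using that unfolding s ss by auto
 then show ?thesis by (simp add: s slot_obj_def d_def)
 qed
 qed
 from C.biprod_iso[OF this b[OF d]] d
 show "\<exists>d\<in>Obj D. \<exists>u v. inverse_arrows C X (Go d) v u" by blast
 qed
qed

end

section \<open>Retracts and biproducts in \<open>HH\<close>\<close>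

text \<open>Applies an equation A B = C D at the head of a right nested product.\<close>

lemma assoc_swap:
 fixes A :: "'a::semiring_0 mat"
 assumes "A * B = C * D" "dcol A = drow B" "dcol B = drow X" "dcol C = drow D" "dcol D = drow X"
 shows "A * (B * X) = C * (D * X)"
 using assms by (simp add: mat_assoc[symmetric])

lemma ap_zero_mat[simp]: "c < b ==> ap (0\<^sub>m a b) c F = 0"
 by (simp add: ap_def)

lemma msum_grhom:
 assumes "!!s. s \<in> J ==> f s \<in> grhom V W"
 shows "msum (len W) (len V) f J \<in> grhom V W"
proof (rule grhomI)
 fix i j assume ij: "i < len W" "j < len V" and nz: "msum (len W) (len V) f J $$ (i, j) ~= 0"
 then obtain s where "s \<in> J" "f s $$ (i, j) ~= 0" by (auto elim: sum.not_neutral_contains_not_neutral)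
 then show "W ! i = V ! j" using grhom_degree[OF assms] ij by blast
qed simp_all

section \<open>HH as a category of matrices, and naturality of the stability map\<close>

context braided_hopf
begin

lemma Hom_tensor_left:
 assumes V: "act_on V rh" and W: "act_on W sg" and X: "act_on U ta" and f: "f \<in> Hom C (V, rh) (W, sg)"
 shows "f <*> idm U \<in> Hom C (tenO C (V, rh) (U, ta)) (tenO C (W, sg) (U, ta))"
proof -
 have fg: "f \<in> grhom V W" and fl: "f * rh = sg * (idm A <*> f)" using f by simp_all
 note d = grhom_dims[OF fg] act_dims[OF V] act_dims[OF W] act_dims[OF X]
 have l: "ap f i (%i'. ap sg (ix (len W) h i') G) = ap rh (ix (len V) h i) (%j. ap f j G)" if "h < n" "i < len V" for h i G
 using arg_cong[OF fl, of "%M. ap M (ix (len V) h i) G"] that d by (simp add: ap_kron)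
 have sw: "ap f j (%r. ap ta c (%q. G r q)) = ap ta c (%q. ap f j (%r. G r q))" for j c G
 by (rule ap_swap)
 have "(f <*> idm U) * tensor_action ch H V rh U ta = tensor_action ch H W sg U ta * (idm A <*> (f <*> idm U))"
 proof (rule kron_ap_eqI[of _ _ "n * len V" "len U"])
 fix k p F assume "k < n * len V" and p: "p < len U"
 then obtain h i where h: "h < n" and i: "i < len V" and k: "k = ix (len V) h i" by (elim ix_decompose)
 have "ap (tensor_action ch H W sg U ta * (idm A <*> (f <*> idm U))) (ix (len U) k p) F =
 ap f i (%i'. dl h (%h1 h2. ch (g h2) (W ! i') * ap sg (ix (len W) h1 i') (%j. ap ta (ix (len U) h2 p) (%q. F (ix (len U) j q)))))"
 unfolding k using h i p d by (simp add: ap_kron ap_kron2 tensor_dims ap_tensor_action mult.assoc[symmetric])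
 also have "... = ap f i (%i'. dl h (%h1 h2. ch (g h2) (V ! i) * ap sg (ix (len W) h1 i') (%j. ap ta (ix (len U) h2 p) (%q. F (ix (len U) j q)))))"
 by (rule ap_grhom_cong[OF fg i]) simp
 also have "... = dl h (%h1 h2. ch (g h2) (V ! i) * ap f i (%i'. ap sg (ix (len W) h1 i') (%j. ap ta (ix (len U) h2 p) (%q. F (ix (len U) j q)))))"
 by (rule trans[OF sc_swap[symmetric]]) (simp only: ap_scale)
 also have "... = dl h (%h1 h2. ch (g h2) (V ! i) * ap rh (ix (len V) h1 i) (%j. ap ta (ix (len U) h2 p) (%q. ap f j (%r. F (ix (len U) r q)))))"
 using i by (simp only: l sw cong: sc_weak_cong)
 also have "... = ap ((f <*> idm U) * tensor_action ch H V rh U ta) (ix (len U) k p) F"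
 unfolding k using h i p d by (simp add: ap_kron tensor_dims ap_tensor_action)
 finally show "ap ((f <*> idm U) * tensor_action ch H V rh U ta) (ix (len U) k p) F =
 ap (tensor_action ch H W sg U ta * (idm A <*> (f <*> idm U))) (ix (len U) k p) F" ..
 qed (use d in \<open>simp_all add: tensor_dims mult.assoc\<close>)
 then show ?thesis using grhom_kron[OF fg grhom_one[of U]] by simp
qed

lemma Hom_tensor_right:
 assumes V: "act_on V rh" and W: "act_on W sg" and X: "act_on U ta" and f: "f \<in> Hom C (V, rh) (W, sg)"
 shows "idm U <*> f \<in> Hom C (tenO C (U, ta) (V, rh)) (tenO C (U, ta) (W, sg))"
proof -
 have fg: "f \<in> grhom V W" and fl: "f * rh = sg * (idm A <*> f)" using f by simp_all
 note d = grhom_dims[OF fg] act_dims[OF V] act_dims[OF W] act_dims[OF X]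
 have l: "ap f i (%i'. ap sg (ix (len W) h i') G) = ap rh (ix (len V) h i) (%j. ap f j G)" if "h < n" "i < len V" for h i G
 using arg_cong[OF fl, of "%M. ap M (ix (len V) h i) G"] that d by (simp add: ap_kron)
 have sw: "ap f j (%r. ap ta c (%q. G r q)) = ap ta c (%q. ap f j (%r. G r q))" for j c G
 by (rule ap_swap)
 have "(idm U <*> f) * tensor_action ch H U ta V rh = tensor_action ch H U ta W sg * (idm A <*> (idm U <*> f))"
 proof (rule kron_ap_eqI[of _ _ "n * len U" "len V"])
 fix k i F assume "k < n * len U" and i: "i < len V"
 then obtain h p where h: "h < n" and p: "p < len U" and k: "k = ix (len U) h p" by (elim ix_decompose)
 have "ap (tensor_action ch H U ta W sg * (idm A <*> (idm U <*> f))) (ix (len V) k i) F =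
 ap f i (%i'. dl h (%h1 h2. ch (g h2) (U ! p) * ap ta (ix (len U) h1 p) (%q. ap sg (ix (len W) h2 i') (%j. F (ix (len W) q j)))))"
 unfolding k using h i p d by (simp add: ap_kron ap_kron2 tensor_dims ap_tensor_action mult.assoc[symmetric])
 also have "... = dl h (%h1 h2. ch (g h2) (U ! p) * ap ta (ix (len U) h1 p) (%q. ap f i (%i'. ap sg (ix (len W) h2 i') (%j. F (ix (len W) q j)))))"
 by (rule trans[OF sc_swap[symmetric]]) (simp only: ap_scale sw)
 also have "... = dl h (%h1 h2. ch (g h2) (U ! p) * ap ta (ix (len U) h1 p) (%q. ap rh (ix (len V) h2 i) (%j. ap f j (%j'. F (ix (len W) q j')))))"
 using i by (simp only: l cong: sc_weak_cong)
 also have "... = ap ((idm U <*> f) * tensor_action ch H U ta V rh) (ix (len V) k i) F"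
 unfolding k using h i p d by (simp add: ap_kron tensor_dims ap_tensor_action)
 finally show "ap ((idm U <*> f) * tensor_action ch H U ta V rh) (ix (len V) k i) F =
 ap (tensor_action ch H U ta W sg * (idm A <*> (idm U <*> f))) (ix (len V) k i) F" ..
 qed (use d in \<open>simp_all add: tensor_dims mult.assoc\<close>)
 then show ?thesis using grhom_kron[OF grhom_one[of U] fg] by simp
qed

text \<open>Every module is the left double dual of its right double dual, so
  \<open>HH_inverse\<close> covers all of them.\<close>

lemma HH_arrow:
 assumes M: "((V, rh), t) \<in> Obj (HH C)" and X: "act_on W sg"
 shows "unit_mat (t (W, sg))" "drow (t (W, sg)) = len W * len V" "dcol (t (W, sg)) = len V * len W"
 "t (W, sg) \<in> Hom C (tenO C (V, rh) (W, sg)) (tenO C (tw P (W, sg)) (V, rh))"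
proof -
 obtain sg' where P: "tw P (W, sg) = (W, sg')" by (simp add: tw_def)
 have X': "act_on W sg'" using tw_Obj(1)[of "(W, sg)"] X P by simp
 have Q: "tw Q (W, sg') = (W, sg)" using tw_tw(2)[of "(W, sg)"] X P by simp
 show "unit_mat (t (W, sg))" "drow (t (W, sg)) = len W * len V" "dcol (t (W, sg)) = len V * len W"
 "t (W, sg) \<in> Hom C (tenO C (V, rh) (W, sg)) (tenO C (tw P (W, sg)) (V, rh))"
 using HH_inverse[OF M X'] unfolding Q P by simp_all
qed

lemma HH_arrow_grhom:
 assumes M: "((V, rh), t) \<in> Obj (HH C)" and X: "act_on W sg"
 shows "t (W, sg) \<in> grhom (V <&> W) (W <&> V)"
 using HH_arrow(4)[OF M X] by (simp add: tw_def)

lemma HH_ops[simp]: "Cmp (HH C) = (*)" "Add (HH C) = (+)" "Scl (HH C) = (\<cdot>\<^sub>m)" "Idn (HH C) M = idm (fst (fst M))"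
 by (simp_all add: HH_def split: prod.split)

lemma HH_HomI:
 assumes "f \<in> grhom V W" "f * rh = sg * (idm A <*> f)"
 and "!!U ta. act_on U ta ==> u (U, ta) * (f <*> idm U) = (idm U <*> f) * t (U, ta)"
 shows "f \<in> Hom (HH C) ((V, rh), t) ((W, sg), u)"
 unfolding HH_Hom using assms by auto

lemma HH_HomD:
 assumes "f \<in> Hom (HH C) ((V, rh), t) ((W, sg), u)"
 shows "f \<in> grhom V W" "f * rh = sg * (idm A <*> f)" "f \<in> Hom C (V, rh) (W, sg)"
 "act_on U ta ==> u (U, ta) * (f <*> idm U) = (idm U <*> f) * t (U, ta)"
proof -
 have "f \<in> Hom C (V, rh) (W, sg)" and t: "!!X. X \<in> Obj C ==> u X * (f <*> Idn C X) = (Idn C X <*> f) * t X"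
 using assms unfolding HH_Hom by blast+
 then show "f \<in> grhom V W" "f * rh = sg * (idm A <*> f)" "f \<in> Hom C (V, rh) (W, sg)" by simp_all
 show "u (U, ta) * (f <*> idm U) = (idm U <*> f) * t (U, ta)" if "act_on U ta"
 using t[of "(U, ta)"] that by simp
qed

lemma HH_act: "((V, rh), t) \<in> Obj (HH C) ==> act_on V rh"
 unfolding HH_Obj by simp

abbreviation dmH :: "('g list \<times> 'k mat) \<times> ('g list \<times> 'k mat \<Rightarrow> 'k mat) \<Rightarrow> nat" where
 "dmH M \<equiv> len (fst (fst M))"

lemma zero_kron: "0\<^sub>m a b <*> 1\<^sub>m m = (0\<^sub>m (a * m) (b * m) :: 'k mat)" "1\<^sub>m m <*> 0\<^sub>m a b = (0\<^sub>m (m * a) (m * b) :: 'k mat)"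
 by (rule kron_ap_eqI[of _ _ b m], simp_all add: ap_kron) (rule kron_ap_eqI[of _ _ m b], simp_all add: ap_kron)

context
 fixes V rh t W sg u
 assumes M: "((V, rh), t) \<in> Obj (HH C)" and N: "((W, sg), u) \<in> Obj (HH C)"
begin

lemma HH_zero_Hom: "0\<^sub>m (len W) (len V) \<in> Hom (HH C) ((V, rh), t) ((W, sg), u)"
proof (rule HH_HomI)
 note aV = act_dims[OF HH_act[OF M]] and aW = act_dims[OF HH_act[OF N]]
 show "0\<^sub>m (len W) (len V) \<in> grhom V W" by (rule grhom_zero)
 show "0\<^sub>m (len W) (len V) * rh = sg * (idm A <*> 0\<^sub>m (len W) (len V))"
 unfolding zero_kron using aV aW by (intro eq_matI) simp_all
 show "u (U, ta) * (0\<^sub>m (len W) (len V) <*> idm U) = (idm U <*> 0\<^sub>m (len W) (len V)) * t (U, ta)"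
 if "act_on U ta" for U ta
 unfolding zero_kron using HH_arrow(2,3)[OF M that] HH_arrow(2,3)[OF N that] by (intro eq_matI) simp_all
qed

context
 fixes f assumes f: "f \<in> Hom (HH C) ((V, rh), t) ((W, sg), u)"
begin

lemma HH_smult_Hom: "c \<cdot>\<^sub>m f \<in> Hom (HH C) ((V, rh), t) ((W, sg), u)"
proof (rule HH_HomI)
 note aV = act_dims[OF HH_act[OF M]] and aW = act_dims[OF HH_act[OF N]]
 note F = HH_HomD[OF f] and fd = grhom_dims[OF HH_HomD(1)[OF f]]
 show "c \<cdot>\<^sub>m f \<in> grhom V W" by (rule grhom_smult[OF F(1)])
 have "(c \<cdot>\<^sub>m f) * rh = c \<cdot>\<^sub>m (f * rh)"
 by (rule mult_smult_assoc_mat[of _ "len W" "len V" _ "n * len V"]) (intro carrier_matI; simp add: fd aV)+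
 also have "... = sg * (c \<cdot>\<^sub>m (idm A <*> f))" unfolding F(2)
 by (rule mult_smult_distrib[symmetric, of _ "len W" "n * len W" _ "n * len V"]) (intro carrier_matI; simp add: fd aW)+
 finally show "(c \<cdot>\<^sub>m f) * rh = sg * (idm A <*> (c \<cdot>\<^sub>m f))" by (simp only: kron_smult_right)
 fix U ta assume X: "act_on U ta"
 note e = fd HH_arrow(2,3)[OF M X] HH_arrow(2,3)[OF N X]
 have "u (U, ta) * (c \<cdot>\<^sub>m (f <*> idm U)) = c \<cdot>\<^sub>m (u (U, ta) * (f <*> idm U))"
 by (rule mult_smult_distrib[of _ "len U * len W" "len W * len U" _ "len V * len U"]) (intro carrier_matI; simp add: e)+
 also have "... = (c \<cdot>\<^sub>m (idm U <*> f)) * t (U, ta)" unfolding F(4)[OF X]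
 by (rule mult_smult_assoc_mat[symmetric, of _ "len U * len W" "len U * len V" _ "len V * len U"]) (intro carrier_matI; simp add: e)+
 finally show "u (U, ta) * ((c \<cdot>\<^sub>m f) <*> idm U) = (idm U <*> (c \<cdot>\<^sub>m f)) * t (U, ta)"
 by (simp only: kron_smult_right kron_smult_left)
qed

lemma HH_add_Hom:
 assumes f': "f' \<in> Hom (HH C) ((V, rh), t) ((W, sg), u)"
 shows "f + f' \<in> Hom (HH C) ((V, rh), t) ((W, sg), u)"
proof (rule HH_HomI)
 note aV = act_dims[OF HH_act[OF M]] and aW = act_dims[OF HH_act[OF N]]
 note F = HH_HomD[OF f] and fd = grhom_dims[OF HH_HomD(1)[OF f]]
 note F' = HH_HomD[OF f'] and fd' = grhom_dims[OF HH_HomD(1)[OF f']]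
 have dd: "drow f = drow f'" "dcol f = dcol f'" using fd fd' by simp_all
 show "f + f' \<in> grhom V W" by (rule grhom_add[OF F(1) F'(1)])
 have "(f + f') * rh = f * rh + f' * rh"
 by (rule add_mult_distrib_mat[of _ "len W" "len V" _ _ "n * len V"]) (intro carrier_matI; simp add: fd fd' aV)+
 also have "... = sg * (idm A <*> f + idm A <*> f')" unfolding F(2) F'(2)
 by (rule mult_add_distrib_mat[symmetric, of _ "len W" "n * len W" _ "n * len V"]) (intro carrier_matI; simp add: fd fd' aW)+
 finally show "(f + f') * rh = sg * (idm A <*> (f + f'))" by (simp only: kron_add_right[OF dd])
 fix U ta assume X: "act_on U ta"
 note e = fd fd' HH_arrow(2,3)[OF M X] HH_arrow(2,3)[OF N X]
 have "u (U, ta) * (f <*> idm U + f' <*> idm U) = u (U, ta) * (f <*> idm U) + u (U, ta) * (f' <*> idm U)"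
 by (rule mult_add_distrib_mat[of _ "len U * len W" "len W * len U" _ "len V * len U"]) (intro carrier_matI; simp add: e)+
 also have "... = (idm U <*> f + idm U <*> f') * t (U, ta)" unfolding F(4)[OF X] F'(4)[OF X]
 by (rule add_mult_distrib_mat[symmetric, of _ "len U * len W" "len U * len V" _ _ "len V * len U"]) (intro carrier_matI; simp add: e)+
 finally show "u (U, ta) * ((f + f') <*> idm U) = (idm U <*> (f + f')) * t (U, ta)"
 by (simp only: kron_add_right[OF dd] kron_add_left[OF dd])
qed

lemma HH_mult_Hom:
 assumes L: "((U, ta), v) \<in> Obj (HH C)" and h: "h \<in> Hom (HH C) ((W, sg), u) ((U, ta), v)"
 shows "h * f \<in> Hom (HH C) ((V, rh), t) ((U, ta), v)"
proof (rule HH_HomI)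
 note F = HH_HomD[OF f] and G = HH_HomD[OF h]
 note d = grhom_dims[OF F(1)] grhom_dims[OF G(1)] act_dims[OF HH_act[OF M]] act_dims[OF HH_act[OF N]] act_dims[OF HH_act[OF L]]
 show "h * f \<in> grhom V U" by (rule grhom_mult[OF G(1) F(1)])
 have "h * f * rh = h * (sg * (idm A <*> f))" using d F(2) by (simp add: mat_assoc)
 also have "... = ta * ((idm A <*> h) * (idm A <*> f))" by (rule assoc_swap[OF G(2)]) (use d in simp_all)
 finally show "h * f * rh = ta * (idm A <*> (h * f))" using d by (simp add: kron_mult)
 fix U' ta' assume X: "act_on U' ta'"
 note e = HH_arrow(2,3)[OF M X] HH_arrow(2,3)[OF N X] HH_arrow(2,3)[OF L X]
 have k1: "(h * f) <*> idm U' = (h <*> idm U') * (f <*> idm U')" using d by (simp add: kron_mult)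
 have k2: "idm U' <*> (h * f) = (idm U' <*> h) * (idm U' <*> f)" using d by (simp add: kron_mult)
 have "v (U', ta') * ((h <*> idm U') * (f <*> idm U')) = (idm U' <*> h) * (u (U', ta') * (f <*> idm U'))"
 by (rule assoc_swap[OF G(4)[OF X]]) (use d e in simp_all)
 then show "v (U', ta') * ((h * f) <*> idm U') = (idm U' <*> (h * f)) * t (U', ta')"
 unfolding k1 k2 F(4)[OF X] using d e by (simp add: mat_assoc)
qed

end

end

lemma HH_one_Hom: "((V, rh), t) \<in> Obj (HH C) ==> idm V \<in> Hom (HH C) ((V, rh), t) ((V, rh), t)"
 by (rule HH_HomI) (simp_all add: act_dims HH_act HH_arrow)

lemma HH_mat_category: "mat_category (HH C) dmH"
proof (unfold_locales, goal_cases)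
 case (1 X Y f)
 show ?case by (rule carrier_matI) (rule grhom_dims[OF HH_HomD(1)[of f "fst (fst X)" "snd (fst X)" "snd X" "fst (fst Y)" "snd (fst Y)" "snd Y", unfolded prod.collapse, OF 1(3)]])+
next
 case (2 X Y)
 show ?case by (rule HH_zero_Hom[of "fst (fst X)" "snd (fst X)" "snd X" "fst (fst Y)" "snd (fst Y)" "snd Y", unfolded prod.collapse, OF 2])
next
 case (3 X)
 show ?case by (rule HH_one_Hom[of "fst (fst X)" "snd (fst X)" "snd X", unfolded prod.collapse, OF 3])
next
 case (4 X Y Z f g)
 show ?case by (rule HH_mult_Hom[of "fst (fst X)" "snd (fst X)" "snd X" "fst (fst Y)" "snd (fst Y)" "snd Y" f "fst (fst Z)" "snd (fst Z)" "snd Z" g, unfolded prod.collapse, OF 4(1,2,4,3,5)])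
next
 case (5 X Y f f')
 show ?case by (rule HH_add_Hom[of "fst (fst X)" "snd (fst X)" "snd X" "fst (fst Y)" "snd (fst Y)" "snd Y" f f', unfolded prod.collapse, OF 5])
next
 case (6 X Y f c)
 show ?case by (rule HH_smult_Hom[of "fst (fst X)" "snd (fst X)" "snd X" "fst (fst Y)" "snd (fst Y)" "snd Y" f c, unfolded prod.collapse, OF 6])
qed (simp_all only: HH_ops)

lemma kron_row: "drow B = 1 ==> dcol f = a ==> f * (1\<^sub>m a <*> B) = f <*> B" for f B :: "'k mat"
 using kron_mult[of f "1\<^sub>m a" "1\<^sub>m 1" B] by simp

lemma kron_col: "dcol B = 1 ==> drow f = a ==> (1\<^sub>m a <*> B) * f = f <*> B" for f B :: "'k mat"
 using kron_mult[of "1\<^sub>m a" f B "1\<^sub>m 1"] by simp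

text \<open>The seven squares of \<open>sigma_natural\<close> pasted together, stated abstractly so
  that only dimensions remain to be checked there.\<close>

lemma chain_swap:
 fixes f E S K E' F1 SV F2 G K' SV' E'' F3 SW F4 K'' :: "'k mat"
 assumes 1: "f * E = E' * F1" and 2: "F1 * S = SV * F2" and 3: "F2 * K = G * K'" and 4: "SV * G = G' * SV'"
 and 5: "E' * G' = E'' * F3" and 6: "F3 * SV' = SW * F4" and 7: "F4 * K' = K'' * f"
 and d: "dcol f = drow E" "dcol E = drow S" "dcol S = drow K" "dcol E' = drow F1" "dcol F1 = drow S"
 "dcol SV = drow F2" "dcol F2 = drow K" "dcol G = drow K'" "drow G = drow F2" "dcol G' = drow SV'"
 "dcol SV' = drow K'" "drow G' = drow F1" "dcol E'' = drow F3" "dcol F3 = drow SV'" "dcol SW = drow F4"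
 "dcol F4 = drow K'"
 shows "f * (E * (S * K)) = E'' * (SW * (K'' * f))"
proof -
 have a: "f * (E * (S * K)) = E' * (F1 * (S * K))" by (rule assoc_swap[OF 1]) (simp_all add: d)
 have b: "F1 * (S * K) = SV * (F2 * K)" by (rule assoc_swap[OF 2]) (simp_all add: d)
 have c: "SV * (G * K') = G' * (SV' * K')" by (rule assoc_swap[OF 4]) (simp_all add: d)
 have e: "E' * (G' * (SV' * K')) = E'' * (F3 * (SV' * K'))" by (rule assoc_swap[OF 5]) (simp_all add: d)
 have f: "F3 * (SV' * K') = SW * (F4 * K')" by (rule assoc_swap[OF 6]) (simp_all add: d)
 show ?thesis by (simp only: a b 3 c e f 7)
qed

text \<open>Dinaturality of coevaluation. Together with \<open>evm_transpose\<close> it carries f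
  around the closed strand of the stability map.\<close>

lemma coevm_transpose:
 assumes "drow f = len W" "dcol f = len V"
 shows "(f <*> idm V) * coevm V = (idm W <*> f\<^sup>T) * coevm W"
proof (rule ap_eqI)
 fix c F assume "c < dcol ((idm W <*> f\<^sup>T) * coevm W)"
 then have c: "c = 0" by simp
 have "ap ((f <*> idm V) * coevm V) c F = (\<Sum>i<len V. \<Sum>r<len W. f $$ (r, i) * F (ix (len V) r i))"
 unfolding c using assms by (simp add: ap_kron) (simp add: ap_def assms)
 also have "... = (\<Sum>r<len W. \<Sum>i<len V. f $$ (r, i) * F (ix (len V) r i))" by (rule sum.swap)
 also have "... = ap ((idm W <*> f\<^sup>T) * coevm W) c F"
 unfolding c using assms by (simp add: ap_kron) (simp add: ap_def assms)
 finally show "ap ((f <*> idm V) * coevm V) c F = ap ((idm W <*> f\<^sup>T) * coevm W) c F" .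
qed (use assms in simp_all)

lemma evm_transpose:
 assumes "drow f = len W" "dcol f = len V"
 shows "evm (grdual V) * (idm V <*> f\<^sup>T) = evm (grdual W) * (f <*> idm W)"
proof (rule kron_ap_eqI[of _ _ "len V" "len W"])
 fix i j and F :: "nat \<Rightarrow> _" assume i: "i < len V" and j: "j < len W"
 note e = ap_evm[of _ "grdual V", unfolded length_grdual] ap_evm[of _ "grdual W", unfolded length_grdual]
 have s: "(\<Sum>r<len V. f $$ (j, r) * (if i = r then F 0 else 0)) = f $$ (j, i) * F 0"
 "(\<Sum>r<len W. f $$ (r, i) * (if r = j then F 0 else 0)) = f $$ (j, i) * F 0"
 using i j by (simp_all add: if_distrib[of "%x. _ * x"] cong: if_cong)
 show "ap (evm (grdual V) * (idm V <*> f\<^sup>T)) (ix (len W) i j) F = ap (evm (grdual W) * (f <*> idm W)) (ix (len W) i j) F"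
 using i j assms by (simp add: ap_kron e) (simp add: ap_def assms e s)
qed (use assms in simp_all)

text \<open>Two squares are used: \<open>a\<close>, because f commutes with the half-braidings of M
  and N, and \<open>b\<close>, because the half-braiding of N is natural in the module. Dinaturality
  of evaluation and coevaluation joins them. Through this, stability passes to glued
  objects.\<close>

lemma sigma_natural:
 assumes M: "((V, rh), t) \<in> Obj (HH C)" and N: "((W, sg), u) \<in> Obj (HH C)" and f: "f \<in> Hom (HH C) ((V, rh), t) ((W, sg), u)"
 shows "sigma_HH C ((W, sg), u) * f = f * sigma_HH C ((V, rh), t)"
proof -
 note F = HH_HomD[OF f]
 note V = HH_act[OF M] and W = HH_act[OF N]
 obtain rh' where Q: "tw Q (V, rh) = (V, rh')" by (simp add: tw_def)
 have V': "act_on V rh'" using tw_Obj(2)[of "(V, rh)"] V Q by simp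
 define sM where "sM = minv (t (tw Q (V, rh)))"
 define sV where "sV = minv (u (tw Q (V, rh)))"
 define sW where "sW = minv (u (tw Q (W, sg)))"
 let ?v = "idm V" and ?w = "idm W"
 let ?E = "?v <*> evm (grdual V)" and ?K = "?v <*> coevm V" and ?T = "f\<^sup>T"
 note d = grhom_dims[OF F(1)] unit_minv(1,2)[OF HH_inverse(1)[OF M V], folded sM_def] unit_minv(1,2)[OF HH_inverse(1)[OF N V], folded sV_def]
 unit_minv(1,2)[OF HH_inverse(1)[OF N W], folded sW_def] HH_inverse(2,3)[OF M V] HH_inverse(2,3)[OF N V] HH_inverse(2,3)[OF N W]
 have a: "sV * (?v <*> f) = (f <*> ?v) * sM"
 unfolding sV_def sM_def
 by (rule minv_natural[OF HH_inverse(1)[OF M V] HH_inverse(1)[OF N V]]) (use F(4)[OF V'] d Q in simp_all)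
 have b: "sW * (f <*> ?w) = (?w <*> f) * sV"
 unfolding sV_def sW_def by (rule HH_natural[OF N V W F(3)])
 have 1: "f * ?E = (?w <*> evm (grdual V)) * (f <*> (?v <*> ?v))"
 using d by (simp add: kron_row kron_mult)
 have 2: "(f <*> (?v <*> ?v)) * (sM <*> ?v) = (sV <*> ?v) * (?v <*> (f <*> ?v))"
 unfolding kron_assoc[symmetric] using d a by (simp add: kron_mult)
 have 3: "(?v <*> (f <*> ?v)) * ?K = (?v <*> (?w <*> ?T)) * (?v <*> coevm W)"
 using d coevm_transpose[OF d(1,2)] by (simp add: kron_mult)
 have 4: "(sV <*> ?v) * (?v <*> (?w <*> ?T)) = (?w <*> (?v <*> ?T)) * (sV <*> ?w)"
 unfolding kron_assoc[symmetric] using d by (simp add: kron_mult)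
 have 5: "(?w <*> evm (grdual V)) * (?w <*> (?v <*> ?T)) = (?w <*> evm (grdual W)) * (?w <*> (f <*> ?w))"
 using d evm_transpose[OF d(1,2)] by (simp add: kron_mult)
 have 6: "(?w <*> (f <*> ?w)) * (sV <*> ?w) = (sW <*> ?w) * (f <*> (?w <*> ?w))"
 unfolding kron_assoc[symmetric] using d b by (simp add: kron_mult)
 have 7: "(f <*> (?w <*> ?w)) * (?v <*> coevm W) = (?w <*> coevm W) * f"
 using d by (simp add: kron_col kron_mult)
 have "f * (?E * ((sM <*> ?v) * ?K)) = (?w <*> evm (grdual W)) * ((sW <*> ?w) * ((?w <*> coevm W) * f))"
 by (rule chain_swap[OF 1 2 3 4 5 6 7]) (use d in simp_all)
 moreover have "f * sigma_HH C ((V, rh), t) = f * (?E * ((sM <*> ?v) * ?K))"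
 unfolding sigma_HH_expand(1)[OF M] sM_def[symmetric] using d by (simp add: mat_assoc)
 moreover have "sigma_HH C ((W, sg), u) * f = (?w <*> evm (grdual W)) * ((sW <*> ?w) * ((?w <*> coevm W) * f))"
 unfolding sigma_HH_expand(1)[OF N] sW_def[symmetric] using d by (simp add: mat_assoc)
 ultimately show ?thesis by simp
qed

end

text \<open>The map on an object W glued from pieces that is induced by maps G s on the pieces. The
  numbers m, l and m', l' are the dimensions of the tensor factors to the left and right of the
  piece, in target and source.\<close>

definition glue :: "'s set \<Rightarrow> nat \<Rightarrow> ('s \<Rightarrow> 'k::field mat) \<Rightarrow> ('s \<Rightarrow> 'k mat) \<Rightarrow> nat \<Rightarrow> nat \<Rightarrow> nat \<Rightarrow> nat \<Rightarrow> ('s \<Rightarrow> 'k mat) \<Rightarrow> 'k mat" where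
 "glue J w p q m l m' l' G = msum (m * w * l) (m' * w * l') (%s. (1\<^sub>m m <*> p s <*> 1\<^sub>m l) * G s * (1\<^sub>m m' <*> q s <*> 1\<^sub>m l')) J"

context
 fixes J :: "'s set" and w :: nat and v :: "'s \<Rightarrow> nat" and p q :: "'s \<Rightarrow> 'k::field mat"
 assumes p: "!!s. s \<in> J ==> drow (p s) = w" "!!s. s \<in> J ==> dcol (p s) = v s"
 and q: "!!s. s \<in> J ==> drow (q s) = v s" "!!s. s \<in> J ==> dcol (q s) = w"
 and one: "msum w w (%s. p s * q s) J = 1\<^sub>m w"
begin

lemma msum_kron_one: "msum (m * w * l) (m * w * l) (%s. (1\<^sub>m m <*> p s <*> 1\<^sub>m l) * (1\<^sub>m m <*> q s <*> 1\<^sub>m l)) J = 1\<^sub>m (m * w * l)"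
proof -
 have c: "p s * q s \<in> carrier_mat w w" if "s \<in> J" for s by (rule carrier_matI) (use p q that in simp_all)
 have "1\<^sub>m (m * w * l) = 1\<^sub>m m <*> msum w w (%s. p s * q s) J <*> 1\<^sub>m l" by (simp add: one)
 also have "... = msum (m * w * l) (m * w * l) (%s. 1\<^sub>m m <*> (p s * q s) <*> 1\<^sub>m l) J"
 by (rule msum_kron) (rule c)
 also have "... = msum (m * w * l) (m * w * l) (%s. (1\<^sub>m m <*> p s <*> 1\<^sub>m l) * (1\<^sub>m m <*> q s <*> 1\<^sub>m l)) J"
 by (rule msum_cong) (simp add: kron_mult p q)
 finally show ?thesis ..
qed

text \<open>Inserting the resolution of the identity into the sum of the p s q s. All axioms for
  glued objects are checked on the pieces by this rule.\<close>

lemma joint_epi: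
 assumes X: "dcol X = m * w * l" "dcol Y = m * w * l" "drow X = drow Y"
 and e: "!!s. s \<in> J ==> X * (1\<^sub>m m <*> p s <*> 1\<^sub>m l) = Y * (1\<^sub>m m <*> p s <*> 1\<^sub>m l)"
 shows "X = Y"
proof -
 let ?L = "%s. 1\<^sub>m m <*> p s <*> 1\<^sub>m l" and ?Q = "%s. 1\<^sub>m m <*> q s <*> 1\<^sub>m l"
 have c: "?L s * ?Q s \<in> carrier_mat (m * w * l) (m * w * l)" if "s \<in> J" for s by (rule carrier_matI) (use p q that in simp_all)
 have ex: "X' = msum (drow X') (m * w * l) (%s. X' * ?L s * ?Q s) J" if X': "dcol X' = m * w * l" for X'
 proof -
 have "X' = X' * msum (m * w * l) (m * w * l) (%s. ?L s * ?Q s) J" unfolding msum_kron_one using X' by simp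
 also have "... = msum (drow X') (m * w * l) (%s. X' * (?L s * ?Q s)) J" by (rule msum_mult_right) (use c X' in simp_all)
 also have "... = msum (drow X') (m * w * l) (%s. X' * ?L s * ?Q s) J"
 by (rule msum_cong) (simp add: mat_assoc p q X')
 finally show ?thesis .
 qed
 have "X = msum (drow X) (m * w * l) (%s. X * ?L s * ?Q s) J" by (rule ex[OF X(1)])
 also have "... = msum (drow Y) (m * w * l) (%s. Y * ?L s * ?Q s) J" unfolding X(3) by (rule msum_cong) (simp only: e)
 also have "... = Y" by (rule ex[OF X(2), symmetric])
 finally show ?thesis .
qed

text \<open>The pieces may overlap: it suffices that the composites q s' p s intertwine the G s. So
  one construction covers direct sums, where these composites are 0 or 1, and the image of an
  idempotent, where there is one piece.\<close>

lemma glue_p: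
 assumes G: "!!s. s \<in> J ==> drow (G s) = m * v s * l" "!!s. s \<in> J ==> dcol (G s) = m' * v s * l'"
 and c: "!!s s'. s \<in> J ==> s' \<in> J ==> (1\<^sub>m m <*> (q s' * p s) <*> 1\<^sub>m l) * G s = G s' * (1\<^sub>m m' <*> (q s' * p s) <*> 1\<^sub>m l')"
 and t: "t \<in> J"
 shows "glue J w p q m l m' l' G * (1\<^sub>m m' <*> p t <*> 1\<^sub>m l') = (1\<^sub>m m <*> p t <*> 1\<^sub>m l) * G t"
proof -
 let ?L = "%s. 1\<^sub>m m <*> p s <*> 1\<^sub>m l" and ?Q = "%s. 1\<^sub>m m <*> q s <*> 1\<^sub>m l"
 and ?R = "%s. 1\<^sub>m m' <*> p s <*> 1\<^sub>m l'" and ?S = "%s. 1\<^sub>m m' <*> q s <*> 1\<^sub>m l'"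
 have c1: "?L s * G s * ?S s \<in> carrier_mat (m * w * l) (m' * w * l')" and c2: "?L s * ?Q s \<in> carrier_mat (m * w * l) (m * w * l)"
 if "s \<in> J" for s by (rule carrier_matI; use p q that in simp)+
 have e: "?L s * G s * ?S s * ?R t = ?L s * ?Q s * (?L t * G t)" if s: "s \<in> J" for s
 proof -
 have 1: "?S s * ?R t = 1\<^sub>m m' <*> (q s * p t) <*> 1\<^sub>m l'" using p q s t by (simp add: kron_mult)
 have 2: "?Q s * ?L t = 1\<^sub>m m <*> (q s * p t) <*> 1\<^sub>m l" using p q s t by (simp add: kron_mult)
 have 3: "G s * (?S s * ?R t) = ?Q s * ?L t * G t" unfolding 1 2 by (rule c[OF t s, symmetric])
 have "?L s * G s * ?S s * ?R t = ?L s * (G s * (?S s * ?R t))" using p q s t G by (simp add: mat_assoc)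
 also have "... = ?L s * (?Q s * ?L t * G t)" by (simp only: 3)
 also have "... = ?L s * ?Q s * (?L t * G t)" using p q s t G by (simp add: mat_assoc)
 finally show ?thesis .
 qed
 have "glue J w p q m l m' l' G * ?R t = msum (m * w * l) (dcol (?R t)) (%s. ?L s * G s * ?S s * ?R t) J"
 unfolding glue_def by (rule msum_mult_left[OF c1]) (use p t in simp_all)
 also have "... = msum (m * w * l) (dcol (?L t * G t)) (%s. ?L s * ?Q s * (?L t * G t)) J"
 proof -
 have dc: "dcol (?R t) = dcol (?L t * G t)" using p t G by simp
 show ?thesis unfolding dc by (rule msum_cong) (rule e)
 qed
 also have "... = msum (m * w * l) (m * w * l) (%s. ?L s * ?Q s) J * (?L t * G t)"
 by (rule msum_mult_left[OF c2, symmetric]) (use p t in simp_all)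
 also have "... = ?L t * G t" unfolding msum_kron_one by (rule left_mult_one_mat') (use p t in simp)
 finally show ?thesis .
qed

end

section \<open>Objects of HH glued from pieces\<close>

context braided_hopf
begin

context
 fixes J :: "'s set" and V rh t p q and W :: "'g list"
 assumes Z: "!!s. s \<in> J ==> ((V s, rh s), t s) \<in> Obj (HH C)"
 and pg: "!!s. s \<in> J ==> p s \<in> grhom (V s) W" and qg: "!!s. s \<in> J ==> q s \<in> grhom W (V s)"
 and one: "msum (len W) (len W) (%s. p s * q s) J = idm W"
 and E: "!!s s'. s \<in> J ==> s' \<in> J ==> q s' * p s \<in> Hom (HH C) ((V s, rh s), t s) ((V s', rh s'), t s')"
begin

lemma glue_dims: "s \<in> J ==> drow (p s) = len W" "s \<in> J ==> dcol (p s) = len (V s)"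
 "s \<in> J ==> drow (q s) = len (V s)" "s \<in> J ==> dcol (q s) = len W"
 "s \<in> J ==> drow (rh s) = len (V s)" "s \<in> J ==> dcol (rh s) = n * len (V s)"
 using grhom_dims[OF pg] grhom_dims[OF qg] act_dims[OF HH_act[OF Z]] by simp_all

lemmas epi = joint_epi[of J p "len W" "%s. len (V s)" q, OF glue_dims(1,2,3,4) one]
 and glue_eq = glue_p[of J p "len W" "%s. len (V s)" q, OF glue_dims(1,2,3,4) one]

text \<open>Action and half-braiding on the glued space. The dimensions record that an action has an
  additional factor A on the left of its source, while a half-braiding moves the module from the
  right of the piece to its left.\<close>

definition "glue_act = glue J (len W) p q 1 1 n 1 rh"
definition "glue_br = (\<lambda>X\<in>Obj C. glue J (len W) p q (len (fst X)) 1 1 (len (fst X)) (%s. t s X))"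

lemma glue_act_dims[simp]: "drow glue_act = len W" "dcol glue_act = n * len W"
 by (simp_all add: glue_act_def glue_def)

lemma glue_act_p: "s \<in> J ==> glue_act * (idm A <*> p s) = p s * rh s"
 using glue_eq[of rh 1 1 n 1 s] glue_dims HH_HomD(2)[OF E] by (simp add: glue_act_def)

lemma glue_br_eq: "act_on U ta ==> glue_br (U, ta) = glue J (len W) p q (len U) 1 1 (len U) (%s. t s (U, ta))"
 by (simp add: glue_br_def)

lemma glue_br_dims:
 assumes "act_on U ta"
 shows "drow (glue_br (U, ta)) = len U * len W" "dcol (glue_br (U, ta)) = len W * len U"
 by (simp_all add: glue_br_eq[OF assms] glue_def)

lemma glue_br_p:
 assumes X: "act_on U ta" and s: "s \<in> J"
 shows "glue_br (U, ta) * (p s <*> idm U) = (idm U <*> p s) * t s (U, ta)"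
 using glue_eq[of "%s. t s (U, ta)" "len U" 1 1 "len U" s] s HH_arrow(2,3)[OF Z X] HH_HomD(4)[OF E X]
 by (simp add: glue_br_eq[OF X])

lemma glue_act_on: "act_on W glue_act"
 unfolding is_action_def
proof (intro conjI)
 have eq: "glue_act = msum (len W) (len (A <&> W)) (%s. p s * rh s * (idm A <*> q s)) J"
 by (simp add: glue_act_def glue_def)
 have "p s * rh s * (idm A <*> q s) \<in> grhom (A <&> W) W" if "s \<in> J" for s
 by (rule grhom_mult[OF grhom_mult[OF pg[OF that] act_grhom[OF HH_act[OF Z[OF that]]]] grhom_kron[OF grhom_one qg[OF that]]])
 then show "glue_act \<in> grhom (A <&> W) W" unfolding eq by (rule msum_grhom)
 show "glue_act * (hmult H <*> idm W) = glue_act * (idm A <*> glue_act)"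
 proof (rule epi[where m = "n * n" and l = 1])
 fix s assume s: "s \<in> J"
 note d = glue_dims[OF s]
 have a: "rh s * (hmult H <*> idm (V s)) = rh s * (idm A <*> rh s)" using HH_act[OF Z[OF s]] by (simp add: is_action_def)
 have 1: "(hmult H <*> idm W) * (1\<^sub>m (n * n) <*> p s) = (idm A <*> p s) * (hmult H <*> idm (V s))"
 using d by (simp add: kron_mult)
 have "1\<^sub>m (n * n) <*> p s = idm A <*> (idm A <*> p s)" unfolding kron_assoc[symmetric] by simp
 then have 2: "(idm A <*> glue_act) * (1\<^sub>m (n * n) <*> p s) = (idm A <*> p s) * (idm A <*> rh s)"
 using d glue_act_p[OF s] by (simp add: kron_mult)
 have "glue_act * (hmult H <*> idm W) * (1\<^sub>m (n * n) <*> p s) = glue_act * ((idm A <*> p s) * (hmult H <*> idm (V s)))"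
 unfolding 1[symmetric] using d by (simp add: mat_assoc)
 also have "... = p s * (rh s * (hmult H <*> idm (V s)))" by (rule assoc_swap[OF glue_act_p[OF s]]) (use d in simp_all)
 also have "... = p s * (rh s * (idm A <*> rh s))" by (simp only: a)
 also have "... = glue_act * ((idm A <*> p s) * (idm A <*> rh s))" by (rule assoc_swap[OF glue_act_p[OF s], symmetric]) (use d in simp_all)
 also have "... = glue_act * (idm A <*> glue_act) * (1\<^sub>m (n * n) <*> p s)" unfolding 2[symmetric] using d by (simp add: mat_assoc)
 finally show "glue_act * (hmult H <*> idm W) * (1\<^sub>m (n * n) <*> p s <*> 1\<^sub>m 1) =
 glue_act * (idm A <*> glue_act) * (1\<^sub>m (n * n) <*> p s <*> 1\<^sub>m 1)" by simp
 qed (simp_all add: mult.assoc)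
 show "glue_act * (hunit H <*> idm W) = idm W"
 proof (rule epi[where m = 1 and l = 1])
 fix s assume s: "s \<in> J"
 note d = glue_dims[OF s]
 have a: "rh s * (hunit H <*> idm (V s)) = idm (V s)" using HH_act[OF Z[OF s]] by (simp add: is_action_def)
 have 1: "(hunit H <*> idm W) * p s = (idm A <*> p s) * (hunit H <*> idm (V s))"
 using d kron_mult[of "hunit H" "1\<^sub>m 1" "idm W" "p s"] by (simp add: kron_mult)
 have "glue_act * (hunit H <*> idm W) * p s = glue_act * ((idm A <*> p s) * (hunit H <*> idm (V s)))"
 unfolding 1[symmetric] using d by (simp add: mat_assoc)
 also have "... = p s * (rh s * (hunit H <*> idm (V s)))" by (rule assoc_swap[OF glue_act_p[OF s]]) (use d in simp_all)
 also have "... = p s" unfolding a using d by simp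
 finally show "glue_act * (hunit H <*> idm W) * (1\<^sub>m 1 <*> p s <*> 1\<^sub>m 1) = idm W * (1\<^sub>m 1 <*> p s <*> 1\<^sub>m 1)"
 using d by simp
 qed simp_all
qed

lemma glue_p_Hom: "s \<in> J ==> p s \<in> Hom C (V s, rh s) (W, glue_act)"
 using pg glue_act_p by simp

text \<open>The inverse is glued from the inverses on the pieces. That both products are identities,
  and that the map is H-linear, is checked on the pieces.\<close>

lemma glue_br_iso:
 assumes X: "act_on U ta"
 shows "is_iso C (tenO C (W, glue_act) (U, ta)) (tenO C (tw P (U, ta)) (W, glue_act)) (glue_br (U, ta))"
proof -
 obtain ta' where P: "tw P (U, ta) = (U, ta')" by (simp add: tw_def)
 have X': "act_on U ta'" using tw_Obj(1)[of "(U, ta)"] X P by simp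
 let ?u = "len U" and ?T = "glue_br (U, ta)"
 define R where "R = glue J (len W) p q 1 ?u ?u 1 (%s. minv (t s (U, ta)))"
 have Rd: "drow R = len W * ?u" "dcol R = ?u * len W" by (simp_all add: R_def glue_def)
 note Td = glue_br_dims[OF X] and tp = glue_br_p[OF X]
 have tt: "drow (t s (U, ta)) = ?u * len (V s)" "dcol (t s (U, ta)) = len (V s) * ?u"
 "drow (minv (t s (U, ta))) = len (V s) * ?u" "dcol (minv (t s (U, ta))) = ?u * len (V s)"
 "minv (t s (U, ta)) * t s (U, ta) = 1\<^sub>m (len (V s) * ?u)" "t s (U, ta) * minv (t s (U, ta)) = 1\<^sub>m (?u * len (V s))"
 if "s \<in> J" for s
 using HH_arrow(2,3)[OF Z[OF that] X] unit_minv[OF HH_arrow(1)[OF Z[OF that] X]] by simp_all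
 have Rp: "R * (idm U <*> p s) = (p s <*> idm U) * minv (t s (U, ta))" if s: "s \<in> J" for s
 proof -
 have "((q s' * p s) <*> idm U) * minv (t s (U, ta)) = minv (t s' (U, ta)) * (idm U <*> (q s' * p s))"
 if "s \<in> J" "s' \<in> J" for s s'
 by (rule minv_natural[OF HH_arrow(1)[OF Z[OF that(1)] X] HH_arrow(1)[OF Z[OF that(2)] X] HH_HomD(4)[OF E[OF that] X], symmetric])
 (use tt that glue_dims in simp_all)
 then show ?thesis
 using glue_eq[of "%s. minv (t s (U, ta))" 1 ?u ?u 1 s] s tt by (simp add: R_def)
 qed
 have RT: "R * ?T = idm (W <&> U)"
 proof (rule epi[where m = 1 and l = ?u])
 fix s assume s: "s \<in> J"
 note d = glue_dims[OF s] tt[OF s] Td Rd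
 have "R * ?T * (p s <*> idm U) = R * ((idm U <*> p s) * t s (U, ta))" unfolding tp[OF s, symmetric] using d by (simp add: mat_assoc)
 also have "... = (p s <*> idm U) * (minv (t s (U, ta)) * t s (U, ta))" by (rule assoc_swap[OF Rp[OF s]]) (use d in simp_all)
 also have "... = p s <*> idm U" unfolding d(11) by (rule right_mult_one_mat') (use d in simp)
 finally show "R * ?T * (1\<^sub>m 1 <*> p s <*> 1\<^sub>m ?u) = idm (W <&> U) * (1\<^sub>m 1 <*> p s <*> 1\<^sub>m ?u)" using d by simp
 qed (simp_all add: Rd Td)
 have TR: "?T * R = idm (U <&> W)"
 proof (rule epi[where m = ?u and l = 1])
 fix s assume s: "s \<in> J"
 note d = glue_dims[OF s] tt[OF s] Td Rd
 have "?T * R * (idm U <*> p s) = ?T * ((p s <*> idm U) * minv (t s (U, ta)))" unfolding Rp[OF s, symmetric] using d by (simp add: mat_assoc)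
 also have "... = (idm U <*> p s) * (t s (U, ta) * minv (t s (U, ta)))" by (rule assoc_swap[OF tp[OF s]]) (use d in simp_all)
 also have "... = idm U <*> p s" unfolding d(12) by (rule right_mult_one_mat') (use d in simp)
 finally show "?T * R * (1\<^sub>m ?u <*> p s <*> 1\<^sub>m 1) = idm (U <&> W) * (1\<^sub>m ?u <*> p s <*> 1\<^sub>m 1)" using d by simp
 qed (simp_all add: Rd Td)
 have g: "?T \<in> grhom (W <&> U) (U <&> W)"
 proof -
 have eq: "?T = msum (len (U <&> W)) (len (W <&> U)) (%s. (idm U <*> p s) * t s (U, ta) * (q s <*> idm U)) J"
 by (simp add: glue_br_eq[OF X] glue_def)
 have "(idm U <*> p s) * t s (U, ta) * (q s <*> idm U) \<in> grhom (W <&> U) (U <&> W)" if "s \<in> J" for s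
 by (rule grhom_mult[OF grhom_mult[OF grhom_kron[OF grhom_one pg[OF that]] HH_arrow_grhom[OF Z[OF that] X]] grhom_kron[OF qg[OF that] grhom_one]])
 then show ?thesis unfolding eq by (rule msum_grhom)
 qed
 let ?a = "tensor_action ch H W glue_act U ta" and ?b = "tensor_action ch H U ta' W glue_act"
 note ad = tensor_dims[OF glue_act_dims act_dims[OF X]] and bd = tensor_dims[OF act_dims[OF X'] glue_act_dims]
 have lin: "?T * ?a = ?b * (idm A <*> ?T)"
 proof (rule epi[where m = n and l = ?u])
 fix s assume s: "s \<in> J"
 let ?as = "tensor_action ch H (V s) (rh s) U ta" and ?bs = "tensor_action ch H U ta' (V s) (rh s)" and ?t = "t s (U, ta)"
 note Vs = HH_act[OF Z[OF s]]
 note d = glue_dims[OF s] tt(1,2)[OF s] Td ad bd tensor_dims[OF glue_dims(5,6)[OF s] act_dims[OF X]] tensor_dims[OF act_dims[OF X'] glue_dims(5,6)[OF s]]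
 have 1: "?a * (idm A <*> (p s <*> idm U)) = (p s <*> idm U) * ?as"
 using Hom_tensor_left[OF Vs glue_act_on X glue_p_Hom[OF s]] by simp
 have 2: "?b * (idm A <*> (idm U <*> p s)) = (idm U <*> p s) * ?bs"
 using Hom_tensor_right[OF Vs glue_act_on X' glue_p_Hom[OF s]] by simp
 have 3: "?t * ?as = ?bs * (idm A <*> ?t)" using HH_arrow(4)[OF Z[OF s] X] unfolding P by simp
 have "(idm A <*> ?T) * (idm A <*> (p s <*> idm U)) = idm A <*> (?T * (p s <*> idm U))" using d by (simp add: kron_mult)
 also have "... = (idm A <*> (idm U <*> p s)) * (idm A <*> ?t)" unfolding tp[OF s] using d by (simp add: kron_mult)
 finally have 4: "(idm A <*> ?T) * (idm A <*> (p s <*> idm U)) = (idm A <*> (idm U <*> p s)) * (idm A <*> ?t)" .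
 have "?T * ?a * (idm A <*> (p s <*> idm U)) = ?T * ((p s <*> idm U) * ?as)"
 unfolding 1[symmetric] by (rule mat_assoc) (use d in \<open>simp_all add: mult.assoc\<close>)
 also have "... = (idm U <*> p s) * (?t * ?as)" by (rule assoc_swap[OF tp[OF s]]) (use d in simp_all)
 also have "... = (idm U <*> p s) * (?bs * (idm A <*> ?t))" by (simp only: 3)
 also have "... = ?b * ((idm A <*> (idm U <*> p s)) * (idm A <*> ?t))"
 by (rule assoc_swap[OF 2, symmetric]) (use d in \<open>simp_all add: mult.assoc\<close>)
 also have "... = ?b * (idm A <*> ?T) * (idm A <*> (p s <*> idm U))"
 unfolding 4[symmetric] by (rule mat_assoc[symmetric]) (use d in \<open>simp_all add: mult.assoc\<close>)
 finally show "?T * ?a * (1\<^sub>m n <*> p s <*> 1\<^sub>m ?u) = ?b * (idm A <*> ?T) * (1\<^sub>m n <*> p s <*> 1\<^sub>m ?u)" by (simp only: kron_assoc)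
 qed (simp_all add: ad bd Td mult.assoc)
 have T: "?T \<in> Hom C (W <&> U, ?a) (U <&> W, ?b)" using g lin by simp
 have "R \<in> Hom C (U <&> W, ?b) (W <&> U, ?a)"
 by (rule Hom_inverse[OF T]) (use ad bd Rd RT TR in \<open>simp_all add: mult.assoc\<close>)
 then show ?thesis unfolding P is_iso_def inverse_arrows_def using T RT TR by auto
qed

lemma glue_HH: "((W, glue_act), glue_br) \<in> Obj (HH C)"
 unfolding HH_Obj
proof (intro conjI ballI)
 show "(W, glue_act) \<in> Obj C" using glue_act_on by simp
 show "glue_br \<in> extensional (Obj C)" by (simp add: glue_br_def)
 fix X assume X: "X \<in> Obj C"
 obtain U ta where X': "X = (U, ta)" by (cases X)
 have U: "act_on U ta" using X X' by simp
 show "is_iso C (tenO C (W, glue_act) X) (tenO C (tw P X) (W, glue_act)) (glue_br X)" unfolding X' by (rule glue_br_iso[OF U])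
 fix Y assume Y: "Y \<in> Obj C"
 obtain U' \<upsilon> where Y': "Y = (U', \<upsilon>)" by (cases Y)
 have U': "act_on U' \<upsilon>" using Y Y' by simp
 note dT = glue_br_dims[OF U] glue_br_dims[OF U']
 show "glue_br Y * (Idn C (W, glue_act) <*> f) = (f <*> Idn C (W, glue_act)) * glue_br X" if f: "f \<in> Hom C X Y" for f
 proof -
 have fd: "drow f = len U'" "dcol f = len U" using f X' Y' grhom_dims by auto
 have "glue_br (U', \<upsilon>) * (idm W <*> f) = (f <*> idm W) * glue_br (U, ta)"
 proof (rule epi[where m = 1 and l = "len U"])
 fix s assume s: "s \<in> J"
 note d = glue_dims[OF s] fd dT HH_arrow(2,3)[OF Z[OF s] U] HH_arrow(2,3)[OF Z[OF s] U']
 have n: "t s (U', \<upsilon>) * (idm (V s) <*> f) = (f <*> idm (V s)) * t s (U, ta)"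
 using Z[OF s] X Y f unfolding HH_Obj X' Y' by (metis H_mod_simps(3))
 have 1: "(idm W <*> f) * (p s <*> idm U) = (p s <*> idm U') * (idm (V s) <*> f)" using d by (simp add: kron_mult)
 have 2: "(idm U' <*> p s) * (f <*> idm (V s)) = (f <*> idm W) * (idm U <*> p s)" using d by (simp add: kron_mult)
 have "glue_br (U', \<upsilon>) * (idm W <*> f) * (p s <*> idm U) = glue_br (U', \<upsilon>) * ((p s <*> idm U') * (idm (V s) <*> f))"
 unfolding 1[symmetric] by (rule mat_assoc) (use d in simp_all)
 also have "... = (idm U' <*> p s) * (t s (U', \<upsilon>) * (idm (V s) <*> f))" by (rule assoc_swap[OF glue_br_p[OF U' s]]) (use d in simp_all)
 also have "... = (idm U' <*> p s) * ((f <*> idm (V s)) * t s (U, ta))" by (simp only: n)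
 also have "... = (f <*> idm W) * ((idm U <*> p s) * t s (U, ta))" by (rule assoc_swap[OF 2]) (use d in simp_all)
 also have "... = (f <*> idm W) * glue_br (U, ta) * (p s <*> idm U)" unfolding glue_br_p[OF U s, symmetric]
 by (rule mat_assoc[symmetric]) (use d in simp_all)
 finally show "glue_br (U', \<upsilon>) * (idm W <*> f) * (1\<^sub>m 1 <*> p s <*> idm U) = (f <*> idm W) * glue_br (U, ta) * (1\<^sub>m 1 <*> p s <*> idm U)"
 by simp
 qed (use fd dT in simp_all)
 then show ?thesis unfolding X' Y' by simp
 qed
 show "glue_br (tenO C X Y) = (Idn C (tw P X) <*> glue_br Y) * (glue_br X <*> Idn C Y)"
 proof -
 let ?ta = "tensor_action ch H U ta U' \<upsilon>"
 have UU: "act_on (U <&> U') ?ta" by (rule act_tensor[OF U U'])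
 have "glue_br (U <&> U', ?ta) = (idm U <*> glue_br (U', \<upsilon>)) * (glue_br (U, ta) <*> idm U')"
 proof (rule epi[where m = 1 and l = "len U * len U'"])
 fix s assume s: "s \<in> J"
 note d = glue_dims[OF s] dT glue_br_dims[OF UU] HH_arrow(2,3)[OF Z[OF s] U] HH_arrow(2,3)[OF Z[OF s] U']
 have "\<forall>X\<in>Obj C. \<forall>Y\<in>Obj C. t s (tenO C X Y) = (Idn C (tw P X) <*> t s Y) * (t s X <*> Idn C Y)"
 using Z[OF s] unfolding HH_Obj by blast
 from this[rule_format, OF X Y] have n: "t s (U <&> U', ?ta) = (idm U <*> t s (U', \<upsilon>)) * (t s (U, ta) <*> idm U')"
 unfolding X' Y' by simp
 have pp: "p s <*> idm (U <&> U') = p s <*> idm U <*> idm U'" unfolding kron_assoc by simp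
 have 1: "(glue_br (U, ta) <*> idm U') * (p s <*> idm U <*> idm U') = (idm U <*> p s <*> idm U') * (t s (U, ta) <*> idm U')"
 using d glue_br_p[OF U s] by (simp add: kron_mult)
 have 2: "(idm U <*> glue_br (U', \<upsilon>)) * (idm U <*> p s <*> idm U') = (idm U <*> (idm U' <*> p s)) * (idm U <*> t s (U', \<upsilon>))"
 unfolding kron_assoc using d glue_br_p[OF U' s] by (simp add: kron_mult)
 have 3: "idm (U <&> U') <*> p s = idm U <*> (idm U' <*> p s)" unfolding kron_assoc[symmetric] by simp
 have "glue_br (U <&> U', ?ta) * (p s <*> idm (U <&> U')) = (idm U <*> (idm U' <*> p s)) * ((idm U <*> t s (U', \<upsilon>)) * (t s (U, ta) <*> idm U'))"
 unfolding glue_br_p[OF UU s] n 3 ..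
 also have "... = (idm U <*> glue_br (U', \<upsilon>)) * ((idm U <*> p s <*> idm U') * (t s (U, ta) <*> idm U'))"
 by (rule assoc_swap[OF 2, symmetric]) (use d in \<open>simp_all add: mult.assoc\<close>)
 also have "... = (idm U <*> glue_br (U', \<upsilon>)) * (glue_br (U, ta) <*> idm U') * (p s <*> idm (U <&> U'))"
 unfolding 1[symmetric] pp by (rule mat_assoc[symmetric]) (use d in \<open>simp_all add: mult.assoc\<close>)
 finally show "glue_br (U <&> U', ?ta) * (1\<^sub>m 1 <*> p s <*> 1\<^sub>m (len U * len U')) =
 (idm U <*> glue_br (U', \<upsilon>)) * (glue_br (U, ta) <*> idm U') * (1\<^sub>m 1 <*> p s <*> 1\<^sub>m (len U * len U'))" by simp
 qed (use dT glue_br_dims[OF UU] in \<open>simp_all add: mult.assoc\<close>)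
 then show ?thesis unfolding X' Y' by simp
 qed
next
 show "glue_br (unitO C) = Idn C (W, glue_act)"
 proof -
 have "glue_br ([0], hcounit H) = idm W"
 proof (rule epi[where m = 1 and l = 1])
 fix s assume s: "s \<in> J"
 have n: "t s ([0], hcounit H) = idm (V s)" using Z[OF s] unfolding HH_Obj by simp
 show "glue_br ([0], hcounit H) * (1\<^sub>m 1 <*> p s <*> 1\<^sub>m 1) = idm W * (1\<^sub>m 1 <*> p s <*> 1\<^sub>m 1)"
 using glue_br_p[OF act_unit_object s] n glue_dims[OF s] by simp
 qed (simp_all add: glue_br_dims[OF act_unit_object])
 then show ?thesis by simp
 qed
qed

lemma glue_p_HH: "s \<in> J ==> p s \<in> Hom (HH C) ((V s, rh s), t s) ((W, glue_act), glue_br)"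
 by (rule HH_HomI) (simp_all add: pg glue_act_p glue_br_p)

lemma glue_q_HH:
 assumes s: "s \<in> J"
 shows "q s \<in> Hom (HH C) ((W, glue_act), glue_br) ((V s, rh s), t s)"
proof (rule HH_HomI[OF qg[OF s]])
 show "q s * glue_act = rh s * (idm A <*> q s)"
 proof (rule epi[where m = n and l = 1])
 fix s' assume s': "s' \<in> J"
 note d = glue_dims[OF s] glue_dims[OF s']
 have "q s * glue_act * (idm A <*> p s') = q s * (p s' * rh s')" unfolding glue_act_p[OF s', symmetric] using d by (simp add: mat_assoc)
 also have "... = q s * p s' * rh s'" using d by (simp add: mat_assoc)
 also have "... = rh s * (idm A <*> (q s * p s'))" by (rule HH_HomD(2)[OF E[OF s' s]])
 also have "... = rh s * ((idm A <*> q s) * (idm A <*> p s'))" using d by (simp add: kron_mult)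
 also have "... = rh s * (idm A <*> q s) * (idm A <*> p s')" by (rule mat_assoc[symmetric]) (use d in simp_all)
 finally show "q s * glue_act * (1\<^sub>m n <*> p s' <*> 1\<^sub>m 1) = rh s * (idm A <*> q s) * (1\<^sub>m n <*> p s' <*> 1\<^sub>m 1)" by simp
 qed (simp_all add: glue_dims[OF s])
 fix U ta assume U: "act_on U ta"
 show "t s (U, ta) * (q s <*> idm U) = (idm U <*> q s) * glue_br (U, ta)"
 proof (rule epi[where m = 1 and l = "len U"])
 fix s' assume s': "s' \<in> J"
 note d = glue_dims[OF s] glue_dims[OF s'] glue_br_dims[OF U] HH_arrow(2,3)[OF Z[OF s] U] HH_arrow(2,3)[OF Z[OF s'] U]
 have "t s (U, ta) * (q s <*> idm U) * (p s' <*> idm U) = t s (U, ta) * ((q s <*> idm U) * (p s' <*> idm U))"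
 by (rule mat_assoc) (use d in simp_all)
 also have "... = t s (U, ta) * ((q s * p s') <*> idm U)" using d by (simp add: kron_mult)
 also have "... = (idm U <*> (q s * p s')) * t s' (U, ta)" by (rule HH_HomD(4)[OF E[OF s' s] U])
 also have "... = (idm U <*> q s) * (idm U <*> p s') * t s' (U, ta)" using d by (simp add: kron_mult)
 also have "... = (idm U <*> q s) * (glue_br (U, ta) * (p s' <*> idm U))" unfolding glue_br_p[OF U s']
 by (rule mat_assoc) (use d in simp_all)
 also have "... = (idm U <*> q s) * glue_br (U, ta) * (p s' <*> idm U)" by (rule mat_assoc[symmetric]) (use d in simp_all)
 finally show "t s (U, ta) * (q s <*> idm U) * (1\<^sub>m 1 <*> p s' <*> idm U) = (idm U <*> q s) * glue_br (U, ta) * (1\<^sub>m 1 <*> p s' <*> idm U)" by simp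
 qed (use glue_dims[OF s] HH_arrow(2,3)[OF Z[OF s] U] glue_br_dims[OF U] in simp_all)
qed

text \<open>By naturality both sides agree after each p s, and the p s are jointly
  epimorphic.\<close>

lemma glue_sigma:
 assumes "!!s. s \<in> J ==> sigma_HH C ((V s, rh s), t s) = idm (V s)"
 shows "sigma_HH C ((W, glue_act), glue_br) = idm W"
proof (rule epi[where m = 1 and l = 1])
 fix s assume s: "s \<in> J"
 show "sigma_HH C ((W, glue_act), glue_br) * (1\<^sub>m 1 <*> p s <*> 1\<^sub>m 1) = idm W * (1\<^sub>m 1 <*> p s <*> 1\<^sub>m 1)"
 using sigma_natural[OF Z[OF s] glue_HH glue_p_HH[OF s]] assms[OF s] glue_dims[OF s] by simp
qed (simp_all add: sigma_HH_expand(2,3)[OF glue_HH])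

text \<open>The form in which gluing is applied: to the image of an idempotent in
  \<open>type_summand\<close> and to direct sums in \<open>HC_biprod_exists\<close>.\<close>

lemma glued_object:
 "\<exists>M. M \<in> Obj (HH C) & fst (fst M) = W & (\<forall>s\<in>J. p s \<in> Hom (HH C) ((V s, rh s), t s) M & q s \<in> Hom (HH C) M ((V s, rh s), t s)) &
 ((\<forall>s\<in>J. sigma_HH C ((V s, rh s), t s) = idm (V s)) \<longrightarrow> sigma_HH C M = idm W)"
 by (intro exI[of _ "((W, glue_act), glue_br)"]) (simp add: glue_HH glue_p_HH glue_q_HH glue_sigma)

end

end

section \<open>The decomposition by types\<close>

lemma mult_entry:
 fixes M N :: "'k::field mat"
 assumes "dcol M = drow N" "i < drow M" "j < dcol N"
 shows "(M * N) $$ (i, j) = (\<Sum>k<drow N. M $$ (i, k) * N $$ (k, j))"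
 using assms by (simp add: scalar_prod_def atLeast0LessThan)

text \<open>Induction on the number of nonzero columns. A nonzero entry (r, c) gives the rank one
  idempotent x y, with x the column c and y the row r divided by that entry. It is graded, as r and
  c have the same degree; e - x y is again a graded idempotent, orthogonal to x y, and its column c
  vanishes.\<close>

lemma graded_idempotent_split:
 fixes e :: "'k::field mat"
 assumes "e \<in> grhom V V" "e * e = e"
 shows "\<exists>W u v. u \<in> grhom W V & v \<in> grhom V W & v * u = idm W & u * v = e"
 using assms
proof (induction "card {c. c < len V & (\<exists>r<len V. e $$ (r, c) ~= 0)}" arbitrary: e rule: less_induct)
 case less
 let ?N = "len V"
 note eg = less(2) and d = grhom_dims[OF less(2)]
 have S: "(\<Sum>k<?N. e $$ (i, k) * e $$ (k, j)) = e $$ (i, j)" if "i < ?N" "j < ?N" for i j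
 using arg_cong[OF less(3), of "%M. M $$ (i, j)"] that d by (simp add: mult_entry del: index_mult_mat(1))
 show ?case
 proof (cases "\<exists>r<?N. \<exists>c<?N. e $$ (r, c) ~= 0")
 case False
 have "0\<^sub>m ?N 0 \<in> grhom [] V" "0\<^sub>m 0 ?N \<in> grhom V []" by (rule grhomI; simp)+
 moreover have "0\<^sub>m 0 ?N * 0\<^sub>m ?N 0 = (idm [] :: 'k mat)" by (rule eq_matI) simp_all
 moreover have "0\<^sub>m ?N 0 * 0\<^sub>m 0 ?N = e" by (rule eq_matI) (use d False in \<open>simp_all add: scalar_prod_def\<close>)
 ultimately show ?thesis by blast
 next
 case True
 then obtain r c where r: "r < ?N" and c: "c < ?N" and a: "e $$ (r, c) ~= 0" by blast
 define b where "b = inverse (e $$ (r, c))"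
 have ba: "b * e $$ (r, c) = 1" using a by (simp add: b_def)
 define e' where "e' = mat ?N ?N (%(i, j). e $$ (i, j) - e $$ (i, c) * b * e $$ (r, j))"
 define x where "x = mat ?N 1 (%(i, _). e $$ (i, c))"
 define y where "y = mat 1 ?N (%(_, j). b * e $$ (r, j))"
 have dd: "drow e' = ?N" "dcol e' = ?N" "drow x = ?N" "dcol x = 1" "drow y = 1" "dcol y = ?N"
 by (simp_all add: e'_def x_def y_def)
 have deg: "V ! r = V ! c" by (rule grhom_degree[OF eg a r c])
 have e'g: "e' \<in> grhom V V"
 proof (rule grhomI)
 fix i j assume ij: "i < ?N" "j < ?N" and nz: "e' $$ (i, j) ~= 0"
 then have "e $$ (i, j) ~= 0 \<or> (e $$ (i, c) ~= 0 & e $$ (r, j) ~= 0)" by (auto simp: e'_def)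
 then show "V ! i = V ! j" using grhom_degree[OF eg] ij r c deg by metis
 qed (simp_all add: dd)
 have e'e': "e' * e' = e'"
 proof (rule eq_matI)
 fix i j assume "i < drow e'" "j < dcol e'"
 then have ij: "i < ?N" "j < ?N" by (simp_all add: dd)
 have t: "(e $$ (i, k) - e $$ (i, c) * b * e $$ (r, k)) * (e $$ (k, j) - e $$ (k, c) * b * e $$ (r, j)) =
 e $$ (i, k) * e $$ (k, j) - (b * e $$ (r, j)) * (e $$ (i, k) * e $$ (k, c)) - (b * e $$ (i, c)) * (e $$ (r, k) * e $$ (k, j)) +
 (b * b * e $$ (i, c) * e $$ (r, j)) * (e $$ (r, k) * e $$ (k, c))" for k
 by (simp add: algebra_simps)
 have "(e' * e') $$ (i, j) = (\<Sum>k<?N. (e $$ (i, k) - e $$ (i, c) * b * e $$ (r, k)) * (e $$ (k, j) - e $$ (k, c) * b * e $$ (r, j)))"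
 using ij dd by (simp add: mult_entry e'_def del: index_mult_mat(1))
 also have "... = e $$ (i, j) - (b * e $$ (r, j)) * e $$ (i, c) - (b * e $$ (i, c)) * e $$ (r, j) + (b * b * e $$ (i, c) * e $$ (r, j)) * e $$ (r, c)"
 unfolding t using ij r c by (simp only: sum.distrib sum_subtractf sum_distrib_left[symmetric] S)
 also have "(b * b * e $$ (i, c) * e $$ (r, j)) * e $$ (r, c) = (b * e $$ (r, c)) * (b * e $$ (i, c) * e $$ (r, j))" by (simp only: mult_ac)
 finally show "(e' * e') $$ (i, j) = e' $$ (i, j)" using ij by (simp add: ba e'_def mult_ac)
 qed (simp_all add: dd)
 have "card {c. c < ?N & (\<exists>r<?N. e' $$ (r, c) ~= 0)} < card {c. c < ?N & (\<exists>r<?N. e $$ (r, c) ~= 0)}"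
 proof (rule psubset_card_mono)
 have "e' $$ (i, c) = 0" if "i < ?N" for i using that c ba by (simp add: e'_def mult.assoc)
 moreover have "e $$ (i, j) ~= 0 \<or> e $$ (r, j) ~= 0" if "e' $$ (i, j) ~= 0" "i < ?N" "j < ?N" for i j
 using that by (auto simp: e'_def)
 ultimately show "{c. c < ?N & (\<exists>r<?N. e' $$ (r, c) ~= 0)} \<subset> {c. c < ?N & (\<exists>r<?N. e $$ (r, c) ~= 0)}"
 using r c a by blast
 qed simp
 from less(1)[OF this e'g e'e'] obtain W' u' v' where u': "u' \<in> grhom W' V" and v': "v' \<in> grhom V W'"
 and vu: "v' * u' = idm W'" and uv: "u' * v' = e'" by blast
 note d' = grhom_dims[OF u'] grhom_dims[OF v']
 let ?m = "len W'"
 have ye: "y * e' = 0\<^sub>m 1 ?N"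
 proof (rule eq_matI)
 fix i j assume "i < drow (0\<^sub>m 1 ?N :: 'k mat)" "j < dcol (0\<^sub>m 1 ?N :: 'k mat)"
 then have ij: "i = 0" "j < ?N" by simp_all
 have t: "b * e $$ (r, k) * (e $$ (k, j) - e $$ (k, c) * b * e $$ (r, j)) =
 b * (e $$ (r, k) * e $$ (k, j)) - (b * b * e $$ (r, j)) * (e $$ (r, k) * e $$ (k, c))" for k by (simp add: algebra_simps)
 have "(y * e') $$ (i, j) = (\<Sum>k<?N. b * e $$ (r, k) * (e $$ (k, j) - e $$ (k, c) * b * e $$ (r, j)))"
 using ij dd by (simp add: mult_entry e'_def y_def del: index_mult_mat(1))
 also have "... = b * e $$ (r, j) - (b * b * e $$ (r, j)) * e $$ (r, c)"
 unfolding t using ij r c by (simp only: sum_subtractf sum_distrib_left[symmetric] S)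
 also have "... = b * e $$ (r, j) - (b * e $$ (r, c)) * (b * e $$ (r, j))" by (simp only: mult_ac)
 finally show "(y * e') $$ (i, j) = 0\<^sub>m 1 ?N $$ (i, j)" using ij by (simp add: ba)
 qed (simp_all add: dd)
 have ex: "e' * x = 0\<^sub>m ?N 1"
 proof (rule eq_matI)
 fix i j assume "i < drow (0\<^sub>m ?N 1 :: 'k mat)" "j < dcol (0\<^sub>m ?N 1 :: 'k mat)"
 then have ij: "i < ?N" "j = 0" by simp_all
 have t: "(e $$ (i, k) - e $$ (i, c) * b * e $$ (r, k)) * e $$ (k, c) =
 e $$ (i, k) * e $$ (k, c) - (e $$ (i, c) * b) * (e $$ (r, k) * e $$ (k, c))" for k by (simp add: algebra_simps)
 have "(e' * x) $$ (i, j) = (\<Sum>k<?N. (e $$ (i, k) - e $$ (i, c) * b * e $$ (r, k)) * e $$ (k, c))"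
 using ij dd by (simp add: mult_entry e'_def x_def del: index_mult_mat(1))
 also have "... = e $$ (i, c) - (e $$ (i, c) * b) * e $$ (r, c)"
 unfolding t using ij r c by (simp only: sum_subtractf sum_distrib_left[symmetric] S)
 also have "... = e $$ (i, c) - e $$ (i, c) * (b * e $$ (r, c))" by (simp only: mult_ac)
 finally show "(e' * x) $$ (i, j) = 0\<^sub>m ?N 1 $$ (i, j)" using ij by (simp add: ba)
 qed (simp_all add: dd)
 have eu: "e' * u' = u'" unfolding uv[symmetric] using d' vu by (simp add: mat_assoc)
 have "y * u' = y * (e' * u')" by (simp only: eu)
 also have "... = y * e' * u'" by (rule mat_assoc[symmetric]) (use dd d' in simp_all)
 finally have yu: "y * u' = 0\<^sub>m 1 ?m" unfolding ye using d' by simp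
 have ve: "v' * e' = v'" unfolding uv[symmetric] using d' vu by (simp add: mat_assoc[symmetric])
 have "v' * x = v' * e' * x" by (simp only: ve)
 also have "... = v' * (e' * x)" by (rule mat_assoc) (use dd d' in simp_all)
 finally have vx: "v' * x = 0\<^sub>m ?m 1" unfolding ex using d' by simp
 \<comment> \<open>The new basis vector is the column c of e, homogeneous of degree
   \<open>V ! c\<close>.\<close>
 let ?W = "V ! c # W'"
 define u where "u = mat ?N (Suc ?m) (%(i, k). case k of 0 \<Rightarrow> e $$ (i, c) | Suc k' \<Rightarrow> u' $$ (i, k'))"
 define v where "v = mat (Suc ?m) ?N (%(k, j). case k of 0 \<Rightarrow> b * e $$ (r, j) | Suc k' \<Rightarrow> v' $$ (k', j))"
 have ud: "drow u = ?N" "dcol u = Suc ?m" "drow v = Suc ?m" "dcol v = ?N" by (simp_all add: u_def v_def)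
 have "u \<in> grhom ?W V"
 proof (rule grhomI)
 fix i k assume "i < ?N" "k < len ?W" "u $$ (i, k) ~= 0"
 then show "V ! i = ?W ! k"
 using grhom_degree[OF eg, of i c] grhom_degree[OF u', of i] c by (cases k) (auto simp: u_def)
 qed (simp_all add: ud)
 moreover have "v \<in> grhom V ?W"
 proof (rule grhomI)
 fix k j assume "k < len ?W" "j < ?N" "v $$ (k, j) ~= 0"
 then show "?W ! k = V ! j"
 using grhom_degree[OF eg, of r j] grhom_degree[OF v', of _ j] r deg by (cases k) (auto simp: v_def)
 qed (simp_all add: ud)
 moreover have "u * v = e"
 proof (rule eq_matI)
 fix i j assume "i < drow e" "j < dcol e"
 then have ij: "i < ?N" "j < ?N" using d by simp_all
 have "(u * v) $$ (i, j) = e $$ (i, c) * (b * e $$ (r, j)) + (\<Sum>k<?m. u' $$ (i, k) * v' $$ (k, j))"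
 using ij ud by (simp add: mult_entry sum.lessThan_Suc_shift u_def v_def del: index_mult_mat(1) sum.lessThan_Suc)
 also have "(\<Sum>k<?m. u' $$ (i, k) * v' $$ (k, j)) = e' $$ (i, j)"
 unfolding uv[symmetric] using ij d' by (simp add: mult_entry del: index_mult_mat(1))
 finally show "(u * v) $$ (i, j) = e $$ (i, j)" using ij by (simp add: e'_def mult.assoc)
 qed (use d ud in simp_all)
 moreover have "v * u = idm ?W"
 proof (rule eq_matI)
 fix k l assume "k < drow (idm ?W :: 'k mat)" "l < dcol (idm ?W :: 'k mat)"
 then have kl: "k < Suc ?m" "l < Suc ?m" by simp_all
 have e0: "(v * u) $$ (k, l) = (\<Sum>i<?N. v $$ (k, i) * u $$ (i, l))"
 using kl ud by (simp add: mult_entry del: index_mult_mat(1))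
 show "(v * u) $$ (k, l) = idm ?W $$ (k, l)"
 proof (cases k)
 case 0
 show ?thesis
 proof (cases l)
 case l: 0
 have "(\<Sum>i<?N. b * e $$ (r, i) * e $$ (i, c)) = b * e $$ (r, c)"
 using S[OF r c] by (simp add: mult.assoc sum_distrib_left[symmetric])
 then show ?thesis unfolding e0 using 0 l ba by (simp add: u_def v_def)
 next
 case (Suc l')
 then have "(\<Sum>i<?N. b * e $$ (r, i) * u' $$ (i, l')) = (y * u') $$ (0, l')"
 using kl dd d' by (simp add: mult_entry y_def del: index_mult_mat(1))
 then show ?thesis unfolding e0 using 0 Suc kl by (simp add: u_def v_def yu del: index_mult_mat(1))
 qed
 next
 case (Suc k')
 show ?thesis
 proof (cases l)
 case 0
 have "(\<Sum>i<?N. v' $$ (k', i) * e $$ (i, c)) = (v' * x) $$ (k', 0)"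
 using kl Suc dd d' by (simp add: mult_entry x_def del: index_mult_mat(1))
 then show ?thesis unfolding e0 using 0 Suc kl by (simp add: u_def v_def vx del: index_mult_mat(1))
 next
 case l: (Suc l')
 then have "(\<Sum>i<?N. v' $$ (k', i) * u' $$ (i, l')) = (v' * u') $$ (k', l')"
 using kl Suc d' by (simp add: mult_entry del: index_mult_mat(1))
 then show ?thesis unfolding e0 using l Suc kl by (simp add: u_def v_def vu del: index_mult_mat(1))
 qed
 qed
 qed (simp_all add: ud)
 ultimately show ?thesis by blast
 qed
qed

text \<open>The scalar f on each homogeneous component. Graded maps commute with it, and for
  multiplicative f it is compatible with tensor products.\<close>

definition dg :: "'g list \<Rightarrow> ('g \<Rightarrow> 'k) \<Rightarrow> 'k::field mat" where
 "dg V f = mat (len V) (len V) (%(i, j). if i = j then f (V ! i) else 0)"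

lemma dg_dims[simp]: "drow (dg V f) = len V" "dcol (dg V f) = len V"
 by (simp_all add: dg_def)

lemma ap_dg: "i < len V ==> ap (dg V f) i F = f (V ! i) * F i"
 unfolding dg_def by (rule ap_mat_diag)

lemma dg_grhom: "dg V f \<in> grhom V V"
 by (rule grhomI) (auto simp: dg_def split: if_splits)

lemma dg_commute:
 assumes "h \<in> grhom V W"
 shows "h * dg V f = dg W f * h"
proof (rule ap_eqI)
 note d = grhom_dims[OF assms]
 fix c F assume "c < dcol (dg W f * h)"
 then have c: "c < len V" using d by simp
 have "ap (dg W f * h) c F = ap h c (%k. f (W ! k) * F k)" using c d by (simp add: ap_dg)
 also have "... = ap h c (%k. f (V ! c) * F k)" by (rule ap_grhom_cong[OF assms c]) simp
 finally show "ap (h * dg V f) c F = ap (dg W f * h) c F" using c d by (simp add: ap_dg ap_scale)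
qed (use grhom_dims[OF assms] in simp_all)

lemma dg_tensor:
 assumes "!!x y. f (x + y) = f x * f y"
 shows "dg (V <&> W) f = dg V f <*> dg W f"
proof (rule kron_ap_eqI[of _ _ "len V" "len W"])
 fix i j F assume ij: "i < len V" "j < len W"
 have "ap (dg (V <&> W) f) (ix (len W) i j) F = f (V ! i + W ! j) * F (ix (len W) i j)"
 using ij ap_dg[of "ix (len W) i j" "V <&> W" f F] by simp
 then show "ap (dg (V <&> W) f) (ix (len W) i j) F = ap (dg V f <*> dg W f) (ix (len W) i j) F"
 using ij by (simp add: ap_kron ap_dg assms)
qed simp_all

lemma dg_mult: "dg V f * dg V h = dg V (%x. f x * h x)"
 by (rule ap_eqI) (simp_all add: ap_dg mult_ac)

lemma one_smult_mat: "1 \<cdot>\<^sub>m M = (M :: 'k::field mat)"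
 by (rule eq_matI) simp_all

lemma dg_const: "dg V (%x. a) = a \<cdot>\<^sub>m idm V"
 by (rule eq_matI) (auto simp: dg_def)

section \<open>The endomorphisms of an object of HH coming from one-dimensional trivial
  modules\<close>

context braided_hopf
begin

abbreviation "pt y \<equiv> ([y], hcounit H)"

lemma tensor_action_point_right:
 assumes "act_on V rh"
 shows "tensor_action ch H V rh [y] (hcounit H) = rh"
proof (rule kron_ap_eqI[of _ _ n "len V"])
 note d = act_dims[OF assms] act_dims[OF act_point[of y]]
 fix h i F assume h: "h < n" and i: "i < len V"
 have "ap (tensor_action ch H V rh [y] (hcounit H)) (ix (len V) h i) F =
 dl h (%h1 h2. ch (g h2) (V ! i) * ap rh (ix (len V) h1 i) (%j. ep h2 * F j))"
 using ap_tensor_action[OF d h i, of 0 F] by simp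
 also have "... = dl h (%h1 h2. ep h2 * ap rh (ix (len V) h1 i) F)"
 proof (rule sc_weak_cong; simp only: ap_scale)
 fix h1 h2 assume h2: "h2 < n"
 have "ep h2 * (ch (g h2) (V ! i) * ap rh (ix (len V) h1 i) F) = ep h2 * ap rh (ix (len V) h1 i) F"
 by (rule ep_cong[OF h2]) (simp add: chi)
 then show "ch (g h2) (V ! i) * (ep h2 * ap rh (ix (len V) h1 i) F) = ep h2 * ap rh (ix (len V) h1 i) F"
 by (simp only: mult.left_commute)
 qed
 also have "... = ap rh (ix (len V) h i) F" by (rule dl_ep[OF h])
 finally show "ap (tensor_action ch H V rh [y] (hcounit H)) (ix (len V) h i) F = ap rh (ix (len V) h i) F" .
qed (use act_dims[OF assms] tensor_dims[OF act_dims[OF assms] act_dims[OF act_point[of y]]] in simp_all)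

text \<open>Here H is braided past k_y before it acts on V, which leaves the character \<chi>(-, y).
  On the right of V nothing is crossed that matters, as the counit lives in degree 0.\<close>

lemma tensor_action_point_left:
 assumes "act_on V rh"
 shows "tensor_action ch H [y] (hcounit H) V rh = rh * (dg A (%a. ch a y) <*> idm V)"
proof (rule kron_ap_eqI[of _ _ n "len V"])
 note d = act_dims[OF act_point[of y]] act_dims[OF assms]
 fix h i F assume h: "h < n" and i: "i < len V"
 have "ap (tensor_action ch H [y] (hcounit H) V rh) (ix (len V) h i) F =
 dl h (%h1 h2. ch (g h2) y * (ep h1 * ap rh (ix (len V) h2 i) F))"
 using ap_tensor_action[OF d h _ i, of 0 F] by simp
 also have "... = dl h (%h1 h2. ep h1 * (ch (g h2) y * ap rh (ix (len V) h2 i) F))" by (simp only: mult.left_commute)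
 also have "... = ch (g h) y * ap rh (ix (len V) h i) F" by (rule ep_dl[OF h])
 finally show "ap (tensor_action ch H [y] (hcounit H) V rh) (ix (len V) h i) F =
 ap (rh * (dg A (%a. ch a y) <*> idm V)) (ix (len V) h i) F"
 using h i d by (simp add: ap_kron ap_dg)
qed (use act_dims[OF assms] tensor_dims[OF act_dims[OF act_point[of y]] act_dims[OF assms]] in simp_all)

text \<open>The half-braiding with k_y is linear only up to the twist of the action by the character
  \<chi>(-, y) from \<open>tensor_action_point_left\<close>; the diagonal factor undoes this twist
  and yields an endomorphism.\<close>

definition loop :: "('g list \<times> 'k mat \<Rightarrow> 'k mat) \<Rightarrow> 'g list \<Rightarrow> 'g \<Rightarrow> 'k mat" where
 "loop t V y = t (pt y) * dg V (%x. inverse (ch x y))"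

lemma inv_char: "inverse (ch (x + x') y) = inverse (ch x y) * inverse (ch x' y)"
 by (simp add: chi)

lemma HH_point:
 assumes M: "((V, rh), t) \<in> Obj (HH C)"
 shows "t (pt y) \<in> grhom V V" "unit_mat (t (pt y))" "drow (t (pt y)) = len V" "dcol (t (pt y)) = len V"
 "t (pt y) * rh = rh * (dg A (%a. ch a y) <*> idm V) * (idm A <*> t (pt y))"
proof -
 note a = HH_arrow[OF M act_point[of y]]
 show u: "unit_mat (t (pt y))" and d: "drow (t (pt y)) = len V" "dcol (t (pt y)) = len V" using a by simp_all
 show "t (pt y) \<in> grhom V V"
 proof (rule grhomI[OF d])
 fix i j assume ij: "i < len V" "j < len V" and nz: "t (pt y) $$ (i, j) ~= 0"
 have "([y] <&> V) ! i = (V <&> [y]) ! j"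
 by (rule grhom_degree[OF HH_arrow_grhom[OF M act_point] nz]) (use ij in simp_all)
 then show "V ! i = V ! j" using ij nth_grtensor[of 0 "[y]" i V] nth_grtensor[of j V 0 "[y]"] by (simp add: add.commute)
 qed
 show "t (pt y) * rh = rh * (dg A (%a. ch a y) <*> idm V) * (idm A <*> t (pt y))"
 using a(4) by (simp add: tw_unit tensor_action_point_left[OF HH_act[OF M]] tensor_action_point_right[OF HH_act[OF M]])
qed

lemma loop_grhom:
 assumes "((V, rh), t) \<in> Obj (HH C)"
 shows "loop t V y \<in> grhom V V" "drow (loop t V y) = len V" "dcol (loop t V y) = len V"
 using grhom_mult[OF HH_point(1)[OF assms] dg_grhom] HH_point(3)[OF assms] by (simp_all add: loop_def)

lemma act_dg:
 assumes V: "act_on V rh" and f: "!!x x'. f (x + x') = f x * f x'"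
 shows "dg V f * rh = rh * (dg A f <*> dg V f)"
 using dg_commute[OF act_grhom[OF V], of f] by (simp add: dg_tensor f)

lemma dg_inverse: "dg V (%a. ch a y) * dg V (%a. inverse (ch a y)) = idm V"
 "dg V (%a. inverse (ch a y)) * dg V (%a. ch a y) = idm V"
 unfolding dg_mult by (rule eq_matI; auto simp: dg_def chi)+

text \<open>Compatibility with the half-braiding at U compares the tensor axiom at k_y \<otimes> U
  with that at U \<otimes> k_y, by naturality along the isomorphism between these two
  modules.\<close>

lemma loop_End:
 assumes M: "((V, rh), t) \<in> Obj (HH C)"
 shows "loop t V y \<in> Hom (HH C) ((V, rh), t) ((V, rh), t)"
proof (rule HH_HomI[OF loop_grhom(1)[OF M]])
 let ?D = "dg V (%x. inverse (ch x y))" and ?F = "dg A (%x. inverse (ch x y))" and ?G = "dg A (%a. ch a y)"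
 note V = HH_act[OF M] and tp = HH_point[OF M, of y]
 note d = tp(3,4) act_dims[OF V]
 have 1: "?D * rh = rh * (?F <*> ?D)" by (rule act_dg[OF V inv_char])
 have "loop t V y * rh = t (pt y) * (?D * rh)" using d by (simp add: loop_def mat_assoc)
 also have "... = t (pt y) * rh * (?F <*> ?D)" unfolding 1 using d by (simp add: mat_assoc)
 also have "... = rh * ((?G <*> idm V) * (idm A <*> t (pt y)) * (?F <*> ?D))" unfolding tp(5) using d by (simp add: mat_assoc)
 also have "(?G <*> idm V) * (idm A <*> t (pt y)) * (?F <*> ?D) = idm A <*> loop t V y"
 using d by (simp add: kron_mult dg_inverse loop_def)
 finally show "loop t V y * rh = rh * (idm A <*> loop t V y)" .
 fix U ta assume U: "act_on U ta"
 let ?E = "dg U (%x. inverse (ch x y))" and ?Ei = "dg U (%x. ch x y)" and ?t = "t (U, ta)" and ?u = "idm U" and ?v = "idm V"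
 note e = d HH_arrow(2,3)[OF M U] act_dims[OF U]
 have yU: "([y] <&> U, tensor_action ch H [y] (hcounit H) U ta) \<in> Obj C" and Uy: "(U <&> [y], tensor_action ch H U ta [y] (hcounit H)) \<in> Obj C"
 using act_tensor[OF act_point U] act_tensor[OF U act_point] by simp_all
 \<comment> \<open>\<open>?E\<close> is that isomorphism from k_y \<otimes> U to U \<otimes> k_y: it
   undoes the character twist on the source.\<close>
 have "?E \<in> grhom ([y] <&> U) (U <&> [y])"
 proof (rule grhomI)
 fix i j assume ij: "i < len (U <&> [y])" "j < len ([y] <&> U)" and nz: "?E $$ (i, j) ~= 0"
 then have "i = j" by (auto simp: dg_def split: if_splits)
 then show "(U <&> [y]) ! i = ([y] <&> U) ! j" using ij nth_grtensor[of 0 "[y]" j U] nth_grtensor[of i U 0 "[y]"] by (simp add: add.commute)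
 qed simp_all
 moreover have "?E * (ta * (?G <*> ?u)) = ta * (idm A <*> ?E)"
 proof -
 have "?E * (ta * (?G <*> ?u)) = ta * ((?F <*> ?E) * (?G <*> ?u))"
 by (rule assoc_swap[OF act_dg[OF U inv_char]]) (use e in simp_all)
 then show ?thesis by (simp add: kron_mult dg_inverse)
 qed
 ultimately have E: "?E \<in> Hom C ([y] <&> U, tensor_action ch H [y] (hcounit H) U ta) (U <&> [y], tensor_action ch H U ta [y] (hcounit H))"
 by (simp add: tensor_action_point_left[OF U] tensor_action_point_right[OF U])
 have nat: "\<forall>X\<in>Obj C. \<forall>Y\<in>Obj C. \<forall>f\<in>Hom C X Y. t Y * (Idn C (V, rh) <*> f) = (f <*> Idn C (V, rh)) * t X"
 and ten: "\<forall>X\<in>Obj C. \<forall>Y\<in>Obj C. t (tenO C X Y) = (Idn C (tw P X) <*> t Y) * (t X <*> Idn C Y)"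
 using M unfolding HH_Obj by blast+
 have P1: "pt y \<in> Obj C" and U1: "(U, ta) \<in> Obj C" using act_point U by simp_all
 have "t (U <&> [y], tensor_action ch H U ta [y] (hcounit H)) = (?u <*> t (pt y)) * ?t"
 using ten[rule_format, OF U1 P1] by simp
 moreover have "t ([y] <&> U, tensor_action ch H [y] (hcounit H) U ta) = ?t * (t (pt y) <*> ?u)"
 using ten[rule_format, OF P1 U1] by simp
 ultimately have n: "(?u <*> t (pt y)) * ?t * (?v <*> ?E) = (?E <*> ?v) * (?t * (t (pt y) <*> ?u))"
 using nat[rule_format, OF yU Uy E] by simp
 have c: "?t * (?D <*> ?E) = (?E <*> ?D) * ?t"
 using dg_commute[OF HH_arrow_grhom[OF M U], of "%x. inverse (ch x y)"] by (simp only: dg_tensor[OF inv_char])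
 have k1: "(?Ei <*> ?v) * (?E <*> ?v) = 1\<^sub>m (len U * len V)" by (simp add: kron_mult dg_inverse)
 have "?t * (loop t V y <*> ?u) = 1\<^sub>m (len U * len V) * (?t * (t (pt y) <*> ?u)) * (?D <*> ?u)"
 using e by (simp add: loop_def mat_assoc kron_mult)
 also have "... = (?Ei <*> ?v) * ((?E <*> ?v) * (?t * (t (pt y) <*> ?u))) * (?D <*> ?u)"
 unfolding k1[symmetric] using e by (simp add: mat_assoc)
 also have "... = (?Ei <*> ?v) * ((?u <*> t (pt y)) * ?t * (?v <*> ?E)) * (?D <*> ?u)" by (simp only: n)
 also have "... = (?Ei <*> ?v) * ((?u <*> t (pt y)) * (?t * ((?v <*> ?E) * (?D <*> ?u))))" using e by (simp add: mat_assoc)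
 also have "(?v <*> ?E) * (?D <*> ?u) = ?D <*> ?E" by (simp add: kron_mult)
 also have "(?Ei <*> ?v) * ((?u <*> t (pt y)) * (?t * (?D <*> ?E))) = (?Ei <*> ?v) * (?u <*> t (pt y)) * (?E <*> ?D) * ?t"
 unfolding c using e by (simp add: mat_assoc)
 also have "(?Ei <*> ?v) * (?u <*> t (pt y)) * (?E <*> ?D) = ?u <*> loop t V y"
 using e by (simp add: kron_mult dg_inverse loop_def)
 finally show "?t * (loop t V y <*> ?u) = (?u <*> loop t V y) * ?t" .
qed

text \<open>The tensor axiom, since k_y \<otimes> k_z is the trivial module of degree y + z.\<close>

lemma loop_add:
 assumes M: "((V, rh), t) \<in> Obj (HH C)"
 shows "loop t V (y + z) = loop t V z * loop t V y"
proof -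
 have P1: "pt y \<in> Obj C" "pt z \<in> Obj C" using act_point by simp_all
 have "\<forall>X\<in>Obj C. \<forall>Y\<in>Obj C. t (tenO C X Y) = (Idn C (tw P X) <*> t Y) * (t X <*> Idn C Y)"
 using M unfolding HH_Obj by blast
 from this[rule_format, OF P1] have "t ([y] <&> [z], tensor_action ch H [y] (hcounit H) [z] (hcounit H)) = t (pt z) * t (pt y)" by simp
 then have t: "t (pt (y + z)) = t (pt z) * t (pt y)"
 unfolding tensor_action_point_right[OF act_point] by (simp add: grtensor_def)
 let ?D = "%y. dg V (%x. inverse (ch x y))"
 have D: "?D (y + z) = ?D z * ?D y" unfolding dg_mult by (simp add: chi mult.commute)
 note d = HH_point(3,4)[OF M]
 have c: "t (pt y) * ?D z = ?D z * t (pt y)" by (rule dg_commute[OF HH_point(1)[OF M]])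
 have "loop t V (y + z) = t (pt z) * (t (pt y) * (?D z * ?D y))" unfolding loop_def t D using d by (simp add: mat_assoc)
 also have "t (pt y) * (?D z * ?D y) = ?D z * (t (pt y) * ?D y)" by (rule assoc_swap[OF c]) (use d in simp_all)
 finally show ?thesis unfolding loop_def using d by (simp add: mat_assoc)
qed

lemma loop_zero:
 assumes M: "((V, rh), t) \<in> Obj (HH C)"
 shows "loop t V 0 = idm V"
proof -
 have "t ([0], hcounit H) = idm V" using M unfolding HH_Obj by simp
 then show ?thesis unfolding loop_def by (simp add: chi dg_const one_smult_mat)
qed

lemma loop_natural:
 assumes M: "((V, rh), t) \<in> Obj (HH C)" and N: "((W, sg), u) \<in> Obj (HH C)" and f: "f \<in> Hom (HH C) ((V, rh), t) ((W, sg), u)"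
 shows "loop u W y * f = f * loop t V y"
proof -
 note F = HH_HomD[OF f]
 note d = grhom_dims[OF F(1)] HH_point(3,4)[OF M] HH_point(3,4)[OF N]
 have 1: "u (pt y) * f = f * t (pt y)" using F(4)[OF act_point[of y]] by simp
 have "loop u W y * f = u (pt y) * (dg W (%x. inverse (ch x y)) * f)" using d by (simp add: loop_def mat_assoc)
 also have "... = u (pt y) * (f * dg V (%x. inverse (ch x y)))" by (simp only: dg_commute[OF F(1)])
 also have "... = f * (t (pt y) * dg V (%x. inverse (ch x y)))" by (rule assoc_swap[OF 1]) (use d in simp_all)
 finally show ?thesis by (simp add: loop_def)
qed

text \<open>Removing the braiding with k_y from both descriptions leaves the scalar: the types are
  the characters through which the loops act.\<close>

lemma has_type_loop:
 assumes M: "((V, rh), t) \<in> Obj (HH C)"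
 shows "has_type x V t \<longleftrightarrow> (\<forall>y. loop t V y = om x y \<cdot>\<^sub>m idm V)"
proof -
 have "minv (t (pt y)) = ubr x [y] V \<longleftrightarrow> loop t V y = om x y \<cdot>\<^sub>m idm V" for y
 proof -
 define D where "D = dg V (%m. om x y * ch m y)"
 define I where "I = dg V (%m. inverse (om x y * ch m y))"
 have u: "ubr x [y] V = I" unfolding I_def
 by (rule ap_eqI) (use ap_ubr[of 0 "[y]" _ V x] in \<open>simp_all add: ap_dg\<close>)
 have nz: "om x y * ch m y ~= 0" for m using om_simps(1) chi(1) by simp
 have DI: "D * I = idm V" "I * D = idm V"
 unfolding dg_mult D_def I_def by (simp_all only: right_inverse[OF nz] left_inverse[OF nz] dg_const one_smult_mat)
 have DIm: "drow D = len V" "dcol D = len V" "drow I = len V" "dcol I = len V"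
 by (simp_all add: D_def I_def)
 have m: "minv I = D" "minv D = I" by (rule minv_eqI; simp add: DI DIm)+
 note d = HH_point(3,4)[OF M, of y]
 have l1: "loop t V y = om x y \<cdot>\<^sub>m idm V" if "t (pt y) = D"
 unfolding loop_def that D_def dg_mult dg_const[symmetric] by (rule arg_cong[of _ _ "dg V"]) (simp add: chi fun_eq_iff)
 have l2: "t (pt y) = D" if l: "loop t V y = om x y \<cdot>\<^sub>m idm V"
 proof -
 have "t (pt y) = loop t V y * dg V (%x. ch x y)" using d by (simp add: loop_def mat_assoc dg_inverse)
 also have "... = D" unfolding l D_def dg_const[symmetric] dg_mult ..
 finally show ?thesis .
 qed
 have "minv (t (pt y)) = I \<longleftrightarrow> t (pt y) = D"
 proof
 assume "minv (t (pt y)) = I"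
 then have "minv (minv (t (pt y))) = D" by (simp only: m)
 then show "t (pt y) = D" by (simp only: minv_minv[OF HH_point(2)[OF M, of y]])
 qed (simp only: m)
 then show ?thesis unfolding u using l1 l2 by blast
 qed
 then show ?thesis by (simp add: has_type_def)
qed

text \<open>An arrow commutes with the loops, so it intertwines two different scalars and
  vanishes.\<close>

lemma HH_Hom_types:
 assumes M: "((V, rh), t) \<in> Obj (HH C)" and N: "((W, sg), u) \<in> Obj (HH C)" and f: "f \<in> Hom (HH C) ((V, rh), t) ((W, sg), u)"
 and x: "has_type x V t" and x': "has_type x' W u" and ne: "om x y ~= om x' y"
 shows "f = 0\<^sub>m (len W) (len V)"
proof (rule eq_matI)
 note d = grhom_dims[OF HH_HomD(1)[OF f]]
 have fc: "f \<in> carrier_mat (len W) (len V)" by (rule carrier_matI[OF d])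
 have "om x' y \<cdot>\<^sub>m f = (om x' y \<cdot>\<^sub>m idm W) * f"
 using mult_smult_assoc_mat[OF one_carrier_mat fc] left_mult_one_mat[OF fc] by (simp only:)
 also have "... = loop u W y * f" using x' unfolding has_type_loop[OF N] by (simp only:)
 also have "... = f * loop t V y" by (rule loop_natural[OF M N f])
 also have "... = f * (om x y \<cdot>\<^sub>m idm V)" using x unfolding has_type_loop[OF M] by (simp only:)
 also have "... = om x y \<cdot>\<^sub>m f"
 using mult_smult_distrib[OF fc one_carrier_mat] right_mult_one_mat[OF fc] by (simp only:)
 finally have "om x' y \<cdot>\<^sub>m f = om x y \<cdot>\<^sub>m f" .
 note eq = this
 fix i j assume "i < drow (0\<^sub>m (len W) (len V) :: 'k mat)" "j < dcol (0\<^sub>m (len W) (len V) :: 'k mat)"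
 then have ij: "i < len W" "j < len V" by simp_all
 have "om x' y * f $$ (i, j) = om x y * f $$ (i, j)"
 using arg_cong[OF eq, of "%M. M $$ (i, j)"] ij d by simp
 then show "f $$ (i, j) = 0\<^sub>m (len W) (len V) $$ (i, j)" using ij ne by simp
qed (use grhom_dims[OF HH_HomD(1)[OF f]] in simp_all)

end

section \<open>Isotypic projections and summands of a given type\<close>

locale nondegenerate = braided_hopf ch H
 for ch :: "'g::{finite, ab_group_add} \<Rightarrow> 'g \<Rightarrow> 'k::field_char_0" and H +
 assumes nondeg: "inj (%x y. ch x y * ch y x)"
begin

lemma om_separates: "x ~= x' ==> \<exists>y. om x y ~= om x' y"
proof (rule ccontr)
 assume ne: "x ~= x'" and "\<nexists>y. om x y ~= om x' y"
 then have "(%y. ch x y * ch y x) = (%y. ch x' y * ch y x')" by (simp add: om_def fun_eq_iff)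
 with ne show False using injD[OF nondeg, of x x'] by simp
qed

lemma om_commute: "om x y = om y x"
 by (simp add: om_def mult.commute)

text \<open>Orthogonality of characters. For y different from 0, nondegeneracy gives z with
  \<open>om z y\<close> different from 1, and translating the summation by z multiplies the sum by
  the inverse of that value.\<close>

lemma sum_om: "(\<Sum>x\<in>UNIV. inverse (om x y)) = (if y = 0 then (of_nat (card (UNIV :: 'g set)) :: 'k) else 0)"
proof (cases "y = 0")
 case True
 then show ?thesis by (simp add: om_simps)
next
 case False
 then obtain z where z: "om z y ~= 1" using om_separates[of y 0] by (auto simp: om_simps om_commute[of y])
 let ?S = "\<Sum>x\<in>UNIV. inverse (om x y)"
 have "?S = (\<Sum>x\<in>UNIV. inverse (om (z + x) y))"
 by (rule sum.reindex_bij_witness[of _ "%x. z + x" "%x. x - z"]) auto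
 also have "... = inverse (om z y) * ?S" by (simp add: om_simps sum_distrib_left)
 finally have fin: "?S = inverse (om z y) * ?S" .
 have "om z y * ?S = om z y * (inverse (om z y) * ?S)" by (rule arg_cong[OF fin])
 also have "... = ?S" using om_simps(1)[of z y] by simp
 finally have "(om z y - 1) * ?S = 0" by (simp add: algebra_simps)
 then show ?thesis using z False by simp
qed

context
 fixes V rh t assumes M: "((V, rh), t) \<in> Obj (HH C)"
begin

abbreviation "T y \<equiv> loop t V y"

lemma T_carrier: "T y \<in> carrier_mat (len V) (len V)"
 by (rule carrier_matI) (use loop_grhom[OF M] in simp_all)

text \<open>The projection onto the isotypic component of the character \<open>om x\<close>. The
  order of G is invertible because k has characteristic 0.\<close>

definition proj :: "'g \<Rightarrow> 'k mat" where
 "proj x = inverse (of_nat (card (UNIV :: 'g set)) :: 'k) \<cdot>\<^sub>m msum (len V) (len V) (%y. inverse (om x y) \<cdot>\<^sub>m T y) UNIV"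

lemma proj_dims[simp]: "drow (proj x) = len V" "dcol (proj x) = len V"
 by (simp_all add: proj_def)

lemma proj_End: "proj x \<in> Hom (HH C) ((V, rh), t) ((V, rh), t)"
proof -
 interpret HH: mat_category "HH C" dmH by (rule HH_mat_category)
 have "msum (len V) (len V) (%y. inverse (om x y) \<cdot>\<^sub>m T y) UNIV \<in> Hom (HH C) ((V, rh), t) ((V, rh), t)"
 using HH.msum_Hom[OF M M finite, of "UNIV :: 'g set" "%y. inverse (om x y) \<cdot>\<^sub>m T y"] HH_smult_Hom[OF M M loop_End[OF M]] by simp
 then show ?thesis unfolding proj_def by (rule HH_smult_Hom[OF M M])
qed

lemma proj_index: "i < len V ==> j < len V ==> proj x $$ (i, j) = inverse (of_nat (card (UNIV :: 'g set)) :: 'k) * (\<Sum>y\<in>UNIV. inverse (om x y) * T y $$ (i, j))"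
 using loop_grhom[OF M] by (simp add: proj_def)

text \<open>Translation of the summation index by z.\<close>

lemma T_proj: "T z * proj x = om x z \<cdot>\<^sub>m proj x"
proof (rule eq_matI)
 fix i j assume "i < drow (om x z \<cdot>\<^sub>m proj x)" "j < dcol (om x z \<cdot>\<^sub>m proj x)"
 then have ij: "i < len V" "j < len V" by simp_all
 note d = loop_grhom(2,3)[OF M]
 have "T z * proj x = inverse (of_nat (card (UNIV :: 'g set)) :: 'k) \<cdot>\<^sub>m (T z * msum (len V) (len V) (%y. inverse (om x y) \<cdot>\<^sub>m T y) UNIV)"
 unfolding proj_def by (rule mult_smult_distrib[OF T_carrier msum_carrier])
 also have "T z * msum (len V) (len V) (%y. inverse (om x y) \<cdot>\<^sub>m T y) UNIV =
 msum (len V) (len V) (%y. T z * (inverse (om x y) \<cdot>\<^sub>m T y)) UNIV"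
 using msum_mult_right[of UNIV "%y. inverse (om x y) \<cdot>\<^sub>m T y" "len V" "len V" "T z"] T_carrier d by simp
 also have "... = msum (len V) (len V) (%y. inverse (om x y) \<cdot>\<^sub>m T (y + z)) UNIV"
 by (rule msum_cong) (simp only: mult_smult_distrib[OF T_carrier T_carrier] loop_add[OF M])
 finally have "(T z * proj x) $$ (i, j) = inverse (of_nat (card (UNIV :: 'g set)) :: 'k) * (\<Sum>y\<in>UNIV. inverse (om x y) * T (y + z) $$ (i, j))"
 using ij d by simp
 also have "(\<Sum>y\<in>UNIV. inverse (om x y) * T (y + z) $$ (i, j)) = (\<Sum>y\<in>UNIV. inverse (om x (y - z)) * T y $$ (i, j))"
 by (rule sum.reindex_bij_witness[of _ "%y. y - z" "%y. y + z"]) auto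
 also have "... = om x z * (\<Sum>y\<in>UNIV. inverse (om x y) * T y $$ (i, j))"
 proof -
 have "inverse (om x (y - z)) = om x z * inverse (om x y)" for y
 proof -
 have "inverse q = r * inverse (q * r)" if "r ~= 0" for q r :: 'k using that by simp
 from this[OF om_simps(1)[of x z], of "om x (y - z)"] show ?thesis unfolding om_simps(2)[symmetric] diff_add_cancel .
 qed
 then show ?thesis by (simp add: sum_distrib_left mult.assoc)
 qed
 finally show "(T z * proj x) $$ (i, j) = (om x z \<cdot>\<^sub>m proj x) $$ (i, j)"
 using ij by (simp add: proj_index)
qed (use loop_grhom(2,3)[OF M] in simp_all)

text \<open>By \<open>T_proj\<close> each of the averaged terms acts on the image of the projection
  as the identity.\<close>

lemma proj_idem: "proj x * proj x = proj x"
proof -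
 note d = loop_grhom(2,3)[OF M]
 have pc: "proj x \<in> carrier_mat (len V) (len V)" by (rule carrier_matI) simp_all
 have "proj x * proj x = inverse (of_nat (card (UNIV :: 'g set)) :: 'k) \<cdot>\<^sub>m (msum (len V) (len V) (%y. inverse (om x y) \<cdot>\<^sub>m T y) UNIV * proj x)"
 unfolding proj_def[of x, THEN arg_cong, of "%M. M * proj x"] by (rule mult_smult_assoc_mat[OF msum_carrier pc])
 also have "msum (len V) (len V) (%y. inverse (om x y) \<cdot>\<^sub>m T y) UNIV * proj x =
 msum (len V) (len V) (%y. (inverse (om x y) \<cdot>\<^sub>m T y) * proj x) UNIV"
 using msum_mult_left[of UNIV "%y. inverse (om x y) \<cdot>\<^sub>m T y" "len V" "len V" "proj x"] T_carrier by simp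
 also have "... = msum (len V) (len V) (%y. proj x) (UNIV :: 'g set)"
 proof (rule msum_cong)
 fix y :: 'g
 have "(inverse (om x y) \<cdot>\<^sub>m T y) * proj x = inverse (om x y) \<cdot>\<^sub>m (om x y \<cdot>\<^sub>m proj x)"
 unfolding mult_smult_assoc_mat[OF T_carrier pc] T_proj ..
 also have "... = proj x" by (rule eq_matI) (simp_all add: om_simps)
 finally show "(inverse (om x y) \<cdot>\<^sub>m T y) * proj x = proj x" .
 qed
 also have "inverse (of_nat (card (UNIV :: 'g set)) :: 'k) \<cdot>\<^sub>m msum (len V) (len V) (%y. proj x) (UNIV :: 'g set) = proj x"
 by (rule eq_matI) simp_all
 finally show ?thesis .
qed

text \<open>After exchanging the sums, orthogonality leaves only the loop at 0, which is the
  identity.\<close>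

lemma proj_sum: "msum (len V) (len V) proj UNIV = idm V"
proof (rule eq_matI)
 fix i j assume "i < drow (idm V :: 'k mat)" "j < dcol (idm V :: 'k mat)"
 then have ij: "i < len V" "j < len V" by simp_all
 have "msum (len V) (len V) proj UNIV $$ (i, j) = inverse (of_nat (card (UNIV :: 'g set)) :: 'k) * (\<Sum>x\<in>UNIV. \<Sum>y\<in>UNIV. inverse (om x y) * T y $$ (i, j))"
 using ij by (simp add: proj_index sum_distrib_left)
 also have "(\<Sum>x\<in>UNIV. \<Sum>y\<in>UNIV. inverse (om x y) * T y $$ (i, j)) = (\<Sum>y\<in>UNIV. (\<Sum>x\<in>UNIV. inverse (om x y)) * T y $$ (i, j))"
 unfolding sum_distrib_right by (rule sum.swap)
 also have "... = (\<Sum>y\<in>(UNIV :: 'g set). if y = 0 then (of_nat (card (UNIV :: 'g set)) :: 'k) * T 0 $$ (i, j) else 0)" by (rule sum.cong[OF refl]) (simp add: sum_om)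
 also have "... = (of_nat (card (UNIV :: 'g set)) :: 'k) * T 0 $$ (i, j)" by simp
 finally show "msum (len V) (len V) proj UNIV $$ (i, j) = idm V $$ (i, j)"
 using ij by (simp add: loop_zero[OF M])
qed simp_all

text \<open>The projection splits in graded spaces, gluing makes its image an object of HH, the
  loops act on that image by the character \<open>om x\<close>, and objects of type x lie in the
  image of \<open>center_obj x\<close>.\<close>

lemma type_summand:
 "\<exists>a u v. a \<in> Obj (aYD ch H) & u \<in> Hom (HH C) (center_obj x a) ((V, rh), t) & v \<in> Hom (HH C) ((V, rh), t) (center_obj x a) &
 v * u = idm (fst (fst (center_obj x a))) & u * v = proj x &
 (sigma_HH C ((V, rh), t) = idm V \<longrightarrow> sigma_HH C (center_obj x a) = idm (fst (fst (center_obj x a))))"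
proof -
 obtain W u v where u: "u \<in> grhom W V" and v: "v \<in> grhom V W" and vu: "v * u = idm W" and uv: "u * v = proj x"
 using graded_idempotent_split[OF HH_HomD(1)[OF proj_End] proj_idem] by blast
 note d = grhom_dims[OF u] grhom_dims[OF v]
 have "\<exists>M. M \<in> Obj (HH C) & fst (fst M) = W & (\<forall>s\<in>{()}. v \<in> Hom (HH C) ((V, rh), t) M & u \<in> Hom (HH C) M ((V, rh), t)) &
 ((\<forall>s\<in>{()}. sigma_HH C ((V, rh), t) = idm V) \<longrightarrow> sigma_HH C M = idm W)"
 \<comment> \<open>Gluing with the single piece V: the map from the piece is v, the map back is u,
   and the resolution of the identity is v u = 1.\<close>
 proof (rule glued_object[of "{()}" "%_. V" "%_. rh" "%_. t" "%_. v" W "%_. u"])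
 show "msum (len W) (len W) (%_. v * u) {()} = idm W" by (rule eq_matI) (simp_all add: vu)
 qed (use M u v uv proj_End in simp_all)
 then obtain M' where M': "M' \<in> Obj (HH C)" "fst (fst M') = W" "v \<in> Hom (HH C) ((V, rh), t) M'" "u \<in> Hom (HH C) M' ((V, rh), t)"
 "sigma_HH C ((V, rh), t) = idm V \<longrightarrow> sigma_HH C M' = idm W" by blast
 obtain N sg w where e: "M' = ((N, sg), w)" by (cases M') auto
 note N = M'(1)[unfolded e] and vH = M'(3)[unfolded e] and uH = M'(4)[unfolded e] and sg = M'(5)[unfolded e]
 have NW: "N = W" using M'(2) by (simp add: e)
 \<comment> \<open>Loops commute with v, so the loop on the image is v T u; since u is fixed by the
   projection, \<open>T_proj\<close> turns T into a scalar.\<close>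
 have "has_type x N w" unfolding has_type_loop[OF N]
 proof
 fix y
 note e = loop_grhom(2,3)[OF N, of y] loop_grhom(2,3)[OF M, of y]
 have "loop w N y = loop w N y * (v * u)" using e by (simp add: vu NW)
 also have "... = loop w N y * v * u" by (rule mat_assoc[symmetric]) (use d e NW in simp_all)
 also have "... = v * T y * u" by (simp only: loop_natural[OF M N vH])
 also have "... = v * (T y * (u * (v * u)))" using d e vu by (simp add: mat_assoc)
 also have "u * (v * u) = proj x * u" unfolding uv[symmetric] by (rule mat_assoc[symmetric]) (use d in simp_all)
 also have "T y * (proj x * u) = om x y \<cdot>\<^sub>m (proj x * u)"
 proof -
 have "T y * (proj x * u) = T y * proj x * u" by (rule mat_assoc[symmetric]) (use d e in simp_all)
 also have "... = om x y \<cdot>\<^sub>m (proj x * u)" unfolding T_proj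
 by (rule mult_smult_assoc_mat[of _ "len V" "len V" _ "len W"]) (intro carrier_matI; simp add: d)+
 finally show ?thesis .
 qed
 also have "v * (om x y \<cdot>\<^sub>m (proj x * u)) = om x y \<cdot>\<^sub>m (v * (proj x * u))"
 by (rule mult_smult_distrib[of _ "len W" "len V" _ "len W"]) (intro carrier_matI; simp add: d)+
 also have "v * (proj x * u) = idm N"
 proof -
 have "v * (u * v * u) = (v * u) * (v * u)" using d by (simp add: mat_assoc)
 then show ?thesis unfolding uv vu by (simp add: NW)
 qed
 finally show "loop w N y = om x y \<cdot>\<^sub>m idm N" .
 qed
 from center_obj_surj[OF N this] obtain a where "a \<in> Obj (aYD ch H)" "center_obj x a = ((N, sg), w)" by blast
 then show ?thesis
 by (intro exI[of _ a] exI[of _ u] exI[of _ v]) (use vH uH vu uv sg NW in \<open>simp only: fst_conv simp_thms\<close>)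
qed

end

section \<open>Assembling the decomposition of HC\<close>

lemma center_obj_Hom_zero:
 assumes a: "a \<in> Obj (aYD ch H)" and b: "b \<in> Obj (aYD ch H)" and ne: "x ~= x'" and f: "f \<in> Hom (HH C) (center_obj x a) (center_obj x' b)"
 shows "f = 0\<^sub>m (len (fst b)) (len (fst a))"
proof -
 obtain y where y: "om x y ~= om x' y" using om_separates[OF ne] by blast
 obtain V rh t where A: "center_obj x a = ((V, rh), t)" by (cases "center_obj x a") auto
 obtain W sg u where B: "center_obj x' b = ((W, sg), u)" by (cases "center_obj x' b") auto
 have V: "V = shift (- x) (fst a)" and W: "W = shift (- x') (fst b)"
 using A B by (simp_all add: center_obj_def split: prod.splits)
 have "f = 0\<^sub>m (len W) (len V)"
 by (rule HH_Hom_types[OF center_obj_HH[OF a, of x, unfolded A] center_obj_HH[OF b, of x', unfolded B] f[unfolded A B] _ _ y])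
 (use center_obj_type[OF a, of x] center_obj_type[OF b, of x'] V W A B in simp_all)
 then show ?thesis by (simp add: V W)
qed

lemma dmH_center: "dmH (center_obj x a) = len (fst a)"
 by (simp add: center_obj_def split: prod.split)

text \<open>\<open>center_obj 0\<close> identifies the Hom sets with those of HH and keeps the
  dimensions, so closure under the operations is inherited.\<close>

lemma aYD_mat_category: "mat_category (aYD ch H) (%a. len (fst a))"
proof -
 interpret HH: mat_category "HH C" dmH by (rule HH_mat_category)
 note H = center_obj_Hom[where x = 0] and O = center_obj_HH[where x = 0]
 show ?thesis
 proof (unfold_locales, goal_cases)
 case (1 X Y f)
 then show ?case using HH.Hom_carrier[OF O[OF 1(1)] O[OF 1(2)]] by (simp add: H dmH_center)
 next
 case (2 X Y)
 then show ?case using HH.zero_Hom[OF O[OF 2(1)] O[OF 2(2)]] by (simp add: H dmH_center)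
 next
 case (3 X)
 then show ?case using HH.one_Hom[OF O[OF 3]] by (simp add: H dmH_center)
 next
 case (4 X Y Z f g)
 then show ?case using HH.mult_Hom[OF O[OF 4(1)] O[OF 4(2)] O[OF 4(3)]] by (simp add: H)
 next
 case (5 X Y f f')
 then show ?case using HH.add_Hom[OF O[OF 5(1)] O[OF 5(2)]] by (simp add: H)
 next
 case (6 X Y f c)
 then show ?case using HH.smult_Hom[OF O[OF 6(1)] O[OF 6(2)]] by (simp add: H)
 qed (simp_all add: aYD_def Let_def split: prod.split)
qed

lemma HC_eq: "HC C = full_sub (HH C) (%M. sigma_HH C M = idm (fst (fst M)))"
 unfolding HC_def by (rule arg_cong[of _ _ "full_sub (HH C)"]) (auto simp: fun_eq_iff)

lemma HC_mat_category: "mat_category (HC C) dmH"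
 unfolding HC_eq by (rule mat_category.full_sub_mat_category[OF HH_mat_category])

lemma HC_Obj: "M \<in> Obj (HC C) \<longleftrightarrow> M \<in> Obj (HH C) & sigma_HH C M = idm (fst (fst M))"
 by (simp add: HC_eq)

lemma HC_Hom: "Hom (HC C) = Hom (HH C)"
 by (simp add: HC_eq)

abbreviation "stab i a \<equiv> i \<cdot>\<^sub>m sigma_aYD ch H a = Idn (aYD ch H) a"

lemma center_obj_HC:
 assumes "a \<in> Obj (aYD ch H)"
 shows "center_obj x a \<in> Obj (HC C) \<longleftrightarrow> stab (ch x x) a"
proof -
 have "Idn (aYD ch H) a = 1\<^sub>m (dmH (center_obj x a))"
 unfolding dmH_center by (simp add: aYD_def Let_def split: prod.split)
 then show ?thesis unfolding HC_Obj by (simp add: center_obj_HH[OF assms] sigma_center_obj[OF assms])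
qed

text \<open>The pieces are glued along coordinate inclusions and projections; an enumeration
  \<open>ps\<close> of all pairs of a piece and a basis index fixes the order of the basis.
  Stability is inherited from the pieces.\<close>

lemma HC_biprod_exists:
 assumes J: "finite (J :: 's set)" and Z: "!!s. s \<in> J ==> Z s \<in> Obj (HC C)"
 shows "\<exists>X p q. mat_category.biprod (HC C) dmH J Z X p q"
proof -
 interpret HC: mat_category "HC C" dmH by (rule HC_mat_category)
 define V where "V s = fst (fst (Z s))" for s
 obtain ps where ps: "set ps = (SIGMA s:J. {..<len (V s)})" "distinct ps"
 using finite_distinct_list[of "SIGMA s:J. {..<len (V s)}"] J by auto
 define W where "W = map (%(s, k). V s ! k) ps"
 define p :: "'s \<Rightarrow> 'k mat" where "p s = mat (len ps) (len (V s)) (%(r, c). if ps ! r = (s, c) then 1 else 0)" for s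
 define q :: "'s \<Rightarrow> 'k mat" where "q s = mat (len (V s)) (len ps) (%(c, r). if ps ! r = (s, c) then 1 else 0)" for s
 have pd: "drow (p s) = len ps" "dcol (p s) = len (V s)" and qd: "drow (q s) = len (V s)" "dcol (q s) = len ps" for s
 by (simp_all add: p_def q_def)
 have lW: "len W = len ps" by (simp add: W_def)
 have qp: "q s' * p s = (if s' = s then idm (V s) else 0\<^sub>m (len (V s')) (len (V s)))" if s: "s \<in> J" for s s'
 proof (rule eq_matI)
 fix k c assume "k < drow (if s' = s then idm (V s) else 0\<^sub>m (len (V s')) (len (V s)) :: 'k mat)"
 "c < dcol (if s' = s then idm (V s) else 0\<^sub>m (len (V s')) (len (V s)) :: 'k mat)"
 then have kc: "k < len (V s')" "c < len (V s)" by (auto split: if_splits)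
 have "(s, c) \<in> set ps" using s kc ps(1) by simp
 then obtain r0 where r0: "r0 < len ps" "ps ! r0 = (s, c)" by (auto simp: in_set_conv_nth)
 have "(q s' * p s) $$ (k, c) = (\<Sum>r<len ps. (if ps ! r = (s', k) then 1 else 0) * (if ps ! r = (s, c) then 1 else 0))"
 using kc pd qd by (simp add: mult_entry p_def q_def del: index_mult_mat(1))
 also have "... = (\<Sum>r<len ps. if r = r0 then (if (s', k) = (s, c) then 1 else 0) else 0)"
 proof (rule sum.cong[OF refl])
 fix r assume "r \<in> {..<len ps}"
 then have "ps ! r = (s, c) \<longleftrightarrow> r = r0" using nth_eq_iff_index_eq[OF ps(2), of r r0] r0 by simp
 then show "(if ps ! r = (s', k) then 1 else 0) * (if ps ! r = (s, c) then 1 else 0) =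
 (if r = r0 then (if (s', k) = (s, c) then 1 else 0) else 0 :: 'k)"
 using r0(2) by (cases "r = r0") auto
 qed
 also have "... = (if (s', k) = (s, c) then 1 else 0)" using r0 by simp
 finally show "(q s' * p s) $$ (k, c) = (if s' = s then idm (V s) else 0\<^sub>m (len (V s')) (len (V s))) $$ (k, c)"
 using kc by auto
 qed (use pd qd in auto)
 have one: "msum (len W) (len W) (%s. p s * q s) J = idm W"
 proof (rule eq_matI)
 fix r r' assume "r < drow (idm W :: 'k mat)" "r' < dcol (idm W :: 'k mat)"
 then have r: "r < len ps" "r' < len ps" by (simp_all add: lW)
 obtain s c where sc: "ps ! r = (s, c)" by (cases "ps ! r")
 then have sc': "s \<in> J" "c < len (V s)" using nth_mem[OF r(1)] ps(1) by auto
 have "msum (len W) (len W) (%s. p s * q s) J $$ (r, r') =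
 (\<Sum>s\<in>J. \<Sum>c<len (V s). (if ps ! r = (s, c) then 1 else 0) * (if ps ! r' = (s, c) then 1 else 0))"
 using r pd qd by (simp add: lW mult_entry p_def q_def del: index_mult_mat(1))
 also have "... = (\<Sum>s'\<in>J. if s' = s then (if r' = r then 1 else 0) else 0)"
 proof (rule sum.cong[OF refl])
 fix s' assume "s' \<in> J"
 have "(\<Sum>k<len (V s'). (if ps ! r = (s', k) then 1 else 0) * (if ps ! r' = (s', k) then 1 else 0)) =
 (\<Sum>k<len (V s'). if k = c then (if s' = s & r' = r then 1 else 0) else 0 :: 'k)"
 proof (rule sum.cong[OF refl])
 fix k
 have idx: "ps ! r' = (s, c) \<longleftrightarrow> r' = r" using nth_eq_iff_index_eq[OF ps(2) r(2,1)] sc by simp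
 show "(if ps ! r = (s', k) then 1 else 0) * (if ps ! r' = (s', k) then 1 else 0) =
 (if k = c then (if s' = s & r' = r then 1 else 0) else 0 :: 'k)"
 by (cases "k = c"; cases "s' = s") (simp_all add: sc idx)
 qed
 then show "(\<Sum>k<len (V s'). (if ps ! r = (s', k) then 1 else 0) * (if ps ! r' = (s', k) then 1 else 0)) =
 (if s' = s then (if r' = r then 1 else 0) else 0 :: 'k)" using sc' by auto
 qed
 also have "... = (if r' = r then 1 else 0)" using sc' J by simp
 finally show "msum (len W) (len W) (%s. p s * q s) J $$ (r, r') = idm W $$ (r, r')" using r by (simp add: lW)
 qed (simp_all add: lW)
 have Zd: "Z s = ((V s, snd (fst (Z s))), snd (Z s))" for s by (simp add: V_def)
 have ZH: "((V s, snd (fst (Z s))), snd (Z s)) \<in> Obj (HH C)" "sigma_HH C ((V s, snd (fst (Z s))), snd (Z s)) = idm (V s)" if "s \<in> J" for s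
 using Z[OF that] unfolding HC_Obj by (simp_all add: V_def)
 have pg: "p s \<in> grhom (V s) W" for s
 by (rule grhomI) (auto simp: p_def W_def split: if_splits)
 have qg: "q s \<in> grhom W (V s)" for s
 by (rule grhomI) (auto simp: q_def W_def split: if_splits)
 have E: "q s' * p s \<in> Hom (HH C) ((V s, snd (fst (Z s))), snd (Z s)) ((V s', snd (fst (Z s'))), snd (Z s'))" if "s \<in> J" "s' \<in> J" for s s'
 using HH_one_Hom[OF ZH(1)[OF that(1)]] HH_zero_Hom[OF ZH(1)[OF that(1)] ZH(1)[OF that(2)]] by (simp add: qp[OF that(1)])
 obtain X where X: "X \<in> Obj (HH C)" "fst (fst X) = W" and pq: "!!s. s \<in> J ==> p s \<in> Hom (HH C) ((V s, snd (fst (Z s))), snd (Z s)) X"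
 "!!s. s \<in> J ==> q s \<in> Hom (HH C) X ((V s, snd (fst (Z s))), snd (Z s))" and sX: "sigma_HH C X = idm W"
 using glued_object[of J V "%s. snd (fst (Z s))" "%s. snd (Z s)" p W q, OF ZH(1) pg qg one E] ZH(2) by blast
 have XC: "X \<in> Obj (HC C)" using X sX by (simp add: HC_Obj)
 have pq': "p s \<in> Hom (HH C) (Z s) X" "q s \<in> Hom (HH C) X (Z s)" if "s \<in> J" for s
 using pq[OF that] by (simp_all only: Zd[symmetric])
 have o: "q s' * p s = (if s' = s then 1\<^sub>m (dmH (Z s)) else 0\<^sub>m (dmH (Z s')) (dmH (Z s)))" if "s \<in> J" "s' \<in> J" for s s'
 using qp[OF that(1)] by (simp only: V_def)
 have m: "msum (dmH X) (dmH X) (%s. p s * q s) J = 1\<^sub>m (dmH X)" unfolding X(2) by (rule one)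
 have "HC.biprod J Z X p q"
 unfolding HC.biprod_def HC_Hom by (intro conjI ballI J XC Z pq' o m)
 then show ?thesis by blast
qed

text \<open>The isotypic summands of X with their inclusions and projections. Composites between
  different types vanish by \<open>center_obj_Hom_zero\<close>, and the projections add up to the
  identity.\<close>

lemma HC_decomposition:
 assumes X: "X \<in> Obj (HC C)"
 shows "\<exists>a p q. (\<forall>x. a x \<in> Obj (aYD ch H) & stab (ch x x) (a x)) & mat_category.biprod (HC C) dmH UNIV (%x. center_obj x (a x)) X p q"
proof -
 interpret HC: mat_category "HC C" dmH by (rule HC_mat_category)
 obtain V rh t where X': "X = ((V, rh), t)" by (cases X) auto
 have M: "((V, rh), t) \<in> Obj (HH C)" and s: "sigma_HH C ((V, rh), t) = idm V" using X unfolding X' HC_Obj by simp_all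
 define S where "S x a u v \<longleftrightarrow> a \<in> Obj (aYD ch H) & u \<in> Hom (HH C) (center_obj x a) ((V, rh), t) & v \<in> Hom (HH C) ((V, rh), t) (center_obj x a) &
 v * u = idm (fst (fst (center_obj x a))) & u * v = proj V t x &
 (sigma_HH C ((V, rh), t) = idm V \<longrightarrow> sigma_HH C (center_obj x a) = idm (fst (fst (center_obj x a))))" for x a u v
 have "\<forall>x. \<exists>a u v. S x a u v" unfolding S_def using type_summand[OF M] by (rule allI)
 then obtain a p q where S: "!!x. S x (a x) (p x) (q x)" by metis
 have a: "a x \<in> Obj (aYD ch H)" and p: "p x \<in> Hom (HH C) (center_obj x (a x)) X" and q: "q x \<in> Hom (HH C) X (center_obj x (a x))"
 and qp: "q x * p x = idm (fst (fst (center_obj x (a x))))" and pq: "p x * q x = proj V t x"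
 and sg: "sigma_HH C (center_obj x (a x)) = idm (fst (fst (center_obj x (a x))))" for x
 using S[of x] s unfolding S_def X' by simp_all
 have st: "center_obj x (a x) \<in> Obj (HC C)" for x using center_obj_HH[OF a] sg by (simp add: HC_Obj)
 have z: "q x' * p x = 0\<^sub>m (dmH (center_obj x' (a x'))) (dmH (center_obj x (a x)))" if "x' ~= x" for x x'
 proof -
 have "q x' * p x \<in> Hom (HH C) (center_obj x (a x)) (center_obj x' (a x'))"
 using HC.mult_Hom[OF st X st, unfolded HC_Hom, OF p q] .
 from center_obj_Hom_zero[OF a a that[symmetric] this] show ?thesis by (simp add: dmH_center)
 qed
 have o: "q x' * p x = (if x' = x then 1\<^sub>m (dmH (center_obj x (a x))) else 0\<^sub>m (dmH (center_obj x' (a x'))) (dmH (center_obj x (a x))))" for x x'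
 by (cases "x' = x") (simp_all only: qp z if_True if_False simp_thms)
 have m: "msum (dmH X) (dmH X) (%x. p x * q x) UNIV = 1\<^sub>m (dmH X)"
 using proj_sum[OF M] by (simp add: pq X')
 have "HC.biprod UNIV (%x. center_obj x (a x)) X p q"
 unfolding HC.biprod_def HC_Hom by (intro conjI ballI finite X st p q o m)
 moreover have "stab (ch x x) (a x)" for x using st[of x] unfolding center_obj_HC[OF a] .
 ultimately show ?thesis using a by (intro exI[of _ a] exI[of _ p] exI[of _ q] conjI allI)
qed

theorem HC_equivalence:
 "linearly_equivalent (HC C) (direct_sum (range (%x. ch x x)) (%i. aYD_stable ch H i \<boxtimes> Vec_power (card {x. ch x x = i})))"
proof -
 interpret HC: mat_category "HC C" dmH by (rule HC_mat_category)
 let ?nn = "%i. card {x. ch x x = i}"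
 have "\<exists>h. bij_betw h {..<?nn i} {x. ch x x = i}" for i
 using ex_bij_betw_nat_finite[of "{x. ch x x = i}"] by (simp add: atLeast0LessThan)
 then have "\<forall>i. \<exists>h. bij_betw h {..<?nn i} {x. ch x x = i}" by (rule allI)
 \<comment> \<open>An enumeration of the fibre of \<theta> over i: the l-th coordinate of Vec^(n_i)
   is matched with the type x = \<open>en i l\<close>.\<close>
 from choice[OF this] obtain en where en0: "\<forall>i. bij_betw (en i) {..<?nn i} {x. ch x x = i}" by (rule exE)
 note en = en0[rule_format]
 have ench: "ch (en i l) (en i l) = i" if "l < ?nn i" for i l
 using bij_betwE[OF en[of i]] that by auto
 have en_inj: "en i l = en i' l' ==> (i, l) = (i', l')" if "l < ?nn i" "l' < ?nn i'" for i l i' l'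
 using ench[OF that(1)] ench[OF that(2)] bij_betw_imp_inj_on[OF en[of i]] that by (auto simp: inj_on_def)
 interpret E: box_decomposition "aYD ch H" "%a. len (fst a)" "HC C" dmH "range (%x. ch x x)" stab ?nn "%i l. center_obj (en i l)"
 proof (intro box_decomposition.intro aYD_mat_category HC_mat_category, unfold_locales)
 show "finite (range (%x. ch x x))" by simp
 show "center_obj (en i l) a \<in> Obj (HC C)" if "l < ?nn i" "a \<in> Obj (aYD ch H)" "stab i a" for i l a
 using center_obj_HC[OF that(2)] ench[OF that(1)] that(3) by simp
 show "dmH (center_obj (en i l) a) = len (fst a)" for i l a by (rule dmH_center)
 show "Hom (HC C) (center_obj (en i l) a) (center_obj (en i l) a') = Hom (aYD ch H) a a'"
 if "a \<in> Obj (aYD ch H)" "a' \<in> Obj (aYD ch H)" for i l a a'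
 unfolding HC_Hom by (rule center_obj_Hom[OF that])
 show "f = 0\<^sub>m (len (fst a')) (len (fst a))"
 if "l < ?nn i" "a \<in> Obj (aYD ch H)" "l' < ?nn i'" "a' \<in> Obj (aYD ch H)" "(i, l) ~= (i', l')"
 "f \<in> Hom (HC C) (center_obj (en i l) a) (center_obj (en i' l') a')" for i l a i' l' a' f
 by (rule center_obj_Hom_zero[OF that(2,4) _ that(6)[unfolded HC_Hom]]) (use en_inj[OF that(1,3)] that(5) in blast)
 show "\<exists>X p q. HC.biprod J Z X p q" if "finite J" "!!s. s \<in> J ==> Z s \<in> Obj (HC C)"
 for J :: "('k \<times> nat \<times> nat \<times> nat) set" and Z
 by (rule HC_biprod_exists[OF that])
 show "\<exists>a p q. (\<forall>i\<in>range (%x. ch x x). \<forall>l<?nn i. a i l \<in> Obj (aYD ch H) & stab i (a i l)) &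
 HC.biprod (SIGMA i:range (%x. ch x x). {..<?nn i}) (%(i, l). center_obj (en i l) (a i l)) X p q" if X: "X \<in> Obj (HC C)" for X
 proof -
 obtain a p q where a0: "\<forall>x. a x \<in> Obj (aYD ch H) & stab (ch x x) (a x)"
 and b: "HC.biprod UNIV (%x. center_obj x (a x)) X p q"
 using HC_decomposition[OF X] by (elim exE conjE)
 have a: "a x \<in> Obj (aYD ch H)" "stab (ch x x) (a x)" for x using a0 by simp_all
 \<comment> \<open>The pairs (i, l) correspond to the elements of G, so the decomposition over all
   types can be reindexed by them.\<close>
 let ?h = "%(i, l). en i l"
 have "bij_betw ?h (SIGMA i:range (%x. ch x x). {..<?nn i}) UNIV"
 unfolding bij_betw_def
 proof
 show "inj_on ?h (SIGMA i:range (%x. ch x x). {..<?nn i})"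
 proof (rule inj_onI)
 fix s s' assume "s \<in> (SIGMA i:range (%x. ch x x). {..<?nn i})" "s' \<in> (SIGMA i:range (%x. ch x x). {..<?nn i})" "?h s = ?h s'"
 then show "s = s'" using en_inj[of "snd s" "fst s" "snd s'" "fst s'"] by (cases s; cases s') simp
 qed
 have "x \<in> ?h ` (SIGMA i:range (%x. ch x x). {..<?nn i})" for x
 proof -
 have "x \<in> en (ch x x) ` {..<?nn (ch x x)}" using bij_betw_imp_surj_on[OF en[of "ch x x"]] by simp
 then obtain l where "l < ?nn (ch x x)" "x = en (ch x x) l" by auto
 then show ?thesis by (intro image_eqI[of _ _ "(ch x x, l)"]) auto
 qed
 then show "?h ` (SIGMA i:range (%x. ch x x). {..<?nn i}) = UNIV" by blast
 qed
 then have c: "HC.biprod (SIGMA i:range (%x. ch x x). {..<?nn i}) (%(i, l). center_obj (en i l) (a (en i l))) X (p \<circ> ?h) (q \<circ> ?h)"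
 by (rule HC.biprod_reindex[OF b]) (simp split: prod.split)
 have st: "stab i (a (en i l))" if "l < ?nn i" for i l using a(2)[of "en i l"] ench[OF that] by simp
 show ?thesis
 by (rule exI[of _ "%i l. a (en i l)"], rule exI[of _ "p \<circ> ?h"], rule exI[of _ "q \<circ> ?h"]) (intro conjI ballI allI impI a(1) st c)
 qed
 qed
 show ?thesis using E.box_equivalence unfolding E.D_def aYD_stable_def .
qed

end

theorem corollary4p45:
  fixes \<chi> :: "'g::{finite, ab_group_add} \<Rightarrow> 'g \<Rightarrow> 'k::{alg_closed_field, field_char_0}"
    and H :: "('g, 'k) hopf"
  assumes "bicharacter \<chi>"
    and "iso_to_characters (\<lambda>x y. \<chi> x y * \<chi> y x)"
    and "hopf_algebra \<chi> H"
  shows "linearly_equivalent (HC (H_mod \<chi> H))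
           (direct_sum (range (\<lambda>x. \<chi> x x))
              (\<lambda>i. aYD_stable \<chi> H i \<boxtimes> Vec_power (card {x. \<chi> x x = i})))"
proof -
  have "inj (\<lambda>x y. \<chi> x y * \<chi> y x)"
    using assms(2) by (simp add: iso_to_characters_def bij_betw_def)
  then interpret nondegenerate \<chi> H
    using assms(1,3) by (intro nondegenerate.intro braided_hopf.intro nondegenerate_axioms.intro)
  show ?thesis by (rule HC_equivalence)
qed

end
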